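(* Let $F$ be a field of characteristic $0$ and let $\mathcal A=\bigoplus_{i,j\in\mathbb Z}\mathcal A_{i,j}$ be a $\mathbb Z\times\mathbb Z$-graded Lie algebra over $F$ with $\dim\mathcal A_{i,j}\le 1$ for all $i,j\in\mathbb Z$. Suppose that (1) $\mathcal A_0:=\bigoplus_{i\in\mathbb Z}\mathcal A_{i,0}$ is isomorphic to the centerless Virasoro algebra $\mathrm{Vir}$; (2) $\mathcal A_{0,-1},\mathcal A_{0,0},\mathcal A_{0,1}$ span the $3$-dimensional simple Lie algebra $sl_2$; (3) $\mathcal A$ is generated, as a Lie algebra, by $\mathcal A_{0,1}$, $\mathcal A_{0,-1}$ and $\mathcal A_0$. Then $\mathcal A$ is isomorphic to one of the following Lie algebras: - $\mathrm{Vir}(\alpha)$ for a suitable $\alpha\in F\setminus\{0\}$; - $\mathcal B(\alpha,\beta;a_1,a_2,a_2')$ for suitable $\alpha,\beta,a_1,a_2,a_2'\in F$ with $\alpha\beta\ne0$ and $\beta\ne\pm1$; - $\mathcal B^+(\alpha,1;a_1,a_2,a_2')$ or $\mathcal B^+(\alpha,-1;a_1,a_2,a_2')$ for suitable $\alpha,a_1,a_2,a_2'\in F$ with $\alpha\neq0$; - $\mathcal C(\alpha)$ or $\bar{\mathcal C}(\alpha)$ for a suitable $\alpha\in F\setminus\{0\}$.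
   Context: $F$ is a field of characteristic $0$. A $\mathbb Z\times\mathbb Z$-grading means $[\mathcal A_{i,j},\mathcal A_{k,\ell}]\subseteq\mathcal A_{i+k,j+\ell}$. The centerless Virasoro algebra is $\mathrm{Vir}=\bigoplus_{i\in\mathbb Z}F L_i$ with bracket $[L_i,L_j]=(j-i)L_{i+j}$. For $\alpha\in F\setminus\{0\}$, $\mathrm{Vir}(\alpha)$ is the Lie algebra with basis $\{L_{i,j}\mid (i,j)\in\mathbb Z\times\mathbb Z\}$ and bracket $$[L_{i,j},L_{k,\ell}]=(k-i+(\ell-j)\alpha)L_{i+k,j+\ell}.$$ For $\alpha,\beta\in F$ with $\alpha\beta\ne0$, put $Z=(\mathbb Z\times\mathbb Z)\setminus\{(-\alpha,\beta),(-2\alpha,2\beta)\}$. For $a_1,a_2,a_2'\in F$, $\mathcal B(\alpha,\beta;a_1,a_2,a_2')$ is the Lie algebra $\bigl(\bigoplus_{(i,j)\in Z}F L_{i,j}\bigr)\oplus F\mathbf c_1\oplus F\mathbf c_2$, where $\mathbf c_1,\mathbf c_2$ are central and, for $(i,j),(k,\ell)\in Z$, $$[L_{i,j},L_{k,\ell}]=\bigl((i+\alpha)(\ell-\beta)-(j-\beta)(k+\alpha)\bigr)L_{i+k,j+\ell}+\delta_{i+k,-\alpha}\delta_{j+\ell,\beta}(\alpha j+\beta i)a_1\mathbf c_1+\delta_{i+k,-2\alpha}\delta_{j+\ell,2\beta}\bigl[a_2(\alpha j+\beta i)+a_2'(\alpha+i)\bigr]\mathbf c_2 .$$ Here $L_{i+k,j+\ell}$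 is read as $0$ if $(i+k,j+\ell)\notin Z$. Conventions: $\mathbf c_1=0$ (that is, the summand $F\mathbf c_1$ is omitted) if $(-\alpha,\beta)\notin\mathbb Z\times\mathbb Z$ or $a_1=0$; $\mathbf c_2=0$ if $(-2\alpha,2\beta)\notin\mathbb Z\times\mathbb Z$ or $a_2=a_2'=0$; otherwise they are nonzero basis elements. If $\beta=-1$, let $Z_+=\{(i,j)\in Z\mid j\ge-1\}$; $\mathcal B^+(\alpha,-1;a_1,a_2,a_2')$ is the subalgebra $\bigl(\bigoplus_{(i,j)\in Z_+}F L_{i,j}\bigr)\oplus F\mathbf c_1\oplus F\mathbf c_2$ of $\mathcal B(\alpha,-1;a_1,a_2,a_2')$. If $\beta=1$, let $Z_-=\{(i,j)\in Z\mid j\le1\}$; $\mathcal B^+(\alpha,1;a_1,a_2,a_2')$ is the subalgebra $\bigl(\bigoplus_{(i,j)\in Z_-}F L_{i,j}\bigr)\oplus F\mathbf c_1\oplus F\mathbf c_2$ of $\mathcal B(\alpha,1;a_1,a_2,a_2')$. For $\alpha\in F\setminus\{0\}$, $\mathcal C(\alpha)$ is the Lie algebra with basis $\{L_{i,j}\mid(i,j)\in\mathbb Z\times\mathbb Z\}$ and bracket $[L_{i,j},L_{k,\ell}]=a_{i,j,k,\ell}L_{i+k,j+\ell}$, where - $a_{i,j,k,\ell}=k(j+1)-(\ell+1)i+(\ell-j)\alpha$ if $j,\ell,j+\ell\ge-1$; - $a_{i,j,k,\ell}=\left[{-\ell-2\atop -\ell-j-2}\right]\bigl(k(j+1)-(\ell+1)i+(\ell-j)\alpha\bigr)$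 if $j\ge0$, $\ell\le-2$; - $a_{i,j,k,\ell}=k-i$ if $j=\ell=-1$; - $a_{i,j,k,\ell}=-\alpha+i$ if $j=-1$, $\ell\le-2$; - $a_{i,j,k,\ell}=0$ if $j,\ell\le-2$; and the remaining cases are determined by skew-symmetry $a_{k,\ell,i,j}=-a_{i,j,k,\ell}$. Here $\left[{p\atop q}\right]=p!/q!$ if $0\le q\le p$, and $\left[{p\atop q}\right]=0$ otherwise. $\mathcal C(\alpha)$ is $\mathbb Z\times\mathbb Z$-graded with $(i,j)$-homogeneous space $FL_{i,j}$. The dual Lie algebra $\bar{\mathcal C}(\alpha)$ is the same Lie algebra regraded so that its $(i,j)$-homogeneous space is the $(i,-j)$-homogeneous space of $\mathcal C(\alpha)$. *)

theory Defs
  imports "HOL-Analysis.Determinants" "HOL-Library.Poly_Mapping"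
begin

section \<open>Lie algebras over a field\<close>

text \<open>
  A Lie algebra is carried by a subspace of an ambient vector space, whose additive structure comes
  from its type class. So subalgebras and algebras given by a basis live in the same framework.
\<close>

record ('f, 'v) lie_struct =
  lie_carrier :: "'v set"
  lie_scale :: "'f \<Rightarrow> 'v \<Rightarrow> 'v"
  lie_bracket :: "'v \<Rightarrow> 'v \<Rightarrow> 'v"

locale lie_algebra = vector_space "lie_scale A"
  for A :: "('f::field, 'v::ab_group_add) lie_struct" +
  assumes subspace_carrier: "subspace (lie_carrier A)"
    and bracket_closed:
      "\<lbrakk>x \<in> lie_carrier A; y \<in> lie_carrier A\<rbrakk> \<Longrightarrow> lie_bracket A x y \<in> lie_carrier A"
    and bracket_add_left:
      "\<lbrakk>x \<in> lie_carrier A; y \<in> lie_carrier A; z \<in> lie_carrier A\<rbrakk>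
        \<Longrightarrow> lie_bracket A (x + y) z = lie_bracket A x z + lie_bracket A y z"
    and bracket_add_right:
      "\<lbrakk>x \<in> lie_carrier A; y \<in> lie_carrier A; z \<in> lie_carrier A\<rbrakk>
        \<Longrightarrow> lie_bracket A x (y + z) = lie_bracket A x y + lie_bracket A x z"
    and bracket_scale_left:
      "\<lbrakk>x \<in> lie_carrier A; y \<in> lie_carrier A\<rbrakk>
        \<Longrightarrow> lie_bracket A (lie_scale A c x) y = lie_scale A c (lie_bracket A x y)"
    and bracket_scale_right:
      "\<lbrakk>x \<in> lie_carrier A; y \<in> lie_carrier A\<rbrakk>
        \<Longrightarrow> lie_bracket A x (lie_scale A c y) = lie_scale A c (lie_bracket A x y)"
    and bracket_self: "x \<in> lie_carrier A \<Longrightarrow> lie_bracket A x x = 0"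
    and jacobi:
      "\<lbrakk>x \<in> lie_carrier A; y \<in> lie_carrier A; z \<in> lie_carrier A\<rbrakk>
        \<Longrightarrow> lie_bracket A x (lie_bracket A y z) + lie_bracket A y (lie_bracket A z x)
          + lie_bracket A z (lie_bracket A x y) = 0"

abbreviation lie_span :: "('f::field, 'v::ab_group_add) lie_struct \<Rightarrow> 'v set \<Rightarrow> 'v set" where
  "lie_span A \<equiv> module.span (lie_scale A)"

definition lie_restrict ::
    "('f, 'v) lie_struct \<Rightarrow> 'v set \<Rightarrow> ('f, 'v) lie_struct" where
  "lie_restrict A H = A\<lparr>lie_carrier := H\<rparr>"

definition lie_subalgebra ::
    "('f::field, 'v::ab_group_add) lie_struct \<Rightarrow> 'v set \<Rightarrow> bool" where
  "lie_subalgebra A H \<longleftrightarrow> H \<subseteq> lie_carrier A \<and> module.subspace (lie_scale A) H \<and>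
     (\<forall>x\<in>H. \<forall>y\<in>H. lie_bracket A x y \<in> H)"

definition lie_generated ::
    "('f::field, 'v::ab_group_add) lie_struct \<Rightarrow> 'v set \<Rightarrow> 'v set" where
  "lie_generated A S = lie_subalgebra A hull S"

text \<open>
  Both sides are required to be Lie algebras. In particular, if the left-hand side is
  \<open>lie_restrict A H\<close>, then \<open>H\<close> is closed under the bracket.
\<close>

definition lie_isomorphic ::
    "('f::field, 'v::ab_group_add) lie_struct \<Rightarrow> ('f, 'w::ab_group_add) lie_struct \<Rightarrow> bool"
    (infix "\<simeq>\<^sub>L" 50) where
  "A \<simeq>\<^sub>L B \<longleftrightarrow> lie_algebra A \<and> lie_algebra B \<and>
     (\<exists>f. bij_betw f (lie_carrier A) (lie_carrier B) \<and>
       (\<forall>x\<in>lie_carrier A. \<forall>y\<in>lie_carrier A. f (x + y) = f x + f y) \<and>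
       (\<forall>c. \<forall>x\<in>lie_carrier A. f (lie_scale A c x) = lie_scale B c (f x)) \<and>
       (\<forall>x\<in>lie_carrier A. \<forall>y\<in>lie_carrier A.
          f (lie_bracket A x y) = lie_bracket B (f x) (f y)))"

locale graded_lie_algebra = lie_algebra A
  for A :: "('f::field, 'v::ab_group_add) lie_struct" +
  fixes G :: "int \<Rightarrow> int \<Rightarrow> 'v set"
  assumes subspace_component: "subspace (G i j)"
    and component_subset: "G i j \<subseteq> lie_carrier A"
    and direct_sum:
      "x \<in> lie_carrier A \<Longrightarrow>
        \<exists>!c :: int \<times> int \<Rightarrow> 'v. (\<forall>i j. c (i, j) \<in> G i j) \<and> finite {p. c p \<noteq> 0} \<and>
          x = (\<Sum>p | c p \<noteq> 0. c p)"
    and bracket_component: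
      "\<lbrakk>x \<in> G i j; y \<in> G k l\<rbrakk> \<Longrightarrow> lie_bracket A x y \<in> G (i + k) (j + l)"

text \<open>
  The library's \<open>dim\<close> is \<open>0\<close> on infinite-dimensional spaces, so a bound on the dimension is
  expressed by means of a finite basis.
\<close>

definition lie_dim_le ::
    "('f::field, 'v::ab_group_add) lie_struct \<Rightarrow> 'v set \<Rightarrow> nat \<Rightarrow> bool" where
  "lie_dim_le A V n \<longleftrightarrow>
     (\<exists>B. finite B \<and> card B \<le> n \<and> \<not> module.dependent (lie_scale A) B \<and> lie_span A B = V)"


section \<open>Lie algebras given by structure constants on a basis\<close>

text \<open>
  The vector space with basis \<open>S\<close> consists of the finitely supported functions with support
  in \<open>S\<close>; the basis element \<open>s\<close> is \<open>Poly_Mapping.single s 1\<close>. The map \<open>br\<close> gives the brackets of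
  pairs of basis elements.
\<close>

definition lie_of_basis ::
    "'b set \<Rightarrow> ('b \<Rightarrow> 'b \<Rightarrow> 'b \<Rightarrow>\<^sub>0 'f) \<Rightarrow> ('f::field, 'b \<Rightarrow>\<^sub>0 'f) lie_struct" where
  "lie_of_basis S br =
     \<lparr>lie_carrier = {x. Poly_Mapping.keys x \<subseteq> S},
      lie_scale = (\<lambda>c. Poly_Mapping.map ((*) c)),
      lie_bracket = (\<lambda>x y. \<Sum>s\<in>Poly_Mapping.keys x. \<Sum>t\<in>Poly_Mapping.keys y.
        Poly_Mapping.map ((*) (Poly_Mapping.lookup x s * Poly_Mapping.lookup y t)) (br s t))\<rparr>"

definition sl2 :: "('f::field, 'f^2^2) lie_struct" where
  "sl2 = \<lparr>lie_carrier = {M. trace M = 0},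
          lie_scale = (\<lambda>c. map_matrix ((*) c)),
          lie_bracket = (\<lambda>M N. M ** N - N ** M)\<rparr>"

definition Vir :: "('f::field, int \<Rightarrow>\<^sub>0 'f) lie_struct" where
  "Vir = lie_of_basis UNIV (\<lambda>i j. Poly_Mapping.single (i + j) (of_int (j - i)))"

definition Vir_alpha :: "'f \<Rightarrow> ('f::field, int \<times> int \<Rightarrow>\<^sub>0 'f) lie_struct" where
  "Vir_alpha \<alpha> = lie_of_basis UNIV (\<lambda>(i, j) (k, l).
     Poly_Mapping.single (i + k, j + l) (of_int (k - i) + of_int (l - j) * \<alpha>))"


subsection \<open>The algebras \<open>\<B>\<close> and \<open>\<B>\<^sup>+\<close>\<close>

datatype B_basis = L int int | C1 | C2

definition B_Z :: "'f::field_char_0 \<Rightarrow> 'f \<Rightarrow> (int \<times> int) set" where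
  "B_Z \<alpha> \<beta> = {(i, j). (of_int i, of_int j) \<notin> {(- \<alpha>, \<beta>), (- 2 * \<alpha>, 2 * \<beta>)}}"

text \<open>The sets \<open>{C1}\<close> and \<open>{C2}\<close> are dropped exactly when \<open>c\<^sub>1 = 0\<close>, respectively \<open>c\<^sub>2 = 0\<close>, by
  convention; the coefficients of \<open>C1\<close>, respectively \<open>C2\<close>, in \<open>B_br\<close> then vanish.\<close>

definition B_set :: "'f::field_char_0 \<Rightarrow> 'f \<Rightarrow> 'f \<Rightarrow> 'f \<Rightarrow> 'f \<Rightarrow> B_basis set" where
  "B_set \<alpha> \<beta> a1 a2 a2' =
     {L i j | i j. (i, j) \<in> B_Z \<alpha> \<beta>}
     \<union> (if - \<alpha> \<in> \<int> \<and> \<beta> \<in> \<int> \<and> a1 \<noteq> 0 then {C1} else {})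
     \<union> (if - 2 * \<alpha> \<in> \<int> \<and> 2 * \<beta> \<in> \<int> \<and> \<not> (a2 = 0 \<and> a2' = 0) then {C2} else {})"

fun B_br :: "'f::field_char_0 \<Rightarrow> 'f \<Rightarrow> 'f \<Rightarrow> 'f \<Rightarrow> 'f \<Rightarrow> B_basis \<Rightarrow> B_basis \<Rightarrow> B_basis \<Rightarrow>\<^sub>0 'f" where
  "B_br \<alpha> \<beta> a1 a2 a2' (L i j) (L k l) =
     (if (i + k, j + l) \<in> B_Z \<alpha> \<beta>
      then Poly_Mapping.single (L (i + k) (j + l))
        ((of_int i + \<alpha>) * (of_int l - \<beta>) - (of_int j - \<beta>) * (of_int k + \<alpha>))
      else 0)
     + (if of_int (i + k) = - \<alpha> \<and> of_int (j + l) = \<beta>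
        then Poly_Mapping.single C1 ((\<alpha> * of_int j + \<beta> * of_int i) * a1)
        else 0)
     + (if of_int (i + k) = - 2 * \<alpha> \<and> of_int (j + l) = 2 * \<beta>
        then Poly_Mapping.single C2
          (a2 * (\<alpha> * of_int j + \<beta> * of_int i) + a2' * (\<alpha> + of_int i))
        else 0)"
| "B_br \<alpha> \<beta> a1 a2 a2' _ _ = 0"

definition B_alg ::
    "'f \<Rightarrow> 'f \<Rightarrow> 'f \<Rightarrow> 'f \<Rightarrow> 'f \<Rightarrow> ('f::field_char_0, B_basis \<Rightarrow>\<^sub>0 'f) lie_struct" where
  "B_alg \<alpha> \<beta> a1 a2 a2' = lie_of_basis (B_set \<alpha> \<beta> a1 a2 a2') (B_br \<alpha> \<beta> a1 a2 a2')"

text \<open>\<open>\<B>\<^sup>+\<close> is only meant for \<open>\<beta> = -1\<close>, where \<open>Z\<^sub>+\<close> is used, and \<open>\<beta> = 1\<close>, where \<open>Z\<^sub>-\<close> is used.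
  The central basis elements \<open>C1\<close>, \<open>C2\<close> are retained whenever they are present in \<open>\<B>\<close>.\<close>

definition B_plus ::
    "'f \<Rightarrow> 'f \<Rightarrow> 'f \<Rightarrow> 'f \<Rightarrow> 'f \<Rightarrow> ('f::field_char_0, B_basis \<Rightarrow>\<^sub>0 'f) lie_struct" where
  "B_plus \<alpha> \<beta> a1 a2 a2' = lie_restrict (B_alg \<alpha> \<beta> a1 a2 a2')
     {x \<in> lie_carrier (B_alg \<alpha> \<beta> a1 a2 a2').
        \<forall>i j. L i j \<in> Poly_Mapping.keys x \<longrightarrow> (\<beta> = - 1 \<longrightarrow> j \<ge> - 1) \<and> (\<beta> = 1 \<longrightarrow> j \<le> 1)}"


subsection \<open>The algebras \<open>\<C>\<close> and \<open>\<C>\<close>-bar\<close>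

definition fact_quot :: "int \<Rightarrow> int \<Rightarrow> 'f::field_char_0" where
  "fact_quot p q = (if 0 \<le> q \<and> q \<le> p then fact (nat p) / fact (nat q) else 0)"

definition C_lin :: "'f::field_char_0 \<Rightarrow> int \<Rightarrow> int \<Rightarrow> int \<Rightarrow> int \<Rightarrow> 'f" where
  "C_lin \<alpha> i j k l = of_int (k * (j + 1) - (l + 1) * i) + of_int (l - j) * \<alpha>"

text \<open>The last branch is the skew-symmetric counterpart of the second one (\<open>l \<ge> 0\<close>) and of the
  fourth one (\<open>l = -1\<close>); it is reached exactly for \<open>j \<le> -2\<close>, \<open>l \<ge> -1\<close>.\<close>

definition C_coeff :: "'f::field_char_0 \<Rightarrow> int \<Rightarrow> int \<Rightarrow> int \<Rightarrow> int \<Rightarrow> 'f" where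
  "C_coeff \<alpha> i j k l =
     (if j \<ge> - 1 \<and> l \<ge> - 1 \<and> j + l \<ge> - 1 then C_lin \<alpha> i j k l
      else if j \<ge> 0 \<and> l \<le> - 2 then fact_quot (- l - 2) (- l - j - 2) * C_lin \<alpha> i j k l
      else if j = - 1 \<and> l = - 1 then of_int (k - i)
      else if j = - 1 \<and> l \<le> - 2 then - \<alpha> + of_int i
      else if j \<le> - 2 \<and> l \<le> - 2 then 0
      else - (if l \<ge> 0 then fact_quot (- j - 2) (- j - l - 2) * C_lin \<alpha> k l i j
              else - \<alpha> + of_int k))"

definition C_alg :: "'f \<Rightarrow> ('f::field_char_0, int \<times> int \<Rightarrow>\<^sub>0 'f) lie_struct" where
  "C_alg \<alpha> = lie_of_basis UNIV (\<lambda>(i, j) (k, l).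
     Poly_Mapping.single (i + k, j + l) (C_coeff \<alpha> i j k l))"

text \<open>In \<open>C_bar\<close> the basis element indexed by \<open>(i, j)\<close> is the basis element of \<open>C_alg\<close> indexed by
  \<open>(i, -j)\<close>, so that the indexing again displays the grading.\<close>

definition C_bar :: "'f \<Rightarrow> ('f::field_char_0, int \<times> int \<Rightarrow>\<^sub>0 'f) lie_struct" where
  "C_bar \<alpha> = lie_of_basis UNIV (\<lambda>(i, j) (k, l).
     Poly_Mapping.single (i + k, j + l) (C_coeff \<alpha> i (- j) k (- l)))"

end

theory Submission
  imports Defs "HOL-Computational_Algebra.Polynomial"
begin

text \<open>
  The columns \<open>A\<^sub>j\<close> of degrees \<open>(i, j)\<close>, \<open>i \<in> \<int>\<close>, are modules over \<open>A\<^sub>0 = Vir\<close> with one-dimensional weight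
  spaces. Comparing the products of \<open>L\<^sub>\<plusminus>\<^sub>1\<close> and \<open>L\<^sub>\<plusminus>\<^sub>2\<close> shows that \<open>A\<^sub>1\<close> and \<open>A\<^sub>-\<^sub>1\<close> are modules of densities
  of some weight \<open>b\<close>, up to a modification at the weight zero for \<open>b \<in> {0, 1}\<close>. The bracket
  \<open>A\<^sub>1 \<times> A\<^sub>-\<^sub>1 \<rightarrow> A\<^sub>0\<close> is an equivariant pairing, which relates the two weights; so, possibly after
  reversing the sign of the second degree, the local part is that of the algebra with structure
  constants \<open>\<kappa> (i l - j k) + \<alpha> (l - j) + (k - i)\<close>. This is \<open>Vir(\<alpha>)\<close> for \<open>\<kappa> = 0\<close> and
  \<open>\<B>(\<alpha>/\<kappa>, 1/\<kappa>)\<close> otherwise. For \<open>\<kappa> \<noteq> \<plusminus>1\<close> the local part determines all brackets except those into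
  two degrees, in which the model degenerates; these brackets are 2-cocycles, and the parameters
  \<open>a\<^sub>1, a\<^sub>2, a\<^sub>2'\<close> describe them. The value \<open>\<kappa> = 1\<close> is avoided by the choice of the sign. For
  \<open>\<kappa> = - 1\<close> the column \<open>A\<^sub>-\<^sub>2\<close> is either central of dimension at most one, which gives \<open>\<B>\<^sup>+\<close>, or the
  Jacobi identity for three elements of \<open>A\<^sub>-\<^sub>1\<close> and the one-dimensionality of the degrees \<open>(i, - 3)\<close>
  force the brackets of \<open>\<C>(\<alpha>)\<close>.
\<close>

section \<open>Modules over the Witt algebra with one-dimensional weight spaces\<close>

lemma poly_coeffs_zero:
  fixes c :: "nat \<Rightarrow> 'f::field_char_0" and x :: "int \<Rightarrow> 'f"
  assumes "\<And>n. (\<Sum>i\<le>d. c i * x n ^ i) = 0" and "inj x" and "i \<le> d"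
  shows "c i = 0"
proof -
  define p where "p = (\<Sum>i\<le>d. monom (c i) i)"
  have "poly p (x n) = 0" for n
    using assms(1)[of n] by (simp add: p_def poly_sum poly_monom)
  then have "range x \<subseteq> {x. poly p x = 0}" by auto
  moreover have "infinite (range x)"
    using finite_imageD[OF _ \<open>inj x\<close>] infinite_UNIV_int by auto
  ultimately have "p = 0"
    using poly_roots_finite[of p] finite_subset by blast
  moreover have "coeff p i = c i"
    using assms(3) by (simp add: p_def coeff_sum)
  ultimately show ?thesis by simp
qed

lemma poly5_coeffs_zero:
  fixes c0 c1 c2 c3 c4 c5 :: "'f::field_char_0" and x :: "int \<Rightarrow> 'f"
  assumes "\<And>n. c0 + c1 * x n + c2 * x n ^ 2 + c3 * x n ^ 3 + c4 * x n ^ 4 + c5 * x n ^ 5 = 0"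
    and "inj x"
  shows "c0 = 0" "c1 = 0" "c2 = 0" "c3 = 0" "c4 = 0" "c5 = 0"
proof -
  have sum: "(\<Sum>i\<le>5. [c0, c1, c2, c3, c4, c5] ! i * x n ^ i) = 0" for n
    using assms(1)[of n] by (simp add: numeral_eq_Suc)
  note z = poly_coeffs_zero[OF sum \<open>inj x\<close>]
  show "c0 = 0" "c1 = 0" "c2 = 0" "c3 = 0" "c4 = 0" "c5 = 0"
    using z[of 0] z[of 1] z[of 2] z[of 3] z[of 4] z[of 5] by (simp_all add: numeral_eq_Suc)
qed

lemma int_diff_const:
  fixes f :: "int \<Rightarrow> 'a::ab_group_add"
  assumes "\<And>k. f k = f (k - 1)"
  shows "f k = f 0"
proof (induction k rule: int_induct[where k = 0])
  case (step1 i)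
  then show ?case using assms[of "i + 1"] by simp
next
  case (step2 i)
  then show ?case using assms[of i] by simp
qed auto

text \<open>The normal forms of modules prescribe the ratios of the scaling factors at neighbouring
  weights; the factors themselves are taken from here.\<close>

lemma int_product_solution:
  fixes r :: "int \<Rightarrow> 'f::field"
  assumes "\<And>k. r k \<noteq> 0"
  obtains t where "\<And>k. t k \<noteq> 0" "\<And>k. t (k + 1) = r k * t k"
proof
  define t where "t k = (if k \<ge> 0 then \<Prod>i\<in>{0..<k}. r i else 1 / (\<Prod>i\<in>{k..<0}. r i))" for k
  show "t k \<noteq> 0" for k
    using assms by (auto simp: t_def)
  show "t (k + 1) = r k * t k" for k
  proof (cases "k \<ge> 0")
    case True
    then have "{0..<k + 1} = insert k {0..<k}" by auto
    then show ?thesis using True by (simp add: t_def)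
  next
    case False
    then have "{k..<0} = insert k {k + 1..<0}" by auto
    then show ?thesis using False assms[of k] by (auto simp: t_def)
  qed
qed

text \<open>Both i and i^2 are solutions, and subtracting the combination that agrees with f at 1
  and 2 leaves a solution \<open>e\<close> with two zeros. The pairs (1, n + 2) carry the zeros
  upwards, and the pairs (- n - 1, n + 2), of sum 1, carry them to negative arguments. The equation
  arises for extensions at weight zero and for cocycles at the first hole.\<close>

lemma quadratic_cocycle:
  fixes f :: "int \<Rightarrow> 'f::field_char_0"
  assumes eq: "\<And>i j. i \<noteq> 0 \<Longrightarrow> j \<noteq> 0 \<Longrightarrow> i + j \<noteq> 0 \<Longrightarrow>
    of_int (i + j) * (f j - f i) = of_int (j - i) * f (i + j)"
  obtains c c' where "\<And>i. i \<noteq> 0 \<Longrightarrow> f i = c * of_int i + c' * of_int i ^ 2"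
proof -
  define c' where "c' = f 2 / 2 - f 1"
  define c where "c = f 1 - c'"
  define e where "e i = f i - c * of_int i - c' * of_int i ^ 2" for i
  have e: "of_int (i + j) * (e j - e i) = of_int (j - i) * e (i + j)" if "i \<noteq> 0" "j \<noteq> 0" "i + j \<noteq> 0" for i j
    using eq[OF that] by (simp add: e_def power2_eq_square algebra_simps)
  have e12: "e 1 = 0" "e 2 = 0" by (simp_all add: e_def c_def c'_def field_simps)
  have pos: "e (int n + 2) = 0" for n
  proof (induction n)
    case (Suc n)
    have "of_int (int n + 1) * e (int n + 3) = 0"
      using e[of 1 "int n + 2"] Suc e12 by (simp add: add_ac)
    moreover have "(of_int (int n + 1) :: 'f) \<noteq> 0" by (subst of_int_eq_0_iff) simp
    ultimately show ?case by (simp add: add_ac del: of_int_add)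
  qed (use e12 in simp)
  have neg: "e (- int n - 1) = 0" for n
    using e[of "- int n - 1" "int n + 2"] pos[of n] e12 by simp
  have "f i = c * of_int i + c' * of_int i ^ 2" if nz: "i \<noteq> 0" for i
  proof -
    consider "i = 1" | "i \<ge> 2" | "i \<le> - 1" using nz by linarith
    then have "e i = 0"
      using e12 pos[of "nat (i - 2)"] neg[of "nat (- i - 1)"] by cases auto
    then show ?thesis by (simp add: e_def algebra_simps)
  qed
  then show thesis by (rule that)
qed

text \<open>The function \<open>i * f i\<close> satisfies the equation of
  \<open>quadratic_cocycle\<close>, so it is a combination of i and i^2.\<close>

lemma affine_cocycle:
  fixes f :: "int \<Rightarrow> 'f::field_char_0"
  assumes eq: "\<And>i j. i \<noteq> 0 \<Longrightarrow> j \<noteq> 0 \<Longrightarrow> i + j \<noteq> 0 \<Longrightarrow>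
    of_int j * f j - of_int i * f i = of_int (j - i) * f (i + j)"
  obtains c c' where "\<And>i. i \<noteq> 0 \<Longrightarrow> f i = c + c' * of_int i"
proof -
  have "of_int (i + j) * (of_int j * f j - of_int i * f i) = of_int (j - i) * (of_int (i + j) * f (i + j))"
    if "i \<noteq> 0" "j \<noteq> 0" "i + j \<noteq> 0" for i j
    unfolding eq[OF that] by simp
  then obtain c c' where c: "\<And>i. i \<noteq> 0 \<Longrightarrow> of_int i * f i = c * of_int i + c' * of_int i ^ 2"
    using quadratic_cocycle[of "\<lambda>i. of_int i * f i"] by blast
  have "f i = c + c' * of_int i" if "i \<noteq> 0" for i
  proof -
    have "of_int i * f i = of_int i * (c + c' * of_int i)"
      using c[OF that] by (simp add: power2_eq_square algebra_simps)
    then show ?thesis using that by simp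
  qed
  then show thesis by (rule that)
qed

text \<open>\<open>a i k\<close> is the coefficient of the action of \<open>L\<^sub>i\<close> on the \<open>k\<close>-th basis vector. Missing weight
  spaces are represented by indices \<open>k\<close> for which all \<open>a i k\<close> and all \<open>a i (k - i)\<close> vanish; the
  relation then still holds for all indices.\<close>

locale witt_module =
  fixes a :: "int \<Rightarrow> int \<Rightarrow> 'f::field_char_0"
  assumes rel: "a j k * a i (j + k) - a i k * a j (i + k) = of_int (j - i) * a (i + j) k"
begin

text \<open>Each product follows a path of the operators L_1, L_-1, L_2, L_-2 that starts and ends
  at index k, so rescaling the basis does not affect it. Commutators give linear recursions for
  these products, and \<open>CC_DD\<close>, which merely regroups six factors, is the nonlinear
  relation that ties the initial values together.\<close>

definition "gg k = a 1 k * a (- 1) (k + 1)"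
definition "CC k = a 2 k * a (- 1) (k + 2) * a (- 1) (k + 1)"
definition "DD k = a 1 k * a 1 (k + 1) * a (- 2) (k + 2)"
definition "FF k = a 2 k * a (- 2) (k + 2)"

lemma gg_step: "gg k = gg (k - 1) + 2 * a 0 k"
  using rel[of 1 k "-1"] by (simp add: gg_def algebra_simps)

lemma CC_step: "CC k = CC (k - 1) + 3 * gg k"
proof -
  have "a 2 k * a (- 1) (k + 2) = a (- 1) k * a 2 (k - 1) + 3 * a 1 k"
    using rel[of 2 k "-1"] by (simp add: algebra_simps)
  then have "CC k = (a (- 1) k * a 2 (k - 1) + 3 * a 1 k) * a (- 1) (k + 1)"
    by (simp add: CC_def)
  then show ?thesis
    by (simp add: CC_def gg_def algebra_simps)
qed

lemma DD_step: "DD k = DD (k - 1) + 3 * gg k"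
proof -
  have "a 1 (k + 1) * a (- 2) (k + 2) = a (- 2) (k + 1) * a 1 (k - 1) + 3 * a (- 1) (k + 1)"
    using rel[of 1 "k + 1" "-2"] by (simp add: algebra_simps)
  then have "DD k = a 1 k * (a (- 2) (k + 1) * a 1 (k - 1) + 3 * a (- 1) (k + 1))"
    by (simp add: DD_def)
  then show ?thesis
    by (simp add: DD_def gg_def algebra_simps)
qed

lemma FF_step: "FF k = FF (k - 2) + 4 * a 0 k"
  using rel[of 2 k "-2"] by (simp add: FF_def algebra_simps)

lemma CC_DD: "CC k * DD k = gg k * gg (k + 1) * FF k"
  by (simp add: CC_def DD_def FF_def gg_def algebra_simps)

lemma rel_succ: "of_int (i - 1) * a (i + 1) k = a i k * a 1 (k + i) - a 1 k * a i (k + 1)"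
  using rel[of i k 1] by (simp add: algebra_simps)

lemma rel_pred: "of_int (i + 1) * a (i - 1) k = a i k * a (- 1) (k + i) - a (- 1) k * a i (k - 1)"
  using rel[of i k "-1"] by (simp add: algebra_simps)

end

text \<open>A missing weight \<open>m\<close> with \<open>\<alpha> + m \<noteq> 0\<close> is refuted on the subalgebra spanned by the \<open>L\<^sub>i\<^sub>d\<close>,
  where \<open>d\<close> is the distance from \<open>m\<close> to a present nonzero weight: the relation \<open>CC_DD\<close> at two
  places yields two incompatible polynomial equations.\<close>

lemma hole_weight_zero:
  fixes a :: "int \<Rightarrow> int \<Rightarrow> 'f::field_char_0"
  assumes "witt_module a"
    and supp: "\<And>i k. a i k \<noteq> 0 \<Longrightarrow> k \<in> S \<and> i + k \<in> S"
    and weight: "\<And>k. k \<in> S \<Longrightarrow> a 0 k = \<alpha> + of_int k"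
    and k: "k \<in> S" "\<alpha> + of_int k \<noteq> 0" and m: "m \<notin> S"
  shows "\<alpha> + of_int m = 0"
proof (rule ccontr)
  interpret witt_module a by fact
  define d where "d = k - m"
  define B where "B i r = a (i * d) (m + r * d) / of_int d" for i r
  define l where "l = (\<alpha> + of_int m) / of_int d"
  assume "\<alpha> + of_int m \<noteq> 0"
  have d: "d \<noteq> 0" using k m by (auto simp: d_def)
  then have l: "l \<noteq> 0" using \<open>\<alpha> + of_int m \<noteq> 0\<close> by (simp add: l_def)
  interpret B: witt_module B
  proof
    fix i j r
    have "a (j * d) (m + r * d) * a (i * d) (m + (j + r) * d) -
        a (i * d) (m + r * d) * a (j * d) (m + (i + r) * d)
        = of_int (j * d - i * d) * a ((i + j) * d) (m + r * d)"
      using rel[of "j * d" "m + r * d" "i * d"] by (simp add: algebra_simps)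
    then have "B j r * B i (j + r) - B i r * B j (i + r)
        = (of_int (j * d - i * d) * a ((i + j) * d) (m + r * d)) / (of_int d * of_int d)"
      by (simp add: B_def flip: diff_divide_distrib)
    also have "\<dots> = of_int (j - i) * B (i + j) r"
      using d by (simp add: B_def field_simps)
    finally show "B j r * B i (j + r) - B i r * B j (i + r) = of_int (j - i) * B (i + j) r" .
  qed
  have Bhole: "B i 0 = 0" "B i (- i) = 0" for i
    using supp[of "i * d" m] supp[of "i * d" "m - i * d"] m by (auto simp: B_def)
  have B0: "B 0 r = l + of_int r" if "m + r * d \<in> S" for r
    using weight[OF that] d by (simp add: B_def l_def field_simps)
  \<comment> \<open>Since \<open>B (- 1) 1\<close> leads into the hole, the commutator of L_-1 and
    L_(n+1) on index 1 has a single term. So no L_n vanishes there, and all indices from 1 on are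
    present.\<close>
  have B1: "B (int n) 1 \<noteq> 0" for n
  proof (induction n)
    case 0
    have "B 0 1 = (\<alpha> + of_int k) / of_int d"
      using weight[OF k(1)] by (simp add: B_def d_def)
    then show ?case using k d by simp
  next
    case (Suc n)
    have "B (1 + int n) 1 * B (- 1) (2 + int n) = of_int (int n + 2) * B (int n) 1"
      using B.rel[of "1 + int n" 1 "-1"] Bhole(2)[of "-1"] by (simp add: algebra_simps)
    moreover have "(of_int (int n + 2) :: 'f) \<noteq> 0"
      by (subst of_int_eq_0_iff) simp
    ultimately show ?case using Suc by auto
  qed
  have inS: "m + int (Suc n) * d \<in> S" for n
    using B1[of n] supp[of "int n * d" "m + d"] d by (auto simp: B_def algebra_simps)
  have w: "B 0 1 = l + 1" "B 0 2 = l + 2" "B 0 3 = l + 3" "B 0 4 = l + 4" "B 0 5 = l + 5"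
    using B0[of 1] B0[of 2] B0[of 3] B0[of 4] B0[of 5] inS[of 0] inS[of 1] inS[of 2] inS[of 3]
      inS[of 4] by simp_all
  \<comment> \<open>The hole supplies zero as the initial value of all four recursions.\<close>
  have base: "B.gg 0 = 0" "B.CC 0 = 0" "B.DD 0 = 0" "B.FF 0 = 0"
    using Bhole(1) by (simp_all add: B.gg_def B.CC_def B.DD_def B.FF_def)
  have g: "B.gg 1 = 2 * l + 2" "B.gg 2 = 4 * l + 6" "B.gg 3 = 6 * l + 12" "B.gg 4 = 8 * l + 20"
      "B.gg 5 = 10 * l + 30"
    using B.gg_step[of 1] B.gg_step[of 2] B.gg_step[of 3] B.gg_step[of 4] B.gg_step[of 5] base w
    by (simp_all add: algebra_simps)
  have C: "B.CC 2 = 18 * l + 24" "B.CC 4 = 60 * l + 120"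
    using B.CC_step[of 1] B.CC_step[of 2] B.CC_step[of 3] B.CC_step[of 4] base g
    by (simp_all add: algebra_simps)
  have D: "B.DD 2 = 18 * l + 24" "B.DD 4 = 60 * l + 120"
    using B.DD_step[of 1] B.DD_step[of 2] B.DD_step[of 3] B.DD_step[of 4] base g
    by (simp_all add: algebra_simps)
  have F: "B.FF 2 = 4 * l + 8" "B.FF 4 = 8 * l + 24"
    using B.FF_step[of 2] B.FF_step[of 4] base w by (simp_all add: algebra_simps)
  have e2: "(18 * l + 24) * (18 * l + 24) = (4 * l + 6) * (6 * l + 12) * (4 * l + 8)"
    using B.CC_DD[of 2] C D F g by simp
  have e4: "(60 * l + 120) * (60 * l + 120) = (8 * l + 20) * (10 * l + 30) * (8 * l + 24)"
    using B.CC_DD[of 4] C D F g by simp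
  have f2: "12 * l * (8 * l\<^sup>2 + 17 * l + 8) = 0"
    using e2 by (simp add: power2_eq_square algebra_simps)
  have f4: "80 * l * (8 * l\<^sup>2 + 23 * l + 12) = 0"
    using e4 by (simp add: power2_eq_square algebra_simps)
  have "8 * l\<^sup>2 + 17 * l + 8 = 0" "8 * l\<^sup>2 + 23 * l + 12 = 0"
    using f2 f4 l by simp_all
  \<comment> \<open>The difference of the two quadratics gives l = - 2/3, which is not a
    root.\<close>
  then have "(1::'f) = 0" by algebra
  then show False by simp
qed

locale weighted_witt_module = witt_module +
  fixes \<alpha>
  assumes weight: "a 0 k = \<alpha> + of_int k"
begin

text \<open>The recursions fix the four products up to the constants \<open>kap\<close>,
  \<open>c1\<close>, \<open>c2\<close> and one value \<open>phi\<close> per parity, since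
  \<open>FF_step\<close> advances by two. Along one parity class \<open>CC_DD\<close> is a
  polynomial identity in the weight, and comparing coefficients gives phi = 4 kap, c2 = - c1 and
  c1^2 = kap^2 (1 - 4 kap).\<close>

lemma obtain_parameter:
  obtains b where
    "\<And>k. gg k = (\<alpha> + of_int k + b) * (\<alpha> + of_int k + 1 - b)"
    "\<And>k. CC k = (\<alpha> + of_int k + 2 * b) * (\<alpha> + of_int k + 2 - b) * (\<alpha> + of_int k + 1 - b)"
    "\<And>k. DD k = (\<alpha> + of_int k + b) * (\<alpha> + of_int k + 1 + b) * (\<alpha> + of_int k + 2 - 2 * b)"
    "\<And>k. FF k = (\<alpha> + of_int k + 2 * b) * (\<alpha> + of_int k + 2 - 2 * b)"
proof -
  define w where "w k = \<alpha> + of_int k" for k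
  define kap where "kap = gg 0 - w 0 * (w 0 + 1)"
  have g: "gg k = w k * (w k + 1) + kap" for k
  proof -
    have "gg k - w k * (w k + 1) = gg 0 - w 0 * (w 0 + 1)"
      by (rule int_diff_const)
        (subst gg_step, simp add: weight w_def algebra_simps)
    then show ?thesis by (simp add: kap_def algebra_simps)
  qed
  define H where "H k = (w k + 1) ^ 3 + (3 * kap - 1) * (w k + 1)" for k
  have Hstep: "H k - H (k - 1) = 3 * gg k" for k
    by (simp add: H_def g w_def power3_eq_cube algebra_simps)
  define c1 where "c1 = CC 0 - H 0"
  define c2 where "c2 = DD 0 - H 0"
  have C: "CC k = H k + c1" for k
  proof -
    have "CC k - H k = CC 0 - H 0"
    proof (rule int_diff_const)
      show "CC k - H k = CC (k - 1) - H (k - 1)" for k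
        using CC_step[of k] Hstep[of k] by (simp add: algebra_simps)
    qed
    then show ?thesis by (simp add: c1_def algebra_simps)
  qed
  have D: "DD k = H k + c2" for k
  proof -
    have "DD k - H k = DD 0 - H 0"
    proof (rule int_diff_const)
      show "DD k - H k = DD (k - 1) - H (k - 1)" for k
        using DD_step[of k] Hstep[of k] by (simp add: algebra_simps)
    qed
    then show ?thesis by (simp add: c2_def algebra_simps)
  qed
  define phi where "phi e = FF e - w e * (w e + 2)" for e
  have F: "FF (2 * n + e) = w (2 * n + e) * (w (2 * n + e) + 2) + phi e" for n e
  proof -
    have "FF (2 * n + e) - w (2 * n + e) * (w (2 * n + e) + 2)
        = FF (2 * 0 + e) - w (2 * 0 + e) * (w (2 * 0 + e) + 2)"
    proof (rule int_diff_const)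
      fix k
      show "FF (2 * k + e) - w (2 * k + e) * (w (2 * k + e) + 2)
        = FF (2 * (k - 1) + e) - w (2 * (k - 1) + e) * (w (2 * (k - 1) + e) + 2)"
        using FF_step[of "2 * k + e"] by (simp add: weight w_def algebra_simps)
    qed
    then show ?thesis by (simp add: phi_def algebra_simps)
  qed
  have key: "phi e = 4 * kap \<and> c2 = - c1 \<and> c1 * c2 = kap\<^sup>2 * (4 * kap - 1)" for e
  proof -
    define x where "x n = w (2 * n + e) + 1" for n
    have "inj x" by (auto simp: x_def w_def inj_def)
    have eq: "(c1 * c2 - kap\<^sup>2 * (phi e - 1)) + (c1 + c2) * (3 * kap - 1) * x n
        + ((3 * kap - 1)\<^sup>2 - kap\<^sup>2 - (2 * kap - 1) * (phi e - 1)) * x n ^ 2 + (c1 + c2) * x n ^ 3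
        + (4 * kap - phi e) * x n ^ 4 + 0 * x n ^ 5 = 0" for n
    proof -
      have ww: "w (2 * n + e) = x n - 1" "w (2 * n + e + 1) = x n"
        by (simp_all add: x_def w_def algebra_simps)
      have "(H (2 * n + e) + c1) * (H (2 * n + e) + c2)
          = gg (2 * n + e) * gg (2 * n + e + 1) * FF (2 * n + e)"
        using CC_DD[of "2 * n + e"] C D by simp
      then have "(x n ^ 3 + (3 * kap - 1) * x n + c1) * (x n ^ 3 + (3 * kap - 1) * x n + c2)
         = ((x n - 1) * x n + kap) * (x n * (x n + 1) + kap) * ((x n - 1) * (x n + 1) + phi e)"
        unfolding H_def g F ww by simp
      then show ?thesis by algebra
    qed
    note z = poly5_coeffs_zero[OF eq \<open>inj x\<close>]
    have "phi e = 4 * kap" "c1 + c2 = 0" using z(5) z(4) by simp_all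
    then show ?thesis using z(1) by (simp add: add_eq_0_iff2)
  qed
  have phi: "FF k = w k * (w k + 2) + 4 * kap" for k
    using F[of "k div 2" "k mod 2"] key by simp
  have c2: "c2 = - c1" and cc: "c1\<^sup>2 = kap\<^sup>2 * (1 - 4 * kap)"
    using key[of 0] by (auto simp: power2_eq_square algebra_simps)
  \<comment> \<open>The quadratic equation for b is solvable in the field itself: for kap \<noteq> 0
    the quotient c1 / kap is a square root of the discriminant 1 - 4 kap. Its sign distinguishes b
    from 1 - b.\<close>
  obtain b where b: "kap = b * (1 - b)" "c1 = kap * (1 - 2 * b)"
  proof (cases "kap = 0")
    case True
    then show ?thesis using that[of 0] cc by simp
  next
    case False
    define b where "b = (1 - c1 / kap) / 2"
    have "2 * b = 1 - c1 / kap" by (simp add: b_def)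
    then have "c1 = kap * (1 - 2 * b)" using False by simp
    moreover from this have "(1 - 2 * b)\<^sup>2 = 1 - 4 * kap"
      using cc False by (simp add: power_mult_distrib)
    then have "4 * kap = 4 * (b * (1 - b))" by algebra
    then have "kap = b * (1 - b)" by simp
    ultimately show ?thesis using that by blast
  qed
  show thesis
  proof
    fix k
    show "gg k = (\<alpha> + of_int k + b) * (\<alpha> + of_int k + 1 - b)"
      unfolding g b w_def by algebra
    show "FF k = (\<alpha> + of_int k + 2 * b) * (\<alpha> + of_int k + 2 - 2 * b)"
      unfolding phi b w_def by algebra
    show "CC k = (\<alpha> + of_int k + 2 * b) * (\<alpha> + of_int k + 2 - b) * (\<alpha> + of_int k + 1 - b)"
      unfolding C H_def b w_def by algebra
    show "DD k = (\<alpha> + of_int k + b) * (\<alpha> + of_int k + 1 + b) * (\<alpha> + of_int k + 2 - 2 * b)"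
      unfolding D c2 H_def b w_def by algebra
  qed
qed

lemma rescaled:
  assumes "\<And>k. t k \<noteq> 0"
  shows "weighted_witt_module (\<lambda>i k. a i k * t k / t (i + k)) \<alpha>"
proof
  fix i j k
  have "a j k * t k / t (j + k) * (a i (j + k) * t (j + k) / t (i + (j + k))) -
    a i k * t k / t (i + k) * (a j (i + k) * t (i + k) / t (j + (i + k)))
    = (a j k * a i (j + k) - a i k * a j (i + k)) * t k / t (i + j + k)"
    using assms by (simp add: field_simps)
  then show "a j k * t k / t (j + k) * (a i (j + k) * t (j + k) / t (i + (j + k))) -
    a i k * t k / t (i + k) * (a j (i + k) * t (i + k) / t (j + (i + k))) =
    of_int (j - i) * (a (i + j) k * t k / t (i + j + k))"
    using rel[of j k i] by simp
  show "a 0 k * t k / t (0 + k) = \<alpha> + of_int k"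
    using weight assms by simp
qed

end

text \<open>The four operators generate the Witt algebra. The factor i - 1 in
  \<open>rel_succ\<close> vanishes for i = 1, so L_2 is not obtained from L_1 and has to be compared
  separately; likewise L_-2.\<close>

lemma witt_module_eqI:
  assumes "witt_module a" "witt_module a'"
    and eq: "\<And>k. a 1 k = a' 1 k" "\<And>k. a (- 1) k = a' (- 1) k"
      "\<And>k. a 2 k = a' 2 k" "\<And>k. a (- 2) k = a' (- 2) k"
  shows "a i k = a' i k"
proof -
  interpret a: witt_module a by fact
  interpret a': witt_module a' by fact
  have zero: "a 0 k = a' 0 k" for k
    using a.rel[of 1 k "-1"] a'.rel[of 1 k "-1"] eq by simp
  have succ: "a (i + 1) k = a' (i + 1) k" if "i \<noteq> 1" "\<And>k. a i k = a' i k" for i k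
  proof -
    have "(of_int (i - 1) :: 'a) * a (i + 1) k = of_int (i - 1) * a' (i + 1) k"
      using a.rel_succ[of i k] a'.rel_succ[of i k] that eq by (simp only:)
    moreover have "(of_int (i - 1) :: 'a) \<noteq> 0" using that by (subst of_int_eq_0_iff) simp
    ultimately show ?thesis by (simp del: of_int_diff)
  qed
  have pred: "a (i - 1) k = a' (i - 1) k" if "i \<noteq> - 1" "\<And>k. a i k = a' i k" for i k
  proof -
    have "(of_int (i + 1) :: 'a) * a (i - 1) k = of_int (i + 1) * a' (i - 1) k"
      using a.rel_pred[of i k] a'.rel_pred[of i k] that eq by (simp only:)
    moreover have "(of_int (i + 1) :: 'a) \<noteq> 0" using that by (subst of_int_eq_0_iff) simp
    ultimately show ?thesis by (simp del: of_int_add)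
  qed
  have pos: "a (int n + 2) k = a' (int n + 2) k" for n k
  proof (induction n arbitrary: k)
    case (Suc n)
    then show ?case using succ[of "int n + 2" k] by (simp add: add_ac)
  qed (use eq in simp)
  have neg: "a (- int n - 2) k = a' (- int n - 2) k" for n k
  proof (induction n arbitrary: k)
    case (Suc n)
    then show ?case using pred[of "- int n - 2" k] by (simp add: algebra_simps)
  qed (use eq in simp)
  consider "i = 0" | "i = 1" | "i = - 1" | "i \<ge> 2" | "i \<le> - 2" by linarith
  then show ?thesis
    using zero eq pos[of "nat (i - 2)"] neg[of "nat (- i - 2)"] by cases auto
qed

lemma density_module:
  "witt_module (\<lambda>i k. \<alpha> + of_int k + of_int i * b :: 'f::field_char_0)"
  by unfold_locales (simp add: algebra_simps)

context weighted_witt_module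
begin

text \<open>For \<open>b = 1/2\<close> and \<open>\<alpha> \<in> 1/2 + \<int>\<close> the operators \<open>L\<^sub>\<plusminus>\<^sub>1\<close> do not connect the weights \<open>- 1/2\<close> and \<open>1/2\<close>,
  so that the scaling there is read off \<open>L\<^sub>2\<close>.\<close>

lemma density_normal_form:
  assumes g: "\<And>k. gg k = (\<alpha> + of_int k + b) * (\<alpha> + of_int k + 1 - b)"
    and C: "\<And>k. CC k = (\<alpha> + of_int k + 2 * b) * (\<alpha> + of_int k + 2 - b) * (\<alpha> + of_int k + 1 - b)"
    and D: "\<And>k. DD k = (\<alpha> + of_int k + b) * (\<alpha> + of_int k + 1 + b) * (\<alpha> + of_int k + 2 - 2 * b)"
    and F: "\<And>k. FF k = (\<alpha> + of_int k + 2 * b) * (\<alpha> + of_int k + 2 - 2 * b)"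
    and gen: "b \<noteq> 0 \<and> b \<noteq> 1 \<or> \<alpha> \<notin> \<int>"
  obtains t where "\<And>k. t k \<noteq> 0"
    "\<And>i k. a i k * t k / t (i + k) = \<alpha> + of_int k + of_int i * b"
proof -
  define w where "w k = \<alpha> + of_int k" for k
  have w_shift: "w (k + 1) = w k + 1" "w (k - 1) = w k - 1" for k by (simp_all add: w_def)
  have nonint: "\<alpha> \<in> \<int>" if "w k = of_int n" for k n
  proof -
    have "\<alpha> = of_int (n - k)" using that by (simp add: w_def algebra_simps)
    then show ?thesis by simp
  qed
  define sing where "sing k \<longleftrightarrow> w k + b = 0 \<and> w k + 1 - b = 0" for k
  have sing: "a 1 k = 0" "a (- 1) (k + 1) = 0" "a 2 (k - 1) \<noteq> 0" "b = 1 / 2" "w k = - 1 / 2"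
    if "sing k" for k
  proof -
    have b: "2 * b = 1" using that unfolding sing_def by algebra
    then show b': "b = 1 / 2" by (simp add: eq_divide_eq mult.commute)
    have "w k = - b" using that by (simp add: sing_def eq_neg_iff_add_eq_0)
    then show wk: "w k = - 1 / 2" by (simp add: b')
    have e: "\<alpha> + of_int (k - 1) = - 3 / 2" using wk by (simp add: w_def algebra_simps)
    have "FF (k - 1) = 1 / 4" "CC (k - 1) = 0" "DD (k - 1) = 0" "gg (k - 1) = 1"
      unfolding F C D g e b' by simp_all
    then show "a 1 k = 0" "a (- 1) (k + 1) = 0" "a 2 (k - 1) \<noteq> 0"
      by (auto simp: FF_def CC_def DD_def gg_def add.commute[of 1])
  qed
  \<comment> \<open>A ratio r between the scaling factors at k + 1 and k normalises both L_1 at k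
    and L_-1 at k + 1 if \<open>P k r\<close> holds. It is read off one of the two that does not
    vanish; at a singular k both vanish and every nonzero r is admissible.\<close>
  define P where "P k r \<longleftrightarrow> r \<noteq> 0 \<and> a 1 k = r * (w k + b) \<and> r * a (- 1) (k + 1) = w k + 1 - b" for k r
  have "\<exists>r. P k r" for k
  proof -
    consider "sing k" | "w k + b \<noteq> 0" "w k + 1 - b \<noteq> 0" | "w k + b = 0" "w k + 1 - b \<noteq> 0"
      | "w k + b \<noteq> 0" "w k + 1 - b = 0"
      by (auto simp: sing_def)
    then show ?thesis
    proof cases
      case 1
      then have "w k + b = 0" "w k + 1 - b = 0" by (auto simp: sing_def)
      then show ?thesis using sing(1,2)[OF 1] by (intro exI[of _ 1]) (simp add: P_def)
    next
      case 2
      have "a 1 k * a (- 1) (k + 1) = (w k + b) * (w k + 1 - b)"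
        using g[of k] by (simp add: gg_def w_def)
      moreover from this have "a 1 k \<noteq> 0" using 2 by auto
      ultimately show ?thesis using 2 unfolding P_def
        by (intro exI[of _ "a 1 k / (w k + b)"] conjI)
          (simp_all add: nonzero_divide_eq_eq mult.commute)
    next
      case 3
      have b: "w k = - b" using 3(1) by (simp add: eq_neg_iff_add_eq_0)
      have b01: "b \<noteq> 0" "b \<noteq> 1" using gen nonint[of k 0] nonint[of k "-1"] b by auto
      have "CC k = b * (2 - 2 * b) * (w k + 1 - b)"
        using C[of k] b by (simp add: w_def)
      then have "CC k \<noteq> 0" using b01 3 by auto
      then have "a (- 1) (k + 1) \<noteq> 0" by (auto simp: CC_def)
      moreover from this have "a 1 k = 0"
        using g[of k] 3 by (simp add: gg_def w_def)
      ultimately show ?thesis using 3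
        by (intro exI[of _ "(w k + 1 - b) / a (- 1) (k + 1)"]) (auto simp: P_def)
    next
      case 4
      have b: "w k = b - 1" using 4(2) by (simp add: algebra_simps)
      have b01: "b \<noteq> 0" "b \<noteq> 1" using gen nonint[of k 0] nonint[of k "-1"] b by auto
      have "DD k = (w k + b) * (w k + 1 + b) * (w k + 2 - 2 * b)"
        using D[of k] by (simp add: w_def)
      also have "\<dots> = (w k + b) * (2 * b) * (1 - b)"
        by (simp add: b)
      finally have "DD k \<noteq> 0" using b01 4 by auto
      then have "a 1 k \<noteq> 0" by (auto simp: DD_def)
      moreover from this have "a (- 1) (k + 1) = 0"
        using g[of k] 4 by (simp add: gg_def w_def)
      ultimately show ?thesis using 4
        by (intro exI[of _ "a 1 k / (w k + b)"]) (auto simp: P_def)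
    qed
  qed
  then obtain r0 where r0: "P k (r0 k)" for k by metis
  define r where "r k = (if sing k then a 2 (k - 1) / (r0 (k - 1) * (w (k - 1) + 2 * b)) else r0 k)" for k
  have r: "P k (r k)" for k
  proof (cases "sing k")
    case True
    then have "w (k - 1) + 2 * b \<noteq> 0" unfolding w_shift sing(4,5)[OF True] by simp
    moreover have "w k + b = 0" "w k + 1 - b = 0" using True by (auto simp: sing_def)
    ultimately show ?thesis using sing(1,2,3)[OF True] r0[of "k - 1"] True
      by (simp add: P_def r_def)
  qed (use r0 in \<open>simp add: r_def\<close>)
  have r_sing: "a 2 (k - 1) = r (k - 1) * r k * (w (k - 1) + 2 * b)" if "sing k" for k
  proof -
    have "\<not> sing (k - 1)" using that by (auto simp: sing_def w_shift)
    moreover have "w (k - 1) + 2 * b \<noteq> 0" unfolding w_shift sing(4,5)[OF that] by simp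
    ultimately show ?thesis using that r0[of "k - 1"] by (simp add: r_def P_def)
  qed
  obtain t where t: "\<And>k. t k \<noteq> 0" "\<And>k. t (k + 1) = r k * t k"
    using int_product_solution[of r] r by (auto simp: P_def)
  define A where "A i k = a i k * t k / t (i + k)" for i k
  interpret A: weighted_witt_module A \<alpha>
    unfolding A_def by (rule rescaled[OF t(1)])
  have A1: "A 1 k = w k + b" for k
    using r[of k] t(1)[of k] t(2)[of k] by (simp add: A_def P_def add.commute)
  have A1': "A (- 1) (k + 1) = w k + 1 - b" for k
    using r[of k] t(1)[of k] t(2)[of k] by (auto simp: A_def P_def add.commute mult.commute)
  have Am1: "A (- 1) k = w k - b" for k
    using A1'[of "k - 1"] by (simp add: w_shift)
  have C': "A 2 k * (w k + 2 - b) * (w k + 1 - b) = (w k + 2 * b) * (w k + 2 - b) * (w k + 1 - b)" for k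
  proof -
    have "A.CC k = CC k" using t(1) by (simp add: A.CC_def CC_def A_def add.commute[of 1] add.commute[of 2])
    then show ?thesis using C[of k] by (simp add: A.CC_def Am1 w_def algebra_simps)
  qed
  have D': "(w k + b) * (w k + 1 + b) * A (- 2) (k + 2) = (w k + b) * (w k + 1 + b) * (w k + 2 - 2 * b)" for k
  proof -
    have "A.DD k = DD k" using t(1) by (simp add: A.DD_def DD_def A_def add.commute[of 1] add.commute[of 2])
    then show ?thesis using D[of k] by (simp add: A.DD_def A1 w_def algebra_simps)
  qed
  have F': "A 2 k * A (- 2) (k + 2) = (w k + 2 * b) * (w k + 2 - 2 * b)" for k
  proof -
    have "A.FF k = FF k" using t(1) by (simp add: A.FF_def FF_def A_def add.commute[of 1] add.commute[of 2])
    then show ?thesis using F[of k] by (simp add: A.FF_def w_def)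
  qed
  \<comment> \<open>Cancelling in \<open>C'\<close> determines L_2 except where w k is b - 2 or b -
    1. At b - 2 the value comes from \<open>D'\<close> and \<open>F'\<close>, or from the choice of
    r at a singular index; the commutator of L_2 and L_-1 transports it to b - 1.\<close>
  have A2a: "A 2 k = w k + 2 * b" if "w k = b - 2" for k
  proof -
    have b01: "b \<noteq> 0" "b \<noteq> 1" using gen nonint[of k "-2"] nonint[of k "-1"] that by auto
    show ?thesis
    proof (cases "2 * b = 1")
      case True
      have "w (k + 1) + b = 2 * b - 1" "w (k + 1) + 1 - b = 0" by (simp_all add: w_shift that)
      then have "w (k + 1) + b = 0" "w (k + 1) + 1 - b = 0" using True by simp_all
      then have "sing (k + 1)" by (simp add: sing_def)
      then have "a 2 k = r k * r (k + 1) * (w k + 2 * b)" using r_sing[of "k + 1"] by simp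
      moreover have "t (k + 2) = r (k + 1) * r k * t k"
        using t(2)[of "k + 1"] t(2)[of k] by (simp add: add.assoc)
      ultimately show ?thesis using t(1)[of k] t(1)[of "k + 2"]
        by (simp add: A_def add.commute[of 2])
    next
      case False
      have "(w k + b) * (w k + 1 + b) = 2 * (b - 1) * (2 * b - 1)"
        unfolding that by algebra
      then have "(w k + b) * (w k + 1 + b) \<noteq> 0" using False b01 by simp
      then have "A (- 2) (k + 2) = w k + 2 - 2 * b" by (metis D' mult_left_cancel)
      then have "A (- 2) (k + 2) = - b" by (simp add: that)
      then show ?thesis using F'[of k] b01 that by simp
    qed
  qed
  have A2: "A 2 k = w k + 2 * b" for k
  proof -
    consider "w k = b - 2" | "w k = b - 1" | "w k + 2 - b \<noteq> 0" "w k + 1 - b \<noteq> 0"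
      by (fastforce simp: algebra_simps)
    then show ?thesis
    proof cases
      case 2
      then have "w (k - 1) = b - 2" by (simp add: w_shift)
      then have e: "A 2 (k - 1) = 3 * b - 2" using A2a[of "k - 1"] by simp
      moreover have "A 2 k * A (- 1) (2 + k) - A (- 1) k * A 2 (k - 1) = 3 * A 1 k"
        using A.rel[of 2 k "-1"] by simp
      moreover have "w (2 + k) = b + 1" using 2 by (simp add: w_def)
      ultimately have "A 2 k + A 2 (k - 1) = 6 * b - 3" using 2 by (simp add: A1 Am1 algebra_simps)
      then show ?thesis using e 2 by algebra
    qed (use C'[of k] A2a in auto)
  qed
  have Am2: "A (- 2) (k + 2) = w k + 2 - 2 * b" for k
  proof (cases "w k + 2 * b = 0")
    case True
    then have wk: "w k = - 2 * b" by (simp add: eq_neg_iff_add_eq_0)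
    have "b \<noteq> 0" "b \<noteq> 1" using gen nonint[of k 0] nonint[of k "-2"] wk by auto
    then show ?thesis using D'[of k] by (simp add: wk)
  qed (use F'[of k] in \<open>simp add: A2\<close>)
  have "A i k = \<alpha> + of_int k + of_int i * b" for i k
  proof (rule witt_module_eqI[OF A.witt_module_axioms density_module])
    show "A (- 2) k = \<alpha> + of_int k + of_int (- 2) * b" for k
      using Am2[of "k - 2"] by (simp add: w_def)
  qed (simp_all add: A1 Am1 A2, simp_all add: w_def)
  then have "a i k * t k / t (i + k) = \<alpha> + of_int k + of_int i * b" for i k
    by (simp add: A_def)
  with t(1) show thesis by (rule that)
qed

text \<open>In the following lemmas, \<open>h\<close> is the index of weight zero.\<close>

lemma succ_zero: "a (i + 1) k = 0" if "i \<noteq> 1" "a i k * a 1 (k + i) = 0" "a 1 k * a i (k + 1) = 0"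
proof -
  have "of_int (i - 1) * a (i + 1) k = 0" using rel_succ[of i k] that by simp
  moreover have "(of_int (i - 1) :: 'a) \<noteq> 0" using that by (subst of_int_eq_0_iff) simp
  ultimately show ?thesis by (simp del: of_int_diff)
qed

lemma pred_zero: "a (i - 1) k = 0" if "i \<noteq> - 1" "a i k * a (- 1) (k + i) = 0" "a (- 1) k * a i (k - 1) = 0"
proof -
  have "of_int (i + 1) * a (i - 1) k = 0" using rel_pred[of i k] that by simp
  moreover have "(of_int (i + 1) :: 'a) \<noteq> 0" using that by (subst of_int_eq_0_iff) simp
  ultimately show ?thesis by (simp del: of_int_add)
qed

text \<open>The four products vanish along the closed paths through h. Each of them contains an
  arrow into h and an arrow out of h, while arrows that avoid h are nonzero. So as soon as one of
  L_1, L_-1, L_2, L_-2 reaches h, all four vanish on the vector at h, and then all L_j do. If none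
  of the four reached h, no L_i would.\<close>

lemma zero_weight_trivial:
  assumes h: "\<alpha> = - of_int h"
    and g: "\<And>k. gg k = (\<alpha> + of_int k) * (\<alpha> + of_int k + 1)"
    and C: "\<And>k. CC k = (\<alpha> + of_int k) * (\<alpha> + of_int k + 1) * (\<alpha> + of_int k + 2)"
    and D: "\<And>k. DD k = (\<alpha> + of_int k) * (\<alpha> + of_int k + 1) * (\<alpha> + of_int k + 2)"
    and F: "\<And>k. FF k = (\<alpha> + of_int k) * (\<alpha> + of_int k + 2)"
    and into: "a i (h - i) \<noteq> 0"
  shows "a j h = 0"
proof -
  have sh: "\<And>n. h - 1 + n = h + (n - 1)" "\<And>n. h - 2 + n = h + (n - 2)" by auto
  have nz: "a (- 2) (h + 1) \<noteq> 0" "a 2 (h - 1) \<noteq> 0" "a 1 (h - 2) \<noteq> 0" "a (- 1) (h - 1) \<noteq> 0"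
      "a 1 (h + 1) \<noteq> 0" "a (- 1) (h + 2) \<noteq> 0"
    using F[of "h - 1"] g[of "h - 2"] g[of "h + 1"] h
    by (auto simp: FF_def gg_def sh add.commute[of _ h])
  have r1: "a 2 h * a (- 1) (h + 2) - a (- 1) h * a 2 (h - 1) = 3 * a 1 h"
    using rel[of 2 h "-1"] by (simp add: algebra_simps)
  have r2: "a (- 2) h * a 1 (h - 2) - a 1 h * a (- 2) (h + 1) = - 3 * a (- 1) h"
    using rel[of "-2" h 1] by (simp add: algebra_simps)
  have some: "a 1 (h - 1) \<noteq> 0 \<or> a (- 1) (h + 1) \<noteq> 0 \<or> a 2 (h - 2) \<noteq> 0 \<or> a (- 2) (h + 2) \<noteq> 0"
  proof (rule ccontr)
    assume *: "\<not> ?thesis"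
    have pos: "a (int n + 2) (h - (int n + 2)) = 0" for n
    proof (induction n)
      case (Suc n)
      then show ?case
        using succ_zero[of "int n + 2" "h - (int n + 3)"] * by (simp add: algebra_simps)
    qed (use * in simp)
    have neg: "a (- int n - 2) (h + (int n + 2)) = 0" for n
    proof (induction n)
      case (Suc n)
      then show ?case
        using pred_zero[of "- int n - 2" "h + (int n + 3)"] * by (simp add: algebra_simps)
    qed (use * in simp)
    have zero: "a 0 h = 0" by (simp add: weight h)
    consider "i = 0" | "i = 1" | "i = - 1" | "i \<ge> 2" | "i \<le> - 2" by linarith
    then show False
      using into * zero pos[of "nat (i - 2)"] neg[of "nat (- i - 2)"] by cases auto
  qed
  have "a 1 h = 0 \<and> a (- 1) h = 0 \<and> a 2 h = 0 \<and> a (- 2) h = 0"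
    using some
  proof (elim disjE)
    assume "a 1 (h - 1) \<noteq> 0"
    then show ?thesis
      using g[of "h - 1"] D[of "h - 1"] D[of "h - 2"] h nz r1
      by (auto simp: gg_def DD_def sh add.commute[of _ h])
  next
    assume "a (- 1) (h + 1) \<noteq> 0"
    then show ?thesis
      using g[of h] C[of "h - 1"] C[of h] h nz r2
      by (auto simp: gg_def CC_def sh add.commute[of _ h])
  next
    assume "a 2 (h - 2) \<noteq> 0"
    then show ?thesis
      using F[of "h - 2"] C[of "h - 2"] h nz r1 r2
      by (auto simp: FF_def CC_def sh add.commute[of _ h])
  next
    assume "a (- 2) (h + 2) \<noteq> 0"
    then show ?thesis
      using F[of h] D[of h] h nz r1 r2
      by (auto simp: FF_def DD_def sh add.commute[of _ h])
  qed
  note base = this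
  have pos: "a (int n + 2) h = 0" for n
  proof (induction n)
    case (Suc n)
    then show ?case using succ_zero[of "int n + 2" h] base by (simp add: algebra_simps)
  qed (use base in simp)
  have neg: "a (- int n - 2) h = 0" for n
  proof (induction n)
    case (Suc n)
    then show ?case using pred_zero[of "- int n - 2" h] base by (simp add: algebra_simps)
  qed (use base in simp)
  have zero: "a 0 h = 0" by (simp add: weight h)
  consider "j = 0" | "j = 1" | "j = - 1" | "j \<ge> 2" | "j \<le> - 2" by linarith
  then show ?thesis
    using base zero pos[of "nat (j - 2)"] neg[of "nat (- j - 2)"] by cases auto
qed

lemma flex_normal_form:
  assumes h: "\<alpha> = - of_int h"
    and g: "\<And>k. gg k = (\<alpha> + of_int k) * (\<alpha> + of_int k + 1)"
    and C: "\<And>k. CC k = (\<alpha> + of_int k) * (\<alpha> + of_int k + 1) * (\<alpha> + of_int k + 2)"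
    and F: "\<And>k. FF k = (\<alpha> + of_int k) * (\<alpha> + of_int k + 2)"
    and triv: "\<And>j. a j h = 0"
  obtains t where "\<And>k. t k \<noteq> 0"
    "\<And>i k. i + k \<noteq> h \<Longrightarrow> a i k * t k / t (i + k) = \<alpha> + of_int k"
proof -
  define w where "w k = (of_int (k - h) :: 'a)" for k
  have w: "\<alpha> + of_int k = w k" for k by (simp add: w_def h)
  \<comment> \<open>No arrow leaves h, so the scale at h is free and the ratio there is 1. The ratio
    at h - 1 then normalises L_2 from h - 1 to h + 1, the connection across h; the weight at h - 1
    is - 1.\<close>
  define r where "r k = (if k = h then 1 else if k = h - 1 then - a 2 (h - 1) else a 1 k / w k)" for k
  have g': "a 1 k * a (- 1) (k + 1) = w k * (w k + 1)" for k
    using g[of k] by (simp add: gg_def w)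
  have F': "a 2 k * a (- 2) (k + 2) = w k * (w k + 2)" for k
    using F[of k] by (simp add: FF_def w)
  have wz: "w k = 0 \<longleftrightarrow> k = h" "w k + 1 = 0 \<longleftrightarrow> k = h - 1" "w k + 2 = 0 \<longleftrightarrow> k = h - 2" for k
  proof -
    have "w k + 1 = of_int (k - h + 1)" "w k + 2 = of_int (k - h + 2)" by (simp_all add: w_def)
    then show "w k = 0 \<longleftrightarrow> k = h" "w k + 1 = 0 \<longleftrightarrow> k = h - 1" "w k + 2 = 0 \<longleftrightarrow> k = h - 2"
      by (auto simp only: w_def of_int_eq_0_iff)
  qed
  have nz1: "a 1 k \<noteq> 0" if "k \<noteq> h" "k \<noteq> h - 1" for k
    using g'[of k] that wz[of k] by auto
  have nz2: "a 2 (h - 1) \<noteq> 0"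
    using F'[of "h - 1"] by (auto simp: w_def)
  have r: "r k \<noteq> 0" for k
    using nz1[of k] nz2 wz(1)[of k] by (simp add: r_def)
  obtain t where t: "\<And>k. t k \<noteq> 0" "\<And>k. t (k + 1) = r k * t k"
    using int_product_solution[of r] r by auto
  define A where "A i k = a i k * t k / t (i + k)" for i k
  interpret A: weighted_witt_module A \<alpha>
    unfolding A_def by (rule rescaled[OF t(1)])
  have triv': "A i h = 0" for i by (simp add: A_def triv)
  have A1: "A 1 k = w k" if "1 + k \<noteq> h" for k
  proof (cases "k = h")
    case True
    then show ?thesis by (simp add: triv' w_def)
  next
    case False
    then show ?thesis
      using that nz1[of k] t(1)[of k] t(2)[of k] wz(1)[of k]
      by (simp add: A_def r_def add.commute[of 1])
  qed
  have Am1: "A (- 1) (k + 1) = w k + 1" if "k \<noteq> h" for k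
  proof (cases "k = h - 1")
    case False
    have "A 1 k * A (- 1) (k + 1) = a 1 k * a (- 1) (k + 1)"
      using t(1) by (simp add: A_def add.commute[of 1])
    then show ?thesis using g'[of k] A1[of k] False that wz(1)[of k] by simp
  qed (simp add: triv' w_def)
  have A2: "A 2 k = w k" if "2 + k \<noteq> h" for k
  proof -
    consider "k = h" | "k = h - 1" | "k \<noteq> h" "k \<noteq> h - 1" by blast
    then show ?thesis
    proof cases
      case 2
      have "t (h + 1) = - a 2 (h - 1) * t (h - 1)"
        using t(2)[of "h - 1"] t(2)[of h] by (simp add: r_def)
      then show ?thesis using t(1)[of "h - 1"] nz2
        by (simp add: A_def 2 w_def add.commute[of 1])
    next
      case 3
      have "A.CC k = CC k" using t(1) by (simp add: A.CC_def CC_def A_def add.commute[of 1] add.commute[of 2])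
      then have "A 2 k * A (- 1) (k + 2) * A (- 1) (k + 1) = w k * (w k + 1) * (w k + 2)"
        using C[of k] by (simp add: A.CC_def w)
      moreover have "A (- 1) (k + 2) = w k + 2" "A (- 1) (k + 1) = w k + 1"
        using Am1[of k] Am1[of "k + 1"] 3 by (simp_all add: w_def add.commute[of 2])
      ultimately show ?thesis using wz[of k] 3 that by auto
    qed (simp add: triv' w_def)
  qed
  have Am2: "A (- 2) (k + 2) = w k + 2" if "k \<noteq> h" for k
  proof (cases "k = h - 2")
    case False
    have "A 2 k * A (- 2) (k + 2) = a 2 k * a (- 2) (k + 2)"
      using t(1) by (simp add: A_def add.commute[of 2])
    then show ?thesis using F'[of k] A2[of k] False that wz(1)[of k] by simp
  qed (simp add: triv' w_def)
  have succ: "A (i + 1) k = w k"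
    if "i \<noteq> 1" "\<And>k. i + k \<noteq> h \<Longrightarrow> A i k = w k" "i + 1 + k \<noteq> h" for i k
  proof -
    have "A i k * A 1 (k + i) = w k * w (k + i)"
      using that(2)[of k] A1[of "k + i"] that(3) by (cases "i + k = h") (auto simp: triv' w_def add_ac)
    moreover have "A 1 k * A i (k + 1) = w k * w (k + 1)"
      using that(2)[of "k + 1"] A1[of k] that(3) by (cases "1 + k = h") (auto simp: triv' w_def add_ac)
    ultimately have "of_int (i - 1) * A (i + 1) k = w k * w (k + i) - w k * w (k + 1)"
      using A.rel_succ[of i k] by (simp only:)
    also have "\<dots> = of_int (i - 1) * w k" by (simp add: w_def algebra_simps)
    finally have "of_int (i - 1) * A (i + 1) k = of_int (i - 1) * w k" .
    moreover have "(of_int (i - 1) :: 'a) \<noteq> 0" using that(1) by (subst of_int_eq_0_iff) simp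
    ultimately show ?thesis by (simp del: of_int_diff)
  qed
  have Am1': "A (- 1) k = w k" if "- 1 + k \<noteq> h" for k
    using Am1[of "k - 1"] that by (simp add: w_def)
  have pred: "A (i - 1) k = w k"
    if "i \<noteq> - 1" "\<And>k. i + k \<noteq> h \<Longrightarrow> A i k = w k" "i - 1 + k \<noteq> h" for i k
  proof -
    have "A i k * A (- 1) (k + i) = w k * w (k + i)"
      using that(2)[of k] Am1'[of "k + i"] that(3) by (cases "i + k = h") (auto simp: triv' w_def add_ac)
    moreover have "A (- 1) k * A i (k - 1) = w k * w (k - 1)"
      using that(2)[of "k - 1"] Am1'[of k] that(3)
      by (cases "k - 1 = h") (auto simp: triv' w_def add_ac)
    ultimately have "of_int (i + 1) * A (i - 1) k = w k * w (k + i) - w k * w (k - 1)"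
      using A.rel_pred[of i k] by (simp only:)
    also have "\<dots> = of_int (i + 1) * w k" by (simp add: w_def algebra_simps)
    finally have "of_int (i + 1) * A (i - 1) k = of_int (i + 1) * w k" .
    moreover have "(of_int (i + 1) :: 'a) \<noteq> 0" using that(1) by (subst of_int_eq_0_iff) simp
    ultimately show ?thesis by (simp del: of_int_add)
  qed
  have pos: "A (int n + 2) k = w k" if "int n + 2 + k \<noteq> h" for n k
    using that
  proof (induction n arbitrary: k)
    case (Suc n)
    then show ?case using succ[of "int n + 2" k] by (simp add: add_ac)
  qed (use A2 in simp)
  have neg: "A (- int n - 2) k = w k" if "- int n - 2 + k \<noteq> h" for n k
    using that
  proof (induction n arbitrary: k)
    case (Suc n)
    then show ?case using pred[of "- int n - 2" k] by (simp add: algebra_simps)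
  next
    case 0
    then show ?case using Am2[of "k - 2"] by (simp add: w_def)
  qed
  have "A i k = w k" if "i + k \<noteq> h" for i k
  proof -
    consider "i = 0" | "i = 1" | "i = - 1" | "i \<ge> 2" | "i \<le> - 2" by linarith
    then show ?thesis
      using that A.weight[of k] A1[of k] Am1'[of k] pos[of "nat (i - 2)" k] neg[of "nat (- i - 2)" k]
      by cases (auto simp: w)
  qed
  then have "a i k * t k / t (i + k) = \<alpha> + of_int k" if "i + k \<noteq> h" for i k
    using that by (simp add: A_def w)
  with t(1) show thesis by (rule that)
qed

text \<open>The arrows that avoid h are already normal. On two arrows into h the module relation
  therefore becomes the equation of \<open>quadratic_cocycle\<close>.\<close>

lemma cocycle_into_zero_weight:
  assumes norm: "\<And>i k. i + k \<noteq> h \<Longrightarrow> a i k = of_int (k - h)" and triv: "\<And>j. a j h = 0"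
  obtains c c' where "\<And>i. a i (h - i) = c * of_int i + c' * of_int i ^ 2"
proof -
  define f where "f i = a i (h - i)" for i
  have eq: "of_int (i + j) * (f j - f i) = of_int (j - i) * f (i + j)" if "i \<noteq> 0" "j \<noteq> 0" for i j
  proof -
    have "a i (j + (h - i - j)) = f i" "a j (i + (h - i - j)) = f j" "a (i + j) (h - i - j) = f (i + j)"
      by (simp_all add: f_def diff_diff_eq)
    moreover have "a j (h - i - j) = - of_int (i + j)" "a i (h - i - j) = - of_int (i + j)"
      using that by (simp_all add: norm)
    ultimately have "- of_int (i + j) * f i - - of_int (i + j) * f j = of_int (j - i) * f (i + j)"
      using rel[of j "h - i - j" i] by (simp only:)
    then show ?thesis by (simp add: algebra_simps)
  qed
  obtain c c' where c: "\<And>i. i \<noteq> 0 \<Longrightarrow> f i = c * of_int i + c' * of_int i ^ 2"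
    using quadratic_cocycle[of f] eq by blast
  have "f i = c * of_int i + c' * of_int i ^ 2" for i
    using c[of i] triv[of 0] by (cases "i = 0") (simp_all add: f_def triv)
  then show thesis using that[of c c'] by (simp add: f_def)
qed

end

definition quadratic :: "(int \<Rightarrow> 'f::field_char_0) \<Rightarrow> bool" where
  "quadratic f \<longleftrightarrow> (\<exists>c0 c1 c2. \<forall>n. f n = c0 + c1 * of_int n + c2 * of_int n ^ 2)"

lemma quadraticI: "(\<And>n. f n = c0 + c1 * of_int n + c2 * of_int n ^ 2) \<Longrightarrow> quadratic f"
  unfolding quadratic_def by blast

definition density_type :: "(int \<Rightarrow> int \<Rightarrow> 'f::field_char_0) \<Rightarrow> 'f \<Rightarrow> 'f \<Rightarrow> bool" where
  "density_type a \<alpha> b \<longleftrightarrow> (\<forall>i k. a i k = \<alpha> + of_int k + of_int i * b)"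

text \<open>The module of functions, with an arbitrary trivial extension at weight zero (if that occurs)
  in place of the constants.\<close>

definition flex_type :: "(int \<Rightarrow> int \<Rightarrow> 'f::field_char_0) \<Rightarrow> 'f \<Rightarrow> bool" where
  "flex_type a \<alpha> \<longleftrightarrow>
     (\<forall>i k. \<alpha> + of_int (i + k) \<noteq> 0 \<longrightarrow> a i k = \<alpha> + of_int k) \<and>
     (\<forall>i k. \<alpha> + of_int k = 0 \<longrightarrow> a i k = 0) \<and>
     (\<exists>c c'. \<forall>i k. \<alpha> + of_int (i + k) = 0 \<longrightarrow> a i k = c * of_int i + c' * of_int i ^ 2)"

text \<open>That the composites of L_n and L_(p-n) depend quadratically on n is common to both kinds
  of modules. It is what \<open>witt_pairing\<close> assumes about them, so either kind can occur on
  either side of a pairing.\<close>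

lemma density_type_quadratic:
  assumes "density_type a \<alpha> b"
  shows "quadratic (\<lambda>n. a n k * a (p - n) (k + n))"
proof (rule quadraticI)
  fix n
  show "a n k * a (p - n) (k + n) = (\<alpha> + of_int k) * (\<alpha> + of_int k + of_int p * b)
      + ((\<alpha> + of_int k) * (1 - b) + b * (\<alpha> + of_int k + of_int p * b)) * of_int n
      + b * (1 - b) * of_int n ^ 2"
    using assms by (simp add: density_type_def power2_eq_square algebra_simps)
qed

lemma flex_type_quadratic:
  assumes "flex_type a \<alpha>"
  shows "quadratic (\<lambda>n. a n k * a (p - n) (k + n))"
proof -
  have norm: "a i k = \<alpha> + of_int k" if "\<alpha> + of_int (i + k) \<noteq> 0" for i k
    using assms that by (auto simp: flex_type_def)
  have triv: "a i k = 0" if "\<alpha> + of_int k = 0" for i k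
    using assms that by (auto simp: flex_type_def)
  obtain c c' where into: "a i k = c * of_int i + c' * of_int i ^ 2" if "\<alpha> + of_int (i + k) = 0" for i k
    using assms by (auto simp: flex_type_def)
  show ?thesis
  proof (cases "\<alpha> + of_int (k + p) = 0")
    case False
    have "a n k * a (p - n) (k + n) = (\<alpha> + of_int k) * (\<alpha> + of_int k + of_int n)" for n
    proof (cases "\<alpha> + of_int (n + k) = 0")
      case True
      then show ?thesis using triv[of "k + n" "p - n"] by (simp add: algebra_simps)
    next
      case n: False
      then show ?thesis using norm[of n k] norm[of "p - n" "k + n"] False by (simp add: algebra_simps)
    qed
    then show ?thesis
      by (intro quadraticI[of _ "(\<alpha> + of_int k)\<^sup>2" "\<alpha> + of_int k" 0]) (simp add: power2_eq_square algebra_simps)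
  next
    case True
    have "a n k * a (p - n) (k + n) = (\<alpha> + of_int k) * (c * of_int (p - n) + c' * of_int (p - n) ^ 2)" for n
    proof (cases "\<alpha> + of_int (n + k) = 0")
      case n: True
      then have "\<alpha> + of_int k + of_int n = \<alpha> + of_int k + of_int p" using True by (simp add: add_ac)
      then have "n = p" by simp
      then show ?thesis using triv[of "k + n" "p - n"] n by (simp add: algebra_simps)
    next
      case False
      have "a (p - n) (k + n) = c * of_int (p - n) + c' * of_int (p - n) ^ 2"
        using True by (intro into) (simp add: add_ac)
      then show ?thesis using norm[OF False] by simp
    qed
    then show ?thesis
      by (intro quadraticI[of _ "(\<alpha> + of_int k) * (c * of_int p + c' * of_int p ^ 2)"
            "(\<alpha> + of_int k) * (- c - 2 * c' * of_int p)" "(\<alpha> + of_int k) * c'"])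
        (simp add: power2_eq_square algebra_simps)
  qed
qed

lemma cyclic_module_normal_form:
  fixes a :: "int \<Rightarrow> int \<Rightarrow> 'f::field_char_0"
  assumes "witt_module a"
    and supp: "\<And>i k. a i k \<noteq> 0 \<Longrightarrow> k \<in> S \<and> i + k \<in> S"
    and weight: "\<And>k. k \<in> S \<Longrightarrow> a 0 k = \<alpha> + of_int k"
    and k: "k \<in> S" "\<alpha> + of_int k \<noteq> 0"
    and cyc: "\<And>T. k \<in> T \<Longrightarrow> (\<And>i j. j \<in> T \<Longrightarrow> a i j \<noteq> 0 \<Longrightarrow> i + j \<in> T) \<Longrightarrow> S \<subseteq> T"
  obtains t where "\<And>k. t k \<noteq> 0"
    "(\<exists>b. b \<noteq> 0 \<and> b \<noteq> 1 \<and> density_type (\<lambda>i k. a i k * t k / t (i + k)) \<alpha> b)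
      \<or> flex_type (\<lambda>i k. a i k * t k / t (i + k)) \<alpha>"
proof -
  interpret witt_module a by fact
  interpret weighted_witt_module a \<alpha>
  proof
    show "a 0 j = \<alpha> + of_int j" for j
      using weight[of j] hole_weight_zero[OF assms(1) supp weight k, of j] supp[of 0 j]
      by (cases "j \<in> S") auto
  qed
  obtain b where b:
    "\<And>k. gg k = (\<alpha> + of_int k + b) * (\<alpha> + of_int k + 1 - b)"
    "\<And>k. CC k = (\<alpha> + of_int k + 2 * b) * (\<alpha> + of_int k + 2 - b) * (\<alpha> + of_int k + 1 - b)"
    "\<And>k. DD k = (\<alpha> + of_int k + b) * (\<alpha> + of_int k + 1 + b) * (\<alpha> + of_int k + 2 - 2 * b)"
    "\<And>k. FF k = (\<alpha> + of_int k + 2 * b) * (\<alpha> + of_int k + 2 - 2 * b)"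
    by (rule obtain_parameter) blast
  show thesis
  proof (cases "b = 0 \<or> b = 1")
    case False
    then obtain t where "\<And>k. t k \<noteq> 0"
      "\<And>i k. a i k * t k / t (i + k) = \<alpha> + of_int k + of_int i * b"
      using density_normal_form[OF b] by blast
    then show thesis using that False unfolding density_type_def by blast
  next
    case True
    have f: "gg k = (\<alpha> + of_int k) * (\<alpha> + of_int k + 1)"
      "CC k = (\<alpha> + of_int k) * (\<alpha> + of_int k + 1) * (\<alpha> + of_int k + 2)"
      "DD k = (\<alpha> + of_int k) * (\<alpha> + of_int k + 1) * (\<alpha> + of_int k + 2)"
      "FF k = (\<alpha> + of_int k) * (\<alpha> + of_int k + 2)" for k
      using True b by (auto simp: algebra_simps)
    show thesis
    proof (cases "\<alpha> \<in> \<int>")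
      case False
      \<comment> \<open>The values b = 0 and b = 1 give the same four products. Without a weight
        zero the normal form for b = 0 is available.\<close>
      have f0: "gg k = (\<alpha> + of_int k + 0) * (\<alpha> + of_int k + 1 - 0)"
        "CC k = (\<alpha> + of_int k + 2 * 0) * (\<alpha> + of_int k + 2 - 0) * (\<alpha> + of_int k + 1 - 0)"
        "DD k = (\<alpha> + of_int k + 0) * (\<alpha> + of_int k + 1 + 0) * (\<alpha> + of_int k + 2 - 2 * 0)"
        "FF k = (\<alpha> + of_int k + 2 * 0) * (\<alpha> + of_int k + 2 - 2 * 0)" for k
        by (simp_all add: f mult_ac)
      obtain t where t: "\<And>k. t k \<noteq> 0" "\<And>i k. a i k * t k / t (i + k) = \<alpha> + of_int k + of_int i * 0"
        using density_normal_form[OF f0] False by blast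
      have "\<alpha> + of_int n \<noteq> 0" for n
        using False by (metis Ints_minus Ints_of_int add.commute add_eq_0_iff2)
      then have "flex_type (\<lambda>i k. a i k * t k / t (i + k)) \<alpha>"
        using t(2) by (simp add: flex_type_def del: of_int_add)
      then show thesis using that t by blast
    next
      case int: True
      then obtain n where "\<alpha> = of_int n" by (rule Ints_cases)
      then obtain h where h: "\<alpha> = - of_int h" by (metis minus_minus of_int_minus)
      have h0: "\<alpha> + of_int k = 0 \<longleftrightarrow> k = h" for k by (simp add: h)
      have triv: "a j h = 0" for j
      proof (cases "h \<in> S")
        case True
        \<comment> \<open>If no L_i reached h, the remaining indices would contain k and be closed
          under the action, against cyclicity.\<close>
        have "\<exists>i. a i (h - i) \<noteq> 0"
        proof (rule ccontr)
          assume *: "\<not> ?thesis"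
          have "S \<subseteq> - {h}"
          proof (rule cyc)
            fix i j
            assume "a i j \<noteq> 0"
            moreover have "a i (h - i) = 0" using * by blast
            ultimately show "i + j \<in> - {h}" by auto
          qed (use k h0 in auto)
          then show False using True by auto
        qed
        then show ?thesis using zero_weight_trivial[OF h f] by blast
      qed (use supp in blast)
      obtain t where t: "\<And>k. t k \<noteq> 0"
        "\<And>i k. i + k \<noteq> h \<Longrightarrow> a i k * t k / t (i + k) = \<alpha> + of_int k"
        using flex_normal_form[OF h f(1,2,4) triv] by blast
      interpret A: weighted_witt_module "\<lambda>i k. a i k * t k / t (i + k)" \<alpha>
        by (rule rescaled[OF t(1)])
      obtain c c' where "\<And>i. a i (h - i) * t (h - i) / t (i + (h - i)) = c * of_int i + c' * of_int i ^ 2"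
        using A.cocycle_into_zero_weight[of h] t(2) triv h by auto
      then have "a i k * t k / t (i + k) = c * of_int i + c' * of_int i ^ 2" if "i + k = h" for i k
        using that[symmetric] by (metis add_diff_cancel_left')
      then have "flex_type (\<lambda>i k. a i k * t k / t (i + k)) \<alpha>"
        using t triv unfolding flex_type_def h0 by auto
      then show thesis using that t by blast
    qed
  qed
qed


section \<open>Structure constants of a \<open>\<int> \<times> \<int>\<close>-graded Lie algebra\<close>

text \<open>\<open>s i j k l\<close> is the structure constant of the basis vectors of degrees \<open>(i, j)\<close> and \<open>(k, l)\<close>, and
  \<open>S\<close> is the support of the grading. A structure constant is taken to be \<open>0\<close> if one of the three
  degrees is outside \<open>S\<close>, so that the Leibniz rule holds for all degrees.\<close>

locale zz_algebra =
  fixes s :: "int \<Rightarrow> int \<Rightarrow> int \<Rightarrow> int \<Rightarrow> 'f::field_char_0" and S :: "(int \<times> int) set" and \<alpha> :: 'f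
  assumes skew: "s k l i j = - s i j k l"
    and leibniz: "s k l m n * s i j (k + m) (l + n)
      = s i j k l * s (i + k) (j + l) m n + s i j m n * s k l (i + m) (j + n)"
    and supp: "s i j k l \<noteq> 0 \<Longrightarrow> (i, j) \<in> S \<and> (k, l) \<in> S \<and> (i + k, j + l) \<in> S"
    and witt: "s i 0 k 0 = of_int (k - i)"
    and alpha: "\<alpha> \<noteq> 0" "s 0 0 0 1 = \<alpha>"
    and pairing: "s 0 1 0 (- 1) \<noteq> 0"
    and generation: "\<lbrakk>\<And>i. (i, 0) \<in> T; (0, 1) \<in> T; (0, - 1) \<in> T;
      \<And>i j k l. \<lbrakk>(i, j) \<in> T; (k, l) \<in> T; s i j k l \<noteq> 0\<rbrakk> \<Longrightarrow> (i + k, j + l) \<in> T\<rbrakk> \<Longrightarrow> S \<subseteq> T"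
begin

lemma supp_zero: "(i, j) \<notin> S \<Longrightarrow> s i j k l = 0" "(i, j) \<notin> S \<Longrightarrow> s k l i j = 0"
  "(i + k, j + l) \<notin> S \<Longrightarrow> s i j k l = 0"
  using supp by blast+

lemma weight: "(i, j) \<in> S \<Longrightarrow> s 0 0 i j = of_int i + of_int j * \<alpha>"
proof -
  \<comment> \<open>The bracket of the degrees (0, 1) and (0, - 1) is a nonzero multiple of the
    vector of degree (0, 0), which commutes with itself; so the weights of the two degrees are
    opposite.\<close>
  have "s 0 1 0 (- 1) * s 0 0 0 0 = (\<alpha> + s 0 0 0 (- 1)) * s 0 1 0 (- 1)"
    using leibniz[of 0 1 0 "-1" 0 0] alpha by (simp add: algebra_simps)
  then have m1: "s 0 0 0 (- 1) = - \<alpha>"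
    using pairing witt[of 0 0] by (simp add: add_eq_0_iff)
  have "S \<subseteq> {(i, j). s 0 0 i j = of_int i + of_int j * \<alpha>}"
  proof (rule generation)
    fix i j k l
    assume *: "(i, j) \<in> {(i, j). s 0 0 i j = of_int i + of_int j * \<alpha>}"
      "(k, l) \<in> {(i, j). s 0 0 i j = of_int i + of_int j * \<alpha>}" "s i j k l \<noteq> 0"
    have "s i j k l * s 0 0 (i + k) (j + l) = s i j k l * (s 0 0 i j + s 0 0 k l)"
      using leibniz[of i j k l 0 0] by (simp add: algebra_simps)
    then have "s 0 0 (i + k) (j + l) = s 0 0 i j + s 0 0 k l" using *(3) by simp
    then show "(i + k, j + l) \<in> {(i, j). s 0 0 i j = of_int i + of_int j * \<alpha>}"
      using * by (simp add: algebra_simps)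
  qed (use witt alpha m1 in auto)
  then show "(i, j) \<in> S \<Longrightarrow> s 0 0 i j = of_int i + of_int j * \<alpha>" by auto
qed

text \<open>For e = 1 or e = - 1 these are the degrees (k, e * n) reached by nonzero brackets of n
  vectors of column e. The point is that nothing else occurs: column 0 (\<open>gen_col_act\<close>)
  and column - e (\<open>gen_col_lower\<close>) lead from such degrees to such degrees, so the
  support of column e * n comes from column e alone.\<close>

inductive gen_col :: "int \<Rightarrow> int \<Rightarrow> nat \<Rightarrow> bool" where
  base: "gen_col e 0 1"
| act: "gen_col e k 1 \<Longrightarrow> s i 0 k e \<noteq> 0 \<Longrightarrow> gen_col e (i + k) 1"
| bracket: "gen_col e i 1 \<Longrightarrow> gen_col e k n \<Longrightarrow> s i e k (e * int n) \<noteq> 0 \<Longrightarrow> gen_col e (i + k) (Suc n)"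

lemma gen_col_pos: "gen_col e k n \<Longrightarrow> n \<ge> 1"
  by (induction rule: gen_col.induct) auto

lemma gen_col_act: "gen_col e k n \<Longrightarrow> s i 0 k (e * int n) \<noteq> 0 \<Longrightarrow> gen_col e (i + k) n"
proof (induction arbitrary: i rule: gen_col.induct)
  case (bracket e j k n)
  have "s j e k (e * int n) * s i 0 (j + k) (e * int (Suc n)) \<noteq> 0"
    using bracket by simp
  then consider "s i 0 j e \<noteq> 0" "s (i + j) e k (e * int n) \<noteq> 0"
    | "s i 0 k (e * int n) \<noteq> 0" "s j e (i + k) (e * int n) \<noteq> 0"
    using leibniz[of j e k "e * int n" i 0] by (fastforce simp: algebra_simps)
  then show ?case
  proof cases
    case 1
    then show ?thesis
      using gen_col.bracket[of e "i + j" k n] gen_col.act[of e j i] bracket by (simp add: add_ac)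
  next
    case 2
    then show ?thesis
      using gen_col.bracket[of e j "i + k" n] bracket by (simp add: add_ac)
  qed
next
  case (base e)
  then show ?case using gen_col.act[of e 0 i] gen_col.base by simp
next
  case (act e k j)
  then show ?case using gen_col.act[of e "j + k" i] gen_col.act[of e k j] by simp
qed

lemma gen_col_lower:
  "gen_col e k n \<Longrightarrow> gen_col (- e) a 1 \<Longrightarrow> n \<ge> 2 \<Longrightarrow> s a (- e) k (e * int n) \<noteq> 0
    \<Longrightarrow> gen_col e (a + k) (n - 1)"
proof (induction rule: gen_col.induct)
  case (bracket e j k n)
  have "s j e k (e * int n) * s a (- e) (j + k) (e * int (Suc n)) \<noteq> 0"
    using bracket by simp
  then consider "s a (- e) j e \<noteq> 0" "s (a + j) 0 k (e * int n) \<noteq> 0"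
    | "s a (- e) k (e * int n) \<noteq> 0" "s j e (a + k) (e * int n - e) \<noteq> 0"
    using leibniz[of j e k "e * int n" a "- e"] by (fastforce simp: algebra_simps)
  then show ?case
  proof cases
    case 1
    then show ?thesis
      using gen_col_act[of e k n "a + j"] bracket by (simp add: add_ac)
  next
    case 2
    show ?thesis
    proof (cases "n = 1")
      case True
      then have "s (a + k) 0 j e \<noteq> 0" using 2 skew[of j e "a + k" 0] by simp
      then show ?thesis using gen_col.act[of e j "a + k"] bracket True by (simp add: add_ac)
    next
      case False
      then have "n \<ge> 2" using gen_col_pos[OF bracket.hyps(2)] by simp
      moreover from this have "e * int (n - 1) = e * int n - e" by (simp add: of_nat_diff algebra_simps)
      ultimately show ?thesis
        using gen_col.bracket[of e j "a + k" "n - 1"] bracket 2 by (simp add: add_ac)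
    qed
  qed
qed auto

definition "gen_set = {(i, j). j = 0 \<or> (\<exists>n. j = int n \<and> gen_col 1 i n) \<or> (\<exists>n. j = - int n \<and> gen_col (- 1) i n)}"

lemma gen_setI: "gen_col e i n \<Longrightarrow> e = 1 \<or> e = - 1 \<Longrightarrow> (i, e * int n) \<in> gen_set"
  by (auto simp: gen_set_def)

lemma gen_set_cases:
  assumes "(i, j) \<in> gen_set" "e = 1 \<or> e = - 1"
  obtains "j = 0" | n where "j = e * int n" "gen_col e i n" | n where "j = - e * int n" "gen_col (- e) i n"
  using assms by (auto simp: gen_set_def)

lemma gen_set_step:
  assumes "gen_col e i 1" and e: "e = 1 \<or> e = - 1" and "(k, l) \<in> gen_set" and nz: "s i e k l \<noteq> 0"
  shows "(i + k, e + l) \<in> gen_set"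
  using assms(3) e
proof (cases rule: gen_set_cases)
  case 1
  then have "s k 0 i e \<noteq> 0" using nz skew[of i e k 0] by simp
  then have "gen_col e (k + i) 1" using assms(1) by (rule gen_col.act[rotated])
  then show ?thesis using gen_setI[of e "k + i" 1] e 1 by (simp add: add.commute)
next
  case (2 n)
  then have "gen_col e (i + k) (Suc n)" using gen_col.bracket[of e i k n] assms(1) nz by simp
  then show ?thesis using gen_setI[of e "i + k" "Suc n"] e 2 by (simp add: algebra_simps)
next
  case (3 n)
  show ?thesis
  proof (cases "n = 1")
    case True
    then show ?thesis using 3 by (simp add: gen_set_def)
  next
    case False
    then have n: "n \<ge> 2" using gen_col_pos[OF 3(2)] by simp
    then have "gen_col (- e) (i + k) (n - 1)"
      using gen_col_lower[of "- e" k n i] 3 assms(1) nz by simp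
    moreover have "- e * int (n - 1) = e + l" using n 3 by (simp add: of_nat_diff algebra_simps)
    ultimately show ?thesis using gen_setI[of "- e" "i + k" "n - 1"] e by auto
  qed
qed

text \<open>Induction on how the first degree was reached: if a bracket with [x, y] is nonzero, the
  Leibniz rule has a nonzero term in which x and y act one after the other, and
  \<open>gen_set_step\<close> treats a single vector of column e.\<close>

lemma gen_set_closed:
  "gen_col e i n \<Longrightarrow> e = 1 \<or> e = - 1 \<Longrightarrow> (k, l) \<in> gen_set \<Longrightarrow> s i (e * int n) k l \<noteq> 0
    \<Longrightarrow> (i + k, e * int n + l) \<in> gen_set"
proof (induction arbitrary: k l rule: gen_col.induct)
  case (base e)
  then show ?case using gen_set_step[of e 0 k l] gen_col.base by simp
next
  case (act e j i)
  then show ?case using gen_set_step[of e "i + j" k l] gen_col.act[of e j i] by simp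
next
  case (bracket e i i' n)
  have "s i e i' (e * int n) * s (i + i') (e * int (Suc n)) k l \<noteq> 0"
    using bracket by simp
  then consider "s i' (e * int n) k l \<noteq> 0" "s i e (i' + k) (e * int n + l) \<noteq> 0"
    | "s i e k l \<noteq> 0" "s i' (e * int n) (i + k) (e + l) \<noteq> 0"
    using leibniz[of i' "e * int n" k l i e] by (fastforce simp: algebra_simps)
  then show ?case
  proof cases
    case 1
    then have "(i' + k, e * int n + l) \<in> gen_set" using bracket by blast
    then show ?thesis using gen_set_step[of e i "i' + k" "e * int n + l"] 1 bracket by (simp add: algebra_simps)
  next
    case 2
    then have "(i + k, e + l) \<in> gen_set" using gen_set_step[of e i k l] bracket by blast
    then show ?thesis using bracket.IH(2)[of "i + k" "e + l"] 2 bracket.prems by (simp add: algebra_simps)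
  qed
qed

lemma supp_gen_set: "S \<subseteq> gen_set"
proof (rule generation)
  show "(0, 1) \<in> gen_set" "(0, - 1) \<in> gen_set"
    using gen_setI[of 1 0 1] gen_setI[of "-1" 0 1] gen_col.base by auto
  fix i j k l
  assume *: "(i, j) \<in> gen_set" "(k, l) \<in> gen_set" "s i j k l \<noteq> 0"
  consider "j = 0" | e n where "e = 1 \<or> e = - 1" "j = e * int n" "gen_col e i n"
    using *(1) by (fastforce simp: gen_set_def)
  then show "(i + k, j + l) \<in> gen_set"
  proof cases
    case 1
    consider "l = 0" | e n where "e = 1 \<or> e = - 1" "l = e * int n" "gen_col e k n"
      using *(2) by (fastforce simp: gen_set_def)
    then show ?thesis
    proof cases
      case (2 e n)
      then show ?thesis using gen_col_act[of e k n i] * 1 gen_setI[of e "i + k" n] by simp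
    qed (use 1 in \<open>simp add: gen_set_def\<close>)
  qed (use gen_set_closed * in blast)
qed (simp add: gen_set_def)

lemma gen_col_supp: "(i, e * int n) \<in> S \<Longrightarrow> n \<ge> 1 \<Longrightarrow> e = 1 \<or> e = - 1 \<Longrightarrow> gen_col e i n"
  using supp_gen_set by (fastforce simp: gen_set_def)

lemma column_cyclic:
  assumes "e = 1 \<or> e = - 1" "0 \<in> T" "\<And>i k. k \<in> T \<Longrightarrow> s i 0 k e \<noteq> 0 \<Longrightarrow> i + k \<in> T"
  shows "{k. (k, e) \<in> S} \<subseteq> T"
proof -
  have "gen_col e' k n \<Longrightarrow> e' = e \<Longrightarrow> n = 1 \<Longrightarrow> k \<in> T" for e' k n
    by (induction rule: gen_col.induct) (use assms gen_col_pos in fastforce)+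
  then show ?thesis using gen_col_supp[of _ e 1] assms(1) by auto
qed

lemma column_generated:
  assumes "(i, e * int (Suc n)) \<in> S" "e = 1 \<or> e = - 1" "n \<ge> 1"
  obtains a where "s a e (i - a) (e * int n) \<noteq> 0"
proof -
  have "gen_col e i (Suc n)" using gen_col_supp assms by simp
  then show thesis
  proof (cases rule: gen_col.cases)
    case (bracket a k)
    then show thesis using that[of a] by simp
  qed (use assms(3) in auto)
qed

end


section \<open>Equivariant pairings of two modules with values in the Witt algebra\<close>

lemma quadratic_add: "quadratic f \<Longrightarrow> quadratic g \<Longrightarrow> quadratic (\<lambda>n. f n + g n)"
proof -
  assume "quadratic f" "quadratic g"
  then obtain c0 c1 c2 d0 d1 d2 where
    "\<And>n. f n = c0 + c1 * of_int n + c2 * of_int n ^ 2" "\<And>n. g n = d0 + d1 * of_int n + d2 * of_int n ^ 2"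
    unfolding quadratic_def by blast
  then show ?thesis
    by (intro quadraticI[of _ "c0 + d0" "c1 + d1" "c2 + d2"]) (simp add: algebra_simps)
qed

lemma quadratic_cmult: "quadratic f \<Longrightarrow> quadratic (\<lambda>n. c * f n)"
proof -
  assume "quadratic f"
  then obtain c0 c1 c2 where "\<And>n. f n = c0 + c1 * of_int n + c2 * of_int n ^ 2"
    unfolding quadratic_def by blast
  then show ?thesis
    by (intro quadraticI[of _ "c * c0" "c * c1" "c * c2"]) (simp add: algebra_simps)
qed

lemma quadratic_diff: "quadratic f \<Longrightarrow> quadratic g \<Longrightarrow> quadratic (\<lambda>n. f n - g n)"
  using quadratic_add[of f "\<lambda>n. - 1 * g n"] quadratic_cmult[of g "- 1"] by simp

lemma quadratic_reflect: "quadratic f \<Longrightarrow> quadratic (\<lambda>n. f (p - n))"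
proof -
  assume "quadratic f"
  then obtain c0 c1 c2 where "\<And>n. f n = c0 + c1 * of_int n + c2 * of_int n ^ 2"
    unfolding quadratic_def by blast
  then show ?thesis
    by (intro quadraticI[of _ "c0 + c1 * of_int p + c2 * of_int p ^ 2" "- c1 - 2 * c2 * of_int p" c2])
      (simp add: power2_eq_square algebra_simps)
qed

lemma quadratic_shift: "quadratic f \<Longrightarrow> quadratic (\<lambda>n. f (n + p))"
  using quadratic_reflect[OF quadratic_reflect, of f 0 "- p"] by (simp add: add.commute)

lemma quadratic_cancel: "quadratic (\<lambda>n. c * f n) \<Longrightarrow> c \<noteq> 0 \<Longrightarrow> quadratic f"
  using quadratic_cmult[of "\<lambda>n. c * f n" "1 / c"] by simp

lemma quadratic_poly5:
  fixes f :: "int \<Rightarrow> 'f::field_char_0"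
  assumes "quadratic f"
    and "\<And>n. f n = c0 + c1 * of_int n + c2 * of_int n ^ 2 + c3 * of_int n ^ 3
      + c4 * of_int n ^ 4 + c5 * of_int n ^ 5"
  shows "c3 = 0" "c4 = 0" "c5 = 0"
proof -
  obtain d0 d1 d2 where d: "\<And>n. f n = d0 + d1 * of_int n + d2 * of_int n ^ 2"
    using assms(1) unfolding quadratic_def by blast
  have "(c0 - d0) + (c1 - d1) * of_int n + (c2 - d2) * of_int n ^ 2 + c3 * of_int n ^ 3
      + c4 * of_int n ^ 4 + c5 * of_int n ^ 5 = (0::'f)" for n
    using assms(2)[of n] d[of n] by (simp add: algebra_simps)
  note z = poly5_coeffs_zero[OF this, of "\<lambda>n. n"]
  show "c3 = 0" "c4 = 0" "c5 = 0"
    by (rule z; simp add: inj_def)+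
qed

text \<open>Reflecting both sums and subtracting shows that f (1 + u) - f u is quadratic;
  \<open>p\<close> is its discrete antiderivative.\<close>

lemma cubic_from_symmetric_sums:
  fixes f :: "int \<Rightarrow> 'f::field_char_0"
  assumes "quadratic (\<lambda>u. f u + f (- u))" "quadratic (\<lambda>u. f u + f (1 - u))"
  obtains e0 e1 e2 e3 where
    "\<And>u. f u = e0 + e1 * of_int u + e2 * of_int u ^ 2 + e3 * of_int u ^ 3"
proof -
  have "quadratic (\<lambda>u. f (1 + u) - f u)"
    using quadratic_diff[OF quadratic_reflect[OF assms(2), of 0] quadratic_reflect[OF assms(1), of 0]]
    by simp
  then obtain c0 c1 c2 where c: "\<And>u. f (1 + u) - f u = c0 + c1 * of_int u + c2 * of_int u ^ 2"
    unfolding quadratic_def by blast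
  define p where "p u = (c0 - c1 / 2 + c2 / 6) * of_int u + (c1 / 2 - c2 / 2) * of_int u ^ 2
      + (c2 / 3) * of_int u ^ 3" for u :: int
  have "f u - p u = f 0 - p 0" for u
  proof (rule int_diff_const)
    fix u
    have "f u - f (u - 1) = c0 + c1 * of_int (u - 1) + c2 * of_int (u - 1) ^ 2"
      using c[of "u - 1"] by simp
    moreover have "p u - p (u - 1) = c0 + c1 * of_int (u - 1) + c2 * of_int (u - 1) ^ 2"
      by (simp add: p_def power2_eq_square power3_eq_cube field_simps)
    ultimately show "f u - p u = f (u - 1) - p (u - 1)" by algebra
  qed
  then show thesis
    using that[of "f 0" "c0 - c1 / 2 + c2 / 6" "c1 / 2 - c2 / 2" "c2 / 3"]
    by (simp add: p_def algebra_simps)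
qed

text \<open>The product of the i-th and the j-th vector is \<open>\<phi> i j\<close> times the basis
  vector L_(i+j) of the Witt algebra, and \<open>i + j - m\<close> is the adjoint action of L_m on
  the latter.\<close>

locale witt_pairing =
  fixes a a' \<phi> :: "int \<Rightarrow> int \<Rightarrow> 'f::field_char_0"
  assumes equivariant: "of_int (i + j - m) * \<phi> i j = a m i * \<phi> (i + m) j + a' m j * \<phi> i (j + m)"
    and quad: "quadratic (\<lambda>n. a n k * a (p - n) (k + n))"
      "quadratic (\<lambda>n. a' n k * a' (p - n) (k + n))"
begin

text \<open>The two instances of equivariance express \<open>L\<^sub>p\<^sub>-\<^sub>n L\<^sub>n y\<^sub>j\<close> through \<open>\<phi> _ j\<close>; all terms
  except two are quadratic in \<open>n\<close>.\<close>

lemma quadratic_terms: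
  "quadratic (\<lambda>u. of_int (2 * u - q + i + j) * (a (u - i) i * \<phi> u j)
    + of_int (q - 2 * u + i + j) * (a (q - u - i) i * \<phi> (q - u) j))"
proof -
  define p where "p = q - 2 * i"
  define f where "f u = \<phi> u j" for u
  have eq: "of_int (i + j + 2 * n - p) * (a n i * f (i + n)) + of_int (i + j + p - 2 * n) * (a (p - n) i * f (i + (p - n)))
     = (of_int (i + j - n) * of_int (i + j + 2 * n - p)) * f i
       + f (i + p) * (a (p - n) i * a n (i + (p - n)))
       - \<phi> i (j + p) * (a' n j * a' (p - n) (j + n))" for n
  proof -
    have e1: "a' n j * \<phi> i (j + n) = of_int (i + j - n) * f i - a n i * f (i + n)"
      using equivariant[of i j n] by (simp add: f_def algebra_simps)
    have e2: "a' n j * \<phi> (i + (p - n)) (j + n)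
        = of_int (i + (p - n) + j - n) * f (i + (p - n)) - a n (i + (p - n)) * f (i + p)"
      using equivariant[of "i + (p - n)" j n] by (simp add: f_def algebra_simps)
    have e3: "a' (p - n) (j + n) * \<phi> i (j + p)
        = of_int (i + (j + n) - (p - n)) * \<phi> i (j + n) - a (p - n) i * \<phi> (i + (p - n)) (j + n)"
      using equivariant[of i "j + n" "p - n"] by (simp add: algebra_simps)
    have "\<phi> i (j + p) * (a' n j * a' (p - n) (j + n))
        = of_int (i + (j + n) - (p - n)) * (a' n j * \<phi> i (j + n))
          - a (p - n) i * (a' n j * \<phi> (i + (p - n)) (j + n))"
      using e3 by algebra
    then show ?thesis
      unfolding e1 e2 by (simp add: algebra_simps)
  qed
  have "quadratic (\<lambda>n. f (i + p) * (a (p - n) i * a n (i + (p - n))))"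
    using quadratic_cmult[OF quadratic_reflect[OF quad(1)[of i p], of p], of "f (i + p)"] by simp
  moreover have "quadratic (\<lambda>n. \<phi> i (j + p) * (a' n j * a' (p - n) (j + n)))"
    using quadratic_cmult[OF quad(2)] .
  moreover have "quadratic (\<lambda>n. (of_int (i + j - n) * of_int (i + j + 2 * n - p)) * f i)"
    by (rule quadraticI[of _ "of_int (i + j) * of_int (i + j - p) * f i"
          "(2 * of_int (i + j) - of_int (i + j - p)) * f i" "- 2 * f i"])
      (simp add: power2_eq_square algebra_simps)
  ultimately have "quadratic (\<lambda>n. of_int (i + j + 2 * n - p) * (a n i * f (i + n))
      + of_int (i + j + p - 2 * n) * (a (p - n) i * f (i + (p - n))))"
    unfolding eq by (intro quadratic_add quadratic_diff)
  from quadratic_shift[OF this, of "- i"] show ?thesis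
  proof (rule back_subst[of quadratic], intro ext)
    fix u
    have "i + j + 2 * (u + - i) - p = 2 * u - q + i + j" "i + j + p - 2 * (u + - i) = q - 2 * u + i + j"
      "i + (u + - i) = u" "i + (p - (u + - i)) = q - u" "u + - i = u - i" "p - (u - i) = q - u - i"
      by (simp_all add: p_def)
    then show "of_int (i + j + 2 * (u + - i) - p) * (a (u + - i) i * f (i + (u + - i)))
      + of_int (i + j + p - 2 * (u + - i)) * (a (p - (u + - i)) i * f (i + (p - (u + - i))))
      = of_int (2 * u - q + i + j) * (a (u - i) i * \<phi> u j)
      + of_int (q - 2 * u + i + j) * (a (q - u - i) i * \<phi> (q - u) j)"
      by (simp only: f_def)
  qed
qed

text \<open>For fixed j the terms of \<open>quadratic_terms\<close> are polynomial in i. The second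
  difference in i isolates f u + f (q - u), with the factor 2 * (1 - b), so f is cubic. The
  coefficients of degree four for q = 0 and q = 1 then eliminate the cubic and the quadratic part,
  where b \<noteq> 0 enters.\<close>

lemma density_affine:
  assumes "density_type a \<alpha> b" "b \<noteq> 0" "b \<noteq> 1"
  obtains p q where "\<And>i. \<phi> i j = p + q * of_int i"
proof -
  define f where "f u = \<phi> u j" for u
  have a: "a i k = \<alpha> + of_int k + of_int i * b" for i k
    using assms by (simp add: density_type_def)
  define E where "E q i = (\<lambda>u. of_int (2 * u - q + i + j) * ((\<alpha> + of_int i + of_int (u - i) * b) * f u)
    + of_int (q - 2 * u + i + j) * ((\<alpha> + of_int i + of_int (q - u - i) * b) * f (q - u)))" for q i
  have E: "quadratic (E q i)" for q i
    using quadratic_terms[of q i j] unfolding E_def a f_def .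
  have sym: "quadratic (\<lambda>u. f u + f (q - u))" for q
  proof (rule quadratic_cancel)
    have "quadratic (\<lambda>u. E q 1 u + E q (- 1) u - 2 * E q 0 u)"
      by (intro quadratic_add quadratic_diff quadratic_cmult E)
    moreover have "(\<lambda>u. E q 1 u + E q (- 1) u - 2 * E q 0 u) = (\<lambda>u. (2 * (1 - b)) * (f u + f (q - u)))"
      by (rule ext) (simp add: E_def algebra_simps)
    ultimately show "quadratic (\<lambda>u. (2 * (1 - b)) * (f u + f (q - u)))" by simp
  qed (use assms in simp)
  obtain e0 e1 e2 e3 where f: "\<And>u. f u = e0 + e1 * of_int u + e2 * of_int u ^ 2 + e3 * of_int u ^ 3"
    using cubic_from_symmetric_sums[of f] sym[of 0] sym[of 1] unfolding diff_0 by blast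
  define J where "J = (of_int j :: 'f)"
  have E0: "E 0 0 u = 2 * (J * \<alpha> * e0) + 0 * of_int u
      + 2 * (2 * b * e0 + (2 * \<alpha> + b * J) * e1 + J * \<alpha> * e2) * of_int u ^ 2
      + 0 * of_int u ^ 3 + 2 * (2 * b * e2 + (2 * \<alpha> + b * J) * e3) * of_int u ^ 4 + 0 * of_int u ^ 5" for u
    unfolding E_def f J_def by (simp add: power2_eq_square power3_eq_cube power4_eq_xxxx algebra_simps)
  have z0: "2 * b * e2 + (2 * \<alpha> + b * J) * e3 = 0"
    using quadratic_poly5(2)[OF E E0] by (metis mult_eq_0_iff zero_neq_numeral)
  define K where "K = J - 1"
  define p0 where "p0 = K * \<alpha> * e0"
  define p1 where "p1 = (2 * \<alpha> + b * K) * e0 + K * \<alpha> * e1"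
  define p2 where "p2 = 2 * b * e0 + (2 * \<alpha> + b * K) * e1 + K * \<alpha> * e2"
  define p3 where "p3 = 2 * b * e1 + (2 * \<alpha> + b * K) * e2 + K * \<alpha> * e3"
  define p4 where "p4 = 2 * b * e2 + (2 * \<alpha> + b * K) * e3"
  define p5 where "p5 = 2 * b * e3"
  have half: "(2 * x + K) * ((\<alpha> + x * b) * (e0 + e1 * x + e2 * x ^ 2 + e3 * x ^ 3))
    = p0 + p1 * x + p2 * x ^ 2 + p3 * x ^ 3 + p4 * x ^ 4 + p5 * x ^ 5" for x
    unfolding p0_def p1_def p2_def p3_def p4_def p5_def by algebra
  have E1: "E 1 0 u = (2 * p0 + p1 + p2 + p3 + p4 + p5) + (- 2 * p2 - 3 * p3 - 4 * p4 - 5 * p5) * of_int u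
      + (2 * p2 + 3 * p3 + 6 * p4 + 10 * p5) * of_int u ^ 2 + (- 4 * p4 - 10 * p5) * of_int u ^ 3
      + (2 * p4 + 5 * p5) * of_int u ^ 4 + 0 * of_int u ^ 5" for u
  proof -
    have "E 1 0 u = (2 * of_int u + K) * ((\<alpha> + of_int u * b) * f u)
        + (2 * of_int (1 - u) + K) * ((\<alpha> + of_int (1 - u) * b) * f (1 - u))"
      by (simp add: E_def K_def J_def algebra_simps)
    then show ?thesis unfolding f half unfolding of_int_diff of_int_1 by algebra
  qed
  have z1: "2 * p4 + 5 * p5 = 0"
    using quadratic_poly5(2)[OF E E1] .
  have "8 * b * e3 = 0" using z0 z1 unfolding p4_def p5_def K_def by algebra
  then have "e3 = 0" using assms by simp
  then have "e2 = 0" using z0 assms by simp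
  then show thesis using that[of e0 e1] f \<open>e3 = 0\<close> by (simp add: f_def)
qed

text \<open>The assumption \<open>zero\<close> hides the irregular coefficients of the module:
  arrows into weight zero are multiplied by a vanishing \<phi>. So a factor \<alpha> + i splits off,
  and already the first difference in i isolates f u + f (q - u).\<close>

lemma flex_quadratic:
  assumes "flex_type a \<alpha>" and zero: "\<And>i. \<alpha> + of_int i = 0 \<Longrightarrow> \<phi> i j = 0"
  shows "quadratic (\<lambda>i. \<phi> i j)"
proof -
  define f where "f u = \<phi> u j" for u
  have a: "a n i * f (i + n) = (\<alpha> + of_int i) * f (i + n)" for n i
    using assms by (cases "\<alpha> + of_int (n + i) = 0") (auto simp: flex_type_def f_def add.commute)
  define E where "E q i = (\<lambda>u. of_int (2 * u - q + i + j) * f u + of_int (q - 2 * u + i + j) * f (q - u))" for q i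
  have E: "quadratic (E q i)" if "\<alpha> + of_int i \<noteq> 0" for q i
  proof (rule quadratic_cancel[OF _ that])
    have "(\<lambda>u. (\<alpha> + of_int i) * E q i u)
      = (\<lambda>u. of_int (2 * u - q + i + j) * (a (u - i) i * f u) + of_int (q - 2 * u + i + j) * (a (q - u - i) i * f (q - u)))"
    proof
      fix u
      have "a (u - i) i * f u = (\<alpha> + of_int i) * f u" "a (q - u - i) i * f (q - u) = (\<alpha> + of_int i) * f (q - u)"
        using a[of "u - i" i] a[of "q - u - i" i] by simp_all
      then show "(\<alpha> + of_int i) * E q i u = of_int (2 * u - q + i + j) * (a (u - i) i * f u)
          + of_int (q - 2 * u + i + j) * (a (q - u - i) i * f (q - u))"
        unfolding E_def by algebra
    qed
    then show "quadratic (\<lambda>u. (\<alpha> + of_int i) * E q i u)"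
      using quadratic_terms[of q i j] by (simp add: f_def)
  qed
  obtain i where i: "\<alpha> + of_int i \<noteq> 0" "\<alpha> + of_int (i + 1) \<noteq> 0"
  proof (cases "\<alpha> + of_int 0 = 0 \<or> \<alpha> + of_int (0 + 1) = 0")
    case True
    then have "\<alpha> = 0 \<or> \<alpha> = - 1" by (auto simp: eq_neg_iff_add_eq_0)
    then show thesis using that[of 2] by auto
  qed (use that[of 0] in auto)
  have sym: "quadratic (\<lambda>u. f u + f (q - u))" for q
  proof -
    have "quadratic (\<lambda>u. E q (i + 1) u - E q i u)"
      by (intro quadratic_diff E i)
    then show ?thesis by (simp add: E_def algebra_simps)
  qed
  obtain e0 e1 e2 e3 where f: "\<And>u. f u = e0 + e1 * of_int u + e2 * of_int u ^ 2 + e3 * of_int u ^ 3"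
    using cubic_from_symmetric_sums[of f] sym[of 0] sym[of 1] unfolding diff_0 by blast
  have "E 0 i u = 2 * of_int (i + j) * e0 + 0 * of_int u + (2 * of_int (i + j) * e2 + 4 * e1) * of_int u ^ 2
      + 0 * of_int u ^ 3 + 4 * e3 * of_int u ^ 4 + 0 * of_int u ^ 5" for u
    unfolding E_def f by (simp add: power2_eq_square power3_eq_cube power4_eq_xxxx algebra_simps)
  from quadratic_poly5(2)[OF E this] i have "e3 = 0" by simp
  then show ?thesis using f by (intro quadraticI[of _ e0 e1 e2]) (simp add: f_def)
qed

end

text \<open>The next two lemmas are about equivariant maps from a module to a density module, in the form
  in which they arise as coefficients of a pairing; they are proved by composing the actions of
  \<open>L\<^sub>m\<close> and \<open>L\<^sub>-\<^sub>m\<close>.\<close>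

lemma flex_hom:
  fixes Z :: "int \<Rightarrow> 'f::field_char_0"
  assumes "flex_type a \<alpha>"
    and hom: "\<And>j m. (\<alpha> + of_int j - c * of_int m) * Z j = a m j * Z (j + m)"
    and c: "c \<noteq> 0" "c \<noteq> - 1"
  shows "Z j = 0"
proof (cases "\<alpha> + of_int j = 0")
  case True
  then have "a 1 j = 0" using assms(1) by (auto simp: flex_type_def)
  then show ?thesis using hom[of j 1] True c by simp
next
  case False
  define w where "w = \<alpha> + of_int j"
  obtain m :: int where m: "m \<noteq> 0" "w + of_int m \<noteq> 0"
  proof (cases "w + 1 = 0")
    case True
    have "w + 2 \<noteq> 0"
    proof
      assume "w + 2 = 0"
      with True have "(1::'f) = 0" by algebra
      then show False by simp
    qed
    then show thesis using that[of 2] by simp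
  qed (use that[of 1] in simp)
  have "(w - c * of_int m) * Z j = w * Z (j + m)"
    using hom[of j m] assms(1) m(2) by (auto simp: flex_type_def w_def add_ac)
  moreover have "(w + of_int m + c * of_int m) * Z (j + m) = (w + of_int m) * Z j"
    using hom[of "j + m" "- m"] assms(1) False by (auto simp: flex_type_def w_def add_ac)
  ultimately have "(c * (c + 1) * of_int m ^ 2) * Z j = 0" by algebra
  moreover have "c + 1 \<noteq> 0" using c by (simp add: eq_neg_iff_add_eq_0)
  ultimately show ?thesis using c m by simp
qed

lemma density_hom:
  fixes Z :: "int \<Rightarrow> 'f::field_char_0"
  assumes "density_type a \<alpha> b" "b \<noteq> 0" "b \<noteq> 1"
    and hom: "\<And>j m. (\<alpha> + of_int j - c * of_int m) * Z j = a m j * Z (j + m)"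
    and "Z i \<noteq> 0"
  shows "b = - c" "Z j = Z i"
proof -
  have a: "a i k = \<alpha> + of_int k + of_int i * b" for i k
    using assms by (simp add: density_type_def)
  define w where "w = \<alpha> + of_int i"
  have up: "(w - c * of_int m) * Z i = (w + of_int m * b) * Z (i + m)"
    and down: "(w + of_int m + c * of_int m) * Z (i + m) = (w + of_int m - of_int m * b) * Z i" for m
    using hom[of i m] hom[of "i + m" "- m"] by (simp_all add: a w_def add_ac)
  have "(b + c) * (b - c - 1) * Z i = 0"
    using up[of 1] down[of 1] by (simp add: algebra_simps) algebra
  then have "b + c = 0 \<or> b - c - 1 = 0" using assms by simp
  then consider "b = - c" | "b = c + 1" by (auto simp: eq_neg_iff_add_eq_0 algebra_simps)
  then show b: "b = - c"
  proof cases
    case 2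
    \<comment> \<open>For b = c + 1, comparing two steps of length one with one of length two leaves
      only c = - 1/2, where c + 1 and - c coincide.\<close>
    have "(w + 1 - c) * Z (i + 1) = (w + 1 + b) * Z (i + 2)"
      using hom[of "i + 1" 1] by (simp add: a w_def add_ac)
    moreover note up[of 1] up[of 2]
    ultimately have "(c * (c + 1) * (2 * c + 1)) * Z i = 0"
      unfolding 2 by (simp add: algebra_simps) algebra
    then have "2 * c + 1 = 0" using assms 2 by (auto simp: eq_neg_iff_add_eq_0)
    then show ?thesis using 2 by algebra
  qed
  have step: "Z (k + m) = Z k"
    if "\<alpha> + of_int k + of_int m * b \<noteq> 0 \<or> \<alpha> + of_int k + of_int m - of_int m * b \<noteq> 0" for k m
  proof -
    have "(\<alpha> + of_int k + of_int m * b) * Z k = (\<alpha> + of_int k + of_int m * b) * Z (k + m)"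
      "(\<alpha> + of_int k + of_int m - of_int m * b) * Z (k + m) = (\<alpha> + of_int k + of_int m - of_int m * b) * Z k"
      using hom[of k m] hom[of "k + m" "- m"] by (simp_all add: a b algebra_simps)
    then show ?thesis using that by auto
  qed
  show "Z j = Z i"
  proof (cases "w + of_int (j - i) * b \<noteq> 0 \<or> w + of_int (j - i) - of_int (j - i) * b \<noteq> 0")
    case True
    then show ?thesis using step[of i "j - i"] by (simp add: w_def)
  next
    case False
    show ?thesis
    proof (cases "j = i")
      case ij: False
      define m where "m = j - i"
      have m: "m \<noteq> 0" "w + of_int m * b = 0" "w + of_int m - of_int m * b = 0"
        using False ij by (auto simp: m_def)
      have "of_int m * (2 * b - 1) = 0" using m(2,3) by algebra
      then have b2: "2 * b = 1" using m(1) by simp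
      then have w2: "2 * w = - of_int m" using m(2,3) by algebra
      \<comment> \<open>The direct step from i to j is blocked in both directions; it is replaced by
        a detour over i + e.\<close>
      define e :: int where "e = (if m = 1 then - 1 else 1)"
      have e: "e \<noteq> m" "e \<noteq> 0" using m(1) by (auto simp: e_def)
      have "2 * (w + of_int e * b) = of_int (e - m)" using b2 w2 unfolding of_int_diff by algebra
      then have "w + of_int e * b \<noteq> 0"
        using e by (metis mult_zero_right of_int_eq_0_iff right_minus_eq)
      then have "Z (i + e) = Z i" using step[of i e] by (simp add: w_def)
      moreover have "2 * (w + of_int e + of_int (m - e) * b) = of_int e"
        using b2 w2 unfolding of_int_diff by algebra
      then have "w + of_int e + of_int (m - e) * b \<noteq> 0"
        using e by (metis mult_zero_right of_int_eq_0_iff)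
      then have "Z (i + e + (m - e)) = Z (i + e)" using step[of "i + e" "m - e"] by (simp add: w_def add_ac)
      ultimately show ?thesis by (simp add: m_def)
    qed simp
  qed
qed

lemma flex_type_norm:
  assumes "flex_type a \<alpha>" "\<alpha> + of_int k + of_int i \<noteq> 0"
  shows "a i k = \<alpha> + of_int k"
  using assms by (auto simp: flex_type_def add_ac)

lemma flex_type_triv:
  assumes "flex_type a \<alpha>" "\<alpha> + of_int k = 0"
  shows "a i k = 0"
  using assms by (auto simp: flex_type_def)

lemma flex_hom0:
  fixes Z :: "int \<Rightarrow> 'f::field_char_0"
  assumes "flex_type a \<alpha>"
    and hom: "\<And>j m. (\<alpha> + of_int j) * Z j = a m j * Z (j + m)"
    and w: "\<alpha> + of_int i \<noteq> 0" "\<alpha> + of_int j \<noteq> 0"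
  shows "Z j = Z i"
proof -
  have "a (i - j) j = \<alpha> + of_int j" using assms(1) w unfolding flex_type_def
    by (metis diff_add_cancel)
  then show ?thesis using hom[of j "i - j"] w by simp
qed

text \<open>An equivariant map from functions to densities of weight one is a multiple of the
  derivative. This is the value c = - 1 excluded in \<open>flex_hom\<close>; for c = 0, in
  \<open>flex_hom0\<close>, the map is a multiple of the identity off weight zero.\<close>

lemma flex_hom1:
  fixes Z :: "int \<Rightarrow> 'f::field_char_0"
  assumes "flex_type a \<alpha>"
    and hom: "\<And>j m. (\<alpha> + of_int j + of_int m) * Z j = a m j * Z (j + m)"
  obtains z where "\<And>j. Z j = z * (\<alpha> + of_int j)"
proof -
  have zero: "Z j = 0" if "\<alpha> + of_int j = 0" for j
    using hom[of j 1] assms(1) that by (auto simp: flex_type_def)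
  obtain i where i: "\<alpha> + of_int i \<noteq> 0"
    by (cases "\<alpha> = 0") (auto intro: that[of 1] that[of 0])
  have "Z j = Z i / (\<alpha> + of_int i) * (\<alpha> + of_int j)" for j
  proof (cases "\<alpha> + of_int j = 0")
    case False
    have "a (j - i) i = \<alpha> + of_int i" using assms(1) False unfolding flex_type_def
      by (metis diff_add_cancel)
    then have "(\<alpha> + of_int j) * Z i = (\<alpha> + of_int i) * Z j" using hom[of i "j - i"] by (simp add: add.assoc)
    then show ?thesis using i by (simp add: field_simps)
  qed (simp add: zero)
  then show thesis by (rule that)
qed

section \<open>Classification of the pairings by the types of the two modules\<close>

context witt_pairing
begin

text \<open>Both sides of equivariance are polynomials in \<alpha> + i. Comparing coefficients shows
  that Q is an intertwiner from the second module to densities of weight - 2 - b, and that P is one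
  to weight - 1 - b up to a term with Q; bilinear maps are thus reduced to linear ones.\<close>

lemma density_coefficients:
  assumes "density_type a \<alpha> b" "b \<noteq> 0" "b \<noteq> 1"
  obtains P Q where
    "\<And>i j. \<phi> i j = P j + Q j * (\<alpha> + of_int i)"
    "\<And>j m. (- \<alpha> + of_int j - (2 + b) * of_int m) * Q j = a' m j * Q (j + m)"
    "\<And>j m. (- \<alpha> + of_int j - (1 + b) * of_int m) * P j - b * of_int m ^ 2 * Q j = a' m j * P (j + m)"
proof -
  have "\<forall>j. \<exists>p q. \<forall>i. \<phi> i j = p + q * of_int i"
    using density_affine[OF assms] by metis
  then obtain p q where pq: "\<And>i j. \<phi> i j = p j + q j * of_int i" by metis
  define P where "P j = p j - \<alpha> * q j" for j
  have \<phi>: "\<phi> i j = P j + q j * (\<alpha> + of_int i)" for i j by (simp add: P_def pq algebra_simps)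
  have a: "a i k = \<alpha> + of_int k + of_int i * b" for i k
    using assms by (simp add: density_type_def)
  have coeffs: "((- \<alpha> + of_int j - (1 + b) * of_int m) * P j - b * of_int m ^ 2 * q j - a' m j * P (j + m)) = 0"
    "((- \<alpha> + of_int j - (2 + b) * of_int m) * q j - a' m j * q (j + m)) = 0" for j m
  proof -
    have "((- \<alpha> + of_int j - (1 + b) * of_int m) * P j - b * of_int m ^ 2 * q j - a' m j * P (j + m))
      + ((- \<alpha> + of_int j - (2 + b) * of_int m) * q j - a' m j * q (j + m)) * (\<alpha> + of_int i)
      + 0 * (\<alpha> + of_int i) ^ 2 + 0 * (\<alpha> + of_int i) ^ 3 + 0 * (\<alpha> + of_int i) ^ 4 + 0 * (\<alpha> + of_int i) ^ 5 = 0" for i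
      using equivariant[of i j m] unfolding \<phi> a by (simp add: power2_eq_square algebra_simps)
    note z = poly5_coeffs_zero[OF this, of "\<lambda>i. i"]
    show "((- \<alpha> + of_int j - (1 + b) * of_int m) * P j - b * of_int m ^ 2 * q j - a' m j * P (j + m)) = 0"
      "((- \<alpha> + of_int j - (2 + b) * of_int m) * q j - a' m j * q (j + m)) = 0"
      by (rule z; simp add: inj_def)+
  qed
  show thesis
    using that[of P q] \<phi> coeffs by simp
qed

text \<open>Vector fields are densities of weight - 1. The two outcomes are the first transvectant,
  with b + b' = - 2, and the product of densities, with b + b' = - 1.\<close>

lemma density_density:
  assumes "density_type a \<alpha> b" "b \<noteq> 0" "b \<noteq> 1" "density_type a' (- \<alpha>) b'" "b' \<noteq> 0" "b' \<noteq> 1"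
    and nz: "\<phi> 0 0 \<noteq> 0"
  obtains q where "q \<noteq> 0" "b' = - 2 - b"
      "\<And>i j. \<phi> i j = q * (b' * (\<alpha> + of_int i) - b * (- \<alpha> + of_int j))"
    | p where "p \<noteq> 0" "b' = - 1 - b" "\<And>i j. \<phi> i j = p"
proof -
  obtain P Q where \<phi>: "\<And>i j. \<phi> i j = P j + Q j * (\<alpha> + of_int i)"
    and Q: "\<And>j m. (- \<alpha> + of_int j - (2 + b) * of_int m) * Q j = a' m j * Q (j + m)"
    and P: "\<And>j m. (- \<alpha> + of_int j - (1 + b) * of_int m) * P j - b * of_int m ^ 2 * Q j = a' m j * P (j + m)"
    using density_coefficients[OF assms(1-3)] by blast
  show thesis
  proof (cases "\<exists>i. Q i \<noteq> 0")
    case True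
    then obtain i where i: "Q i \<noteq> 0" ..
    note hom = density_hom[OF assms(4-6) Q i]
    have b': "b' = - 2 - b" using hom(1) by simp
    define q where "q = Q i"
    define x where "x = b / b' * q"
    \<comment> \<open>What remains of P after subtracting the transvectant with leading coefficient
      Q. It intertwines to weight - 1 - b, which differs from b' = - 2 - b, and so vanishes.\<close>
    define R where "R j = P j + x * (- \<alpha> + of_int j)" for j
    have "(- \<alpha> + of_int j - (1 + b) * of_int m) * R j = a' m j * R (j + m)" for j m
    proof -
      define y where "y = - \<alpha> + (of_int j :: 'f)"
      have "b * q = b' * x" using assms by (simp add: x_def)
      moreover have "(y - (1 + b) * of_int m) * P j - b * of_int m ^ 2 * q = (y + of_int m * b') * P (j + m)"
        using P[of j m] hom(2)[of j] assms(4) by (simp add: density_type_def y_def q_def)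
      ultimately have "(y - (1 + b) * of_int m) * (P j + x * y) = (y + of_int m * b') * (P (j + m) + x * (y + of_int m))"
        using b' by algebra
      moreover have "a' m j = y + of_int m * b'" using assms(4) by (simp add: density_type_def y_def)
      ultimately show ?thesis by (simp add: R_def y_def add.assoc)
    qed
    then have "R j = 0" for j
      using density_hom(1)[OF assms(4-6), of "1 + b" R j] b' by fastforce
    then have Pj: "P j = - (b / b' * q * (- \<alpha> + of_int j))" for j
      by (simp add: R_def x_def eq_neg_iff_add_eq_0)
    have "\<phi> i j = (q / b') * (b' * (\<alpha> + of_int i) - b * (- \<alpha> + of_int j))" for i j
      using assms hom(2)[of j] by (simp add: \<phi> Pj q_def field_simps)
    then show thesis using that(1)[of "q / b'"] i b' assms by (simp add: q_def)
  next
    case False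
    then have Q0: "Q j = 0" for j by blast
    have hom: "(- \<alpha> + of_int j - (1 + b) * of_int m) * P j = a' m j * P (j + m)" for j m
      using P[of j m] by (simp add: Q0)
    have P0: "P 0 \<noteq> 0" using nz by (simp add: \<phi> Q0)
    note h = density_hom[OF assms(4-6) hom P0]
    then show thesis using that(2)[of "P 0"] P0 by (simp add: \<phi> Q0)
  qed
qed

text \<open>Off weight zero the second module consists of functions g, which enter as such or
  through the derivative dg of weight one. The outcomes are the transvectant of f and dg, the
  product of f and dg, and the product of f and g, for f of weight - 3, - 2 and - 1.\<close>

lemma density_flex:
  assumes "density_type a \<alpha> b" "b \<noteq> 0" "b \<noteq> 1" "flex_type a' (- \<alpha>)" "\<alpha> \<noteq> 0"
    and nz: "\<phi> 0 0 \<noteq> 0"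
  obtains q where "q \<noteq> 0" "b = - 3"
      "\<And>i j. \<phi> i j = q * (- \<alpha> + of_int j) * ((\<alpha> + of_int i) + 3 * (- \<alpha> + of_int j))"
    | p where "p \<noteq> 0" "b = - 2" "\<And>i j. \<phi> i j = p * (- \<alpha> + of_int j)"
    | p where "p \<noteq> 0" "b = - 1" "\<And>i j. - \<alpha> + of_int j \<noteq> 0 \<Longrightarrow> \<phi> i j = p"
proof -
  obtain P Q where \<phi>: "\<And>i j. \<phi> i j = P j + Q j * (\<alpha> + of_int i)"
    and Q: "\<And>j m. (- \<alpha> + of_int j - (2 + b) * of_int m) * Q j = a' m j * Q (j + m)"
    and P: "\<And>j m. (- \<alpha> + of_int j - (1 + b) * of_int m) * P j - b * of_int m ^ 2 * Q j = a' m j * P (j + m)"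
    using density_coefficients[OF assms(1-3)] by blast
  note norm = flex_type_norm[OF assms(4)] and triv = flex_type_triv[OF assms(4)]
  show thesis
  proof (cases "b = - 3")
    case True
    obtain q where q: "\<And>j. Q j = q * (- \<alpha> + of_int j)"
      using flex_hom1[OF assms(4), of Q] Q True by auto
    define R where "R j = P j - 3 * q * (- \<alpha> + of_int j) ^ 2" for j
    have "R j = 0" for j
    proof (rule flex_hom[OF assms(4), of "- 2"])
      fix j m
      define y where "y = - \<alpha> + (of_int j :: 'f)"
      have "a' m j * (y + of_int m) = y * (y + of_int m)"
        using norm[of j m] by (cases "y + of_int m = 0") (auto simp: y_def)
      moreover have "(y + 2 * of_int m) * P j + 3 * of_int m ^ 2 * (q * y) = a' m j * P (j + m)"
        using P[of j m] by (simp add: True q y_def)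
      ultimately have "(y - - 2 * of_int m) * (P j - 3 * q * y ^ 2) = a' m j * (P (j + m) - 3 * q * (y + of_int m) ^ 2)"
        by algebra
      then show "(- \<alpha> + of_int j - - 2 * of_int m) * R j = a' m j * R (j + m)"
        by (simp only: R_def y_def of_int_add add.assoc)
    qed auto
    then have "\<phi> i j = q * (- \<alpha> + of_int j) * ((\<alpha> + of_int i) + 3 * (- \<alpha> + of_int j))" for i j
      by (simp add: R_def \<phi> q power2_eq_square algebra_simps)
    then show thesis using that(1)[of q] True nz by auto
  next
    case False
    have Q0: "Q j = 0" for j
    proof (cases "b = - 2")
      case True
      show ?thesis
      proof (cases "- \<alpha> + of_int j = 0")
        case j: True
        then have "of_int j = \<alpha>" by simp
        then have "P j + 2 * Q j = 0" "- P j + 2 * Q j = 0"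
          using P[of j 1] P[of j "- 1"] triv[OF j] by (simp_all add: True)
        then have "4 * Q j = 0" by algebra
        then show ?thesis by simp
      next
        case j: False
        define y where "y = - \<alpha> + (of_int j :: 'f)"
        obtain m :: int where m: "m \<noteq> 0" "y + of_int m \<noteq> 0"
        proof (cases "y + 1 = 0")
          case True
          have "y + 2 \<noteq> 0"
          proof
            assume "y + 2 = 0"
            with True have "(1::'f) = 0" by algebra
            then show False by simp
          qed
          then show thesis using that[of 2] by simp
        qed (use that[of 1] in simp)
        have jm: "- \<alpha> + of_int (j + m) \<noteq> 0"
          using m(2) unfolding y_def of_int_add add.assoc .
        have "(- \<alpha> + of_int j) * Q j = a' m j * Q (j + m)" for j m
          using Q[of j m] True by simp
        then have e: "Q (j + m) = Q j"
          using flex_hom0[OF assms(4) _ j jm] by blast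
        have "(y + of_int m) * P j + 2 * of_int m ^ 2 * Q j = y * P (j + m)"
          using P[of j m] norm[of j m] m by (simp add: True y_def)
        moreover have "y * P (j + m) + 2 * of_int m ^ 2 * Q j = (y + of_int m) * P j"
          using P[of "j + m" "- m"] norm[of "j + m" "- m"] j by (simp add: True y_def e add_ac)
        ultimately have "4 * (of_int m ^ 2 * Q j) = 0" by algebra
        then show ?thesis using m by simp
      qed
    next
      case b: False
      have "2 + b \<noteq> 0" "2 + b \<noteq> - 1"
      proof -
        show "2 + b \<noteq> 0" using b by (auto simp: add_eq_0_iff)
        show "2 + b \<noteq> - 1"
        proof
          assume "2 + b = - 1"
          then have "b = - 3" by algebra
          then show False using \<open>b \<noteq> - 3\<close> by simp
        qed
      qed
      then show ?thesis using flex_hom[OF assms(4) Q] by blast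
    qed
    have hom: "(- \<alpha> + of_int j - (1 + b) * of_int m) * P j = a' m j * P (j + m)" for j m
      using P[of j m] by (simp add: Q0)
    have P0: "P 0 \<noteq> 0" using nz by (simp add: \<phi> Q0)
    then have "1 + b = 0 \<or> 1 + b = - 1" using flex_hom[OF assms(4) hom] by blast
    then show thesis
    proof
      assume "1 + b = 0"
      then have b: "b = - 1" by (simp add: eq_neg_iff_add_eq_0 add.commute)
      have "P j = P 0" if "- \<alpha> + of_int j \<noteq> 0" for j
        using flex_hom0[OF assms(4), of P 0 j] hom that assms(5) b by simp
      then show thesis using that(3)[of "P 0"] P0 b by (simp add: \<phi> Q0)
    next
      assume "1 + b = - 1"
      then have b: "b = - 2" by algebra
      obtain p where p: "\<And>j. P j = p * (- \<alpha> + of_int j)"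
        using flex_hom1[OF assms(4), of P] hom b by auto
      then show thesis using that(2)[of p] P0 b by (simp add: \<phi> Q0)
    qed
  qed
qed

text \<open>At weight zero of the first module, \<phi> is an intertwiner that
  \<open>flex_hom\<close> excludes. So \<open>flex_quadratic\<close> applies, and the three
  coefficients in \<alpha> + i are intertwiners with c = 3, 2, 1, which vanish one after the
  other.\<close>

lemma flex_flex:
  assumes flex: "flex_type a \<alpha>" "flex_type a' (- \<alpha>)"
  shows "\<phi> i j = 0"
proof -
  have norm: "a i k = \<alpha> + of_int k" if "\<alpha> + of_int (i + k) \<noteq> 0" for i k
    using flex that by (auto simp: flex_type_def)
  have triv: "a i k = 0" if "\<alpha> + of_int k = 0" for i k
    using flex that by (auto simp: flex_type_def)
  have zero: "\<phi> i j = 0" if "\<alpha> + of_int i = 0" for i j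
  proof (rule flex_hom[OF flex(2), of 1 "\<phi> i"])
    fix j m
    have "- \<alpha> + of_int j - of_int m = of_int (i + j - m)"
      using that by (simp add: algebra_simps add_eq_0_iff2)
    then show "(- \<alpha> + of_int j - 1 * of_int m) * \<phi> i j = a' m j * \<phi> i (j + m)"
      using equivariant[of i j m] triv[OF that] by simp
  qed auto
  have "\<forall>j. \<exists>c0 c1 c2. \<forall>i. \<phi> i j = c0 + c1 * of_int i + c2 * of_int i ^ 2"
    using flex_quadratic[OF flex(1) zero] unfolding quadratic_def by blast
  then obtain c0 c1 c2 where c: "\<And>i j. \<phi> i j = c0 j + c1 j * of_int i + c2 j * of_int i ^ 2"
    by metis
  define A where "A j = c0 j - \<alpha> * c1 j + \<alpha> ^ 2 * c2 j" for j
  define B where "B j = c1 j - 2 * \<alpha> * c2 j" for j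
  have \<phi>: "\<phi> i j = A j + B j * (\<alpha> + of_int i) + c2 j * (\<alpha> + of_int i) ^ 2" for i j
    unfolding c A_def B_def by algebra
  have hom: "(- \<alpha> + of_int j - 1 * of_int m) * A j - a' m j * A (j + m) = 0"
    "(- \<alpha> + of_int j - 2 * of_int m) * B j - of_int m ^ 2 * c2 j - a' m j * B (j + m) = 0"
    "(- \<alpha> + of_int j - 3 * of_int m) * c2 j - a' m j * c2 (j + m) = 0" for j m
  proof -
    have "((- \<alpha> + of_int j - 1 * of_int m) * A j - a' m j * A (j + m))
      + ((- \<alpha> + of_int j - 2 * of_int m) * B j - of_int m ^ 2 * c2 j - a' m j * B (j + m)) * (\<alpha> + of_int i)
      + ((- \<alpha> + of_int j - 3 * of_int m) * c2 j - a' m j * c2 (j + m)) * (\<alpha> + of_int i) ^ 2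
      + 0 * (\<alpha> + of_int i) ^ 3 + 0 * (\<alpha> + of_int i) ^ 4 + 0 * (\<alpha> + of_int i) ^ 5 = 0" for i
    proof -
      define x where "x = \<alpha> + (of_int i :: 'f)"
      have "a m i * \<phi> (i + m) j = x * \<phi> (i + m) j"
        using norm[of m i] zero[of "i + m" j]
        by (cases "\<alpha> + of_int (i + m) = 0") (auto simp: x_def add.commute)
      moreover have "of_int (i + j - m) = x + (- \<alpha> + of_int j - (of_int m :: 'f))" by (simp add: x_def)
      ultimately have "(x + (- \<alpha> + of_int j - of_int m)) * \<phi> i j = x * \<phi> (i + m) j + a' m j * \<phi> i (j + m)"
        using equivariant[of i j m] by (simp only:)
      moreover have "\<phi> i j = A j + B j * x + c2 j * x ^ 2"
        "\<phi> (i + m) j = A j + B j * (x + of_int m) + c2 j * (x + of_int m) ^ 2"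
        "\<phi> i (j + m) = A (j + m) + B (j + m) * x + c2 (j + m) * x ^ 2"
        by (simp_all add: \<phi> x_def add_ac)
      ultimately show ?thesis unfolding x_def[symmetric] by algebra
    qed
    note z = poly5_coeffs_zero[OF this, of "\<lambda>i. i"]
    show "(- \<alpha> + of_int j - 1 * of_int m) * A j - a' m j * A (j + m) = 0"
      "(- \<alpha> + of_int j - 2 * of_int m) * B j - of_int m ^ 2 * c2 j - a' m j * B (j + m) = 0"
      "(- \<alpha> + of_int j - 3 * of_int m) * c2 j - a' m j * c2 (j + m) = 0"
      by (rule z; simp add: inj_def)+
  qed
  have C0: "c2 j = 0" for j
    by (rule flex_hom[OF flex(2), of 3]) (use hom(3) in simp_all)
  have B0: "B j = 0" for j
    by (rule flex_hom[OF flex(2), of 2]) (use hom(2) C0 in simp_all)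
  have "A j = 0" for j
    by (rule flex_hom[OF flex(2), of 1]) (use hom(1) in simp_all)
  then show ?thesis by (simp add: \<phi> B0 C0)
qed

end


section \<open>The local part\<close>

definition resc :: "(int \<Rightarrow> int \<Rightarrow> 'f::field) \<Rightarrow> (int \<Rightarrow> int \<Rightarrow> int \<Rightarrow> int \<Rightarrow> 'f) \<Rightarrow> int \<Rightarrow> int \<Rightarrow> int \<Rightarrow> int \<Rightarrow> 'f" where
  "resc t s i j k l = s i j k l * t i j * t k l / t (i + k) (j + l)"

definition flip :: "(int \<Rightarrow> int \<Rightarrow> int \<Rightarrow> int \<Rightarrow> 'f) \<Rightarrow> int \<Rightarrow> int \<Rightarrow> int \<Rightarrow> int \<Rightarrow> 'f" where
  "flip s i j k l = s i (- j) k (- l)"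

definition flip_set :: "(int \<times> int) set \<Rightarrow> (int \<times> int) set" where
  "flip_set S = {(i, j). (i, - j) \<in> S}"

lemma flip_flip [simp]: "flip (flip s) = s"
  by (simp add: flip_def fun_eq_iff)

text \<open>For \<open>\<kappa> \<noteq> 0\<close> this is the structure constant of \<open>\<B>(\<alpha>/\<kappa>, 1/\<kappa>)\<close> with respect to the basis
  vectors \<open>\<kappa> L\<^sub>i\<^sub>j\<close>, and for \<open>\<kappa> = 0\<close> the one of \<open>Vir(\<alpha>)\<close>. The holes are the two omitted degrees.\<close>

definition block :: "'f::field_char_0 \<Rightarrow> 'f \<Rightarrow> int \<Rightarrow> int \<Rightarrow> int \<Rightarrow> int \<Rightarrow> 'f" where
  "block \<kappa> \<alpha> i j k l = \<kappa> * of_int (i * l - j * k) + \<alpha> * of_int (l - j) + of_int (k - i)"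

definition hole :: "'f::field_char_0 \<Rightarrow> 'f \<Rightarrow> int \<Rightarrow> int \<Rightarrow> bool" where
  "hole \<kappa> \<alpha> i j \<longleftrightarrow> \<kappa> * of_int j = 1 \<and> \<kappa> * of_int i = - \<alpha> \<or> \<kappa> * of_int j = 2 \<and> \<kappa> * of_int i = - 2 * \<alpha>"

lemma block_flip: "block (- \<kappa>) (- \<alpha>) i j k l = block \<kappa> \<alpha> i (- j) k (- l)"
  by (simp add: block_def algebra_simps)

lemma hole_flip: "hole (- \<kappa>) (- \<alpha>) i j = hole \<kappa> \<alpha> i (- j)"
proof -
  have e: "- x = y \<longleftrightarrow> x = - y" for x y :: 'a by auto
  show ?thesis by (simp add: hole_def e)
qed

lemma hole_minus1: "hole \<kappa> \<alpha> i (- 1) \<longleftrightarrow> \<kappa> \<in> {- 1, - 2} \<and> of_int i = \<alpha>"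
proof -
  have e: "- x = y \<longleftrightarrow> x = - y" for x y :: 'a by auto
  show ?thesis by (auto simp: hole_def e)
qed

lemma no_hole_1: "\<kappa> \<noteq> 1 \<Longrightarrow> \<kappa> \<noteq> 2 \<Longrightarrow> \<not> hole \<kappa> \<alpha> i 1"
  by (simp add: hole_def)

lemma no_hole_0: "\<not> hole \<kappa> \<alpha> i 0"
  by (simp add: hole_def)

context zz_algebra
begin

lemma witt_column: "witt_module (\<lambda>i k. s i 0 k l)"
proof
  fix i j k
  show "s j 0 k l * s i 0 (j + k) l - s i 0 k l * s j 0 (i + k) l = of_int (j - i) * s (i + j) 0 k l"
    using leibniz[of j 0 k l i 0] witt[of i j] by simp
qed

lemma zz_flip: "zz_algebra (flip s) (flip_set S) (- \<alpha>)"
proof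
  fix i j k l m n
  show "flip s k l i j = - flip s i j k l" unfolding flip_def by (rule skew)
  show "flip s k l m n * flip s i j (k + m) (l + n)
      = flip s i j k l * flip s (i + k) (j + l) m n + flip s i j m n * flip s k l (i + m) (j + n)"
    using leibniz[of k "- l" m "- n" i "- j"] by (simp add: flip_def)
  show "flip s i j k l \<noteq> 0 \<Longrightarrow> (i, j) \<in> flip_set S \<and> (k, l) \<in> flip_set S \<and> (i + k, j + l) \<in> flip_set S"
    using supp[of i "- j" k "- l"] by (simp add: flip_def flip_set_def)
  show "flip s i 0 k 0 = of_int (k - i)" using witt by (simp add: flip_def)
  show "- \<alpha> \<noteq> 0" using alpha by simp
  have "(0, - 1) \<in> S" using pairing supp by blast
  then show "flip s 0 0 0 1 = - \<alpha>" using weight[of 0 "- 1"] by (simp add: flip_def)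
  show "flip s 0 1 0 (- 1) \<noteq> 0" using pairing skew[of 0 1 0 "- 1"] by (simp add: flip_def)
next
  fix T :: "(int \<times> int) set"
  assume T: "\<And>i. (i, 0) \<in> T" "(0, 1) \<in> T" "(0, - 1) \<in> T"
    "\<And>i j k l. \<lbrakk>(i, j) \<in> T; (k, l) \<in> T; flip s i j k l \<noteq> 0\<rbrakk> \<Longrightarrow> (i + k, j + l) \<in> T"
  have "S \<subseteq> flip_set T"
  proof (rule generation)
    fix i j k l
    assume "(i, j) \<in> flip_set T" "(k, l) \<in> flip_set T" "s i j k l \<noteq> 0"
    then show "(i + k, j + l) \<in> flip_set T"
      using T(4)[of i "- j" k "- l"] by (simp add: flip_set_def flip_def)
  qed (use T in \<open>auto simp: flip_set_def\<close>)
  then show "flip_set S \<subseteq> T" by (auto simp: flip_set_def)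
qed

lemma zz_resc:
  assumes t: "\<And>i j. t i j \<noteq> 0" "\<And>i. t i 0 = 1"
  shows "zz_algebra (resc t s) S \<alpha>"
proof
  fix i j k l m n
  show "resc t s k l i j = - resc t s i j k l"
    using skew[of k l i j] by (simp add: resc_def add.commute)
  have "resc t s k l m n * resc t s i j (k + m) (l + n)
      = (s k l m n * s i j (k + m) (l + n)) * (t i j * t k l * t m n / t (i + k + m) (j + l + n))"
    using t by (simp add: resc_def add_ac)
  moreover have "resc t s i j k l * resc t s (i + k) (j + l) m n
      = (s i j k l * s (i + k) (j + l) m n) * (t i j * t k l * t m n / t (i + k + m) (j + l + n))"
    using t by (simp add: resc_def)
  moreover have "resc t s i j m n * resc t s k l (i + m) (j + n)
      = (s i j m n * s k l (i + m) (j + n)) * (t i j * t k l * t m n / t (i + k + m) (j + l + n))"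
    using t by (simp add: resc_def add_ac)
  ultimately show "resc t s k l m n * resc t s i j (k + m) (l + n)
      = resc t s i j k l * resc t s (i + k) (j + l) m n + resc t s i j m n * resc t s k l (i + m) (j + n)"
    using leibniz[of k l m n i j] by (simp only: distrib_right[symmetric])
  show "resc t s i j k l \<noteq> 0 \<Longrightarrow> (i, j) \<in> S \<and> (k, l) \<in> S \<and> (i + k, j + l) \<in> S"
    using supp[of i j k l] by (simp add: resc_def)
  show "resc t s i 0 k 0 = of_int (k - i)" using witt t by (simp add: resc_def)
  show "\<alpha> \<noteq> 0" "resc t s 0 0 0 1 = \<alpha>" using alpha t by (simp_all add: resc_def)
  show "resc t s 0 1 0 (- 1) \<noteq> 0" using pairing t by (simp add: resc_def)
next
  fix T :: "(int \<times> int) set"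
  assume T: "\<And>i. (i, 0) \<in> T" "(0, 1) \<in> T" "(0, - 1) \<in> T"
    "\<And>i j k l. \<lbrakk>(i, j) \<in> T; (k, l) \<in> T; resc t s i j k l \<noteq> 0\<rbrakk> \<Longrightarrow> (i + k, j + l) \<in> T"
  show "S \<subseteq> T"
    by (rule generation) (use T t in \<open>auto simp: resc_def\<close>)
qed

lemma column_normal_form:
  assumes e: "e = 1 \<or> e = - 1"
  obtains t where "\<And>k. t k \<noteq> 0"
    "(\<exists>b. b \<noteq> 0 \<and> b \<noteq> 1 \<and> density_type (\<lambda>i k. s i 0 k e * t k / t (i + k)) (of_int e * \<alpha>) b)
      \<or> flex_type (\<lambda>i k. s i 0 k e * t k / t (i + k)) (of_int e * \<alpha>)"
proof (rule cyclic_module_normal_form[of "\<lambda>i k. s i 0 k e" "{k. (k, e) \<in> S}" "of_int e * \<alpha>" 0])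
  show "witt_module (\<lambda>i k. s i 0 k e)" by (rule witt_column)
  show "s i 0 k e \<noteq> 0 \<Longrightarrow> k \<in> {k. (k, e) \<in> S} \<and> i + k \<in> {k. (k, e) \<in> S}" for i k
    using supp[of i 0 k e] by simp
  show "k \<in> {k. (k, e) \<in> S} \<Longrightarrow> s 0 0 k e = of_int e * \<alpha> + of_int k" for k
    using weight[of k e] by simp
  show "0 \<in> {k. (k, e) \<in> S}" using supp[OF pairing] e by auto
  show "of_int e * \<alpha> + of_int 0 \<noteq> 0" using alpha e by auto
  show "0 \<in> T \<Longrightarrow> (\<And>i j. j \<in> T \<Longrightarrow> s i 0 j e \<noteq> 0 \<Longrightarrow> i + j \<in> T) \<Longrightarrow> {k. (k, e) \<in> S} \<subseteq> T" for T
    using column_cyclic[OF e, of T] by blast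
qed (use that in blast)

lemma xy_equivariant:
  "of_int (i + j - m) * s i 1 j (- 1) = s m 0 i 1 * s (i + m) 1 j (- 1) + s m 0 j (- 1) * s i 1 (j + m) (- 1)"
  using leibniz[of i 1 j "- 1" m 0] witt[of m "i + j"] by (simp add: add_ac mult.commute)

text \<open>A constant pairing would define an order-zero intertwiner; the one-dimensionality of the
  degrees \<open>(i, 3)\<close> leaves only two exceptional values of \<open>b\<close>.\<close>

lemma constant_pairing:
  assumes a: "density_type (\<lambda>i k. s i 0 k 1) \<alpha> b" "b \<noteq> 1"
    and p: "p \<noteq> 0" "\<And>i j. - \<alpha> + of_int j \<noteq> 0 \<Longrightarrow> s i 1 j (- 1) = p"
  shows "b = - 2 \<or> b = 1 / 2"
proof -
  have L1: "s i 0 k 1 = \<alpha> + of_int k + of_int i * b" for i k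
    using a by (simp add: density_type_def)
  define c where "c = p * (1 - b)"
  have c: "c \<noteq> 0" using p a by (simp add: c_def)
  have yx: "s k (- 1) i 1 = - p" if "- \<alpha> + of_int k \<noteq> 0" for i k
    using p(2)[OF that] skew[of i 1 k "- 1"] by (simp add: minus_equation_iff)
  have uw: "s i 1 j 1 * s k (- 1) (i + j) 2 = c * of_int (i - j)" if "- \<alpha> + of_int k \<noteq> 0" for i j k
  proof -
    have "s i 1 j 1 * s k (- 1) (i + j) 2 = - p * s (k + i) 0 j 1 + - p * s i 1 (k + j) 0"
      using leibniz[of i 1 j 1 k "- 1"] yx[OF that] by simp
    moreover have "s i 1 (k + j) 0 = - (\<alpha> + of_int i + of_int (k + j) * b)"
      using skew[of i 1 "k + j" 0] by (simp only: L1)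
    ultimately have "s i 1 j 1 * s k (- 1) (i + j) 2
      = - p * (\<alpha> + of_int j + of_int (k + i) * b) + - p * - (\<alpha> + of_int i + of_int (k + j) * b)"
      by (simp only: L1)
    then show ?thesis by (simp add: c_def algebra_simps)
  qed
  define \<sigma> where "\<sigma> n = s 0 (- 1) n 2" for n
  have u\<sigma>: "s i 1 j 1 * \<sigma> (i + j) = c * of_int (i - j)" for i j
    using uw[of 0 i j] alpha by (simp add: \<sigma>_def)
  \<comment> \<open>The indices 2 * n + 1 and - n - 1 have sum n, and their difference 3 * n + 2 is
    never zero; so this bracket of column 1 reaches every degree (n, 2).\<close>
  have ne: "(of_int (2 * n + 1 - (- n - 1)) :: 'f) \<noteq> 0" for n
    by (subst of_int_eq_0_iff) presburger
  have \<sigma>: "\<sigma> n \<noteq> 0" "s (2 * n + 1) 1 (- n - 1) 1 \<noteq> 0" for n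
    using u\<sigma>[of "2 * n + 1" "- n - 1"] c ne[of n] by auto
  have w: "s k (- 1) n 2 = \<sigma> n" if "- \<alpha> + of_int k \<noteq> 0" for k n
  proof -
    have "s (2 * n + 1) 1 (- n - 1) 1 * s k (- 1) n 2 = s (2 * n + 1) 1 (- n - 1) 1 * \<sigma> n"
      using uw[OF that, of "2 * n + 1" "- n - 1"] u\<sigma>[of "2 * n + 1" "- n - 1"] by simp
    then show ?thesis using \<sigma>(2)[of n] by simp
  qed
  have \<rho>: "s m 0 n 2 * \<sigma> (n + m) = \<sigma> n * (of_int n + 2 * \<alpha> + (2 * b + 1) * of_int m)" for m n
  proof -
    define i where "i = 2 * n + 1"
    define j where "j = - n - 1"
    have ij: "i + j = n" by (simp add: i_def j_def)
    have "s i 1 j 1 * s m 0 n 2 = (\<alpha> + of_int i + of_int m * b) * s (m + i) 1 j 1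
        + (\<alpha> + of_int j + of_int m * b) * s i 1 (m + j) 1"
      using leibniz[of i 1 j 1 m 0] by (simp add: L1 ij)
    then have "(s i 1 j 1 * \<sigma> n) * (s m 0 n 2 * \<sigma> (n + m))
      = \<sigma> n * ((\<alpha> + of_int i + of_int m * b) * (s (m + i) 1 j 1 * \<sigma> (n + m))
        + (\<alpha> + of_int j + of_int m * b) * (s i 1 (m + j) 1 * \<sigma> (n + m)))"
      by algebra
    moreover have "s (m + i) 1 j 1 * \<sigma> (n + m) = c * of_int (m + i - j)"
      using u\<sigma>[of "m + i" j] by (simp add: ij add_ac flip: ij)
    moreover have "s i 1 (m + j) 1 * \<sigma> (n + m) = c * of_int (i - (m + j))"
      using u\<sigma>[of i "m + j"] by (simp add: ij add_ac flip: ij)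
    moreover have "s i 1 j 1 * \<sigma> n = c * of_int (i - j)"
      using u\<sigma>[of i j] by (simp add: ij)
    moreover have "of_int n = of_int i + (of_int j :: 'f)" by (simp flip: ij)
    ultimately have "c * of_int (i - j) * (s m 0 n 2 * \<sigma> (n + m))
        = c * of_int (i - j) * (\<sigma> n * (of_int n + 2 * \<alpha> + (2 * b + 1) * of_int m))"
      unfolding of_int_add of_int_diff by algebra
    moreover have "(of_int (i - j) :: 'f) \<noteq> 0" using ne[of n] unfolding i_def j_def .
    ultimately show ?thesis using c by (metis mult_cancel_left mult_eq_0_iff)
  qed
  define U where "U i = s i 1 (- i) 2 / \<sigma> (- i)" for i
  define V where "V k = s k (- 1) 0 3 * \<sigma> k" for k
  have UV: "U i * V k = p * (- 2 * \<alpha> - (2 + b) * of_int k + (2 - 4 * b) * of_int i)"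
    if k: "- \<alpha> + of_int k \<noteq> 0" for i k
  proof -
    have eq: "s i 1 (- i) 2 * s k (- 1) 0 3 = - p * s (k + i) 0 (- i) 2 + \<sigma> (- i) * s i 1 (k - i) 1"
      using leibniz[of i 1 "- i" 2 k "- 1"] yx[OF k] w[OF k] by simp
    have "s i 1 (- i) 2 * V k = (s i 1 (- i) 2 * s k (- 1) 0 3) * \<sigma> k"
      by (simp add: V_def)
    also have "\<dots> = - p * (s (k + i) 0 (- i) 2 * \<sigma> (- i + (k + i))) + \<sigma> (- i) * (s i 1 (k - i) 1 * \<sigma> (i + (k - i)))"
      unfolding eq by (simp add: algebra_simps)
    finally have "s i 1 (- i) 2 * V k = \<sigma> (- i) * (p * (- 2 * \<alpha> - (2 + b) * of_int k + (2 - 4 * b) * of_int i))"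
      unfolding \<rho> u\<sigma> c_def by (simp add: algebra_simps)
    then show ?thesis using \<sigma>(1)[of "- i"] by (simp add: U_def)
  qed
  obtain k :: int where k: "k \<noteq> 0" "- \<alpha> + of_int k \<noteq> 0"
    by (cases "\<alpha> = 1") (auto intro: that[of 1] that[of 2])
  \<comment> \<open>All U i * V k pass through degree (0, 3), so they form a matrix of rank one and
    this minor vanishes. The values in \<open>UV\<close> are affine in i and k without a mixed term,
    which makes the minor a multiple of the product of the two slopes.\<close>
  have "(U 0 * V 0) * (U 1 * V k) = (U 0 * V k) * (U 1 * V 0)" by simp
  moreover have "U 0 * V k = p * (- 2 * \<alpha> - (2 + b) * of_int k)"
    "U 1 * V k = p * (- 2 * \<alpha> - (2 + b) * of_int k + (2 - 4 * b))"
    "U 0 * V 0 = p * (- 2 * \<alpha>)" "U 1 * V 0 = p * (- 2 * \<alpha> + (2 - 4 * b))"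
    using UV[OF k(2), of 0] UV[OF k(2), of 1] UV[of 0 0] UV[of 0 1] alpha by simp_all
  ultimately have "p ^ 2 * ((2 + b) * (2 - 4 * b) * of_int k) = 0" by algebra
  then have "2 + b = 0 \<or> 2 - 4 * b = 0" using p k by simp
  then show ?thesis
  proof
    assume "2 + b = 0"
    then show ?thesis by (simp add: eq_neg_iff_add_eq_0 add.commute)
  qed (auto simp: field_simps)
qed

end

text \<open>Brackets that end in a hole are left open: the model does not determine them, and they
  later give the central parameters. By \<open>local_hole\<close>, vectors in holes of the columns 1
  and - 1 are annihilated by column 0 and by the opposite column.\<close>

locale block_local = zz_algebra +
  fixes \<kappa>
  assumes local_act: "e = 1 \<or> e = - 1 \<Longrightarrow> \<not> hole \<kappa> \<alpha> i e \<Longrightarrow> \<not> hole \<kappa> \<alpha> (m + i) e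
      \<Longrightarrow> s m 0 i e = block \<kappa> \<alpha> m 0 i e"
    and local_pair: "\<not> hole \<kappa> \<alpha> i 1 \<Longrightarrow> \<not> hole \<kappa> \<alpha> j (- 1) \<Longrightarrow> s i 1 j (- 1) = block \<kappa> \<alpha> i 1 j (- 1)"
    and local_hole: "e = 1 \<or> e = - 1 \<Longrightarrow> hole \<kappa> \<alpha> i e \<Longrightarrow> s m 0 i e = 0"
      "e = 1 \<or> e = - 1 \<Longrightarrow> hole \<kappa> \<alpha> i e \<Longrightarrow> s j (- e) i e = 0"
begin

lemma block_local_flip: "block_local (flip s) (flip_set S) (- \<alpha>) (- \<kappa>)"
proof (intro block_local.intro zz_flip block_local_axioms.intro)
  show "e = 1 \<or> e = - 1 \<Longrightarrow> \<not> hole (- \<kappa>) (- \<alpha>) i e \<Longrightarrow> \<not> hole (- \<kappa>) (- \<alpha>) (m + i) e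
      \<Longrightarrow> flip s m 0 i e = block (- \<kappa>) (- \<alpha>) m 0 i e" for e i m
    using local_act[of "- e" i m] by (auto simp: hole_flip block_flip flip_def)
  show "\<not> hole (- \<kappa>) (- \<alpha>) i 1 \<Longrightarrow> \<not> hole (- \<kappa>) (- \<alpha>) j (- 1)
      \<Longrightarrow> flip s i 1 j (- 1) = block (- \<kappa>) (- \<alpha>) i 1 j (- 1)" for i j
    using local_pair[of j i] skew[of i "- 1" j 1]
    by (simp add: hole_flip block_flip flip_def) (simp add: block_def algebra_simps)
  show "e = 1 \<or> e = - 1 \<Longrightarrow> hole (- \<kappa>) (- \<alpha>) i e \<Longrightarrow> flip s m 0 i e = 0" for e i m
    using local_hole(1)[of "- e" i m] by (auto simp: hole_flip flip_def)
  show "e = 1 \<or> e = - 1 \<Longrightarrow> hole (- \<kappa>) (- \<alpha>) i e \<Longrightarrow> flip s j (- e) i e = 0" for e i j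
    using local_hole(2)[of "- e" i j] by (auto simp: hole_flip flip_def)
qed

end

text \<open>For \<kappa> = - 1 column - 1 itself may contain a hole, into which column 0 can act
  with a linear and a quadratic term. The condition \<open>flex\<close> retains this information for
  \<open>no_quadratic_cocycle\<close>.\<close>

locale block_local' = block_local +
  assumes kappa: "\<kappa> \<noteq> 1" "\<kappa> \<noteq> 2"
    and flex: "\<kappa> = - 1 \<Longrightarrow> flex_type (\<lambda>m j. s m 0 j (- 1)) (- \<alpha>)"

context zz_algebra
begin

text \<open>The action on column 1 is that of \<open>block\<close> for \<kappa> = b + 1. The
  transvectant is the generic case, with b' = - \<kappa> - 1; the pairings with functions through
  their derivative give \<kappa> = - 2 and \<kappa> = - 1; the pairings with constant \<phi> are
  refuted by \<open>constant_pairing\<close>.\<close>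

lemma density_local:
  assumes M: "density_type (\<lambda>i k. s i 0 k 1) \<alpha> b" "b \<noteq> 0" "b \<noteq> 1"
    and N: "(\<exists>b'. b' \<noteq> 0 \<and> b' \<noteq> 1 \<and> density_type (\<lambda>i k. s i 0 k (- 1)) (- \<alpha>) b')
      \<or> flex_type (\<lambda>i k. s i 0 k (- 1)) (- \<alpha>)"
  obtains t \<kappa> where "\<And>i j. t i j \<noteq> 0" "\<And>i. t i 0 = 1" "block_local' (resc t s) S \<alpha> \<kappa>"
proof -
  note result = that
  interpret witt_pairing "\<lambda>i k. s i 0 k 1" "\<lambda>i k. s i 0 k (- 1)" "\<lambda>i j. s i 1 j (- 1)"
    using xy_equivariant density_type_quadratic[OF M(1)] N density_type_quadratic flex_type_quadratic
    by unfold_locales blast+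
  have M': "s i 0 k 1 = \<alpha> + of_int k + of_int i * b" for i k
    using M by (simp add: density_type_def)
  define \<kappa> where "\<kappa> = b + 1"
  have \<kappa>: "\<kappa> \<noteq> 1" "\<kappa> \<noteq> 2" using M by (auto simp: \<kappa>_def)
  have goal: thesis
    if t: "\<And>i. t i \<noteq> 0"
      and act: "\<And>i m. \<not> hole \<kappa> \<alpha> i (- 1) \<Longrightarrow> \<not> hole \<kappa> \<alpha> (m + i) (- 1) \<Longrightarrow>
        s m 0 i (- 1) * t i / t (m + i) = block \<kappa> \<alpha> m 0 i (- 1)"
      and pair: "\<And>i j. \<not> hole \<kappa> \<alpha> j (- 1) \<Longrightarrow> s i 1 j (- 1) * t j = block \<kappa> \<alpha> i 1 j (- 1)"
      and hl: "\<And>i j. hole \<kappa> \<alpha> j (- 1) \<Longrightarrow> s i 0 j (- 1) = 0 \<and> s i 1 j (- 1) = 0"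
      and flx: "\<kappa> = - 1 \<Longrightarrow> flex_type (\<lambda>m j. s m 0 j (- 1) * t j / t (m + j)) (- \<alpha>)" for t
  proof -
    define T where "T i j = (if j = - 1 then t i else 1)" for i j :: int
    have T: "T i j \<noteq> 0" "T i 0 = 1" for i j using t by (auto simp: T_def)
    interpret R: zz_algebra "resc T s" S \<alpha> by (rule zz_resc) (use T in auto)
    have "block_local' (resc T s) S \<alpha> \<kappa>"
    proof
      show "resc T s m 0 i e = block \<kappa> \<alpha> m 0 i e"
        if "e = 1 \<or> e = - 1" "\<not> hole \<kappa> \<alpha> i e" "\<not> hole \<kappa> \<alpha> (m + i) e" for e i m
        using that act[of i m] by (auto simp: resc_def T_def M' block_def \<kappa>_def algebra_simps)
      show "resc T s i 1 j (- 1) = block \<kappa> \<alpha> i 1 j (- 1)"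
        if "\<not> hole \<kappa> \<alpha> i 1" "\<not> hole \<kappa> \<alpha> j (- 1)" for i j
        using pair[OF that(2), of i] by (simp add: resc_def T_def)
      show "resc T s m 0 i e = 0" if "e = 1 \<or> e = - 1" "hole \<kappa> \<alpha> i e" for e i m
        using that hl[of i m] no_hole_1[OF \<kappa>, of \<alpha> i] by (auto simp: resc_def)
      show "resc T s j (- e) i e = 0" if "e = 1 \<or> e = - 1" "hole \<kappa> \<alpha> i e" for e i j
        using that hl[of i j] no_hole_1[OF \<kappa>, of \<alpha> i] by (auto simp: resc_def)
      show "\<kappa> \<noteq> 1" "\<kappa> \<noteq> 2" by (fact \<kappa>)+
      show "flex_type (\<lambda>m j. resc T s m 0 j (- 1)) (- \<alpha>)" if "\<kappa> = - 1"
        using flx[OF that] by (simp add: resc_def T_def)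
    qed
    then show thesis using result[of T \<kappa>] T by blast
  qed
  from N show thesis
  proof
    assume "\<exists>b'. b' \<noteq> 0 \<and> b' \<noteq> 1 \<and> density_type (\<lambda>i k. s i 0 k (- 1)) (- \<alpha>) b'"
    then obtain b' where b': "b' \<noteq> 0" "b' \<noteq> 1" "density_type (\<lambda>i k. s i 0 k (- 1)) (- \<alpha>) b'" by blast
    then have N': "s i 0 k (- 1) = - \<alpha> + of_int k + of_int i * b'" for i k
      by (simp add: density_type_def)
    from density_density[OF M b'(3,1,2) pairing] show thesis
    proof cases
      case (1 q)
      have "b' = - \<kappa> - 1" using 1 by (simp add: \<kappa>_def)
      then have nh: "\<not> hole \<kappa> \<alpha> i (- 1)" for i using b' by (auto simp: hole_minus1)
      show thesis
      proof (rule goal[of "\<lambda>_. 1 / q"])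
        show "s m 0 i (- 1) * (1 / q) / (1 / q) = block \<kappa> \<alpha> m 0 i (- 1)" for i m
          using 1(1) unfolding N' \<open>b' = - \<kappa> - 1\<close> by (simp add: block_def algebra_simps)
        show "s i 1 j (- 1) * (1 / q) = block \<kappa> \<alpha> i 1 j (- 1)" for i j
          using 1(1) unfolding 1(3) 1(2) by (simp add: block_def \<kappa>_def algebra_simps)
        show "flex_type (\<lambda>m j. s m 0 j (- 1) * (1 / q) / (1 / q)) (- \<alpha>)" if "\<kappa> = - 1"
          using that \<open>b' = - \<kappa> - 1\<close> b' by simp
      qed (use 1 nh in auto)
    next
      case (2 p)
      interpret F: zz_algebra "flip s" "flip_set S" "- \<alpha>" by (rule zz_flip)
      \<comment> \<open>After reversing the second degree the same restriction holds for b'. Two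
        values from - 2 and 1/2, equal or not, never have sum - 1.\<close>
      have "b = - 2 \<or> b = 1 / 2" using constant_pairing[OF M(1,3), of p] 2 by auto
      moreover have "b' = - 2 \<or> b' = 1 / 2"
      proof (rule F.constant_pairing)
        show "density_type (\<lambda>i k. flip s i 0 k 1) (- \<alpha>) b'" using b' by (simp add: flip_def)
        show "flip s i 1 j (- 1) = - p" for i j using skew[of i "- 1" j 1] 2 by (simp add: flip_def)
      qed (use b' 2 in auto)
      ultimately show thesis using 2(2) b' by (auto simp: field_simps)
    qed
  next
    assume flex: "flex_type (\<lambda>i k. s i 0 k (- 1)) (- \<alpha>)"
    from density_flex[OF M flex alpha(1) pairing] show thesis
    proof cases
      case (1 q)
      have \<kappa>: "\<kappa> = - 2" using 1 by (simp add: \<kappa>_def)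
      have h: "hole \<kappa> \<alpha> i (- 1) \<longleftrightarrow> - \<alpha> + of_int i = 0" for i
        by (auto simp: hole_minus1 \<kappa>)
      \<comment> \<open>Off weight zero, division by the weight turns functions into densities of
        weight one, the normal form b' = - \<kappa> - 1 for \<kappa> = - 2.\<close>
      define t where "t j = (if - \<alpha> + of_int j = 0 then 1 else 1 / (q * (- \<alpha> + of_int j)))" for j
      show thesis
      proof (rule goal[of t])
        show "t i \<noteq> 0" for i using 1 by (simp add: t_def)
        show "s m 0 i (- 1) * t i / t (m + i) = block \<kappa> \<alpha> m 0 i (- 1)"
          if "\<not> hole \<kappa> \<alpha> i (- 1)" "\<not> hole \<kappa> \<alpha> (m + i) (- 1)" for i m
        proof -
          have "s m 0 i (- 1) = - \<alpha> + of_int i"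
            using flex that unfolding h flex_type_def by blast
          moreover have "t i = 1 / (q * (- \<alpha> + of_int i))" "t (m + i) = 1 / (q * (- \<alpha> + of_int (m + i)))"
            using that unfolding h t_def by simp_all
          moreover have "block \<kappa> \<alpha> m 0 i (- 1) = - \<alpha> + of_int (m + i)"
            by (simp add: block_def \<kappa>)
          ultimately show ?thesis using that(1) 1(1) unfolding h by simp
        qed
        show "s i 1 j (- 1) * t j = block \<kappa> \<alpha> i 1 j (- 1)" if "\<not> hole \<kappa> \<alpha> j (- 1)" for i j
          using that 1(1) unfolding h t_def 1(3) by (simp add: block_def \<kappa> field_simps)
        show "s i 0 j (- 1) = 0 \<and> s i 1 j (- 1) = 0" if "hole \<kappa> \<alpha> j (- 1)" for i j
          using that flex_type_triv[OF flex] unfolding h 1(3) by simp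
      qed (use \<kappa> in simp)
    next
      case (2 p)
      have \<kappa>: "\<kappa> = - 1" using 2 by (simp add: \<kappa>_def)
      have h: "hole \<kappa> \<alpha> i (- 1) \<longleftrightarrow> - \<alpha> + of_int i = 0" for i
        by (auto simp: hole_minus1 \<kappa>)
      show thesis
      proof (rule goal[of "\<lambda>_. 2 / p"])
        show "s m 0 i (- 1) * (2 / p) / (2 / p) = block \<kappa> \<alpha> m 0 i (- 1)"
          if "\<not> hole \<kappa> \<alpha> i (- 1)" "\<not> hole \<kappa> \<alpha> (m + i) (- 1)" for i m
        proof -
          have "s m 0 i (- 1) = - \<alpha> + of_int i"
            using flex that unfolding h flex_type_def by blast
          then show ?thesis using 2 by (simp add: block_def \<kappa> algebra_simps)
        qed
        show "s i 1 j (- 1) * (2 / p) = block \<kappa> \<alpha> i 1 j (- 1)" for i j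
          using 2(1) unfolding 2(3) by (simp add: block_def \<kappa> algebra_simps)
        show "s i 0 j (- 1) = 0 \<and> s i 1 j (- 1) = 0" if "hole \<kappa> \<alpha> j (- 1)" for i j
          using that flex_type_triv[OF flex] unfolding h 2(3) by simp
        show "flex_type (\<lambda>m j. s m 0 j (- 1) * (2 / p) / (2 / p)) (- \<alpha>)"
          using flex 2 by simp
      qed (use 2 in simp)
    next
      case (3 p)
      then show thesis using constant_pairing[OF M(1,3) 3(1,3)] by (auto simp: field_simps)
    qed
  qed
qed

lemma local_normal_form:
  obtains t \<kappa> where "\<And>i j. t i j \<noteq> 0" "\<And>i. t i 0 = 1" "block_local' (resc t s) S \<alpha> \<kappa>"
  | t \<kappa> where "\<And>i j. t i j \<noteq> 0" "\<And>i. t i 0 = 1"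
      "block_local' (resc t (flip s)) (flip_set S) (- \<alpha>) \<kappa>"
proof -
  obtain t1 where t1: "\<And>k. t1 k \<noteq> 0"
    "(\<exists>b. b \<noteq> 0 \<and> b \<noteq> 1 \<and> density_type (\<lambda>i k. s i 0 k 1 * t1 k / t1 (i + k)) \<alpha> b)
      \<or> flex_type (\<lambda>i k. s i 0 k 1 * t1 k / t1 (i + k)) \<alpha>"
    using column_normal_form[of 1] by auto
  obtain t2 where t2: "\<And>k. t2 k \<noteq> 0"
    "(\<exists>b. b \<noteq> 0 \<and> b \<noteq> 1 \<and> density_type (\<lambda>i k. s i 0 k (- 1) * t2 k / t2 (i + k)) (- \<alpha>) b)
      \<or> flex_type (\<lambda>i k. s i 0 k (- 1) * t2 k / t2 (i + k)) (- \<alpha>)"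
    using column_normal_form[of "- 1"] by auto
  define T where "T i j = (if j = 1 then t1 i else if j = - 1 then t2 i else 1)" for i j :: int
  have T: "T i j \<noteq> 0" "T i 0 = 1" for i j using t1 t2 by (auto simp: T_def)
  have c1: "(\<lambda>i k. resc T s i 0 k 1) = (\<lambda>i k. s i 0 k 1 * t1 k / t1 (i + k))"
    and c2: "(\<lambda>i k. resc T s i 0 k (- 1)) = (\<lambda>i k. s i 0 k (- 1) * t2 k / t2 (i + k))"
    by (simp_all add: resc_def T_def)
  interpret R: zz_algebra "resc T s" S \<alpha> by (rule zz_resc) (use T in auto)
  have resc2: "resc t (resc T s) = resc (\<lambda>i j. T i j * t i j) s" for t
    by (simp add: resc_def fun_eq_iff mult_ac)
  consider b where "b \<noteq> 0" "b \<noteq> 1" "density_type (\<lambda>i k. resc T s i 0 k 1) \<alpha> b"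
    | b where "b \<noteq> 0" "b \<noteq> 1" "density_type (\<lambda>i k. resc T s i 0 k (- 1)) (- \<alpha>) b"
    | "flex_type (\<lambda>i k. resc T s i 0 k 1) \<alpha>" "flex_type (\<lambda>i k. resc T s i 0 k (- 1)) (- \<alpha>)"
    using t1(2) t2(2) unfolding c1 c2 by blast
  then show thesis
  proof cases
    case (1 b)
    obtain t \<kappa> where "\<And>i j. t i j \<noteq> 0" "\<And>i. t i 0 = 1" "block_local' (resc t (resc T s)) S \<alpha> \<kappa>"
      using R.density_local[OF 1(3,1,2)] t2(2) unfolding c2 by blast
    then show thesis using that(1)[of "\<lambda>i j. T i j * t i j" \<kappa>] T unfolding resc2 by simp
  next
    case (2 b)
    interpret F: zz_algebra "flip (resc T s)" "flip_set S" "- \<alpha>" by (rule R.zz_flip)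
    have M: "density_type (\<lambda>i k. flip (resc T s) i 0 k 1) (- \<alpha>) b"
      using 2(3) by (simp add: flip_def)
    have N: "(\<exists>b'. b' \<noteq> 0 \<and> b' \<noteq> 1 \<and> density_type (\<lambda>i k. flip (resc T s) i 0 k (- 1)) (- (- \<alpha>)) b')
      \<or> flex_type (\<lambda>i k. flip (resc T s) i 0 k (- 1)) (- (- \<alpha>))"
      using t1(2) unfolding c1[symmetric] by (simp add: flip_def)
    obtain t \<kappa> where t: "\<And>i j. t i j \<noteq> 0" "\<And>i. t i 0 = 1"
      "block_local' (resc t (flip (resc T s))) (flip_set S) (- \<alpha>) \<kappa>"
      using F.density_local[OF M 2(1,2) N] by blast
    have "resc t (flip (resc T s)) = resc (\<lambda>i j. T i (- j) * t i j) (flip s)"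
      by (simp add: resc_def flip_def fun_eq_iff mult_ac)
    then show thesis using that(2)[of "\<lambda>i j. T i (- j) * t i j" \<kappa>] T t by simp
  next
    case 3
    interpret witt_pairing "\<lambda>i k. resc T s i 0 k 1" "\<lambda>i k. resc T s i 0 k (- 1)" "\<lambda>i j. resc T s i 1 j (- 1)"
      using R.xy_equivariant flex_type_quadratic[OF 3(1)] flex_type_quadratic[OF 3(2)]
      by unfold_locales blast+
    show thesis using flex_flex[OF 3, of 0 0] R.pairing by simp
  qed
qed

end


section \<open>The columns of positive second degree\<close>

lemma block_jacobi:
  "block \<kappa> \<alpha> k l m n * block \<kappa> \<alpha> i j (k + m) (l + n)
    = block \<kappa> \<alpha> i j k l * block \<kappa> \<alpha> (i + k) (j + l) m n + block \<kappa> \<alpha> i j m n * block \<kappa> \<alpha> k l (i + m) (j + n)"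
  unfolding block_def of_int_add of_int_diff of_int_mult by algebra

lemma block_skew: "block \<kappa> \<alpha> k l i j = - block \<kappa> \<alpha> i j k l"
  by (simp add: block_def algebra_simps)

lemma hole_unique: "hole \<kappa> \<alpha> i j \<Longrightarrow> hole \<kappa> \<alpha> i' j \<Longrightarrow> i = i'"
proof -
  assume *: "hole \<kappa> \<alpha> i j" "hole \<kappa> \<alpha> i' j"
  have "\<kappa> * of_int i = \<kappa> * of_int i'"
    using * unfolding hole_def by (elim disjE conjE, simp_all only:) simp_all
  moreover have "\<kappa> \<noteq> 0" using * by (auto simp: hole_def)
  ultimately show ?thesis by simp
qed

lemma block_from_hole1:
  assumes "\<kappa> * of_int j = 1" "\<kappa> * of_int i = - \<alpha>"
  shows "block \<kappa> \<alpha> i j k l = 0"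
proof -
  have "\<kappa> * block \<kappa> \<alpha> i j k l = 0"
    using assms unfolding block_def of_int_diff of_int_mult by algebra
  then show ?thesis using assms by auto
qed

lemma block_into_hole2:
  assumes "\<kappa> * of_int (j + l) = 2" "\<kappa> * of_int (i + k) = - 2 * \<alpha>"
  shows "block \<kappa> \<alpha> i j k l = 0"
proof -
  have kl: "\<kappa> * of_int l = 2 - \<kappa> * of_int j" "\<kappa> * of_int k = - 2 * \<alpha> - \<kappa> * of_int i"
    using assms by (simp_all add: algebra_simps)
  have "\<kappa> * block \<kappa> \<alpha> i j k l = (\<kappa> * of_int i) * (\<kappa> * of_int l) - (\<kappa> * of_int j) * (\<kappa> * of_int k)
      + \<alpha> * (\<kappa> * of_int l) - \<alpha> * (\<kappa> * of_int j) + \<kappa> * of_int k - \<kappa> * of_int i"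
    unfolding block_def by (simp add: algebra_simps)
  also have "\<dots> = 0" unfolding kl by (simp add: algebra_simps)
  finally show ?thesis using assms by auto
qed

text \<open>In the model the vector at the first hole is central, and no bracket reaches the second
  hole. Either way a composite through a hole is zero, so Leibniz identities of the model and of the
  algebra can be compared term by term although brackets into holes are unknown.\<close>

lemma block_through_hole:
  assumes "hole \<kappa> \<alpha> (i + k) (j + l)"
  shows "block \<kappa> \<alpha> i j k l * block \<kappa> \<alpha> m n (i + k) (j + l) = 0"
  using assms block_into_hole2[of \<kappa> j l i k \<alpha>] block_from_hole1[of \<kappa> "j + l" "i + k" \<alpha> m n]
    block_skew[of \<kappa> \<alpha> m n "i + k" "j + l"] by (auto simp: hole_def)

lemma finite_unique: "(\<And>a b. P a \<Longrightarrow> P b \<Longrightarrow> a = b) \<Longrightarrow> finite {a. P a}"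
  by (metis (mono_tags, lifting) finite.emptyI finite_insert finite_subset insertCI mem_Collect_eq subsetI)

lemma finite_hole: "inj f \<Longrightarrow> finite {a. hole \<kappa> \<alpha> (f a) j}"
  by (rule finite_unique) (use hole_unique in \<open>blast dest: injD\<close>)

lemma affine_nonzero:
  fixes c0 c1 :: "'f::field_char_0"
  assumes "c1 \<noteq> 0 \<or> c0 \<noteq> 0" "finite B"
  obtains a :: int where "a \<notin> B" "c1 * of_int a + c0 \<noteq> 0"
proof -
  have "finite {a::int. c1 * of_int a + c0 = 0}"
  proof (cases "c1 = 0")
    case False
    show ?thesis
    proof (rule finite_unique)
      fix a b :: int
      assume "c1 * of_int a + c0 = 0" "c1 * of_int b + c0 = 0"
      then have "c1 * of_int a = c1 * of_int b" by (metis add_right_cancel)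
      then show "a = b" using False by simp
    qed
  qed (use assms in simp)
  then have "finite (B \<union> {a::int. c1 * of_int a + c0 = 0})" using assms by simp
  then obtain a :: int where "a \<notin> B \<union> {a. c1 * of_int a + c0 = 0}"
    using ex_new_if_finite[OF infinite_UNIV_int] by blast
  then show thesis using that by blast
qed

text \<open>Holes lie in the columns 1 / \<kappa> and 2 / \<kappa>. These are neighbours only for
  \<kappa> = 1 and \<kappa> = - 1, and in the latter case they are negative.\<close>

lemma adjacent_holes:
  assumes "\<kappa> \<noteq> 1" "j \<ge> 1" "hole \<kappa> \<alpha> i j"
  shows "\<not> hole \<kappa> \<alpha> i' (j + 1)"
proof
  assume "hole \<kappa> \<alpha> i' (j + 1)"
  then have "\<kappa> * of_int j + \<kappa> = 1 \<or> \<kappa> * of_int j + \<kappa> = 2" "\<kappa> * of_int j = 1 \<or> \<kappa> * of_int j = 2"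
    using assms by (auto simp: hole_def algebra_simps)
  then consider "\<kappa> = 0" | "1 + \<kappa> = 2" | "2 + \<kappa> = 1" by auto
  then have "\<kappa> = 0 \<or> \<kappa> = - 1"
  proof cases
    case 2
    then have "\<kappa> = 1" by (metis add_left_cancel one_add_one)
    then show ?thesis using assms(1) by simp
  next
    case 3
    then have "\<kappa> = 1 - 2" by (metis add_diff_cancel_left')
    then show ?thesis by simp
  qed simp
  then show False
  proof
    assume "\<kappa> = - 1"
    then have "(of_int (- j) :: 'a) = of_int 1 \<or> (of_int (- j) :: 'a) = of_int 2"
      using assms by (auto simp: hole_def)
    then show False using assms(2) unfolding of_int_eq_iff by auto
  qed (use assms in \<open>auto simp: hole_def\<close>)
qed

text \<open>The constant is affine in a and vanishes identically only if (i, n + 1) is the second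
  hole, the degree that the model does not reach. Otherwise all but finitely many a serve.\<close>

lemma choose_x:
  fixes \<kappa> \<alpha> :: "'f::field_char_0"
  assumes "\<kappa> \<noteq> 1" "n \<ge> 1" "\<not> hole \<kappa> \<alpha> i (n + 1)" "finite B"
  obtains a where "a \<notin> B" "\<not> hole \<kappa> \<alpha> a 1" "\<not> hole \<kappa> \<alpha> (i - a) n" "block \<kappa> \<alpha> a 1 (i - a) n \<noteq> 0"
proof -
  define c1 where "c1 = \<kappa> * of_int (n + 1) - 2"
  define c0 where "c0 = (1 - \<kappa>) * of_int i + \<alpha> * of_int (n - 1)"
  have eq: "block \<kappa> \<alpha> a 1 (i - a) n = c1 * of_int a + c0" for a
    by (simp add: block_def c1_def c0_def algebra_simps)
  have nz: "c1 \<noteq> 0 \<or> c0 \<noteq> 0"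
  proof (rule ccontr)
    assume "\<not> ?thesis"
    then have c: "c1 = 0" "c0 = 0" by auto
    have "n \<noteq> 1" using c(1) assms(1) by (auto simp: c1_def)
    have "of_int (n - 1) * (\<kappa> * of_int i + 2 * \<alpha>) = c1 * of_int i + 2 * c0"
      by (simp add: c1_def c0_def algebra_simps)
    then have "of_int (n - 1) * (\<kappa> * of_int i + 2 * \<alpha>) = 0" by (simp only: c) simp
    moreover have "(of_int (n - 1) :: 'f) \<noteq> 0" using \<open>n \<noteq> 1\<close> by (subst of_int_eq_0_iff) simp
    ultimately have e: "\<kappa> * of_int i + 2 * \<alpha> = 0" by (metis mult_eq_0_iff)
    have "\<kappa> * of_int (n + 1) = 2" using c(1) unfolding c1_def right_minus_eq .
    moreover have "\<kappa> * of_int i = - 2 * \<alpha>" using e by (simp add: add_eq_0_iff2)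
    ultimately show False using assms(3) unfolding hole_def by blast
  qed
  have fin: "finite (B \<union> {a. hole \<kappa> \<alpha> a 1} \<union> {a. hole \<kappa> \<alpha> (i - a) n})"
    using assms(4) finite_hole[of "\<lambda>a. a" \<kappa> \<alpha> 1] finite_hole[of "\<lambda>a. i - a" \<kappa> \<alpha> n] by (simp add: inj_def)
  obtain a where "a \<notin> B \<union> {a. hole \<kappa> \<alpha> a 1} \<union> {a. hole \<kappa> \<alpha> (i - a) n}" "c1 * of_int a + c0 \<noteq> 0"
    by (rule affine_nonzero[OF nz fin])
  then show thesis using that[of a] by (simp add: eq)
qed

text \<open>Dually, the constant is affine in k and vanishes identically only at the first hole,
  whose vector is central in the model. Column - 1 thus detects the other degrees.\<close>

lemma choose_y:
  fixes \<kappa> \<alpha> :: "'f::field_char_0"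
  assumes "j \<ge> 1" "\<not> hole \<kappa> \<alpha> i j"
  obtains k where "\<not> hole \<kappa> \<alpha> k (- 1)" "\<not> hole \<kappa> \<alpha> (k + i) (j - 1)" "block \<kappa> \<alpha> k (- 1) i j \<noteq> 0"
proof -
  define c1 where "c1 = \<kappa> * of_int j - 1"
  define c0 where "c0 = (\<kappa> + 1) * of_int i + \<alpha> * of_int (j + 1)"
  have eq: "block \<kappa> \<alpha> k (- 1) i j = c1 * of_int k + c0" for k
    by (simp add: block_def c1_def c0_def algebra_simps)
  have nz: "c1 \<noteq> 0 \<or> c0 \<noteq> 0"
  proof (rule ccontr)
    assume "\<not> ?thesis"
    then have c: "c1 = 0" "c0 = 0" by auto
    have "of_int (j + 1) * (\<kappa> * of_int i + \<alpha>) = c1 * of_int i + c0"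
      by (simp add: c1_def c0_def algebra_simps)
    then have "of_int (j + 1) * (\<kappa> * of_int i + \<alpha>) = 0" by (simp only: c) simp
    moreover have "(of_int (j + 1) :: 'f) \<noteq> 0" using assms(1) by (subst of_int_eq_0_iff) simp
    ultimately have e: "\<kappa> * of_int i + \<alpha> = 0" by (metis mult_eq_0_iff)
    have "\<kappa> * of_int j = 1" using c(1) unfolding c1_def right_minus_eq .
    moreover have "\<kappa> * of_int i = - \<alpha>" using e by (simp add: add_eq_0_iff2)
    ultimately show False using assms(2) unfolding hole_def by blast
  qed
  have fin: "finite ({k. hole \<kappa> \<alpha> k (- 1)} \<union> {k. hole \<kappa> \<alpha> (k + i) (j - 1)})"
    using finite_hole[of "\<lambda>k. k" \<kappa> \<alpha> "- 1"] finite_hole[of "\<lambda>k. k + i" \<kappa> \<alpha> "j - 1"] by (simp add: inj_def)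
  obtain a where "a \<notin> {k. hole \<kappa> \<alpha> k (- 1)} \<union> {k. hole \<kappa> \<alpha> (k + i) (j - 1)}" "c1 * of_int a + c0 \<noteq> 0"
    by (rule affine_nonzero[OF nz fin])
  then show thesis using that[of a] by (simp add: eq)
qed

text \<open>The brackets of the columns \<open>0\<close> and \<open>\<plusminus>1\<close> with the columns \<open>1, \<dots>, n\<close> are those of the model, as
  far as they do not involve or reach a hole, and the holes are central as far as visible.\<close>

definition good :: "'f::field_char_0 \<Rightarrow> 'f \<Rightarrow> int \<Rightarrow> (int \<Rightarrow> int \<Rightarrow> int \<Rightarrow> int \<Rightarrow> 'f) \<Rightarrow> bool" where
  "good \<kappa> \<alpha> n s \<longleftrightarrow>
    (\<forall>j m i. 1 \<le> j \<and> j \<le> n \<and> \<not> hole \<kappa> \<alpha> i j \<and> \<not> hole \<kappa> \<alpha> (m + i) j \<longrightarrow> s m 0 i j = block \<kappa> \<alpha> m 0 i j) \<and>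
    (\<forall>j k i. 1 \<le> j \<and> j \<le> n \<and> \<not> hole \<kappa> \<alpha> k (- 1) \<and> \<not> hole \<kappa> \<alpha> i j \<and> \<not> hole \<kappa> \<alpha> (k + i) (j - 1)
      \<longrightarrow> s k (- 1) i j = block \<kappa> \<alpha> k (- 1) i j) \<and>
    (\<forall>j a i. 1 \<le> j \<and> j + 1 \<le> n \<and> \<not> hole \<kappa> \<alpha> a 1 \<and> \<not> hole \<kappa> \<alpha> i j \<and> \<not> hole \<kappa> \<alpha> (a + i) (j + 1)
      \<longrightarrow> s a 1 i j = block \<kappa> \<alpha> a 1 i j) \<and>
    (\<forall>j m i. 1 \<le> j \<and> j \<le> n \<and> hole \<kappa> \<alpha> i j \<longrightarrow> s m 0 i j = 0 \<and> s m (- 1) i j = 0) \<and>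
    (\<forall>j a i. 1 \<le> j \<and> j + 1 \<le> n \<and> hole \<kappa> \<alpha> i j \<longrightarrow> s a 1 i j = 0)"

lemma goodD:
  assumes "good \<kappa> \<alpha> n s" "1 \<le> j"
  shows "j \<le> n \<Longrightarrow> \<not> hole \<kappa> \<alpha> i j \<Longrightarrow> \<not> hole \<kappa> \<alpha> (m + i) j \<Longrightarrow> s m 0 i j = block \<kappa> \<alpha> m 0 i j"
    and "j \<le> n \<Longrightarrow> \<not> hole \<kappa> \<alpha> m (- 1) \<Longrightarrow> \<not> hole \<kappa> \<alpha> i j \<Longrightarrow> \<not> hole \<kappa> \<alpha> (m + i) (j - 1)
      \<Longrightarrow> s m (- 1) i j = block \<kappa> \<alpha> m (- 1) i j"
    and "j + 1 \<le> n \<Longrightarrow> \<not> hole \<kappa> \<alpha> m 1 \<Longrightarrow> \<not> hole \<kappa> \<alpha> i j \<Longrightarrow> \<not> hole \<kappa> \<alpha> (m + i) (j + 1)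
      \<Longrightarrow> s m 1 i j = block \<kappa> \<alpha> m 1 i j"
    and "j \<le> n \<Longrightarrow> hole \<kappa> \<alpha> i j \<Longrightarrow> s m 0 i j = 0"
    and "j \<le> n \<Longrightarrow> hole \<kappa> \<alpha> i j \<Longrightarrow> s m (- 1) i j = 0"
    and "j + 1 \<le> n \<Longrightarrow> hole \<kappa> \<alpha> i j \<Longrightarrow> s m 1 i j = 0"
  using assms unfolding good_def by blast+

context block_local
begin

abbreviation "bl \<equiv> block \<kappa> \<alpha>"
abbreviation "hol \<equiv> hole \<kappa> \<alpha>"

lemma yx: "\<not> hol a 1 \<Longrightarrow> \<not> hol k (- 1) \<Longrightarrow> s k (- 1) a 1 = bl k (- 1) a 1"
  using local_pair[of a k] skew[of k "- 1" a 1] block_skew[of \<kappa> \<alpha> k "- 1" a 1] by simp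

lemma good_1: "good \<kappa> \<alpha> 1 s"
  unfolding good_def
proof (intro conjI allI impI)
  fix j m i :: int
  assume *: "1 \<le> j \<and> j \<le> 1 \<and> hole \<kappa> \<alpha> i j"
  then have "j = 1" by simp
  then show "s m 0 i j = 0" "s m (- 1) i j = 0" using * local_hole[of 1 i m] by auto
next
  fix j m i :: int
  assume *: "1 \<le> j \<and> j \<le> 1 \<and> \<not> hol i j \<and> \<not> hol (m + i) j"
  then have "j = 1" by simp
  then show "s m 0 i j = bl m 0 i j" using * local_act[of 1 i m] by auto
next
  fix j m i :: int
  assume *: "1 \<le> j \<and> j \<le> 1 \<and> \<not> hol m (- 1) \<and> \<not> hol i j \<and> \<not> hol (m + i) (j - 1)"
  then have "j = 1" by simp
  then show "s m (- 1) i j = bl m (- 1) i j" using * yx[of i m] by auto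
qed auto

lemma act0_skew: "s a 1 k 0 = - s k 0 a 1"
  using skew[of a 1 k 0] .

text \<open>By the Leibniz rule, column - 1 acts on a bracket of the columns 1 and n through
  brackets in columns up to n, which are known. So the product of a raising and a lowering constant
  agrees with the model, and only a common factor for each degree is undetermined.\<close>

lemma good_product:
  assumes good: "good \<kappa> \<alpha> n s" and n: "n \<ge> 1"
    and nh: "\<not> hol a 1" "\<not> hol (i - a) n" "\<not> hol k (- 1)" "\<not> hol (k + i) n"
  shows "s a 1 (i - a) n * s k (- 1) i (n + 1) = bl a 1 (i - a) n * bl k (- 1) i (n + 1)"
proof -
  define b where "b = i - a"
  have i: "a + b = i" "k + a + b = k + i" by (simp_all add: b_def)
  have "s a 1 b n * s k (- 1) i (n + 1) = s k (- 1) a 1 * s (k + a) 0 b n + s k (- 1) b n * s a 1 (k + b) (n - 1)"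
    using leibniz[of a 1 b n k "- 1"] i by (simp add: add.commute)
  moreover have "bl a 1 b n * bl k (- 1) i (n + 1) = bl k (- 1) a 1 * bl (k + a) 0 b n + bl k (- 1) b n * bl a 1 (k + b) (n - 1)"
    using block_jacobi[of \<kappa> \<alpha> a 1 b n k "- 1"] i by (simp add: add.commute)
  moreover have "s k (- 1) a 1 = bl k (- 1) a 1" by (rule yx) (use nh in auto)
  moreover have "s (k + a) 0 b n = bl (k + a) 0 b n"
    by (rule goodD(1)[OF good n]) (use nh i in \<open>auto simp: b_def\<close>)
  moreover have "s k (- 1) b n * s a 1 (k + b) (n - 1) = bl k (- 1) b n * bl a 1 (k + b) (n - 1)"
  proof (cases "hol (k + b) (n - 1)")
    case True
    then have n2: "n - 1 \<ge> 1" using n no_hole_0[of \<kappa> \<alpha>] by (cases "n = 1") auto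
    then have "s a 1 (k + b) (n - 1) = 0" by (intro goodD(6)[OF good n2]) (use True in auto)
    then show ?thesis using block_through_hole[of \<kappa> \<alpha> k b "- 1" n a 1] True by simp
  next
    case False
    have "s k (- 1) b n = bl k (- 1) b n"
      by (rule goodD(2)[OF good n]) (use nh False in \<open>auto simp: b_def\<close>)
    moreover have "s a 1 (k + b) (n - 1) = bl a 1 (k + b) (n - 1)"
    proof (cases "n = 1")
      case True
      have "s (k + b) 0 a 1 = bl (k + b) 0 a 1"
        by (rule local_act) (use nh True i in \<open>auto simp: b_def add_ac\<close>)
      then show ?thesis using True act0_skew block_skew[of \<kappa> \<alpha> a 1 "k + b" 0] by simp
    next
      case False
      then have n2: "n - 1 \<ge> 1" using n by simp
      have e: "a + (k + b) = k + i" using i by simp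
      have "\<not> hol (a + (k + b)) (n - 1 + 1)" unfolding e using nh by simp
      then show ?thesis by (intro goodD(3)[OF good n2]) (use nh \<open>\<not> hol (k + b) (n - 1)\<close> in auto)
    qed
    ultimately show ?thesis by simp
  qed
  ultimately show ?thesis by (simp add: b_def)
qed

lemma good_column_hole:
  assumes good: "good \<kappa> \<alpha> n s" and n: "n \<ge> 1" and \<kappa>: "\<kappa> \<noteq> 1" and h: "hol i (n + 1)"
  shows "s k (- 1) i (n + 1) = 0"
proof (cases "(i, n + 1) \<in> S")
  case True
  then obtain a where a: "s a 1 (i - a) n \<noteq> 0"
  proof -
    have "1 \<le> nat n" "int (nat n) = n" using n by linarith+
    then show thesis
      using column_generated[of i 1 "nat n"] True that by (auto simp: add.commute)
  qed
  have "of_int n \<noteq> (0::'a)" using n by simp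
  \<comment> \<open>For n \<ge> 1 a hole in column n + 1 excludes \<kappa> = 2, - 1, - 2, so the
    columns 1 and - 1 contain no holes.\<close>
  have \<kappa>12: "\<kappa> * of_int (n + 1) = 1 \<or> \<kappa> * of_int (n + 1) = 2" using h by (auto simp: hole_def)
  have "\<kappa> \<noteq> 2"
  proof
    assume "\<kappa> = 2"
    then have "of_int (2 * (n + 1)) = (of_int 1 :: 'a) \<or> of_int (2 * (n + 1)) = (of_int 2 :: 'a)"
      using \<kappa>12 by auto
    then show False using n unfolding of_int_eq_iff by auto
  qed
  moreover have "\<kappa> \<notin> {- 1, - 2}"
  proof
    assume "\<kappa> \<in> {- 1, - 2}"
    then obtain c :: int where c: "\<kappa> = of_int (- c)" "c > 0" by (auto intro: that[of 1] that[of 2])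
    then have "of_int (- c * (n + 1)) = (of_int 1 :: 'a) \<or> of_int (- c * (n + 1)) = (of_int 2 :: 'a)"
      using \<kappa>12 by auto
    moreover have "- c * (n + 1) < 0" using c n by (simp add: mult_neg_pos)
    ultimately show False unfolding of_int_eq_iff by auto
  qed
  ultimately have nh: "\<not> hol a 1" "\<not> hol k (- 1)" using \<kappa> no_hole_1 hole_minus1 by blast+
  have "\<not> hol i' n" for i' using adjacent_holes[OF \<kappa> n] h by blast
  then have "s a 1 (i - a) n * s k (- 1) i (n + 1) = bl a 1 (i - a) n * bl k (- 1) i (n + 1)"
    using good_product[OF good n nh(1) _ nh(2)] by blast
  moreover have "bl a 1 (i - a) n * bl k (- 1) i (n + 1) = 0"
    using block_through_hole[of \<kappa> \<alpha> a "i - a" 1 n k "- 1"] h by (simp add: add.commute)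
  ultimately show ?thesis using a by simp
qed (use supp_zero in blast)

text \<open>The number \<open>c i\<close> is the factor left open by \<open>good_product\<close>.
  Once it is divided out, vanishing in column n + 1 is tested by applying column - 1, which detects
  every degree that is not a hole (\<open>detect\<close>).\<close>

lemma good_step:
  assumes good: "good \<kappa> \<alpha> n s" and n: "n \<ge> 1" and \<kappa>: "\<kappa> \<noteq> 1"
  obtains t where "\<And>i j. t i j \<noteq> 0" "\<And>i j. j \<le> n \<Longrightarrow> t i j = 1" "good \<kappa> \<alpha> (n + 1) (resc t s)"
proof -
  have "\<exists>c. c \<noteq> 0 \<and> (\<not> hol i (n + 1) \<longrightarrow>
      (\<forall>a. \<not> hol a 1 \<longrightarrow> \<not> hol (i - a) n \<longrightarrow> s a 1 (i - a) n / c = bl a 1 (i - a) n) \<and>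
      (\<forall>k. \<not> hol k (- 1) \<longrightarrow> \<not> hol (k + i) n \<longrightarrow> s k (- 1) i (n + 1) * c = bl k (- 1) i (n + 1)))" for i
  proof (cases "hol i (n + 1)")
    case False
    obtain a where a: "\<not> hol a 1" "\<not> hol (i - a) n" "bl a 1 (i - a) n \<noteq> 0"
      using choose_x[OF \<kappa> n False finite.emptyI] by blast
    obtain k where k: "\<not> hol k (- 1)" "\<not> hol (k + i) n" "bl k (- 1) i (n + 1) \<noteq> 0"
      using choose_y[of "n + 1" \<kappa> \<alpha> i] n False by auto
    have p: "s a 1 (i - a) n * s k (- 1) i (n + 1) = bl a 1 (i - a) n * bl k (- 1) i (n + 1)"
      using good_product[OF good n a(1,2) k(1,2)] .
    then have nz: "s a 1 (i - a) n \<noteq> 0" "s k (- 1) i (n + 1) \<noteq> 0" using a k by auto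
    define c where "c = s a 1 (i - a) n / bl a 1 (i - a) n"
    have c: "c \<noteq> 0" using nz a by (simp add: c_def)
    have 1: "s k' (- 1) i (n + 1) * c = bl k' (- 1) i (n + 1)" if "\<not> hol k' (- 1)" "\<not> hol (k' + i) n" for k'
      using good_product[OF good n a(1,2) that] a by (simp add: c_def field_simps)
    have 2: "s a' 1 (i - a') n / c = bl a' 1 (i - a') n" if "\<not> hol a' 1" "\<not> hol (i - a') n" for a'
    proof -
      have "s a' 1 (i - a') n * s k (- 1) i (n + 1) = bl a' 1 (i - a') n * (s k (- 1) i (n + 1) * c)"
        using good_product[OF good n that k(1,2)] 1[OF k(1,2)] by simp
      also have "\<dots> = (bl a' 1 (i - a') n * c) * s k (- 1) i (n + 1)" by simp
      finally have "s a' 1 (i - a') n = bl a' 1 (i - a') n * c" using nz(2) by (simp only: mult_cancel_right simp_thms)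
      then show ?thesis using c by simp
    qed
    show ?thesis using c 1 2 by blast
  qed (auto intro: exI[of _ 1])
  then obtain c where c0: "\<And>i. c i \<noteq> 0" and
    cx: "\<And>i a. \<not> hol i (n + 1) \<Longrightarrow> \<not> hol a 1 \<Longrightarrow> \<not> hol (i - a) n \<Longrightarrow> s a 1 (i - a) n / c i = bl a 1 (i - a) n" and
    cy: "\<And>i k. \<not> hol i (n + 1) \<Longrightarrow> \<not> hol k (- 1) \<Longrightarrow> \<not> hol (k + i) n \<Longrightarrow> s k (- 1) i (n + 1) * c i = bl k (- 1) i (n + 1)"
    by metis
  define t where "t i j = (if j = n + 1 then c i else 1)" for i j
  have t: "t i j \<noteq> 0" "j \<le> n \<Longrightarrow> t i j = 1" for i j using c0 by (auto simp: t_def)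
  define r where "r = resc t s"
  interpret R: zz_algebra r S \<alpha>
    unfolding r_def by (rule zz_resc) (use t n in auto)
  have low: "r i j k l = s i j k l" if "j \<le> n" "l \<le> n" "j + l \<le> n" for i j k l
    using that t by (simp add: r_def resc_def)
  have rx: "r a 1 b n = bl a 1 b n" if "\<not> hol (a + b) (n + 1)" "\<not> hol a 1" "\<not> hol b n" for a b
    using cx[of "a + b" a] that n by (simp add: r_def resc_def t_def add.commute)
  have ry: "r k (- 1) i (n + 1) = bl k (- 1) i (n + 1)"
    if "\<not> hol i (n + 1)" "\<not> hol k (- 1)" "\<not> hol (k + i) n" for k i
    using cy[of i k] that n by (simp add: r_def resc_def t_def)
  have yhole: "r k (- 1) i (n + 1) = 0" if "hol i (n + 1)" for k i
    using good_column_hole[OF good n \<kappa> that] by (simp add: r_def resc_def)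
  have detect: "\<exists>k. r k (- 1) i (n + 1) \<noteq> 0" if "\<not> hol i (n + 1)" for i
  proof -
    note nh = that
    obtain k where "\<not> hol k (- 1)" "\<not> hol (k + i) (n + 1 - 1)" "bl k (- 1) i (n + 1) \<noteq> 0"
      by (rule choose_y[of "n + 1" \<kappa> \<alpha> i]) (use n nh in auto)
    then show ?thesis using ry[OF nh, of k] by (intro exI[of _ k]) simp
  qed
  have lhole0: "r m 0 i (n + 1) = 0" if h: "hol i (n + 1)" and "m \<noteq> 0" for m i
  proof -
    have "\<not> hol (m + i) (n + 1)" using hole_unique[OF h] \<open>m \<noteq> 0\<close> by fastforce
    then obtain k where k: "r k (- 1) (m + i) (n + 1) \<noteq> 0" using detect by blast
    have "r m 0 i (n + 1) * r k (- 1) (m + i) (n + 1) = 0"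
      using R.leibniz[of m 0 i "n + 1" k "- 1"] yhole[OF h] by simp
    then show ?thesis using k by simp
  qed
  have lhole: "r m 0 i (n + 1) = 0" if h: "hol i (n + 1)" for m i
  proof (cases "m = 0")
    case True
    have "2 * r 0 0 i (n + 1) = 0"
      using witt_module.rel[OF R.witt_column, of 1 i "n + 1" "- 1"] lhole0[OF h, of 1] lhole0[OF h, of "- 1"]
      by simp
    then show ?thesis using True by simp
  qed (use lhole0[OF h] in simp)
  have xhole: "r a 1 i n = 0" if h: "hol i n" for a i
  proof -
    have "\<not> hol (a + i) (n + 1)" using adjacent_holes[OF \<kappa> n h] .
    then obtain k where k: "r k (- 1) (a + i) (n + 1) \<noteq> 0" using detect by blast
    have "r m 0 i n = 0" "r m (- 1) i n = 0" for m
      using goodD(4,5)[OF good n order_refl h] low n by simp_all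
    then have "r a 1 i n * r k (- 1) (a + i) (n + 1) = 0"
      using R.leibniz[of a 1 i n k "- 1"] by (simp add: add.commute)
    then show ?thesis using k by simp
  qed
  have lact: "r m 0 i (n + 1) = bl m 0 i (n + 1)" if nh: "\<not> hol i (n + 1)" "\<not> hol (m + i) (n + 1)" for m i
  proof -
    have fin: "finite ({a. hol (m + a) 1} \<union> {a. hol (m + i - a) n})"
      using finite_hole[of "\<lambda>a. m + a" \<kappa> \<alpha> 1] finite_hole[of "\<lambda>a. m + i - a" \<kappa> \<alpha> n] by (simp add: inj_def)
    obtain a where a: "\<not> hol (m + a) 1" "\<not> hol (m + i - a) n"
      "\<not> hol a 1" "\<not> hol (i - a) n" "bl a 1 (i - a) n \<noteq> 0"
      by (rule choose_x[OF \<kappa> n nh(1) fin]) blast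
    define b where "b = i - a"
    have b: "a + b = i" "m + (a + b) = m + i" "m + i - a = m + b" by (simp_all add: b_def)
    have "r a 1 b n * r m 0 i (n + 1) = r m 0 a 1 * r (m + a) 1 b n + r m 0 b n * r a 1 (m + b) n"
      using R.leibniz[of a 1 b n m 0] b by (simp add: add.commute)
    moreover have "bl a 1 b n * bl m 0 i (n + 1) = bl m 0 a 1 * bl (m + a) 1 b n + bl m 0 b n * bl a 1 (m + b) n"
      using block_jacobi[of \<kappa> \<alpha> a 1 b n m 0] b by (simp add: add.commute)
    moreover have "r a 1 b n = bl a 1 b n" by (rule rx) (use nh a b in \<open>auto simp: b_def\<close>)
    moreover have "r (m + a) 1 b n = bl (m + a) 1 b n" by (rule rx) (use nh a b in \<open>auto simp: b_def add.assoc\<close>)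
    moreover have "r a 1 (m + b) n = bl a 1 (m + b) n" by (rule rx) (use nh a b in \<open>auto simp: add.left_commute\<close>)
    moreover have "r m 0 a 1 = bl m 0 a 1"
      using low[of 0 1 m a] n local_act[of 1 a m] a by simp
    moreover have "r m 0 b n = bl m 0 b n"
      using low[of 0 n m b] n goodD(1)[OF good n order_refl, of b m] a b by (simp add: b_def)
    ultimately have "bl a 1 b n * r m 0 i (n + 1) = bl a 1 b n * bl m 0 i (n + 1)" by simp
    then show ?thesis using a(5) by (simp add: b_def)
  qed
  have "good \<kappa> \<alpha> (n + 1) r"
    unfolding good_def
  proof (intro conjI allI impI)
    fix j m i
    assume *: "1 \<le> j \<and> j \<le> n + 1 \<and> \<not> hol i j \<and> \<not> hol (m + i) j"
    show "r m 0 i j = bl m 0 i j"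
      using lact[of i m] goodD(1)[OF good, of j i m] low[of 0 j m i] * n by (cases "j = n + 1") auto
  next
    fix j k i
    assume *: "1 \<le> j \<and> j \<le> n + 1 \<and> \<not> hol k (- 1) \<and> \<not> hol i j \<and> \<not> hol (k + i) (j - 1)"
    show "r k (- 1) i j = bl k (- 1) i j"
      using ry[of i k] goodD(2)[OF good, of j k i] low[of "- 1" j k i] * n by (cases "j = n + 1") auto
  next
    fix j a i
    assume *: "1 \<le> j \<and> j + 1 \<le> n + 1 \<and> \<not> hol a 1 \<and> \<not> hol i j \<and> \<not> hol (a + i) (j + 1)"
    show "r a 1 i j = bl a 1 i j"
      using rx[of a i] goodD(3)[OF good, of j a i] low[of 1 j a i] * n by (cases "j = n") auto
  next
    fix j m i
    assume *: "1 \<le> j \<and> j \<le> n + 1 \<and> hol i j"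
    show "r m 0 i j = 0"
      using lhole[of i m] goodD(4)[OF good, of j i m] low[of 0 j m i] * n by (cases "j = n + 1") auto
    show "r m (- 1) i j = 0"
      using yhole[of i m] goodD(5)[OF good, of j i m] low[of "- 1" j m i] * n by (cases "j = n + 1") auto
  next
    fix j a i
    assume *: "1 \<le> j \<and> j + 1 \<le> n + 1 \<and> hol i j"
    show "r a 1 i j = 0"
      using xhole[of i a] goodD(6)[OF good, of j i a] low[of 1 j a i] * n by (cases "j = n") auto
  qed
  then show thesis using that[of t] t unfolding r_def by blast
qed

lemma block_local_resc:
  assumes t: "\<And>i j. t i j \<noteq> 0" "\<And>i j. \<bar>j\<bar> \<le> 1 \<Longrightarrow> t i j = 1"
  shows "block_local (resc t s) S \<alpha> \<kappa>"
proof (intro block_local.intro zz_resc block_local_axioms.intro)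
  fix i j m e :: int
  assume e: "e = 1 \<or> e = - 1"
  then have low: "resc t s m 0 i e = s m 0 i e" "resc t s j (- e) i e = s j (- e) i e"
    using t(2) by (auto simp: resc_def)
  show "\<not> hol i e \<Longrightarrow> \<not> hol (m + i) e \<Longrightarrow> resc t s m 0 i e = bl m 0 i e"
    using e local_act low by simp
  show "hol i e \<Longrightarrow> resc t s m 0 i e = 0" "hol i e \<Longrightarrow> resc t s j (- e) i e = 0"
    using e local_hole low by auto
qed (use t local_pair in \<open>simp_all add: resc_def\<close>)

text \<open>Each step rescales one further column and keeps the previous ones, so the sequence of
  scalings \<open>f n\<close> is eventually constant on every column. The limit \<open>t\<close>
  takes its value on column j from stage \<open>nat j\<close>, where it is already final.\<close>

lemma positive_columns:
  assumes \<kappa>: "\<kappa> \<noteq> 1"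
  obtains t where "\<And>i j. t i j \<noteq> 0" "\<And>i j. j \<le> 1 \<Longrightarrow> t i j = 1" "\<And>n. good \<kappa> \<alpha> n (resc t s)"
proof -
  define P where "P n t \<longleftrightarrow> (\<forall>i j. t i j \<noteq> 0) \<and> (\<forall>i j. j \<le> 1 \<longrightarrow> t i j = 1) \<and> good \<kappa> \<alpha> (int n + 1) (resc t s)" for n t
  define Q where "Q n t t' \<longleftrightarrow> (\<forall>i j. j \<le> int n + 1 \<longrightarrow> t' i j = t i j)"
    for n and t t' :: "int \<Rightarrow> int \<Rightarrow> 'a"
  have one: "resc (\<lambda>_ _. 1) s = s" by (simp add: resc_def fun_eq_iff)
  have "\<exists>f. \<forall>n. P n (f n) \<and> Q n (f n) (f (Suc n))"
  proof (rule dependent_nat_choice)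
    show "\<exists>t. P 0 t" unfolding P_def by (intro exI[of _ "\<lambda>_ _. 1"]) (simp add: good_1 one)
  next
    fix t n
    assume P: "P n t"
    interpret R: block_local "resc t s" S \<alpha> \<kappa>
      by (rule block_local_resc) (use P in \<open>auto simp: P_def\<close>)
    obtain t' where t': "\<And>i j. t' i j \<noteq> 0" "\<And>i j. j \<le> int n + 1 \<Longrightarrow> t' i j = 1"
      "good \<kappa> \<alpha> (int n + 1 + 1) (resc t' (resc t s))"
      using R.good_step[of "int n + 1"] P \<kappa> unfolding P_def by auto
    have "resc t' (resc t s) = resc (\<lambda>i j. t i j * t' i j) s"
      by (simp add: resc_def fun_eq_iff mult_ac)
    then show "\<exists>t'. P (Suc n) t' \<and> Q n t t'"
      using P t' unfolding P_def Q_def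
      by (intro exI[of _ "\<lambda>i j. t i j * t' i j"]) (simp add: add_ac)
  qed
  then obtain f where f: "\<And>n. P n (f n)" "\<And>n. Q n (f n) (f (Suc n))" by blast
  define t where "t i j = f (nat j) i j" for i j
  have stable: "f (n + d) i j = f n i j" if "j \<le> int n + 1" for n d i j
  proof (induction d)
    case (Suc d)
    then show ?case using f(2)[of "n + d"] that by (simp add: Q_def)
  qed simp
  have tf: "t i j = f n i j" if "j \<le> int n" for i j n
  proof -
    have "n = nat j + (n - nat j)" using that by simp
    then show ?thesis using stable[of j "nat j" "n - nat j" i] by (simp add: t_def)
  qed
  have agree: "resc t s i j k l = resc (f n) s i j k l" if "j \<le> int n" "l \<le> int n" "j + l \<le> int n" for i j k l n
    using tf that by (simp add: resc_def)
  have "good \<kappa> \<alpha> n (resc t s)" for n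
  proof -
    define N where "N = nat n"
    have N: "n \<le> int N" by (simp add: N_def)
    have g: "good \<kappa> \<alpha> (int N + 1) (resc (f N) s)" using f(1)[of N] by (simp add: P_def)
    show ?thesis
      unfolding good_def
    proof (intro conjI allI impI)
      fix j m i
      assume *: "1 \<le> j \<and> j \<le> n \<and> \<not> hol i j \<and> \<not> hol (m + i) j"
      show "resc t s m 0 i j = bl m 0 i j"
        using agree[of 0 N j m i] goodD(1)[OF g, of j i m] * N by auto
    next
      fix j k i
      assume *: "1 \<le> j \<and> j \<le> n \<and> \<not> hol k (- 1) \<and> \<not> hol i j \<and> \<not> hol (k + i) (j - 1)"
      show "resc t s k (- 1) i j = bl k (- 1) i j"
        using agree[of "- 1" N j k i] goodD(2)[OF g, of j k i] * N by auto
    next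
      fix j a i
      assume *: "1 \<le> j \<and> j + 1 \<le> n \<and> \<not> hol a 1 \<and> \<not> hol i j \<and> \<not> hol (a + i) (j + 1)"
      show "resc t s a 1 i j = bl a 1 i j"
        using agree[of 1 N j a i] goodD(3)[OF g, of j a i] * N by auto
    next
      fix j m i
      assume *: "1 \<le> j \<and> j \<le> n \<and> hol i j"
      show "resc t s m 0 i j = 0"
        using agree[of 0 N j m i] goodD(4)[OF g, of j i m] * N by auto
      show "resc t s m (- 1) i j = 0"
        using agree[of "- 1" N j m i] goodD(5)[OF g, of j i m] * N by auto
    next
      fix j a i
      assume *: "1 \<le> j \<and> j + 1 \<le> n \<and> hol i j"
      show "resc t s a 1 i j = 0"
        using agree[of 1 N j a i] goodD(6)[OF g, of j i a] * N by auto
    qed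
  qed
  moreover have "t i j \<noteq> 0" "j \<le> 1 \<Longrightarrow> t i j = 1" for i j
    using f(1)[of "nat j"] by (auto simp: t_def P_def)
  ultimately show thesis using that by blast
qed

end


section \<open>All brackets for \<open>\<kappa> \<noteq> \<plusminus>1\<close>\<close>

text \<open>\<open>f p\<close> stands for the component at the hole \<open>(h, h')\<close> of the bracket of the basis vectors of
  degrees \<open>p\<close> and \<open>(h, h') - p\<close>.\<close>

definition cocyc :: "'f::field_char_0 \<Rightarrow> 'f \<Rightarrow> int \<Rightarrow> int \<Rightarrow> (int \<Rightarrow> int \<Rightarrow> 'f) \<Rightarrow> bool" where
  "cocyc \<kappa> \<alpha> h h' f \<longleftrightarrow> (\<forall>i j. f (h - i) (h' - j) = - f i j) \<and>
    (\<forall>i j k l. \<not> hole \<kappa> \<alpha> i j \<and> \<not> hole \<kappa> \<alpha> k l \<and> \<not> hole \<kappa> \<alpha> (i + k) (j + l) \<and> \<not> hole \<kappa> \<alpha> (h - i) (h' - j)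
      \<and> \<not> hole \<kappa> \<alpha> (h - k) (h' - l) \<and> \<not> hole \<kappa> \<alpha> (h - i - k) (h' - j - l) \<longrightarrow>
      block \<kappa> \<alpha> k l (h - i - k) (h' - j - l) * f i j
        = block \<kappa> \<alpha> i j k l * f (i + k) (j + l) + block \<kappa> \<alpha> i j (h - i - k) (h' - j - l) * f k l)"

lemma cocycD:
  assumes "cocyc \<kappa> \<alpha> h h' f"
  shows "f (h - i) (h' - j) = - f i j"
    and "\<not> hole \<kappa> \<alpha> i j \<Longrightarrow> \<not> hole \<kappa> \<alpha> k l \<Longrightarrow> \<not> hole \<kappa> \<alpha> (i + k) (j + l) \<Longrightarrow> \<not> hole \<kappa> \<alpha> (h - i) (h' - j)
      \<Longrightarrow> \<not> hole \<kappa> \<alpha> (h - k) (h' - l) \<Longrightarrow> \<not> hole \<kappa> \<alpha> (h - i - k) (h' - j - l) \<Longrightarrow>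
      block \<kappa> \<alpha> k l (h - i - k) (h' - j - l) * f i j
        = block \<kappa> \<alpha> i j k l * f (i + k) (j + l) + block \<kappa> \<alpha> i j (h - i - k) (h' - j - l) * f k l"
  using assms unfolding cocyc_def by blast+

lemma cocyc_flip:
  assumes "cocyc \<kappa> \<alpha> h h' f"
  shows "cocyc (- \<kappa>) (- \<alpha>) h (- h') (\<lambda>i j. f i (- j))"
  unfolding cocyc_def hole_flip block_flip
proof (intro conjI allI impI; (elim conjE)?)
  show "f (h - i) (- (- h' - j)) = - f i (- j)" for i j
    using cocycD(1)[OF assms, of i "- j"] by (simp add: add.commute)
  fix i j k l
  assume "\<not> hole \<kappa> \<alpha> i (- j)" "\<not> hole \<kappa> \<alpha> k (- l)" "\<not> hole \<kappa> \<alpha> (i + k) (- (j + l))"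
    "\<not> hole \<kappa> \<alpha> (h - i) (- (- h' - j))" "\<not> hole \<kappa> \<alpha> (h - k) (- (- h' - l))"
    "\<not> hole \<kappa> \<alpha> (h - i - k) (- (- h' - j - l))"
  moreover have "- (j + l) = - j + - l" "- (- h' - j) = h' - - j" "- (- h' - l) = h' - - l"
    "- (- h' - j - l) = h' - - j - - l" by auto
  ultimately show "block \<kappa> \<alpha> k (- l) (h - i - k) (- (- h' - j - l)) * f i (- j) =
       block \<kappa> \<alpha> i (- j) k (- l) * f (i + k) (- (j + l)) +
       block \<kappa> \<alpha> i (- j) (h - i - k) (- (- h' - j - l)) * f k (- l)"
    using cocycD(2)[OF assms, of i "- j" k "- l"] by (simp only: simp_thms)
qed

lemma cocyc_diff: "cocyc \<kappa> \<alpha> h h' f \<Longrightarrow> cocyc \<kappa> \<alpha> h h' g \<Longrightarrow> cocyc \<kappa> \<alpha> h h' (\<lambda>i j. f i j - g i j)"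
  unfolding cocyc_def by (simp add: right_diff_distrib)

definition hole1 :: "'f::field_char_0 \<Rightarrow> 'f \<Rightarrow> int \<Rightarrow> int \<Rightarrow> bool" where
  "hole1 \<kappa> \<alpha> i j \<longleftrightarrow> \<kappa> * of_int j = 1 \<and> \<kappa> * of_int i = - \<alpha>"

definition hole2 :: "'f::field_char_0 \<Rightarrow> 'f \<Rightarrow> int \<Rightarrow> int \<Rightarrow> bool" where
  "hole2 \<kappa> \<alpha> i j \<longleftrightarrow> \<kappa> * of_int j = 2 \<and> \<kappa> * of_int i = - 2 * \<alpha>"

lemma hole_iff: "hole \<kappa> \<alpha> i j \<longleftrightarrow> hole1 \<kappa> \<alpha> i j \<or> hole2 \<kappa> \<alpha> i j"
  by (simp add: hole_def hole1_def hole2_def)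

lemma hole12_flip:
  "hole1 (- \<kappa>) (- \<alpha>) i j = hole1 \<kappa> \<alpha> i (- j)" "hole2 (- \<kappa>) (- \<alpha>) i j = hole2 \<kappa> \<alpha> i (- j)"
proof -
  have e: "- x = y \<longleftrightarrow> x = - y" for x y :: 'a by auto
  show "hole1 (- \<kappa>) (- \<alpha>) i j = hole1 \<kappa> \<alpha> i (- j)" "hole2 (- \<kappa>) (- \<alpha>) i j = hole2 \<kappa> \<alpha> i (- j)"
    by (simp_all add: hole1_def hole2_def e)
qed

lemma hole_coordinates:
  assumes "hole \<kappa> \<alpha> h h'"
  shows "\<kappa> \<noteq> 0" "of_int h = - \<alpha> * of_int h'"
proof -
  show \<kappa>: "\<kappa> \<noteq> 0" using assms by (auto simp: hole_def)
  have "\<kappa> * of_int h = - \<alpha> * (\<kappa> * of_int h')" using assms by (auto simp: hole_def)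
  then have "\<kappa> * of_int h = \<kappa> * (- \<alpha> * of_int h')" by (simp only: mult.left_commute)
  then show "of_int h = - \<alpha> * of_int h'" using \<kappa> by (simp only: mult_cancel_left simp_thms)
qed

text \<open>This linear form is the coefficient of \<open>C1\<close> in \<open>B_br\<close>, in the
  scaling of \<open>block\<close>.\<close>

lemma cocyc_linear1:
  assumes "hole1 \<kappa> \<alpha> h h'"
  shows "cocyc \<kappa> \<alpha> h h' (\<lambda>i j. c * (\<alpha> * of_int j + of_int i))"
  unfolding cocyc_def
proof (intro conjI allI impI)
  have h: "of_int h = - \<alpha> * of_int h'" "\<kappa> * of_int h' = 1"
    using assms hole_coordinates[of \<kappa> \<alpha> h h'] by (auto simp: hole_iff hole1_def)
  show "c * (\<alpha> * of_int (h' - j) + of_int (h - i)) = - (c * (\<alpha> * of_int j + of_int i))" for i j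
    by (simp add: h algebra_simps)
  show "block \<kappa> \<alpha> k l (h - i - k) (h' - j - l) * (c * (\<alpha> * of_int j + of_int i)) =
       block \<kappa> \<alpha> i j k l * (c * (\<alpha> * of_int (j + l) + of_int (i + k))) +
       block \<kappa> \<alpha> i j (h - i - k) (h' - j - l) * (c * (\<alpha> * of_int l + of_int k))" for i j k l
    unfolding block_def of_int_add of_int_diff of_int_mult h(1) by (simp add: algebra_simps)
qed

text \<open>The additional form \<alpha> + \<kappa> * i satisfies the identity up to a multiple of
  \<kappa> * h' - 2, which is zero at the second hole. The two forms correspond to the parameters a2
  and a2'.\<close>

lemma cocyc_linear2:
  assumes "hole2 \<kappa> \<alpha> h h'"
  shows "cocyc \<kappa> \<alpha> h h' (\<lambda>i j. c * (\<alpha> * of_int j + of_int i) + c' * (\<alpha> + \<kappa> * of_int i))"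
  unfolding cocyc_def
proof (intro conjI allI impI)
  have h: "of_int h = - \<alpha> * of_int h'" "\<kappa> * of_int h' = 2"
    using assms hole_coordinates[of \<kappa> \<alpha> h h'] by (auto simp: hole_iff hole2_def)
  show "c * (\<alpha> * of_int (h' - j) + of_int (h - i)) + c' * (\<alpha> + \<kappa> * of_int (h - i))
      = - (c * (\<alpha> * of_int j + of_int i) + c' * (\<alpha> + \<kappa> * of_int i))" for i j
    using h(2) unfolding of_int_diff h(1) by (simp add: algebra_simps)
  show "block \<kappa> \<alpha> k l (h - i - k) (h' - j - l) * (c * (\<alpha> * of_int j + of_int i) + c' * (\<alpha> + \<kappa> * of_int i)) =
       block \<kappa> \<alpha> i j k l * (c * (\<alpha> * of_int (j + l) + of_int (i + k)) + c' * (\<alpha> + \<kappa> * of_int (i + k))) +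
       block \<kappa> \<alpha> i j (h - i - k) (h' - j - l) * (c * (\<alpha> * of_int l + of_int k) + c' * (\<alpha> + \<kappa> * of_int k))" for i j k l
  proof -
    have "block \<kappa> \<alpha> k l (h - i - k) (h' - j - l) * (c * (\<alpha> * of_int j + of_int i) + c' * (\<alpha> + \<kappa> * of_int i)) =
       block \<kappa> \<alpha> i j k l * (c * (\<alpha> * of_int (j + l) + of_int (i + k)) + c' * (\<alpha> + \<kappa> * of_int (i + k))) +
       block \<kappa> \<alpha> i j (h - i - k) (h' - j - l) * (c * (\<alpha> * of_int l + of_int k) + c' * (\<alpha> + \<kappa> * of_int k))
       + (\<kappa> * of_int h' - 2) * (c' * \<alpha> * block \<kappa> \<alpha> i j k l)"
      unfolding block_def of_int_add of_int_diff of_int_mult h(1) by (simp add: algebra_simps)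
    then show ?thesis using h(2) by simp
  qed
qed

lemma hole_minus_act:
  assumes "hole \<kappa> \<alpha> h h'" "m \<noteq> 0"
  shows "\<not> hole \<kappa> \<alpha> (h - m) h'"
  using hole_unique[OF assms(1), of "h - m"] assms(2) by auto

lemma hole_minus_x:
  assumes "hole \<kappa> \<alpha> h h'" "\<kappa> \<noteq> 1" "\<kappa> \<noteq> - 1"
  shows "\<not> hole \<kappa> \<alpha> i (h' - 1)"
proof
  assume "hole \<kappa> \<alpha> i (h' - 1)"
  then have "\<kappa> * of_int h' - \<kappa> = 1 \<or> \<kappa> * of_int h' - \<kappa> = 2" "\<kappa> * of_int h' = 1 \<or> \<kappa> * of_int h' = 2" "\<kappa> \<noteq> 0"
    using assms by (auto simp: hole_def algebra_simps)
  then consider "1 - \<kappa> = 2" | "2 - \<kappa> = 1" by auto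
  then show False
  proof cases
    case 1
    then have "\<kappa> = 1 - 2" by (metis diff_diff_eq2 add_diff_cancel_left')
    then show False using assms by simp
  next
    case 2
    then have "\<kappa> = 2 - 1" by (metis diff_diff_eq2 add_diff_cancel_left')
    then show False using assms by simp
  qed
qed

text \<open>On column 0 the condition depends only on \<kappa> * h', which is 1 or 2. The first
  value gives the equation of \<open>quadratic_cocycle\<close>, the second that of
  \<open>affine_cocycle\<close>.\<close>

lemma cocyc_col0:
  assumes coc: "cocyc \<kappa> \<alpha> h h' f" and h: "hole \<kappa> \<alpha> h h'" and ij: "i \<noteq> 0" "j \<noteq> 0" "i + j \<noteq> 0"
  shows "(\<kappa> * of_int h' - 2) * of_int j * f i 0 - of_int i * f i 0
    = of_int (j - i) * f (i + j) 0 + ((\<kappa> * of_int h' - 2) * of_int i - of_int j) * f j 0"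
proof -
  note hc = hole_coordinates[OF h]
  have "block \<kappa> \<alpha> j 0 (h - i - j) h' * f i 0 = block \<kappa> \<alpha> i 0 j 0 * f (i + j) 0 + block \<kappa> \<alpha> i 0 (h - i - j) h' * f j 0"
    using cocycD(2)[OF coc, of i 0 j 0] no_hole_0[of \<kappa> \<alpha>] hole_minus_act[OF h ij(1)] hole_minus_act[OF h ij(2)]
      hole_minus_act[OF h ij(3)] by (simp add: diff_diff_eq)
  then show ?thesis
    unfolding block_def of_int_add of_int_diff of_int_mult hc(2) by (simp add: algebra_simps)
qed

lemma cocyc_x_equation:
  assumes coc: "cocyc \<kappa> \<alpha> h h' f" and h: "hole \<kappa> \<alpha> h h'" and \<kappa>: "\<kappa> \<noteq> 1" "\<kappa> \<noteq> - 1"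
    and nh: "\<not> hole \<kappa> \<alpha> i 1" "\<not> hole \<kappa> \<alpha> (m + i) 1" and m: "m \<noteq> 0"
  shows "((\<kappa> * of_int h' - 2) * of_int i + \<kappa> * of_int m - \<kappa> * of_int h - 2 * \<alpha> - of_int m) * f m 0
    = (\<alpha> + of_int i + (\<kappa> - 1) * of_int m) * f (m + i) 1
     - (\<alpha> + of_int i + (\<kappa> + 2 - \<kappa> * of_int h') * of_int m) * f i 1"
proof -
  note hc = hole_coordinates[OF h]
  have "block \<kappa> \<alpha> i 1 (h - m - i) (h' - 1) * f m 0
      = block \<kappa> \<alpha> m 0 i 1 * f (m + i) 1 + block \<kappa> \<alpha> m 0 (h - m - i) (h' - 1) * f i 1"
    using cocycD(2)[OF coc, of m 0 i 1] no_hole_0[of \<kappa> \<alpha>] nh hole_minus_act[OF h m] hole_minus_x[OF h \<kappa>]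
    by simp
  moreover have "block \<kappa> \<alpha> i 1 (h - m - i) (h' - 1)
      = (\<kappa> * of_int h' - 2) * of_int i + \<kappa> * of_int m - \<kappa> * of_int h - 2 * \<alpha> - of_int m"
    unfolding block_def of_int_add of_int_diff of_int_mult using hc(2) by (simp add: algebra_simps)
  moreover have "block \<kappa> \<alpha> m 0 i 1 = \<alpha> + of_int i + (\<kappa> - 1) * of_int m"
    by (simp add: block_def algebra_simps)
  moreover have "block \<kappa> \<alpha> m 0 (h - m - i) (h' - 1) = - (\<alpha> + of_int i + (\<kappa> + 2 - \<kappa> * of_int h') * of_int m)"
    unfolding block_def of_int_add of_int_diff of_int_mult using hc(2) by (simp add: algebra_simps)
  ultimately show ?thesis by (simp only: mult_minus_left add_uminus_conv_diff)
qed

text \<open>A quadratic term on column 0 does not extend to column 1: the equations for (m, i) and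
  (- m, m + i) eliminate f (m + i) 1, and m = 1, 2 give 6 * c * \<kappa> * (\<kappa> - 1) = 0. The
  same relation then gives f i 1 = 0 unless \<kappa> = 1/2.\<close>

lemma cocyc_hole1_x:
  fixes \<kappa> :: "'f::field_char_0"
  assumes coc: "cocyc \<kappa> \<alpha> h h' f" and h: "hole1 \<kappa> \<alpha> h h'" and \<kappa>: "\<kappa> \<noteq> 1" "\<kappa> \<noteq> - 1"
    and f: "\<And>m. m \<noteq> 0 \<Longrightarrow> f m 0 = c * of_int m ^ 2"
  shows "c = 0" "f i 1 = 0"
proof -
  have hh: "hole \<kappa> \<alpha> h h'" using h by (simp add: hole_iff)
  have kh: "\<kappa> * of_int h' = 1" "\<kappa> * of_int h = - \<alpha>" using h by (auto simp: hole1_def)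
  have "\<kappa> \<noteq> 2"
  proof
    assume "\<kappa> = 2"
    then have "of_int (2 * h') = (of_int 1 :: 'f)" using kh by simp
    then have "2 * h' = 1" by (simp only: of_int_eq_iff)
    then show False by presburger
  qed
  then have nh: "\<not> hole \<kappa> \<alpha> i 1" for i using no_hole_1 \<kappa> by blast
  have eq: "(- \<alpha> - of_int i + (\<kappa> - 1) * of_int m) * (c * of_int m ^ 2)
      = (\<alpha> + of_int i + (\<kappa> - 1) * of_int m) * f (m + i) 1 - (\<alpha> + of_int i + (\<kappa> + 1) * of_int m) * f i 1"
    if "m \<noteq> 0" for i m
    using cocyc_x_equation[OF coc hh \<kappa> nh nh that, of i] f[OF that] unfolding kh by (simp add: algebra_simps)
  have key': "of_int m ^ 2 * ((4 * \<kappa> - 2) * f i 1 + c * (2 * (\<alpha> + of_int i) ^ 2 + 2 * \<kappa> * (\<kappa> - 1) * of_int m ^ 2)) = 0"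
    if "m \<noteq> 0" for i m
  proof -
    have "(- \<alpha> - (of_int m + of_int i) - (\<kappa> - 1) * of_int m) * (c * of_int m ^ 2)
      = (\<alpha> + (of_int m + of_int i) - (\<kappa> - 1) * of_int m) * f i 1
        - (\<alpha> + (of_int m + of_int i) - (\<kappa> + 1) * of_int m) * f (m + i) 1"
      using eq[of "- m" "m + i"] that by simp
    with eq[OF that, of i] show ?thesis by algebra
  qed
  have key: "(4 * \<kappa> - 2) * f i 1 + c * (2 * (\<alpha> + of_int i) ^ 2 + 2 * \<kappa> * (\<kappa> - 1) * of_int m ^ 2) = 0"
    if "m \<noteq> 0" for i m
    using key'[OF that, of i] that unfolding mult_eq_0_iff by simp
  have k12: "(4 * \<kappa> - 2) * f i 1 + c * (2 * (\<alpha> + of_int i) ^ 2 + 2 * \<kappa> * (\<kappa> - 1) * 1) = 0"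
    "(4 * \<kappa> - 2) * f i 1 + c * (2 * (\<alpha> + of_int i) ^ 2 + 2 * \<kappa> * (\<kappa> - 1) * 4) = 0" for i
    using key[of 1 i] key[of 2 i] by simp_all
  have "6 * (c * \<kappa> * (\<kappa> - 1)) = 0" using k12(1)[of 0] k12(2)[of 0] by algebra
  then show c: "c = 0" using \<kappa> hole_coordinates(1)[OF hh] by simp
  show "f i 1 = 0"
  proof (cases "4 * \<kappa> - 2 = 0")
    case False
    then show ?thesis using key[of 1 i] c by simp
  next
    case True
    then have "\<kappa> * 2 = 1" by (simp add: mult.commute)
    have "\<kappa> * of_int h' = \<kappa> * 2" using kh \<open>\<kappa> * 2 = 1\<close> by simp
    then have "of_int h' = (of_int 2 :: 'f)" using hole_coordinates(1)[OF hh] by simp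
    then have h': "h' = 2" by (simp only: of_int_eq_iff)
    \<comment> \<open>For \<kappa> = 1/2 the hole lies in column 2 and column 1 is paired with
      itself. This m makes the coefficient of f (m + i) 1 vanish; if m = 0, the degree (i, 1) is
      paired with itself and f is skew.\<close>
    define m where "m = 2 * i - h"
    have m: "of_int m = 2 * (\<alpha> + of_int i)"
      using hole_coordinates(2)[OF hh] by (simp add: m_def h')
    show ?thesis
    proof (cases "m = 0")
      case True
      then have "h - i = i" by (simp add: m_def)
      then have "f i 1 = - f i 1" using cocycD(1)[OF coc, of i 1] h' by simp
      then have "2 * f i 1 = 0" by (metis add.right_inverse mult_2)
      then show ?thesis by simp
    next
      case False
      have e1: "\<alpha> + of_int i + (\<kappa> - 1) * of_int m = 0" and e2: "\<alpha> + of_int i + (\<kappa> + 1) * of_int m = 4 * (\<alpha> + of_int i)"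
        using \<open>\<kappa> * 2 = 1\<close> unfolding m by algebra+
      have "(\<alpha> + of_int i + (\<kappa> + 1) * of_int m) * f i 1 = 0" using eq[OF False, of i] e1 c by simp
      moreover have "\<alpha> + of_int i \<noteq> 0" using m False by (metis mult_zero_right of_int_eq_0_iff)
      ultimately show ?thesis unfolding e2 by (metis mult_eq_0_iff zero_neq_numeral)
    qed
  qed
qed

lemma cocyc_hole2_x:
  fixes \<kappa> :: "'f::field_char_0"
  assumes coc: "cocyc \<kappa> \<alpha> h h' f" and h: "hole2 \<kappa> \<alpha> h h'" and \<kappa>: "\<kappa> \<noteq> 1" "\<kappa> \<noteq> - 1"
    and f: "\<And>m. m \<noteq> 0 \<Longrightarrow> f m 0 = 0" and nh: "\<not> hole \<kappa> \<alpha> i 1"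
  shows "f i 1 = 0"
proof -
  have hh: "hole \<kappa> \<alpha> h h'" using h by (simp add: hole_iff)
  have kh: "\<kappa> * of_int h' = 2" "\<kappa> * of_int h = - 2 * \<alpha>" using h by (auto simp: hole2_def)
  show ?thesis
  proof (cases "\<kappa> = 2")
    case True
    \<comment> \<open>For \<kappa> = 2 the hole lies in column 1, and skewness exchanges the columns
      1 and 0.\<close>
    then have h': "h' = 1" using kh by simp
    then have "h - i \<noteq> 0" using nh hh by auto
    then show ?thesis using cocycD(1)[OF coc, of "h - i" 0] f[of "h - i"] h' by simp
  next
    case False
    then have nh: "\<not> hole \<kappa> \<alpha> i 1" for i using no_hole_1 \<kappa> by blast
    have eq: "(\<alpha> + of_int i + (\<kappa> - 1) * of_int m) * f (m + i) 1 = (\<alpha> + of_int i + \<kappa> * of_int m) * f i 1"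
      if "m \<noteq> 0" for i m
      using cocyc_x_equation[OF coc hh \<kappa> nh nh that, of i] f[OF that] unfolding kh by simp
    define x where "x = \<alpha> + (of_int i :: 'f)"
    have "(x + (\<kappa> - 1)) * f (1 + i) 1 = (x + \<kappa>) * f i 1"
      using eq[of 1 i] by (simp add: x_def)
    moreover have "(x + 1 - (\<kappa> - 1)) * f i 1 = (x + 1 - \<kappa>) * f (1 + i) 1"
      using eq[of "- 1" "1 + i"] by (simp add: x_def add_ac)
    ultimately have "2 * (\<kappa> - 1) * f i 1 = 0" by algebra
    then show ?thesis using \<kappa> by simp
  qed
qed

text \<open>The cocycle identity reduces a column to column 1 and the preceding column. The choice
  of a also avoids the finitely many cases in which a complementary degree is a hole.\<close>

lemma cocyc_positive:
  assumes coc: "cocyc \<kappa> \<alpha> h h' f" and \<kappa>: "\<kappa> \<noteq> 1" "\<kappa> \<noteq> - 1"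
    and x: "\<And>i. \<not> hole \<kappa> \<alpha> i 1 \<Longrightarrow> f i 1 = 0"
    and nh: "\<not> hole \<kappa> \<alpha> i (int n + 1)" "\<not> hole \<kappa> \<alpha> (h - i) (h' - (int n + 1))"
  shows "f i (int n + 1) = 0"
  using nh
proof (induction n arbitrary: i)
  case 0
  then show ?case using x by simp
next
  case (Suc n)
  define N where "N = int n + 1"
  have N: "int (Suc n) + 1 = N + 1" "N \<ge> 1" by (simp_all add: N_def)
  have fin: "finite ({a. hole \<kappa> \<alpha> (h - a) (h' - 1)} \<union> {a. hole \<kappa> \<alpha> (h - (i - a)) (h' - N)})"
    using finite_hole[of "\<lambda>a. h - a" \<kappa> \<alpha> "h' - 1"] finite_hole[of "\<lambda>a. h - (i - a)" \<kappa> \<alpha> "h' - N"]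
    by (simp add: inj_def)
  obtain a where a: "\<not> hole \<kappa> \<alpha> (h - a) (h' - 1)" "\<not> hole \<kappa> \<alpha> (h - (i - a)) (h' - N)"
    "\<not> hole \<kappa> \<alpha> a 1" "\<not> hole \<kappa> \<alpha> (i - a) N" "block \<kappa> \<alpha> a 1 (i - a) N \<noteq> 0"
    by (rule choose_x[OF \<kappa>(1) N(2) Suc.prems(1)[unfolded N(1)] fin]) blast
  have "f (i - a) N = 0" using Suc.IH[of "i - a"] a by (simp add: N_def)
  moreover have "f a 1 = 0" using x a by simp
  moreover have "a + (i - a) = i" "1 + N = N + 1" "h - a - (i - a) = h - i" "h' - 1 - N = h' - (N + 1)" by auto
  ultimately have "block \<kappa> \<alpha> a 1 (i - a) N * f i (N + 1) = 0"
    using cocycD(2)[OF coc, of a 1 "i - a" N] a Suc.prems unfolding N(1) by (simp only:) simp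
  then show ?case using a unfolding N(1) by simp
qed

text \<open>The vanishing of a cocycle is checked on the columns \<open>0\<close> and \<open>\<plusminus>1\<close>, which generate.\<close>

lemma cocyc_zero:
  assumes coc: "cocyc \<kappa> \<alpha> h h' f" and h: "hole \<kappa> \<alpha> h h'" and \<kappa>: "\<kappa> \<noteq> 1" "\<kappa> \<noteq> - 1"
    and f: "\<And>m. m \<noteq> 0 \<Longrightarrow> f m 0 = 0"
    and nh: "\<not> hole \<kappa> \<alpha> i j" "\<not> hole \<kappa> \<alpha> (h - i) (h' - j)"
  shows "f i j = 0"
proof -
  have x: "f i 1 = 0" if "\<not> hole \<kappa> \<alpha> i 1" for i
    using h cocyc_hole1_x(2)[OF coc _ \<kappa>, of 0] cocyc_hole2_x[OF coc _ \<kappa> f that] f unfolding hole_iff by fastforce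
  have \<kappa>': "- \<kappa> \<noteq> 1" "- \<kappa> \<noteq> - 1" using \<kappa> by (auto simp: minus_equation_iff)
  note coc' = cocyc_flip[OF coc]
  have y: "f i (- 1) = 0" if "\<not> hole (- \<kappa>) (- \<alpha>) i 1" for i
    using h cocyc_hole1_x(2)[OF coc' _ \<kappa>', of 0] cocyc_hole2_x[OF coc' _ \<kappa>' _ that] f
    unfolding hole_iff hole12_flip by fastforce
  consider "j = 0" | "j = int (nat (j - 1)) + 1" | "j = - (int (nat (- j - 1)) + 1)" by linarith
  then show ?thesis
  proof cases
    case 1
    then have "i \<noteq> 0" using h nh by auto
    then show ?thesis using f 1 by simp
  next
    case 2
    show ?thesis using cocyc_positive[OF coc \<kappa> x, of i "nat (j - 1)"] 2 nh by simp
  next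
    case 3
    define n where "n = nat (- j - 1)"
    have j: "j = - (int n + 1)" using 3 by (simp add: n_def)
    have "\<not> hole (- \<kappa>) (- \<alpha>) i (int n + 1)" "\<not> hole (- \<kappa>) (- \<alpha>) (h - i) (- h' - (int n + 1))"
      using nh unfolding hole_flip j by (simp_all add: algebra_simps)
    then show ?thesis using cocyc_positive[OF coc' \<kappa>' y, of i n] by (simp add: j)
  qed
qed

lemma cocyc_form1:
  assumes coc: "cocyc \<kappa> \<alpha> h h' f" and h: "hole1 \<kappa> \<alpha> h h'" and \<kappa>: "\<kappa> \<noteq> 1" "\<kappa> \<noteq> - 1"
  obtains c where "\<And>i j. \<not> hole \<kappa> \<alpha> i j \<Longrightarrow> \<not> hole \<kappa> \<alpha> (h - i) (h' - j) \<Longrightarrow> f i j = c * (\<alpha> * of_int j + of_int i)"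
proof -
  have hh: "hole \<kappa> \<alpha> h h'" and kh: "\<kappa> * of_int h' = 1" using h by (auto simp: hole_iff hole1_def)
  have "of_int (i + j) * (f j 0 - f i 0) = of_int (j - i) * f (i + j) 0" if "i \<noteq> 0" "j \<noteq> 0" "i + j \<noteq> 0" for i j
    using cocyc_col0[OF coc hh that] unfolding kh by (simp add: algebra_simps)
  then obtain c c' where c: "\<And>i. i \<noteq> 0 \<Longrightarrow> f i 0 = c * of_int i + c' * of_int i ^ 2"
    using quadratic_cocycle[of "\<lambda>i. f i 0"] by blast
  define g where "g i j = f i j - c * (\<alpha> * of_int j + of_int i)" for i j
  have g: "cocyc \<kappa> \<alpha> h h' g" unfolding g_def by (rule cocyc_diff[OF coc cocyc_linear1[OF h]])
  have "g m 0 = c' * of_int m ^ 2" if "m \<noteq> 0" for m using c[OF that] by (simp add: g_def)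
  moreover from this have "c' = 0" by (rule cocyc_hole1_x(1)[OF g h \<kappa>])
  ultimately have "g i j = 0" if "\<not> hole \<kappa> \<alpha> i j" "\<not> hole \<kappa> \<alpha> (h - i) (h' - j)" for i j
    using cocyc_zero[OF g hh \<kappa> _ that] by simp
  then show thesis using that[of c] by (simp add: g_def)
qed

lemma cocyc_form2:
  assumes coc: "cocyc \<kappa> \<alpha> h h' f" and h: "hole2 \<kappa> \<alpha> h h'" and \<kappa>: "\<kappa> \<noteq> 1" "\<kappa> \<noteq> - 1" and "\<alpha> \<noteq> 0"
  obtains c c' where "\<And>i j. \<not> hole \<kappa> \<alpha> i j \<Longrightarrow> \<not> hole \<kappa> \<alpha> (h - i) (h' - j) \<Longrightarrow>
    f i j = c * (\<alpha> * of_int j + of_int i) + c' * (\<alpha> + \<kappa> * of_int i)"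
proof -
  have hh: "hole \<kappa> \<alpha> h h'" and kh: "\<kappa> * of_int h' = 2" using h by (auto simp: hole_iff hole2_def)
  have "of_int j * f j 0 - of_int i * f i 0 = of_int (j - i) * f (i + j) 0" if "i \<noteq> 0" "j \<noteq> 0" "i + j \<noteq> 0" for i j
    using cocyc_col0[OF coc hh that] unfolding kh by (simp add: algebra_simps)
  then obtain d d' where d: "\<And>i. i \<noteq> 0 \<Longrightarrow> f i 0 = d + d' * of_int i"
    using affine_cocycle[of "\<lambda>i. f i 0"] by blast
  \<comment> \<open>On column 0 the two linear forms are i and \<alpha> + \<kappa> * i; the
    constants c and c' express d + d' * i by them.\<close>
  define c' where "c' = d / \<alpha>"
  define c where "c = d' - \<kappa> * c'"
  define g where "g i j = f i j - (c * (\<alpha> * of_int j + of_int i) + c' * (\<alpha> + \<kappa> * of_int i))" for i j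
  have g: "cocyc \<kappa> \<alpha> h h' g" unfolding g_def by (rule cocyc_diff[OF coc cocyc_linear2[OF h]])
  have "g m 0 = 0" if "m \<noteq> 0" for m
    using d[OF that] \<open>\<alpha> \<noteq> 0\<close> by (simp add: g_def c_def c'_def algebra_simps)
  then have "g i j = 0" if "\<not> hole \<kappa> \<alpha> i j" "\<not> hole \<kappa> \<alpha> (h - i) (h' - j)" for i j
    using cocyc_zero[OF g hh \<kappa> _ that] by simp
  then show thesis using that[of c c'] by (simp add: g_def)
qed

lemma good_cong:
  assumes "\<And>i j k l. \<bar>j\<bar> \<le> 1 \<Longrightarrow> 1 \<le> l \<Longrightarrow> s i j k l = s' i j k l"
  shows "good \<kappa> \<alpha> n s = good \<kappa> \<alpha> n s'"
  unfolding good_def using assms by simp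

section \<open>Brackets of arbitrary columns\<close>

locale block_full = block_local +
  assumes good_pos: "good \<kappa> \<alpha> n s"
    and good_neg: "good (- \<kappa>) (- \<alpha>) n (flip s)"
    and kappa: "\<kappa> \<noteq> 1" "\<kappa> \<noteq> - 1"

lemma (in block_local) block_full_exists:
  assumes \<kappa>: "\<kappa> \<noteq> 1" "\<kappa> \<noteq> - 1"
  obtains t where "\<And>i j. t i j \<noteq> 0" "\<And>i. t i 0 = 1" "block_full (resc t s) S \<alpha> \<kappa>"
proof -
  interpret F: block_local "flip s" "flip_set S" "- \<alpha>" "- \<kappa>" by (rule block_local_flip)
  obtain t1 where t1: "\<And>i j. t1 i j \<noteq> 0" "\<And>i j. j \<le> 1 \<Longrightarrow> t1 i j = 1" "\<And>n. good \<kappa> \<alpha> n (resc t1 s)"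
    by (rule positive_columns[OF \<kappa>(1)]) blast
  have "- \<kappa> \<noteq> 1" using \<kappa> by (auto simp: minus_equation_iff)
  then obtain t2 where t2: "\<And>i j. t2 i j \<noteq> 0" "\<And>i j. j \<le> 1 \<Longrightarrow> t2 i j = 1"
    "\<And>n. good (- \<kappa>) (- \<alpha>) n (resc t2 (flip s))"
    by (rule F.positive_columns) blast
  define t where "t i j = (if j \<ge> 0 then t1 i j else t2 i (- j))" for i j
  have t: "t i j \<noteq> 0" "\<bar>j\<bar> \<le> 1 \<Longrightarrow> t i j = 1" for i j using t1 t2 by (auto simp: t_def)
  interpret R: block_local "resc t s" S \<alpha> \<kappa> by (rule block_local_resc[OF t])
  have "good \<kappa> \<alpha> n (resc t s)" for n
  proof (subst good_cong[of _ "resc t1 s"])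
    show "resc t s i j k l = resc t1 s i j k l" if "\<bar>j\<bar> \<le> 1" "1 \<le> l" for i j k l
    proof -
      have "t i j = 1" "t1 i j = 1" using that t(2) t1(2) by auto
      moreover have "t k l = t1 k l" "t (i + k) (j + l) = t1 (i + k) (j + l)" using that by (auto simp: t_def)
      ultimately show ?thesis by (simp add: resc_def)
    qed
  qed (rule t1)
  moreover have "good (- \<kappa>) (- \<alpha>) n (flip (resc t s))" for n
  proof (subst good_cong[of _ "resc t2 (flip s)"])
    show "flip (resc t s) i j k l = resc t2 (flip s) i j k l" if "\<bar>j\<bar> \<le> 1" "1 \<le> l" for i j k l
    proof -
      have "t i (- j) = 1" "t2 i j = 1" "t k (- l) = t2 k l" using that t(2)[of "- j" i] t2(2)[of j i] by (auto simp: t_def)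
      moreover have "t (i + k) (- j - l) = t2 (i + k) (j + l)"
      proof (cases "j + l = 0")
        case True
        then have e: "- j - l = 0" by simp
        show ?thesis unfolding e True using t(2)[of 0] t2(2)[of 0] by simp
      next
        case False
        then have "\<not> - j - l \<ge> 0" "- (- j - l) = j + l" using that by auto
        then show ?thesis by (simp only: t_def if_False)
      qed
      ultimately show ?thesis by (simp add: resc_def flip_def)
    qed
  qed (rule t2)
  ultimately have "block_full (resc t s) S \<alpha> \<kappa>"
    using \<kappa> by unfold_locales
  then show thesis using that[of t] t by simp
qed

context block_full
begin

lemma block_full_flip: "block_full (flip s) (flip_set S) (- \<alpha>) (- \<kappa>)"
  using block_local_flip good_pos good_neg kappa
  by (auto simp: block_full_def block_full_axioms_def minus_equation_iff)

lemma act: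
  assumes "\<not> hol k l" "\<not> hol (m + k) l"
  shows "s m 0 k l = bl m 0 k l"
proof -
  consider "l \<ge> 1" | "l = 0" | "- l \<ge> 1" by linarith
  then show ?thesis
  proof cases
    case 1
    show ?thesis by (rule goodD(1)[OF good_pos 1 order_refl assms])
  next
    case 2
    then show ?thesis by (simp add: witt block_def)
  next
    case 3
    have "flip s m 0 k (- l) = block (- \<kappa>) (- \<alpha>) m 0 k (- l)"
      by (rule goodD(1)[OF good_neg 3 order_refl]) (use assms in \<open>simp_all add: hole_flip\<close>)
    then show ?thesis by (simp add: flip_def block_flip)
  qed
qed

lemma x_bracket:
  assumes "\<not> hol a 1" "\<not> hol k l" "\<not> hol (a + k) (1 + l)"
  shows "s a 1 k l = bl a 1 k l"
proof -
  consider "l \<ge> 1" | "l = 0" | "- l \<ge> 1" by linarith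
  then show ?thesis
  proof cases
    case 1
    show ?thesis by (rule goodD(3)[OF good_pos 1 order_refl]) (use assms in \<open>simp_all add: add.commute\<close>)
  next
    case 2
    then show ?thesis
      using act0_skew[of a k] local_act[of 1 a k] block_skew[of \<kappa> \<alpha> a 1 k 0] assms by (simp add: add.commute)
  next
    case 3
    have "flip s a (- 1) k (- l) = block (- \<kappa>) (- \<alpha>) a (- 1) k (- l)"
      by (rule goodD(2)[OF good_neg 3 order_refl]) (use assms in \<open>simp_all add: hole_flip add.commute\<close>)
    then show ?thesis by (simp add: flip_def block_flip)
  qed
qed

lemma hole_cases: "hol i j \<Longrightarrow> j \<ge> 1 \<or> - j \<ge> 1"
  using no_hole_0[of \<kappa> \<alpha> i] by (cases "j = 0") auto

lemma hole_generators:
  assumes "hol k l"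
  shows "s m 0 k l = 0" "s m 1 k l = 0" "s m (- 1) k l = 0"
proof -
  have "s m 0 k l = 0 \<and> s m 1 k l = 0 \<and> s m (- 1) k l = 0"
    using hole_cases[OF assms]
  proof
    assume l: "l \<ge> 1"
    show ?thesis
      using goodD(4-6)[OF good_pos[of "l + 1"] l, of k m] assms by simp
  next
    assume l: "- l \<ge> 1"
    have "hole (- \<kappa>) (- \<alpha>) k (- l)" using assms by (simp add: hole_flip)
    then show ?thesis
      using goodD(4-6)[OF good_neg[of "- l + 1"] l, of k m] by (simp add: flip_def)
  qed
  then show "s m 0 k l = 0" "s m 1 k l = 0" "s m (- 1) k l = 0" by auto
qed

text \<open>The degrees that commute with a given vector are closed under nonzero brackets, so by
  generation it suffices to look at the columns 0, 1 and - 1.\<close>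

lemma hole_central:
  assumes "hol k l"
  shows "s i j k l = 0"
proof -
  have "S \<subseteq> {(i, j). s i j k l = 0}"
  proof (rule generation)
    fix i j i' j'
    assume "(i, j) \<in> {(i, j). s i j k l = 0}" "(i', j') \<in> {(i, j). s i j k l = 0}" "s i j i' j' \<noteq> 0"
    then show "(i + i', j + j') \<in> {(i, j). s i j k l = 0}"
      using leibniz[of i' j' k l i j] by simp
  qed (use hole_generators[OF assms] in auto)
  then show ?thesis using supp_zero(1)[of i j] by (cases "(i, j) \<in> S") auto
qed

text \<open>A vector of the next column is obtained from a bracket with column 1, and the Leibniz
  rule leads back to the induction hypothesis. Terms through a hole vanish in the algebra because
  holes are central, and in the model by \<open>block_through_hole\<close>.\<close>

lemma positive_bracket:
  assumes "\<not> hol i (int n + 1)" "\<not> hol k l" "\<not> hol (i + k) (int n + 1 + l)"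
  shows "s i (int n + 1) k l = bl i (int n + 1) k l"
  using assms
proof (induction n arbitrary: i k l)
  case 0
  then show ?case using x_bracket by simp
next
  case (Suc n)
  define N where "N = int n + 1"
  have N: "int (Suc n) + 1 = N + 1" "N \<ge> 1" "1 + N = N + 1" by (simp_all add: N_def)
  note prems = Suc.prems[unfolded N(1)]
  obtain a where a: "\<not> hol a 1" "\<not> hol (i - a) N" "bl a 1 (i - a) N \<noteq> 0"
    using choose_x[OF kappa(1) N(2) prems(1) finite.emptyI] by blast
  define b where "b = i - a"
  have b: "a + b = i" "a + (b + k) = i + k" "b + (a + k) = i + k" "1 + (N + l) = N + 1 + l" "N + (1 + l) = N + 1 + l"
    by (simp_all add: b_def)
  have IH: "s b N k' l' = bl b N k' l'" if "\<not> hol k' l'" "\<not> hol (b + k') (N + l')" for k' l'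
    using Suc.IH[of b k' l'] a that by (simp add: N_def b_def)
  have "s b N k l * s a 1 (b + k) (N + l) = s a 1 b N * s i (N + 1) k l + s a 1 k l * s b N (a + k) (1 + l)"
    using leibniz[of b N k l a 1] by (simp add: b N(3))
  moreover have "bl b N k l * bl a 1 (b + k) (N + l) = bl a 1 b N * bl i (N + 1) k l + bl a 1 k l * bl b N (a + k) (1 + l)"
    using block_jacobi[of \<kappa> \<alpha> b N k l a 1] by (simp add: b N(3))
  moreover have "s a 1 b N = bl a 1 b N"
    by (rule x_bracket) (use a prems in \<open>simp_all add: b_def N(3)\<close>)
  moreover have "s b N k l * s a 1 (b + k) (N + l) = bl b N k l * bl a 1 (b + k) (N + l)"
  proof (cases "hol (b + k) (N + l)")
    case True
    then show ?thesis using hole_generators(2)[OF True] block_through_hole[of \<kappa> \<alpha> b k N l a 1] by simp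
  next
    case False
    then show ?thesis using IH[of k l] x_bracket[of a "b + k" "N + l"] prems a by (simp add: b)
  qed
  moreover have "s a 1 k l * s b N (a + k) (1 + l) = bl a 1 k l * bl b N (a + k) (1 + l)"
  proof (cases "hol (a + k) (1 + l)")
    case True
    then show ?thesis using hole_central[OF True] block_through_hole[of \<kappa> \<alpha> a k 1 l b N] by simp
  next
    case False
    then show ?thesis using IH[of "a + k" "1 + l"] x_bracket[of a k l] prems a by (simp add: b)
  qed
  ultimately have "bl a 1 b N * s i (N + 1) k l = bl a 1 b N * bl i (N + 1) k l"
    by (metis add_right_cancel)
  then show ?case using a(3) unfolding N(1) by (simp add: b_def)
qed

lemma bracket:
  assumes "\<not> hol i j" "\<not> hol k l" "\<not> hol (i + k) (j + l)"
  shows "s i j k l = bl i j k l"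
proof -
  consider "j = 0" | "j = int (nat (j - 1)) + 1" | "j = - (int (nat (- j - 1)) + 1)" by linarith
  then show ?thesis
  proof cases
    case 1
    then show ?thesis using act assms by simp
  next
    case 2
    then show ?thesis using positive_bracket[of i "nat (j - 1)" k l] assms by simp
  next
    case 3
    interpret F: block_full "flip s" "flip_set S" "- \<alpha>" "- \<kappa>" by (rule block_full_flip)
    define n where "n = nat (- j - 1)"
    have j: "j = - (int n + 1)" using 3 by (simp add: n_def)
    have "flip s i (int n + 1) k (- l) = block (- \<kappa>) (- \<alpha>) i (int n + 1) k (- l)"
    proof (rule F.positive_bracket)
      have e: "- (int n + 1 + - l) = j + l" by (simp add: j)
      show "\<not> hole (- \<kappa>) (- \<alpha>) (i + k) (int n + 1 + - l)" unfolding hole_flip e by (rule assms(3))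
    qed (use assms in \<open>simp_all add: hole_flip j\<close>)
    then show ?thesis by (simp add: flip_def block_flip j)
  qed
qed

lemma not_hole_supp:
  assumes "\<not> hol i j"
  shows "(i, j) \<in> S"
proof -
  have pos: "(i, j) \<in> S" if "j \<ge> 1" "\<not> hole \<kappa> \<alpha> i j" "block_full s S \<alpha> \<kappa>" for i j s S \<alpha> and \<kappa> :: 'a
  proof -
    interpret B: block_full s S \<alpha> \<kappa> by fact
    note nh = that
    obtain k where k: "\<not> hole \<kappa> \<alpha> k (- 1)" "\<not> hole \<kappa> \<alpha> (k + i) (j - 1)" "block \<kappa> \<alpha> k (- 1) i j \<noteq> 0"
      using choose_y[OF nh(1,2)] by blast
    then have "s k (- 1) i j \<noteq> 0" using B.bracket[of k "- 1" i j] nh by simp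
    then show ?thesis using B.supp by blast
  qed
  consider "j = 0" | "j \<ge> 1" | "- j \<ge> 1" by linarith
  then show ?thesis
  proof cases
    case 1
    have "s (i - 1) 0 i 0 \<noteq> 0" by (simp add: witt)
    then show ?thesis using supp 1 by blast
  next
    case 2
    then show ?thesis using pos[of j \<kappa> \<alpha> i s S] assms block_full_axioms by blast
  next
    case 3
    then show ?thesis
      using pos[of "- j" "- \<kappa>" "- \<alpha>" i "flip s" "flip_set S"] assms block_full_flip
      by (simp add: hole_flip flip_set_def)
  qed
qed

lemma hole_cocyc:
  assumes h: "hol h h'"
  shows "cocyc \<kappa> \<alpha> h h' (\<lambda>i j. s i j (h - i) (h' - j))"
  unfolding cocyc_def
proof (intro conjI allI impI; (elim conjE)?)
  show "s (h - i) (h' - j) (h - (h - i)) (h' - (h' - j)) = - s i j (h - i) (h' - j)" for i j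
    using skew[of "h - i" "h' - j" i j] by simp
  fix i j k l
  assume nh: "\<not> hol i j" "\<not> hol k l" "\<not> hol (i + k) (j + l)" "\<not> hol (h - i) (h' - j)"
    "\<not> hol (h - k) (h' - l)" "\<not> hol (h - i - k) (h' - j - l)"
  have e: "k + (h - i - k) = h - i" "l + (h' - j - l) = h' - j" "i + (h - i - k) = h - k" "j + (h' - j - l) = h' - l"
    by simp_all
  have "s k l (h - i - k) (h' - j - l) * s i j (h - i) (h' - j)
      = s i j k l * s (i + k) (j + l) (h - i - k) (h' - j - l) + s i j (h - i - k) (h' - j - l) * s k l (h - k) (h' - l)"
    using leibniz[of k l "h - i - k" "h' - j - l" i j] unfolding e .
  moreover have "s k l (h - i - k) (h' - j - l) = bl k l (h - i - k) (h' - j - l)"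
    "s i j k l = bl i j k l" "s i j (h - i - k) (h' - j - l) = bl i j (h - i - k) (h' - j - l)"
    using nh by (auto intro!: bracket simp: e)
  ultimately show "bl k l (h - i - k) (h' - j - l) * s i j (h - i) (h' - j)
      = bl i j k l * s (i + k) (j + l) (h - (i + k)) (h' - (j + l)) + bl i j (h - i - k) (h' - j - l) * s k l (h - k) (h' - l)"
    by (simp add: diff_diff_eq)
qed

lemma hole1_cocycle:
  assumes "hole1 \<kappa> \<alpha> h h'"
  obtains c where "\<And>i j k l. \<not> hol i j \<Longrightarrow> \<not> hol k l \<Longrightarrow> i + k = h \<Longrightarrow> j + l = h'
    \<Longrightarrow> s i j k l = c * (\<alpha> * of_int j + of_int i)"
proof -
  obtain c where c: "\<And>i j. \<not> hol i j \<Longrightarrow> \<not> hol (h - i) (h' - j) \<Longrightarrow>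
    s i j (h - i) (h' - j) = c * (\<alpha> * of_int j + of_int i)"
    using cocyc_form1[OF hole_cocyc assms kappa] assms by (auto simp: hole_iff)
  show thesis
  proof (rule that)
    fix i j k l
    assume *: "\<not> hol i j" "\<not> hol k l" "i + k = h" "j + l = h'"
    then have kl: "k = h - i" "l = h' - j" by auto
    show "s i j k l = c * (\<alpha> * of_int j + of_int i)" using *(1,2) unfolding kl by (rule c)
  qed
qed

lemma hole2_cocycle:
  assumes "hole2 \<kappa> \<alpha> h h'"
  obtains c c' where "\<And>i j k l. \<not> hol i j \<Longrightarrow> \<not> hol k l \<Longrightarrow> i + k = h \<Longrightarrow> j + l = h'
    \<Longrightarrow> s i j k l = c * (\<alpha> * of_int j + of_int i) + c' * (\<alpha> + \<kappa> * of_int i)"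
proof -
  obtain c c' where c: "\<And>i j. \<not> hol i j \<Longrightarrow> \<not> hol (h - i) (h' - j) \<Longrightarrow>
    s i j (h - i) (h' - j) = c * (\<alpha> * of_int j + of_int i) + c' * (\<alpha> + \<kappa> * of_int i)"
    using cocyc_form2[OF hole_cocyc assms kappa alpha(1)] assms by (auto simp: hole_iff)
  show thesis
  proof (rule that)
    fix i j k l
    assume *: "\<not> hol i j" "\<not> hol k l" "i + k = h" "j + l = h'"
    then have kl: "k = h - i" "l = h' - j" by auto
    show "s i j k l = c * (\<alpha> * of_int j + of_int i) + c' * (\<alpha> + \<kappa> * of_int i)" using *(1,2) unfolding kl by (rule c)
  qed
qed

end

lemma (in zz_algebra) supp_produced:
  assumes "(h, h') \<in> S" "h' \<noteq> 0" "h \<noteq> 0"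
  obtains i j k l where "i + k = h" "j + l = h'" "s i j k l \<noteq> 0"
proof -
  have "S \<subseteq> {(i, j). j = 0 \<or> i = 0 \<or> (\<exists>k l m n. k + m = i \<and> l + n = j \<and> s k l m n \<noteq> 0)}"
    by (rule generation) blast+
  then show thesis using assms that by blast
qed


section \<open>The case \<open>\<kappa> = - 1\<close>\<close>

lemma hole_minus_one: "hole (- 1) \<alpha> i j \<longleftrightarrow> j = - 1 \<and> of_int i = \<alpha> \<or> j = - 2 \<and> of_int i = 2 * \<alpha>"
proof -
  have e: "- x = y \<longleftrightarrow> x = - y" for x y :: 'a by auto
  have "(of_int j :: 'a) = - 1 \<longleftrightarrow> j = - 1" "(of_int j :: 'a) = - 2 \<longleftrightarrow> j = - 2"
    by (metis of_int_1 of_int_eq_iff of_int_minus, metis of_int_eq_iff of_int_minus of_int_numeral)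
  then show ?thesis by (auto simp: hole_def e)
qed

context block_local
begin

lemma xy_minus_one:
  assumes "\<kappa> = - 1"
  shows "s i 1 j (- 1) = 2 * (of_int j - \<alpha>)"
proof (cases "of_int j = \<alpha>")
  case True
  then show ?thesis using local_hole(2)[of "- 1" j i] assms by (simp add: hole_minus_one)
next
  case False
  then show ?thesis using local_pair[of i j] assms by (simp add: hole_minus_one block_def algebra_simps)
qed

text \<open>The other class of trivial extensions in column \<open>- 1\<close> would make column \<open>- 2\<close> a module of
  densities of weight \<open>3\<close>, and the degrees \<open>(i, - 3)\<close> would not be one-dimensional.\<close>

lemma no_quadratic_cocycle:
  assumes \<kappa>: "\<kappa> = - 1" and flex: "flex_type (\<lambda>m j. s m 0 j (- 1)) (- \<alpha>)" and \<alpha>: "\<alpha> = of_int h"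
    and into: "\<And>i k. i + k = h \<Longrightarrow> s i 0 k (- 1) = g * of_int i + g' * of_int i ^ 2"
  shows "g' = 0"
proof (rule ccontr)
  assume g': "g' \<noteq> 0"
  define Y where "Y j = (of_int (j - h) :: 'a)" for j
  have Y0: "Y j = 0 \<longleftrightarrow> j = h" and Yadd: "Y (n + j) = of_int n + Y j" for n j
    by (simp_all add: Y_def)
  have xy: "s i 1 j (- 1) = 2 * Y j" for i j
    using xy_minus_one[OF \<kappa>] by (simp add: Y_def \<alpha>)
  have norm: "s n 0 j (- 1) = Y j" if "n + j \<noteq> h" for n j
  proof -
    have "- \<alpha> + of_int (n + j) \<noteq> 0" using that unfolding \<alpha> by (metis add.commute add_uminus_conv_diff of_int_eq_iff right_minus_eq)
    then have "s n 0 j (- 1) = - \<alpha> + of_int j" using flex unfolding flex_type_def by blast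
    then show ?thesis by (simp add: Y_def \<alpha>)
  qed
  define c where "c i k = s i (- 1) k (- 1)" for i k
  define \<xi> where "\<xi> p = s (h - p) 1 p (- 2)" for p
  have into': "s (h - k) 0 k (- 1) = - g * Y k + g' * Y k ^ 2" for k
    using into[of "h - k" k] by (simp add: Y_def power2_eq_square algebra_simps)
  \<comment> \<open>Column 1 applied to a bracket of two vectors of column - 1: the two terms cancel
    except at the target (h, - 1), where the quadratic part of the extension survives.\<close>
  have xw: "c i k * s m 1 (i + k) (- 2) = (if m + i + k = h then 2 * g' * (Y i * Y k * (Y k - Y i)) else 0)" for i k m
  proof -
    have eq: "c i k * s m 1 (i + k) (- 2) = 2 * Y i * s (m + i) 0 k (- 1) + 2 * Y k * s i (- 1) (m + k) 0"
      using leibniz[of i "- 1" k "- 1" m 1] by (simp add: xy c_def)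
    have sk: "s i (- 1) (m + k) 0 = - s (m + k) 0 i (- 1)" by (rule skew)
    show ?thesis
    proof (cases "m + i + k = h")
      case True
      then have "m + i = h - k" "m + k = h - i" by auto
      then show ?thesis unfolding eq sk by (simp only: into' True diff_add_cancel refl if_True) (simp add: power2_eq_square algebra_simps)
    next
      case False
      then show ?thesis unfolding eq sk using norm[of "m + i" k] norm[of "m + k" i] by (simp add: add_ac)
    qed
  qed
  have c\<xi>: "c i k * \<xi> (i + k) = 2 * g' * (Y i * Y k * (Y k - Y i))" for i k
    using xw[of i k "h - (i + k)"] by (simp add: \<xi>_def)
  have pick: "\<exists>i k. i + k = p \<and> Y i * Y k * (Y k - Y i) \<noteq> 0" for p
  proof -
    obtain i where "i \<notin> {h, p - h} \<union> {i. 2 * i = p}"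
      using ex_new_if_finite[of "{h, p - h} \<union> {i. 2 * i = p}"] infinite_UNIV_int
        finite_unique[of "\<lambda>i. 2 * i = p"] by auto
    then have "i \<noteq> h" "p - i \<noteq> h" "p - 2 * i \<noteq> 0" by auto
    then have "Y i \<noteq> 0" "Y (p - i) \<noteq> 0" "of_int (p - 2 * i) \<noteq> (0::'a)" by (auto simp only: Y0 of_int_eq_0_iff)
    moreover have "Y (p - i) - Y i = of_int (p - 2 * i)" by (simp add: Y_def)
    ultimately have "Y i * Y (p - i) * (Y (p - i) - Y i) \<noteq> 0" by (simp del: of_int_diff)
    then show ?thesis by (intro exI[of _ i] exI[of _ "p - i"]) simp
  qed
  have \<xi>0: "\<xi> p \<noteq> 0" for p
    using pick[of p] c\<xi> g' by (metis mult_eq_0_iff zero_neq_numeral)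
  have ch: "c i k = 0" if "i = h \<or> k = h" for i k
    using c\<xi>[of i k] \<xi>0 that by (auto simp: Y_def)
  have \<rho>: "s n 0 p (- 2) * \<xi> (p + n) = \<xi> p * (of_int (p - 2 * h) + 3 * of_int n)" for n p
  proof -
    obtain i k where ik: "i + k = p" "Y i * Y k * (Y k - Y i) \<noteq> 0" using pick by blast
    have "c i k * s n 0 p (- 2) = s n 0 i (- 1) * c (n + i) k + s n 0 k (- 1) * c i (n + k)"
      using leibniz[of i "- 1" k "- 1" n 0] ik by (simp add: c_def)
    moreover have "s n 0 i (- 1) * c (n + i) k = Y i * c (n + i) k" "s n 0 k (- 1) * c i (n + k) = Y k * c i (n + k)"
      using norm[of n i] norm[of n k] ch by (cases "n + i = h", auto)+
    ultimately have "(c i k * \<xi> p) * (s n 0 p (- 2) * \<xi> (p + n))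
      = \<xi> p * (Y i * (c (n + i) k * \<xi> (n + i + k)) + Y k * (c i (n + k) * \<xi> (i + (n + k))))"
      unfolding ik(1)[symmetric] by (simp add: add_ac) algebra
    moreover have "c i k * \<xi> p = 2 * g' * (Y i * Y k * (Y k - Y i))" using c\<xi>[of i k] by (simp add: ik)
    moreover have "\<xi> p * (Y i * (c (n + i) k * \<xi> (n + i + k)) + Y k * (c i (n + k) * \<xi> (i + (n + k))))
      = 2 * g' * (Y i * Y k * (Y k - Y i)) * (\<xi> p * (Y i + Y k + 3 * of_int n))"
      unfolding c\<xi> Yadd by (simp add: algebra_simps)
    ultimately have "2 * g' * (Y i * Y k * (Y k - Y i)) * (s n 0 p (- 2) * \<xi> (p + n))
      = 2 * g' * (Y i * Y k * (Y k - Y i)) * (\<xi> p * (Y i + Y k + 3 * of_int n))" by simp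
    then have "s n 0 p (- 2) * \<xi> (p + n) = \<xi> p * (Y i + Y k + 3 * of_int n)" using ik(2) g' by simp
    moreover have "Y i + Y k = of_int (p - 2 * h)" by (simp add: Y_def flip: ik(1))
    ultimately show ?thesis by simp
  qed
  define U where "U i = s i (- 1) (2 * h - i) (- 2) / \<xi> (2 * h - i)" for i
  define V where "V m = s m 1 (2 * h) (- 3) * \<xi> (2 * h + m)" for m
  have UV: "U i * V m = 2 * Y i * (2 * of_int i + 3 * of_int m)" for i m
  proof -
    define k where "k = 2 * h - i"
    have k: "i + k = 2 * h" by (simp add: k_def)
    have "s m 1 k (- 2) * s i (- 1) (m + k) (- 1) = 0"
    proof (cases "m + k = h")
      case False
      obtain i' k' where ik: "i' + k' = k" "Y i' * Y k' * (Y k' - Y i') \<noteq> 0" using pick by blast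
      have "c i' k' \<noteq> 0" using c\<xi>[of i' k'] ik g' by auto
      then have "s m 1 k (- 2) = 0" using xw[of i' k' m] False ik by (auto simp: add.assoc)
      then show ?thesis by simp
    qed (use ch in \<open>simp add: c_def\<close>)
    then have *: "s i (- 1) k (- 2) * s m 1 (2 * h) (- 3) = 2 * Y i * s (m + i) 0 k (- 2)"
      using leibniz[of i "- 1" k "- 2" m 1] by (simp add: xy k)
    have "s i (- 1) k (- 2) * V m = 2 * Y i * (s (m + i) 0 k (- 2) * \<xi> (k + (m + i)))"
    proof -
      have "k + (m + i) = 2 * h + m" using k by simp
      then show ?thesis using * unfolding V_def by (simp only: mult.assoc[symmetric])
    qed
    then have "s i (- 1) k (- 2) * V m = \<xi> k * (2 * Y i * (of_int (k - 2 * h) + 3 * of_int (m + i)))"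
      unfolding \<rho> by simp
    moreover have "of_int (k - 2 * h) + 3 * of_int (m + i) = 2 * of_int i + 3 * (of_int m :: 'a)" by (simp add: k_def)
    ultimately show ?thesis using \<xi>0[of k] by (simp add: U_def k_def)
  qed
  \<comment> \<open>The products pass through degree (2 * h, - 3) and form a matrix of rank one,
    while this minor of the values in \<open>UV\<close> is a nonzero constant.\<close>
  have "(U (h + 1) * V 0) * (U (h + 2) * V 1) = (U (h + 1) * V 1) * (U (h + 2) * V 0)" by simp
  then have "(12::'a) = 0" unfolding UV Y_def by simp algebra
  then show False by simp
qed

end

text \<open>Column \<open>- 1\<close> is scaled such that it is the module of functions, with the constants possibly
  missing.\<close>

locale block_minus = zz_algebra +
  assumes good_pos: "good (- 1) \<alpha> n s"
    and xy: "s i 1 j (- 1) = 2 * (of_int j - \<alpha>)"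
    and ly: "(n + j, - 1) \<in> S \<or> of_int (n + j) \<noteq> \<alpha> \<Longrightarrow> s n 0 j (- 1) = of_int j - \<alpha>"

text \<open>Beyond the positive columns only the vector at the hole of column - 1 remains to be
  scaled. By \<open>no_quadratic_cocycle\<close> column 0 acts into it by a linear form, whose
  factor g is nonzero because the hole, if present, is reached from (0, - 1).\<close>

lemma (in block_local') block_minus_exists:
  assumes \<kappa>: "\<kappa> = - 1"
  obtains t where "\<And>i j. t i j \<noteq> 0" "\<And>i. t i 0 = 1" "block_minus (resc t s) S \<alpha>"
proof -
  obtain t1 where t1: "\<And>i j. t1 i j \<noteq> 0" "\<And>i j. j \<le> 1 \<Longrightarrow> t1 i j = 1" "\<And>n. good \<kappa> \<alpha> n (resc t1 s)"
    by (rule positive_columns[OF kappa(1)]) blast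
  define r where "r = resc t1 s"
  interpret R: block_local r S \<alpha> \<kappa>
    unfolding r_def by (rule block_local_resc) (use t1 in auto)
  have flexr: "flex_type (\<lambda>m j. r m 0 j (- 1)) (- \<alpha>)"
    using flex[OF \<kappa>] t1(2) by (simp add: r_def resc_def)
  have "\<exists>g. g \<noteq> 0 \<and> (\<forall>n j. (n + j, - 1) \<in> S \<longrightarrow> of_int (n + j) = \<alpha> \<longrightarrow> r n 0 j (- 1) = g * (of_int j - \<alpha>))"
  proof (cases "\<exists>h. of_int h = \<alpha> \<and> (h, - 1) \<in> S")
    case True
    then obtain h where h: "of_int h = \<alpha>" "(h, - 1) \<in> S" by blast
    obtain g g' where into: "r i 0 k (- 1) = g * of_int i + g' * of_int i ^ 2" if "- \<alpha> + of_int (i + k) = 0" for i k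
      using flexr unfolding flex_type_def by blast
    have into: "r i 0 k (- 1) = g * of_int i + g' * of_int i ^ 2" if "i + k = h" for i k
      using into[of i k] that h(1) by simp
    have "g' = 0" by (rule R.no_quadratic_cocycle[OF \<kappa> flexr h(1)[symmetric] into])
    have into: "r i 0 k (- 1) = - g * (of_int k - \<alpha>)" if "i + k = h" for i k
    proof -
      have "i = h - k" using that by simp
      then have e: "of_int i = \<alpha> - of_int k" by (simp flip: h(1))
      have "r i 0 k (- 1) = g * of_int i" using into[OF that] \<open>g' = 0\<close> by simp
      then show ?thesis unfolding e by (simp add: algebra_simps)
    qed
    have "g \<noteq> 0"
    proof
      assume "g = 0"
      have "{k. (k, - 1) \<in> S} \<subseteq> - {h}"
      proof (rule R.column_cyclic)
        fix i k
        assume "r i 0 k (- 1) \<noteq> 0"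
        then show "i + k \<in> - {h}" using into[of i k] \<open>g = 0\<close> by auto
      qed (use alpha h in auto)
      then show False using h by blast
    qed
    moreover have "n + j = h" if "of_int (n + j) = \<alpha>" for n j
      using that unfolding h(1)[symmetric] by (simp only: of_int_eq_iff)
    ultimately show ?thesis using into by (intro exI[of _ "- g"]) auto
  qed (auto intro: exI[of _ 1])
  then obtain g where g: "g \<noteq> 0"
    "\<And>n j. (n + j, - 1) \<in> S \<Longrightarrow> of_int (n + j) = \<alpha> \<Longrightarrow> r n 0 j (- 1) = g * (of_int j - \<alpha>)" by blast
  define t where "t i j = (if j = - 1 \<and> of_int i = \<alpha> then g else 1)" for i j :: int
  have t: "t i j \<noteq> 0" "t i 0 = 1" for i j using g by (auto simp: t_def)
  have tj: "j \<noteq> - 1 \<Longrightarrow> t i j = 1" "of_int i \<noteq> \<alpha> \<Longrightarrow> t i j = 1" for i j by (auto simp: t_def)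
  interpret T: zz_algebra "resc t r" S \<alpha> by (rule R.zz_resc) (use t in auto)
  have triv: "r n 0 j (- 1) = 0" if "of_int j = \<alpha>" for n j
    using flex_type_triv[OF flexr, of j n] that by simp
  have "block_minus (resc t r) S \<alpha>"
  proof
    show "good (- 1) \<alpha> n (resc t r)" for n
    proof -
      have nohole: "\<not> hole (- 1) \<alpha> i j" if "1 \<le> j" for i j using that by (simp add: hole_minus_one)
      have g: "good (- 1) \<alpha> n r" using t1(3)[of n] by (simp add: r_def \<kappa>)
      show ?thesis unfolding good_def
      proof (intro conjI allI impI)
        fix j k i
        assume *: "1 \<le> j \<and> j \<le> n \<and> \<not> hole (- 1) \<alpha> k (- 1) \<and> \<not> hole (- 1) \<alpha> i j \<and> \<not> hole (- 1) \<alpha> (k + i) (j - 1)"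
        then show "resc t r k (- 1) i j = block (- 1) \<alpha> k (- 1) i j"
          using goodD(2)[OF g, of j k i] tj by (simp add: resc_def hole_minus_one)
      qed (((use nohole in blast) | (use goodD[OF g] tj nohole in \<open>simp add: resc_def\<close>))+)
    qed
    show "resc t r i 1 j (- 1) = 2 * (of_int j - \<alpha>)" for i j
      using R.xy_minus_one[OF \<kappa>, of i j] tj by (cases "of_int j = \<alpha>") (simp_all add: resc_def)
    show "resc t r n 0 j (- 1) = of_int j - \<alpha>" if "(n + j, - 1) \<in> S \<or> of_int (n + j) \<noteq> \<alpha>" for n j
    proof (cases "of_int j = \<alpha>")
      case True
      then show ?thesis using triv by (simp add: resc_def)
    next
      case j: False
      show ?thesis
      proof (cases "of_int (n + j) = \<alpha>")
        case True
        then show ?thesis using g(2)[of n j] that j g(1) by (simp add: resc_def t_def)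
      next
        case False
        then have "r n 0 j (- 1) = - \<alpha> + of_int j"
          using flexr unfolding flex_type_def by (metis add.commute add_uminus_conv_diff right_minus_eq)
        then show ?thesis using tj(2)[OF False] tj(2)[OF j] t(2) by (simp add: resc_def)
      qed
    qed
  qed
  moreover have "resc t r = resc (\<lambda>i j. t1 i j * t i j) s"
    by (simp add: r_def resc_def fun_eq_iff mult_ac)
  ultimately show thesis using that[of "\<lambda>i j. t1 i j * t i j"] t t1 by simp
qed

lemma block_minus_one: "block (- 1) \<alpha> i j k l = C_lin \<alpha> i j k l"
  by (simp add: block_def C_lin_def algebra_simps)

context block_minus
begin

abbreviation "Y j \<equiv> of_int j - \<alpha>"

lemma no_hole: "j \<ge> 0 \<Longrightarrow> \<not> hole (- 1) \<alpha> i j"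
  by (auto simp: hole_minus_one)

lemma act: "l \<ge> 0 \<Longrightarrow> s m 0 k l = block (- 1) \<alpha> m 0 k l"
  using goodD(1)[OF good_pos, of l l k m] no_hole[of l]
  by (cases "l = 0") (simp_all add: witt block_def)

lemma x_bracket: "l \<ge> - 1 \<Longrightarrow> s a 1 k l = block (- 1) \<alpha> a 1 k l"
proof -
  assume "l \<ge> - 1"
  then consider "l = - 1" | "l = 0" | "l \<ge> 1" by linarith
  then show ?thesis
  proof cases
    case 1
    then show ?thesis by (simp add: xy block_def algebra_simps)
  next
    case 2
    then show ?thesis using skew[of a 1 k 0] act[of 1 k a] block_skew[of "- 1" \<alpha> a 1 k 0] by simp
  next
    case 3
    then show ?thesis using goodD(3)[OF good_pos, of l "l + 1" a k] no_hole by simp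
  qed
qed

lemma xy0: "of_int j = \<alpha> \<Longrightarrow> s j (- 1) i 1 = 0"
  using skew[of j "- 1" i 1] xy[of i j] by simp

text \<open>If (m, - 1) is a hole, the constants of the model vanish. The vector there commutes with
  column 1 and therefore with everything that column 1 generates.\<close>

lemma y_bracket:
  assumes "l \<ge> 1"
  shows "s m (- 1) k l = block (- 1) \<alpha> m (- 1) k l"
proof (cases "of_int m = \<alpha>")
  case False
  then show ?thesis
    using goodD(2)[OF good_pos assms order_refl, of m k] no_hole[of l] no_hole[of "l - 1"] assms
    by (simp add: hole_minus_one)
next
  case True
  have "s m (- 1) k (int n + 1) = 0" for n
  proof (induction n arbitrary: k)
    case 0
    then show ?case using xy0[OF True] by simp
  next
    case (Suc n)
    obtain a where a: "block (- 1) \<alpha> a 1 (k - a) (int n + 1) \<noteq> 0"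
      using choose_x[of "- 1" "int n + 1" \<alpha> k "{}"] no_hole by auto
    have "s a 1 (k - a) (int n + 1) * s m (- 1) k (int (Suc n) + 1) = 0"
      using leibniz[of a 1 "k - a" "int n + 1" m "- 1"] xy0[OF True, of a] Suc[of "k - a"] by (simp add: add_ac)
    then show ?case using a x_bracket by simp
  qed
  from this[of "nat (l - 1)"] show ?thesis
    using assms True by (simp add: block_def algebra_simps)
qed

lemma bracket:
  assumes "j \<ge> 0" "l \<ge> 0"
  shows "s i j k l = block (- 1) \<alpha> i j k l"
proof -
  have "s i (int n + 1) k l = block (- 1) \<alpha> i (int n + 1) k l" if "l \<ge> 0" for n i k l
    using that
  proof (induction n arbitrary: i k l)
    case 0
    then show ?case using x_bracket by simp
  next
    case (Suc n)
    obtain a where a: "block (- 1) \<alpha> a 1 (i - a) (int n + 1) \<noteq> 0"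
      using choose_x[of "- 1" "int n + 1" \<alpha> i "{}"] no_hole by auto
    define b where "b = i - a"
    have e: "a + b = i" "int (Suc n) + 1 = 1 + (int n + 1)" by (simp_all add: b_def)
    have IH: "s b (int n + 1) k' l' = block (- 1) \<alpha> b (int n + 1) k' l'" if "l' \<ge> 0" for k' l'
      using Suc.IH that by blast
    have "block (- 1) \<alpha> a 1 b (int n + 1) * s i (int (Suc n) + 1) k l
        = block (- 1) \<alpha> a 1 b (int n + 1) * block (- 1) \<alpha> i (int (Suc n) + 1) k l"
      using leibniz[of b "int n + 1" k l a 1] block_jacobi[of "- 1" \<alpha> b "int n + 1" k l a 1] Suc.prems
      unfolding e(2) e(1)[symmetric] by (auto simp: IH x_bracket)
    then show ?case using a by (simp add: b_def)
  qed
  from this[OF assms(2), of i "nat (j - 1)" k] show ?thesis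
    using act[OF assms(2)] assms(1) by (cases "j = 0") auto
qed

lemma ly0: "of_int j = \<alpha> \<Longrightarrow> s n 0 j (- 1) = 0"
  using ly[of n j] supp_zero(3)[of n j 0 "- 1"] by (cases "(n + j, - 1) \<in> S") auto

text \<open>Column - 2 is spanned by brackets of column - 1. On such a bracket the Leibniz rule
  gives 2 * Y a * Y b - 2 * Y b * Y a = 0, because column 0 acts on column - 1 as on
  functions.\<close>

lemma x_kills: "s m 1 p (- 2) = 0"
proof (cases "(p, - 2) \<in> S \<and> (m + p, - 1) \<in> S")
  case True
  obtain a where a: "s a (- 1) (p - a) (- 1) \<noteq> 0"
    using column_generated[of p "- 1" 1] True by auto
  have "s a (- 1) (p - a) (- 1) * s m 1 p (- 2)
      = 2 * Y a * s (m + a) 0 (p - a) (- 1) + 2 * Y (p - a) * s a (- 1) (m + (p - a)) 0"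
    using leibniz[of a "- 1" "p - a" "- 1" m 1] by (simp add: xy)
  moreover have "s (m + a) 0 (p - a) (- 1) = Y (p - a)" by (rule ly) (use True in \<open>simp add: add_ac\<close>)
  moreover have "s (m + (p - a)) 0 a (- 1) = Y a" by (rule ly) (use True in \<open>simp add: add_ac\<close>)
  ultimately have "s a (- 1) (p - a) (- 1) * s m 1 p (- 2) = 2 * Y a * Y (p - a) + 2 * Y (p - a) * - Y a"
    using skew[of a "- 1" "m + (p - a)" 0] by (simp only:)
  also have "\<dots> = 0" by (simp only: mult_minus_right mult_minus_left mult_ac add.right_inverse)
  finally have "s a (- 1) (p - a) (- 1) * s m 1 p (- 2) = 0" .
  then show ?thesis using a by simp
qed (use supp_zero(2)[of p "- 2" m 1] supp_zero(3)[of m p 1 "- 2"] in auto)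

lemma act_yy:
  "s n 0 (i + k) (- 2) * s i (- 1) k (- 1)
    = Y i * s (n + i) (- 1) k (- 1) + Y k * s i (- 1) (n + k) (- 1)"
proof -
  have *: "s n 0 j (- 1) = Y j \<or> (n + j, - 1) \<notin> S" for j using ly[of n j] by blast
  have "s n 0 i (- 1) * s (n + i) (- 1) k (- 1) = Y i * s (n + i) (- 1) k (- 1)"
    using *[of i] supp_zero(1)[of "n + i" "- 1"] by auto
  moreover have "s n 0 k (- 1) * s i (- 1) (n + k) (- 1) = Y k * s i (- 1) (n + k) (- 1)"
    using *[of k] supp_zero(2)[of "n + k" "- 1"] by auto
  moreover have "s i (- 1) k (- 1) * s n 0 (i + k) (- 2)
      = s n 0 i (- 1) * s (n + i) (- 1) k (- 1) + s n 0 k (- 1) * s i (- 1) (n + k) (- 1)"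
    using leibniz[of i "- 1" k "- 1" n 0] by simp
  ultimately show ?thesis by (simp only: mult.commute[of "s n 0 (i + k) (- 2)"])
qed

lemma x_yz: "s i (- 1) k (- 2) * s m 1 (i + k) (- 3) = 2 * Y i * s (m + i) 0 k (- 2)"
  using leibniz[of i "- 1" k "- 2" m 1] by (simp add: xy x_kills)

text \<open>If column - 2 is concentrated in the second hole, column 0 acts on it by zero, and
  equivariance makes the bracket of column - 1 a multiple of Y i. Column - 3 then vanishes by the
  Jacobi identity, and with it everything below.\<close>

lemma column_2_trivial:
  assumes triv: "\<And>k. (k, - 2) \<in> S \<Longrightarrow> of_int k = 2 * \<alpha>"
  obtains d where "\<And>i k. of_int (i + k) = 2 * \<alpha> \<Longrightarrow> s i (- 1) k (- 1) = d * Y i"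
    and "\<And>i j. j \<le> - 3 \<Longrightarrow> (i, j) \<notin> S"
    and "\<And>k i j. s i j k (- 2) = 0"
proof -
  have unique: "(k, - 2) \<in> S \<Longrightarrow> of_int k' = 2 * \<alpha> \<Longrightarrow> k' = k" for k k'
    using triv[of k] by (metis of_int_eq_iff)
  have c0: "s i (- 1) k (- 1) = 0" if "of_int (i + k) \<noteq> 2 * \<alpha>" for i k
    using triv[of "i + k"] supp_zero(3)[of i k "- 1" "- 1"] that by auto
  have \<rho>: "s n 0 k (- 2) = 0" for n k
  proof (rule ccontr)
    assume n: "s n 0 k (- 2) \<noteq> 0"
    then have S: "(k, - 2) \<in> S" "(n + k, - 2) \<in> S" using supp by fastforce+
    then have "n = 0" using unique[OF S(1) triv[OF S(2)]] by simp
    then show False using n weight[OF S(1)] triv[OF S(1)] by simp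
  qed
  have \<gamma>: "Y i' * s i (- 1) k (- 1) = Y i * s i' (- 1) k' (- 1)"
    if "of_int (i + k) = 2 * \<alpha>" "i + k = i' + k'" for i k i' k'
  proof (cases "i = i'")
    case False
    have Y: "Y k = - Y i" using that(1) by (simp add: algebra_simps)
    have "i - i' + i' = i" "i - i' + k = k'" using that by auto
    then have "Y i' * s i (- 1) k (- 1) + Y k * s i' (- 1) k' (- 1) = 0"
      using act_yy[of "i - i'" i' k] \<rho> by simp
    then show ?thesis unfolding Y by (simp only: mult_minus_left add_uminus_conv_diff right_minus_eq)
  qed (use that in simp)
  obtain d where d: "\<And>i k. of_int (i + k) = 2 * \<alpha> \<Longrightarrow> s i (- 1) k (- 1) = d * Y i"
  proof (cases "\<exists>p. of_int p = 2 * \<alpha>")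
    case True
    then obtain p where p: "of_int p = 2 * \<alpha>" by blast
    show thesis
    proof (rule that)
      fix i k
      assume ik: "of_int (i + k) = 2 * \<alpha>"
      then have "i + k = 0 + p" using p by (metis add_0 of_int_eq_iff)
      then show "s i (- 1) k (- 1) = (s 0 (- 1) p (- 1) / (- \<alpha>)) * Y i"
        using \<gamma>[OF ik, of 0 p] alpha(1) by (simp add: field_simps)
    qed
  qed (use that in blast)
  have empty3: "(k, - 3) \<notin> S" for k
  proof
    assume "(k, - 3) \<in> S"
    then obtain a where a: "s a (- 1) (k - a) (- 2) \<noteq> 0"
      using column_generated[of k "- 1" 2] by auto
    define p where "p = k - a"
    have p: "(p, - 2) \<in> S" "of_int p = 2 * \<alpha>" using a supp triv unfolding p_def by blast+
    obtain b where "s b (- 1) (p - b) (- 1) \<noteq> 0"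
      using column_generated[of p "- 1" 1] p(1) by auto
    then have d0: "d \<noteq> 0" using d[of b "p - b"] p(2) by auto
    \<comment> \<open>The vector of degree (p, - 2) is a multiple of the bracket of the degrees (j,
      - 1) and (p - j, - 1). For this j neither of the two has a nonzero bracket with (a, - 1), so
      that degree annihilates (p, - 2).\<close>
    obtain j where j: "j \<notin> {a, p - a}" "1 * of_int j + - \<alpha> \<noteq> 0"
      by (rule affine_nonzero[of 1 "- \<alpha>" "{a, p - a}"]) auto
    have "s j (- 1) (p - j) (- 1) \<noteq> 0" using d[of j "p - j"] j p d0 by simp
    moreover have "s a (- 1) j (- 1) = 0" "s a (- 1) (p - j) (- 1) = 0"
      using unique[OF p(1), of "a + j"] unique[OF p(1), of "a + (p - j)"] j(1) by (intro c0; fastforce)+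
    ultimately have "s a (- 1) p (- 2) = 0"
      using leibniz[of j "- 1" "p - j" "- 1" a "- 1"] by simp
    then show False using a by (simp add: p_def)
  qed
  have empty: "(k, - int (n + 3)) \<notin> S" for n k
  proof (induction n arbitrary: k)
    case (Suc n)
    show ?case
    proof
      assume "(k, - int (Suc n + 3)) \<in> S"
      then obtain a where "s a (- 1) (k - a) (- int (n + 3)) \<noteq> 0"
        using column_generated[of k "- 1" "n + 3"] by auto
      then show False using supp Suc by blast
    qed
  qed (use empty3 in simp)
  have low: "(i, j) \<notin> S" if "j \<le> - 3" for i j
    using empty[of i "nat (- j - 3)"] that by simp
  show thesis
  proof (rule that[OF d low])
    fix k i j
    have "S \<subseteq> {(i, j). s i j k (- 2) = 0}"
    proof (rule generation)
      fix i j i' j'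
      assume "(i, j) \<in> {(i, j). s i j k (- 2) = 0}" "(i', j') \<in> {(i, j). s i j k (- 2) = 0}" "s i j i' j' \<noteq> 0"
      then show "(i + i', j + j') \<in> {(i, j). s i j k (- 2) = 0}"
        using leibniz[of i' j' k "- 2" i j] by simp
    qed (use \<rho> x_kills low supp_zero(3)[of 0 k "- 1" "- 2"] in auto)
    then show "s i j k (- 2) = 0" using supp_zero(1)[of i j] by (cases "(i, j) \<in> S") auto
  qed
qed

text \<open>Since the degrees \<open>(p, - 3)\<close> are one-dimensional, the action on column \<open>- 2\<close> splits into
  factors; a factor is missing for at most one \<open>k\<close>, which another \<open>p\<close> provides.\<close>

lemma column_2_factors:
  assumes \<rho>0: "\<And>k. s 0 0 k (- 2) = of_int k - 2 * \<alpha>"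
  obtains g K where "\<And>q k. s (q - k) 0 k (- 2) = g k * K q"
proof -
  obtain h where h: "\<And>j. Y j = 0 \<Longrightarrow> j = h"
  proof (cases "\<exists>h. of_int h = \<alpha>")
    case True
    then obtain h where "of_int h = \<alpha>" by blast
    then show thesis using that[of h] by (metis of_int_eq_iff right_minus_eq)
  qed auto
  have fac: "s (q - k) 0 k (- 2) = s (p - k) (- 1) k (- 2) / (2 * Y (p - k)) * s (q - p) 1 p (- 3)" if "p - k \<noteq> h" for p q k
  proof -
    have "Y (p - k) \<noteq> 0" using h that by blast
    moreover have "s (p - k) (- 1) k (- 2) * s (q - p) 1 p (- 3) = 2 * Y (p - k) * s (q - k) 0 k (- 2)"
      using x_yz[of "p - k" k "q - p"] by simp
    ultimately show ?thesis by (simp only: times_divide_eq_left nonzero_eq_divide_eq mult_eq_0_iff zero_neq_numeral[symmetric] simp_thms mult.commute[of "s (q - k) 0 k (- 2)"])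
  qed
  \<comment> \<open>With p = 3 * h the factorisation misses only k = 2 * h, with p = 3 * h + 1 only
    k = 2 * h + 1; an index outside both matches the two versions.\<close>
  define g0 where "g0 k = s (3 * h - k) (- 1) k (- 2) / (2 * Y (3 * h - k))" for k
  define K0 where "K0 q = s (q - 3 * h) 1 (3 * h) (- 3)" for q
  define g1 where "g1 k = s (3 * h + 1 - k) (- 1) k (- 2) / (2 * Y (3 * h + 1 - k))" for k
  define K1 where "K1 q = s (q - (3 * h + 1)) 1 (3 * h + 1) (- 3)" for q
  have f0: "s (q - k) 0 k (- 2) = g0 k * K0 q" if "k \<noteq> 2 * h" for q k
    using fac[of "3 * h" k q] that by (simp add: g0_def K0_def)
  have f1: "s (q - k) 0 k (- 2) = g1 k * K1 q" if "k \<noteq> 2 * h + 1" for q k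
    using fac[of "3 * h + 1" k q] that by (simp add: g1_def K1_def)
  obtain k where k: "k \<notin> {2 * h, 2 * h + 1}" "1 * of_int k + - 2 * \<alpha> \<noteq> 0"
    by (rule affine_nonzero[of 1 "- 2 * \<alpha>" "{2 * h, 2 * h + 1}"]) auto
  have "g1 k * K1 k \<noteq> 0" using f1[of k k] \<rho>0[of k] k by simp
  then have "g1 k \<noteq> 0" by auto
  moreover have "g1 k * K1 q = g0 k * K0 q" for q using f0[of k q] f1[of k q] k by simp
  ultimately have K1: "K1 q = g0 k / g1 k * K0 q" for q by (simp add: field_simps)
  show thesis
  proof (rule that)
    show "s (q - k') 0 k' (- 2) = (if k' = 2 * h then g1 k' * (g0 k / g1 k) else g0 k') * K0 q" for q k'
      using f0[of k' q] f1[of k' q] K1[of q] by (cases "k' = 2 * h") simp_all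
  qed
qed

text \<open>Multiplied by g, the brackets of column - 1 become \<open>C i k\<close> and satisfy two
  identities. The Jacobi identity \<open>cyc\<close> gives C i k = Y k * f i - Y i * f k, and
  equivariance, \<open>shift\<close>, makes the increments of f independent of the place. So f is
  affine, and C i k is a multiple of k - i.\<close>

lemma column_2_module:
  assumes q0: "(q0, - 2) \<in> S" "of_int q0 \<noteq> 2 * \<alpha>"
  obtains g0 g where "g0 \<noteq> 0" "\<And>i k. s i (- 1) k (- 1) * g (i + k) = g0 * of_int (k - i)"
proof -
  \<comment> \<open>A missing degree of column - 2 has weight zero by
    \<open>hole_weight_zero\<close>, so the weight formula holds for all k.\<close>
  have \<rho>0: "s 0 0 k (- 2) = of_int k - 2 * \<alpha>" for k
  proof (cases "(k, - 2) \<in> S")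
    case False
    have "- 2 * \<alpha> + of_int k = 0"
    proof (rule hole_weight_zero[OF witt_column[of "- 2"]])
      show "s i 0 k (- 2) \<noteq> 0 \<Longrightarrow> k \<in> {k. (k, - 2) \<in> S} \<and> i + k \<in> {k. (k, - 2) \<in> S}" for i k
        using supp[of i 0 k "- 2"] by simp
      show "k \<in> {k. (k, - 2) \<in> S} \<Longrightarrow> s 0 0 k (- 2) = - 2 * \<alpha> + of_int k" for k using weight[of k "- 2"] by simp
      show "q0 \<in> {k. (k, - 2) \<in> S}" "- 2 * \<alpha> + of_int q0 \<noteq> 0" "k \<notin> {k. (k, - 2) \<in> S}" using q0 False by auto
    qed
    then show ?thesis using supp_zero(2)[OF False, of 0 0] by (simp add: algebra_simps)
  qed (use weight[of k "- 2"] in simp)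
  obtain g K where gK: "\<And>q k. s (q - k) 0 k (- 2) = g k * K q"
    using column_2_factors[OF \<rho>0] by blast
  have \<sigma>: "g k * K k = of_int k - 2 * \<alpha>" for k using gK[of k k] \<rho>0[of k] by simp
  define C where "C i k = s i (- 1) k (- 1) * g (i + k)" for i k
  have C_skew: "C k i = - C i k" for i k using skew[of k "- 1" i "- 1"] by (simp add: C_def add.commute)
  have shift: "(Y i + Y k + of_int n) * C i k = Y i * C (n + i) k + Y k * C i (n + k)" for i k n
  proof -
    have "g (i + k) * K (n + (i + k)) * s i (- 1) k (- 1)
        = Y i * s (n + i) (- 1) k (- 1) + Y k * s i (- 1) (n + k) (- 1)"
      using act_yy[of n i k] gK[of "n + (i + k)" "i + k"] by simp
    then have "(g (n + (i + k)) * K (n + (i + k))) * C i k = Y i * C (n + i) k + Y k * C i (n + k)"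
      unfolding C_def by (simp only: add_ac) algebra
    moreover have "of_int (n + (i + k)) - 2 * \<alpha> = Y i + Y k + of_int n" by simp
    ultimately show ?thesis unfolding \<sigma> by (simp only:)
  qed
  have cyc: "Y k * C i j + Y i * C j k + Y j * C k i = 0" for i j k
  proof -
    have "g q0 * K q0 \<noteq> 0" using \<sigma>[of q0] q0(2) by simp
    then obtain q where q: "K q \<noteq> 0" by fastforce
    define P where "P = i + j + k"
    define X where "X = s (q - P) 1 P (- 3)"
    have e: "s i (- 1) j (- 1) * s k (- 1) (i + j) (- 2) + s j (- 1) k (- 1) * s i (- 1) (j + k) (- 2)
        + s k (- 1) i (- 1) * s j (- 1) (i + k) (- 2) = 0"
      using leibniz[of i "- 1" j "- 1" k "- 1"] skew[of "i + k" "- 2" j "- 1"] skew[of "k + i" "- 2" j "- 1"]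
        skew[of "j + k" "- 2" i "- 1"] skew[of k "- 1" j "- 1"]
      by (simp add: add.commute)
    have G: "s a (- 1) b (- 2) * X = 2 * Y a * (g b * K q)" if "a + b = P" for a b
    proof -
      have "q - P + a = q - b" using that by simp
      then show ?thesis using x_yz[of a b "q - P"] gK[of q b] that by (simp only: X_def)
    qed
    have "2 * K q * (Y k * C i j + Y i * C j k + Y j * C k i)
      = s i (- 1) j (- 1) * (2 * Y k * (g (i + j) * K q)) + s j (- 1) k (- 1) * (2 * Y i * (g (j + k) * K q))
        + s k (- 1) i (- 1) * (2 * Y j * (g (i + k) * K q))"
      by (simp add: C_def algebra_simps)
    also have "\<dots> = (s i (- 1) j (- 1) * s k (- 1) (i + j) (- 2) + s j (- 1) k (- 1) * s i (- 1) (j + k) (- 2)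
        + s k (- 1) i (- 1) * s j (- 1) (i + k) (- 2)) * X"
    proof -
      have "k + (i + j) = P" "i + (j + k) = P" "j + (i + k) = P" by (simp_all add: P_def)
      note e = this[THEN G, symmetric]
      show ?thesis unfolding e by (simp only: distrib_right mult.assoc)
    qed
    finally have "2 * K q * (Y k * C i j + Y i * C j k + Y j * C k i) = 0" using e by simp
    then show ?thesis using q by simp
  qed
  obtain u where u: "u \<notin> {}" "1 * of_int u + - \<alpha> \<noteq> 0" by (rule affine_nonzero[of 1 "- \<alpha>" "{}"]) auto
  then have Yu: "Y u \<noteq> 0" by simp
  define f where "f i = C i u / Y u" for i
  have Cf: "C i k = Y k * f i - Y i * f k" for i k
  proof -
    have "Y k * C i u + Y i * - C k u + Y u * - C i k = 0"
      using cyc[of k i u] unfolding C_skew[of u k] C_skew[of k i] .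
    then have "Y u * C i k = Y k * C i u - Y i * C k u" by algebra
    then have "C i k = (Y k * C i u - Y i * C k u) / Y u"
      by (intro nonzero_eq_divide_eq[THEN iffD2, OF Yu]) (simp only: mult.commute)
    then show ?thesis unfolding f_def by (simp only: diff_divide_distrib times_divide_eq_right)
  qed
  have diff: "f (n + i) - f i = f (n + k) - f k" if "Y i \<noteq> 0" "Y k \<noteq> 0" for i k n
  proof -
    have "Y i * Y k * ((f (n + i) - f i) - (f (n + k) - f k)) = 0"
      using shift[of i k n] unfolding Cf of_int_add by algebra
    then show ?thesis using that by simp
  qed
  define \<delta> where "\<delta> = f (u + 1)"
  have fu: "f u = 0" using C_skew[of u u] by (simp add: f_def)
  have step: "f (n + u + 1) = f (n + u) + \<delta>" for n
  proof -
    have fin: "finite {i. of_int (n + i) = \<alpha>}"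
      by (rule finite_unique) (metis add_left_imp_eq of_int_eq_iff)
    \<comment> \<open>Both Y i and Y (n + i) have to be nonzero, so that \<open>diff\<close>
      compares the increments at i and at n + i with those at u.\<close>
    obtain i where i: "i \<notin> {i. of_int (n + i) = \<alpha>}" "1 * of_int i + - \<alpha> \<noteq> 0"
      by (rule affine_nonzero[OF disjI1[OF one_neq_zero] fin]) blast
    then have Y: "Y i \<noteq> 0" "Y (n + i) \<noteq> 0" by simp_all
    have "f (n + 1 + u) - f u = f (n + 1 + i) - f i" by (rule diff[OF Yu Y(1)])
    moreover have "f (n + u) - f u = f (n + i) - f i" by (rule diff[OF Yu Y(1)])
    moreover have "f (1 + u) - f u = f (1 + (n + i)) - f (n + i)" by (rule diff[OF Yu Y(2)])
    ultimately have "(f (n + 1 + u) - f u) - (f (n + u) - f u) = f (1 + u) - f u"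
      by (simp only:) (simp add: algebra_simps)
    then show ?thesis by (simp add: fu \<delta>_def algebra_simps)
  qed
  have "f (n + u) = of_int n * \<delta>" for n
  proof (induction n rule: int_induct[where k = 0])
    case (step1 i)
    then show ?case using step[of i] by (simp add: algebra_simps)
  next
    case (step2 i)
    then show ?case using step[of "i - 1"] by (simp add: algebra_simps)
  qed (simp add: fu)
  then have f: "f i = of_int (i - u) * \<delta>" for i by (metis diff_add_cancel)
  define g0 where "g0 = - \<delta> * Y u"
  have C: "C i k = g0 * of_int (k - i)" for i k
    unfolding Cf f g0_def of_int_diff by algebra
  show thesis
  proof (rule that)
    obtain a where a: "s a (- 1) (q0 - a) (- 1) \<noteq> 0"
      using column_generated[of q0 "- 1" 1] q0(1) by auto
    have "g q0 \<noteq> 0" using \<sigma>[of q0] q0(2) by auto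
    then show "g0 \<noteq> 0" using a C[of a "q0 - a"] by (auto simp: C_def)
    show "s i (- 1) k (- 1) * g (i + k) = g0 * of_int (k - i)" for i k
      using C[of i k] by (simp add: C_def)
  qed
qed

end

text \<open>The columns up to \<open>- 2\<close> are scaled such that \<open>(0, - 1)\<close> acts on them as in \<open>\<C>(\<alpha>)\<close>, unless it
  acts by zero, which is excluded later.\<close>

locale block_C = block_minus +
  assumes yy: "s i (- 1) k (- 1) = of_int (k - i)"
    and y0: "n \<ge> 2 \<Longrightarrow> s 0 (- 1) p (- int n) \<noteq> 0 \<Longrightarrow> s 0 (- 1) p (- int n) = - \<alpha>"

text \<open>The vector of degree (0, - 1) preserves the first degree, so the scaling is propagated
  down each line of fixed p: the factor at depth n + 1 makes the action from column - 2 - n equal to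
  - \<alpha>. A vanishing constant is left alone.\<close>

primrec C_scale where
  "C_scale s \<alpha> g p 0 = g p"
| "C_scale s \<alpha> g p (Suc n) = C_scale s \<alpha> g p n
    * (if s 0 (- 1) p (- 2 - int n) = 0 then 1 else s 0 (- 1) p (- 2 - int n) / (- \<alpha>))"

lemma (in block_minus) block_C_exists:
  assumes q0: "(q0, - 2) \<in> S" "of_int q0 \<noteq> 2 * \<alpha>"
  obtains t where "\<And>i j. t i j \<noteq> 0" "\<And>i. t i 0 = 1" "block_C (resc t s) S \<alpha>"
proof -
  obtain g0 g where g0: "g0 \<noteq> 0" and g: "\<And>i k. s i (- 1) k (- 1) * g (i + k) = g0 * of_int (k - i)"
    using column_2_module[OF q0] by blast
  have gnz: "g p \<noteq> 0" for p
  proof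
    assume "g p = 0"
    obtain i where "i \<notin> {}" "- 2 * of_int i + of_int p \<noteq> (0::'a)" by (rule affine_nonzero[of "- 2" "of_int p" "{}"]) auto
    then have "of_int (p - i - i) \<noteq> (0::'a)" by (simp add: algebra_simps)
    then show False using g[of i "p - i"] g0 \<open>g p = 0\<close> by simp
  qed
  define T where "T = C_scale s \<alpha> (\<lambda>p. g0 / g p)"
  define t where "t i j = (if j \<le> - 2 then T i (nat (- j - 2)) else 1)" for i j
  have T: "T p n \<noteq> 0" for p n unfolding T_def by (induction n) (use gnz g0 alpha in auto)
  have t: "t i j \<noteq> 0" "j \<ge> - 1 \<Longrightarrow> t i j = 1" for i j using T by (auto simp: t_def)
  interpret R: zz_algebra "resc t s" S \<alpha> by (rule zz_resc) (use t in auto)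
  have "block_C (resc t s) S \<alpha>"
  proof
    show "good (- 1) \<alpha> n (resc t s)" for n
    proof (subst good_cong[of _ s])
      show "resc t s i j k l = s i j k l" if "\<bar>j\<bar> \<le> 1" "1 \<le> l" for i j k l
        using that t(2) by (simp add: resc_def)
    qed (rule good_pos)
    show "resc t s i 1 j (- 1) = 2 * Y j" for i j using xy t(2) by (simp add: resc_def)
    show "(n + j, - 1) \<in> S \<or> of_int (n + j) \<noteq> \<alpha> \<Longrightarrow> resc t s n 0 j (- 1) = Y j" for n j
      using ly t(2) by (simp add: resc_def)
    show "resc t s i (- 1) k (- 1) = of_int (k - i)" for i k
      using g[of i k] gnz[of "i + k"] g0 by (simp add: resc_def t_def T_def field_simps)
    show "resc t s 0 (- 1) p (- int n) = - \<alpha>" if n: "n \<ge> 2" "resc t s 0 (- 1) p (- int n) \<noteq> 0" for n p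
    proof -
      obtain m where m: "n = m + 2" using n(1) by (metis add.commute le_Suc_ex)
      have "nat (1 + (int m + 2) - 2) = Suc m" "nat (int m + 2 - 2) = m" by auto
      moreover have e: "- int (m + 2) = - 2 - int m" by simp
      moreover have "s 0 (- 1) p (- 2 - int m) \<noteq> 0" using n(2) unfolding resc_def m e by auto
      ultimately show ?thesis using T[of p m] alpha(1) by (simp add: resc_def t_def m T_def)
    qed
  qed
  then show thesis using that[of t] t by simp
qed

lemma (in block_minus) upper_supp:
  assumes "j \<ge> 0"
  shows "(i, j) \<in> S"
proof -
  obtain m where "m \<notin> {}" "of_int (- j - 1) * of_int m + (of_int i + of_int j * \<alpha>) \<noteq> 0"
    by (rule affine_nonzero[of "of_int (- j - 1)" "of_int i + of_int j * \<alpha>" "{}"]) (use assms in \<open>auto simp del: of_int_minus of_int_diff\<close>)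
  moreover have "s m 0 i j = of_int (- j - 1) * of_int m + (of_int i + of_int j * \<alpha>)"
    using act[OF assms, of m i] by (simp add: block_def algebra_simps)
  ultimately have "s m 0 i j \<noteq> 0" by simp
  then show ?thesis using supp by blast
qed

lemma below_minus_one: "j \<le> - 2 \<Longrightarrow> \<exists>n. j = - 2 - int n"
  by (intro exI[of _ "nat (- 2 - j)"]) simp

context block_C
begin

lemma column_minus_one: "(i, - 1) \<in> S"
proof -
  have "s i (- 1) (i + 1) (- 1) \<noteq> 0" using yy[of i "i + 1"] by simp
  then show ?thesis using supp by blast
qed

lemma ly': "s n 0 j (- 1) = Y j"
  using ly column_minus_one by simp

lemma column_minus_two: "s m 0 k (- 2) = C_lin \<alpha> m 0 k (- 2)"
proof -
  obtain i where i: "i \<notin> {}" "- 2 * of_int i + of_int k \<noteq> (0::'a)"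
    by (rule affine_nonzero[of "- 2" "of_int k" "{}"]) auto
  define j where "j = k - i"
  have k: "of_int k = of_int i + (of_int j :: 'a)" by (simp add: j_def)
  have "s m 0 k (- 2) * of_int (j - i) = Y i * of_int (j - (m + i)) + Y j * of_int (m + j - i)"
    using act_yy[of m i j] unfolding yy by (simp add: j_def)
  then have "s m 0 k (- 2) * of_int (j - i) = (of_int k - 2 * \<alpha> + of_int m) * of_int (j - i)"
    unfolding k of_int_add of_int_diff by algebra
  moreover have "of_int (j - i) \<noteq> (0::'a)" using i(2) unfolding k by simp
  ultimately show ?thesis by (simp add: C_lin_def)
qed

text \<open>Equation \<open>E\<close> only gives products of a lowering and a raising constant. For
  i = 0 and a suitable m the product is nonzero, so the normalisation of (0, - 1) applies and fixes
  the raising constant, which in turn determines the lowering constants for all i.\<close>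

lemma low_step:
  assumes act': "\<And>m k. s m 0 k (- 2 - int n) = C_lin \<alpha> m 0 k (- 2 - int n)"
    and xy': "\<And>m k i. s m 1 k (- 2 - int n) * s i (- 1) (m + k) (- 1 - int n)
      = of_nat n * C_lin \<alpha> m 1 k (- 2 - int n) * Y i"
  shows "s i (- 1) k (- 2 - int n) = Y i"
    and "s m 0 k (- 3 - int n) = C_lin \<alpha> m 0 k (- 3 - int n)"
    and "s m 1 k (- 3 - int n) = of_nat (Suc n) * C_lin \<alpha> m 1 k (- 3 - int n)"
proof -
  have e: "- 2 - int n - 1 = - 3 - int n" "- 1 + (- 2 - int n) = - 3 - int n" "1 + (- 2 - int n) = - 1 - int n" by auto
  have E: "s i (- 1) k (- 2 - int n) * s m 1 (i + k) (- 3 - int n)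
      = Y i * (of_nat (Suc n) * C_lin \<alpha> m 1 (i + k) (- 3 - int n))" for i k m
  proof -
    have "s i (- 1) k (- 2 - int n) * s m 1 (i + k) (- 3 - int n)
      = 2 * Y i * C_lin \<alpha> (m + i) 0 k (- 2 - int n) + of_nat n * C_lin \<alpha> m 1 k (- 2 - int n) * Y i"
      using leibniz[of i "- 1" k "- 2 - int n" m 1] unfolding e xy' by (simp add: xy act')
    then show ?thesis unfolding C_lin_def of_int_add of_int_diff of_int_mult of_int_minus of_int_numeral of_int_of_nat_eq of_nat_Suc of_int_1 of_int_0 by algebra
  qed
  have y: "s i (- 1) k (- 2 - int n) = Y i" for i k
  proof -
    define p where "p = i + k"
    have nz: "of_nat (n + 2) \<noteq> (0::'a)" by (subst of_nat_eq_0_iff) simp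
    obtain m where m: "m \<notin> {}" "of_nat (n + 2) * of_int m + (2 * of_int p - of_nat (n + 4) * \<alpha>) \<noteq> 0"
      by (rule affine_nonzero[OF disjI1[OF nz] finite.emptyI]) blast
    define w where "w = of_nat (Suc n) * C_lin \<alpha> m 1 p (- 3 - int n)"
    define K where "K = s m 1 p (- 3 - int n)"
    have w: "w \<noteq> 0"
    proof -
      have "C_lin \<alpha> m 1 p (- 3 - int n) = of_nat (n + 2) * of_int m + (2 * of_int p - of_nat (n + 4) * \<alpha>)"
        by (simp add: C_lin_def algebra_simps)
      then show ?thesis unfolding w_def using m(2) by (simp del: of_nat_Suc)
    qed
    have E0: "s 0 (- 1) p (- 2 - int n) * K = - \<alpha> * w" using E[of 0 p m] by (simp add: w_def K_def)
    then have "s 0 (- 1) p (- 2 - int n) \<noteq> 0" using w alpha by auto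
    then have "s 0 (- 1) p (- 2 - int n) = - \<alpha>" using y0[of "n + 2" p] by simp
    then have "K = w" using E0 alpha by simp
    moreover have "s i (- 1) k (- 2 - int n) * K = Y i * w" using E[of i k m] by (simp add: w_def K_def p_def)
    ultimately show ?thesis using w by simp
  qed
  show "s i (- 1) k (- 2 - int n) = Y i" by (rule y)
  show "s m 1 k (- 3 - int n) = of_nat (Suc n) * C_lin \<alpha> m 1 k (- 3 - int n)"
    using E[of 0 k m] y[of 0 k] alpha(1) by simp
  have "- \<alpha> * s m 0 k (- 3 - int n) = - \<alpha> * (Y m + C_lin \<alpha> m 0 k (- 2 - int n))"
    using leibniz[of 0 "- 1" k "- 2 - int n" m 0] unfolding e y act' by (simp add: ly' y algebra_simps)
  then have "s m 0 k (- 3 - int n) = Y m + C_lin \<alpha> m 0 k (- 2 - int n)"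
    using alpha(1) by (simp only: mult_cancel_left neg_equal_0_iff_equal simp_thms)
  then show "s m 0 k (- 3 - int n) = C_lin \<alpha> m 0 k (- 3 - int n)"
    by (simp add: C_lin_def algebra_simps)
qed

lemma low_columns:
  "s m 0 k (- 2 - int n) = C_lin \<alpha> m 0 k (- 2 - int n)"
  "s m 1 k (- 2 - int n) = of_nat n * C_lin \<alpha> m 1 k (- 2 - int n)"
  "s m (- 1) k (- 2 - int n) = Y m"
proof -
  define act' where "act' n \<longleftrightarrow> (\<forall>m k. s m 0 k (- 2 - int n) = C_lin \<alpha> m 0 k (- 2 - int n))" for n
  define x' where "x' n \<longleftrightarrow> (\<forall>m k. s m 1 k (- 2 - int n) = of_nat n * C_lin \<alpha> m 1 k (- 2 - int n))" for n
  define y' where "y' n \<longleftrightarrow> (\<forall>m k. s m (- 1) k (- 2 - int n) = Y m)" for n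
  \<comment> \<open>A condition on the product and not on its factors, so as to include n = 0: there
    the bracket with (i, - 1) takes place inside column - 1 and is not Y i, but both sides vanish by
    \<open>x_kills\<close>.\<close>
  define xy' where "xy' n \<longleftrightarrow> (\<forall>m k i. s m 1 k (- 2 - int n) * s i (- 1) (m + k) (- 1 - int n)
      = of_nat n * C_lin \<alpha> m 1 k (- 2 - int n) * Y i)" for n
  have e: "- 2 - int (Suc n) = - 3 - int n" "- 1 - int (Suc n) = - 2 - int n" for n by simp_all
  have step: "y' n \<and> act' (Suc n) \<and> x' (Suc n)" if "act' n" "xy' n" for n
    using low_step[of n] that unfolding act'_def x'_def y'_def xy'_def e by blast
  have base: "act' 0" "x' 0" "xy' 0" using column_minus_two x_kills by (simp_all add: act'_def x'_def xy'_def)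
  have "act' n \<and> x' n \<and> xy' n" for n
  proof (induction n)
    case (Suc n)
    then have st: "y' n" "act' (Suc n)" "x' (Suc n)" using step by auto
    then have "xy' (Suc n)" unfolding xy'_def x'_def y'_def e by simp
    then show ?case using st by blast
  qed (use base in blast)
  then have "act' n" "x' n" "y' n" using step by auto
  then show "s m 0 k (- 2 - int n) = C_lin \<alpha> m 0 k (- 2 - int n)"
    "s m 1 k (- 2 - int n) = of_nat n * C_lin \<alpha> m 1 k (- 2 - int n)"
    "s m (- 1) k (- 2 - int n) = Y m" by (auto simp: act'_def x'_def y'_def)
qed

text \<open>For l \<le> - 2 and j \<ge> 0 this is the falling factorial with j factors starting at -
  l - 2. It is zero as soon as j + l \<ge> - 1, in accordance with \<open>x_kills\<close>.\<close>

definition C_factor :: "int \<Rightarrow> int \<Rightarrow> 'a" where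
  "C_factor j l = (if l \<ge> - 1 then 1 else fact_quot (- l - 2) (- l - j - 2))"

lemma C_factor_step:
  assumes "l \<le> - 2" "j \<ge> 0"
  shows "C_factor j l * C_factor 1 (j + l) = C_factor (j + 1) l" "C_factor 1 l * C_factor j (1 + l) = C_factor (j + 1) l"
proof -
  define n where "n = nat (- l - 2)"
  define m where "m = nat j"
  have l: "l = - 2 - int n" and j: "j = int m" using assms by (simp_all add: n_def m_def)
  show "C_factor j l * C_factor 1 (j + l) = C_factor (j + 1) l"
  proof (cases "m + 1 \<le> n")
    case True
    then obtain d where "n = m + 1 + d" by (metis le_Suc_ex)
    moreover have "1 + of_nat d \<noteq> (0::'a)" by (metis of_nat_Suc of_nat_neq_0)
    ultimately show ?thesis by (simp add: C_factor_def l j fact_quot_def nat_add_distrib)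
  next
    case False
    then show ?thesis by (cases "m = n") (simp_all add: C_factor_def l j fact_quot_def)
  qed
  show "C_factor 1 l * C_factor j (1 + l) = C_factor (j + 1) l"
  proof (cases n)
    case (Suc n')
    then show ?thesis
      by (cases "m \<le> n'") (simp_all add: C_factor_def l j fact_quot_def nat_add_distrib of_nat_diff add_ac)
  qed (simp add: C_factor_def l j fact_quot_def)
qed

lemma upper_bracket:
  assumes "j \<ge> 0"
  shows "s i j k l = C_factor j l * C_lin \<alpha> i j k l"
proof -
  have EE0: "C_factor 0 l = 1" for l by (simp add: C_factor_def fact_quot_def)
  have EE1: "C_factor 1 (- 2 - int n) = of_nat n" for n
    by (cases n) (simp_all add: C_factor_def fact_quot_def nat_add_distrib)
  have zero: "s i 0 k l = C_factor 0 l * C_lin \<alpha> i 0 k l" for i k l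
  proof -
    consider "l \<ge> 0" | "l = - 1" | "l = - 2 - int (nat (- 2 - l))" by linarith
    then show ?thesis
    proof cases
      case 3
      then show ?thesis using low_columns(1)[of i k "nat (- 2 - l)"] by (simp add: EE0)
    qed (simp_all add: EE0 act ly' block_minus_one C_lin_def)
  qed
  have one: "s i 1 k l = C_factor 1 l * C_lin \<alpha> i 1 k l" for i k l
  proof -
    consider "l \<ge> - 1" | "l = - 2 - int (nat (- 2 - l))" by linarith
    then show ?thesis
    proof cases
      case 1
      then show ?thesis using x_bracket by (simp add: C_factor_def block_minus_one)
    next
      case 2
      then show ?thesis using low_columns(2)[of i k "nat (- 2 - l)"] EE1[of "nat (- 2 - l)"] by simp
    qed
  qed
  have high: "s i j k l = C_lin \<alpha> i j k l" if "j \<ge> 0" "l \<ge> - 1" for i j k l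
  proof -
    note jl = that
    consider "l \<ge> 0" | "l = - 1" "j \<ge> 1" | "l = - 1" "j = 0" using jl by linarith
    then show ?thesis
    proof cases
      case 1
      then show ?thesis using bracket jl by (simp add: block_minus_one)
    next
      case 2
      then show ?thesis using y_bracket[of j k i] skew[of i j k l] block_skew[of "- 1" \<alpha> i j k l] by (simp add: block_minus_one)
    next
      case 3
      then show ?thesis using zero[of i k l] by (simp add: C_factor_def)
    qed
  qed
  have "s i (int n + 1) k l = C_factor (int n + 1) l * C_lin \<alpha> i (int n + 1) k l" for n i k l
  proof (induction n arbitrary: i k l)
    case 0
    then show ?case using one by simp
  next
    case (Suc n)
    show ?case
    proof (cases "l \<ge> - 1")
      case True
      then show ?thesis using high[of "int (Suc n) + 1" l] by (simp add: C_factor_def)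
    next
      case False
      define j where "j = int n + 1"
      obtain a where a: "block (- 1) \<alpha> a 1 (i - a) j \<noteq> 0"
        using choose_x[of "- 1" j \<alpha> i "{}"] no_hole by (auto simp: j_def)
      define b where "b = i - a"
      have e: "a + b = i" "int (Suc n) + 1 = j + 1" "1 + j = j + 1" by (simp_all add: b_def j_def)
      have IH: "s b j k' l' = C_factor j l' * C_lin \<alpha> b j k' l'" for k' l'
        using Suc.IH by (simp add: j_def)
      have j: "C_factor 1 j = 1" by (simp add: C_factor_def j_def)
      have C_factor: "C_factor j l * C_factor 1 (j + l) = C_factor (j + 1) l" "C_factor 1 l * C_factor j (1 + l) = C_factor (j + 1) l"
        using C_factor_step[of l j] False by (simp_all add: j_def)
      have "C_lin \<alpha> a 1 b j * s i (j + 1) k l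
        = (C_factor j l * C_factor 1 (j + l)) * (C_lin \<alpha> b j k l * C_lin \<alpha> a 1 (b + k) (j + l))
          - (C_factor 1 l * C_factor j (1 + l)) * (C_lin \<alpha> a 1 k l * C_lin \<alpha> b j (a + k) (1 + l))"
        using leibniz[of b j k l a 1] unfolding IH one e by (simp add: j algebra_simps)
      also have "\<dots> = C_lin \<alpha> a 1 b j * (C_factor (j + 1) l * C_lin \<alpha> i (j + 1) k l)"
        using block_jacobi[of "- 1" \<alpha> b j k l a 1] unfolding C_factor block_minus_one e by algebra
      finally show ?thesis using a unfolding e by (simp add: block_minus_one b_def)
    qed
  qed
  from this[of i "nat (j - 1)" k l] show ?thesis
    using zero[of i k l] assms by (cases "j = 0") auto
qed

text \<open>On columns below - 1 the degree (a, - 1) acts with the constant Y a, whatever vector it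
  is applied to. These actions commute, so brackets of column - 1, that is column - 2, act by zero
  there. Lower columns are reached from column - 2 by (0, - 1).\<close>

lemma lower_bracket: "s i (- 2 - int n) k (- 2 - int m) = 0"
proof (induction n arbitrary: i k m)
  case 0
  have y: "s a (- 1) b (- 3 - int m) = Y a" for a b
    using low_columns(3)[of a b "Suc m"] by simp
  define p where "p = (if i = 0 then 1 else 0 :: int)"
  have "s p (- 1) (i - p) (- 1) \<noteq> 0" unfolding yy by (subst of_int_eq_0_iff) (simp add: p_def)
  moreover have "s p (- 1) (i - p) (- 1) * s i (- 2) k (- 2 - int m) = 0"
    using leibniz[of "i - p" "- 1" k "- 2 - int m" p "- 1"] low_columns(3)[of _ _ m] y by (simp add: mult.commute)
  ultimately show ?case by simp
next
  case (Suc n)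
  have "s 0 (- 1) i (- 2 - int n) * s i (- 2 - int (Suc n)) k (- 2 - int m) = 0"
    using leibniz[of i "- 2 - int n" k "- 2 - int m" 0 "- 1"] Suc[of i k m] Suc[of i k "Suc m"] by simp
  then show ?case using low_columns(3)[of 0 i n] alpha(1) by simp
qed

lemma coeff: "s i j k l = C_coeff \<alpha> i j k l"
proof -
  have up: "s i j k l = C_coeff \<alpha> i j k l" if "j \<ge> 0" for i j k l
  proof (cases "l \<ge> - 1")
    case True
    then show ?thesis using upper_bracket[OF that, of i k l] that by (simp add: C_factor_def C_coeff_def)
  next
    case False
    then show ?thesis using upper_bracket[OF that, of i k l] that by (simp add: C_factor_def C_coeff_def)
  qed
  consider "j \<ge> 0" | "j < 0" "l \<ge> 0" | "j = - 1" "l = - 1" | "j = - 1" "l \<le> - 2" | "j \<le> - 2" "l = - 1" | "j \<le> - 2" "l \<le> - 2"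
    by linarith
  then show ?thesis
  proof cases
    case 1
    then show ?thesis by (rule up)
  next
    case 2
    have "C_coeff \<alpha> i j k l = - C_coeff \<alpha> k l i j"
      using 2 by (auto simp: C_coeff_def C_lin_def algebra_simps)
    then show ?thesis using up[OF 2(2), of k i j] skew[of i j k l] by simp
  next
    case 3
    then show ?thesis using yy by (simp add: C_coeff_def)
  next
    case 4
    then show ?thesis using below_minus_one[OF 4(2)] low_columns(3)[of i k] by (auto simp: C_coeff_def)
  next
    case 5
    then show ?thesis using below_minus_one[OF 5(1)] low_columns(3)[of k i] skew[of i j k l] by (auto simp: C_coeff_def)
  next
    case 6
    then show ?thesis using below_minus_one[OF 6(1)] below_minus_one[OF 6(2)] lower_bracket by (auto simp: C_coeff_def)
  qed
qed

lemma supp_UNIV: "S = UNIV"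
proof -
  have "(i, j) \<in> S" for i j
  proof -
    consider "j \<ge> 0" | "j = - 1" | "j \<le> - 2" by linarith
    then show ?thesis
    proof cases
      case 1
      then show ?thesis by (rule upper_supp)
    next
      case 2
      then show ?thesis using column_minus_one by simp
    next
      case 3
      then obtain n where j: "j = - 2 - int n" using below_minus_one by blast
      have "s 0 (- 1) i j \<noteq> 0" using low_columns(3)[of 0 i n] alpha(1) by (simp add: j)
      then show ?thesis using supp by blast
    qed
  qed
  then show ?thesis by auto
qed

end


section \<open>Normal forms of the structure constants\<close>

text \<open>\<open>D\<close> tells which columns occur: all of them for \<open>\<B>\<close> and those with \<open>j \<ge> - 1\<close> for \<open>\<B>\<^sup>+\<close>.\<close>

locale block_shape = zz_algebra s S \<alpha> for s :: "int \<Rightarrow> int \<Rightarrow> int \<Rightarrow> int \<Rightarrow> 'f::field_char_0" and S \<alpha> +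
  fixes \<kappa> c d d' :: 'f and D :: "int \<Rightarrow> bool"
  assumes columns: "\<kappa> \<noteq> 1 \<and> \<kappa> \<noteq> - 1 \<and> D = (\<lambda>j. True) \<or> \<kappa> = - 1 \<and> D = (\<lambda>j. j \<ge> - 1)"
    and degrees: "\<not> hole \<kappa> \<alpha> i j \<Longrightarrow> (i, j) \<in> S \<longleftrightarrow> D j"
      "hole1 \<kappa> \<alpha> i j \<Longrightarrow> (i, j) \<in> S \<longleftrightarrow> c \<noteq> 0"
      "hole2 \<kappa> \<alpha> i j \<Longrightarrow> (i, j) \<in> S \<longleftrightarrow> d \<noteq> 0 \<or> d' \<noteq> 0"
    and central: "hole \<kappa> \<alpha> k l \<Longrightarrow> s i j k l = 0"
    and bracket: "\<lbrakk>D j; D l; \<not> hole \<kappa> \<alpha> i j; \<not> hole \<kappa> \<alpha> k l; \<not> hole \<kappa> \<alpha> (i + k) (j + l)\<rbrakk>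
      \<Longrightarrow> s i j k l = block \<kappa> \<alpha> i j k l"
      "\<lbrakk>D j; D l; \<not> hole \<kappa> \<alpha> i j; \<not> hole \<kappa> \<alpha> k l; hole1 \<kappa> \<alpha> (i + k) (j + l)\<rbrakk>
      \<Longrightarrow> s i j k l = c * (\<alpha> * of_int j + of_int i)"
      "\<lbrakk>D j; D l; \<not> hole \<kappa> \<alpha> i j; \<not> hole \<kappa> \<alpha> k l; hole2 \<kappa> \<alpha> (i + k) (j + l)\<rbrakk>
      \<Longrightarrow> s i j k l = d * (\<alpha> * of_int j + of_int i) + d' * (\<alpha> + \<kappa> * of_int i)"

lemma hole1_unique: "hole1 \<kappa> \<alpha> i j \<Longrightarrow> hole1 \<kappa> \<alpha> i' j' \<Longrightarrow> i = i' \<and> j = j'"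
  unfolding hole1_def by (metis mult_cancel_left mult_zero_left of_int_eq_iff zero_neq_one)

lemma hole2_unique: "hole2 \<kappa> \<alpha> i j \<Longrightarrow> hole2 \<kappa> \<alpha> i' j' \<Longrightarrow> i = i' \<and> j = j'"
  unfolding hole2_def by (metis mult_cancel_left mult_zero_left of_int_eq_iff zero_neq_numeral)

lemma (in block_full) hole_produced:
  assumes "hol h h'" "(h, h') \<in> S"
  obtains i j k l where "i + k = h" "j + l = h'" "\<not> hol i j" "\<not> hol k l" "s i j k l \<noteq> 0"
proof -
  have "h' \<noteq> 0" "h \<noteq> 0" using assms(1) alpha(1) by (auto simp: hole_def)
  with assms(2) obtain i j k l where *: "i + k = h" "j + l = h'" "s i j k l \<noteq> 0"
    by (rule supp_produced)
  moreover have "\<not> hol k l" using hole_central[of k l i j] *(3) by blast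
  moreover have "\<not> hol i j" using hole_central[of i j k l] skew[of i j k l] *(3) by auto
  ultimately show thesis using that by blast
qed

text \<open>A hole that belongs to the support is reached by some nonzero bracket, so its cocycle is
  nonzero; a missing hole gets the parameters zero. This matches the convention by which
  \<open>C1\<close> and \<open>C2\<close> are present or absent.\<close>

lemma (in block_full) shape: "\<exists>c d d'. block_shape s S \<alpha> \<kappa> c d d' (\<lambda>j. True)"
proof -
  have *: "\<exists>c. \<forall>h h'. hole1 \<kappa> \<alpha> h h' \<longrightarrow> ((h, h') \<in> S \<longleftrightarrow> c \<noteq> 0) \<and>
    (\<forall>i j k l. \<not> hol i j \<longrightarrow> \<not> hol k l \<longrightarrow> i + k = h \<longrightarrow> j + l = h' \<longrightarrow> s i j k l = c * (\<alpha> * of_int j + of_int i))"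
  proof (cases "\<exists>h h'. hole1 \<kappa> \<alpha> h h' \<and> (h, h') \<in> S")
    case True
    then obtain h h' where h: "hole1 \<kappa> \<alpha> h h'" "(h, h') \<in> S" by blast
    obtain c where c: "\<And>i j k l. \<not> hol i j \<Longrightarrow> \<not> hol k l \<Longrightarrow> i + k = h \<Longrightarrow> j + l = h'
      \<Longrightarrow> s i j k l = c * (\<alpha> * of_int j + of_int i)" by (rule hole1_cocycle[OF h(1)]) blast
    have "hol h h'" using h by (simp add: hole_iff)
    then obtain i j k l where "i + k = h" "j + l = h'" "\<not> hol i j" "\<not> hol k l" "s i j k l \<noteq> 0"
      by (rule hole_produced[OF _ h(2)])
    then have "c \<noteq> 0" using c[of i j k l] by auto
    then show ?thesis using c h hole1_unique[OF h(1)] by blast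
  next
    case False
    then have "s i j k l = 0" if "hole1 \<kappa> \<alpha> (i + k) (j + l)" for i j k l
      using that supp_zero(3)[of i k j l] by blast
    then show ?thesis using False by (intro exI[of _ 0]) auto
  qed
  obtain c where c0: "\<forall>h h'. hole1 \<kappa> \<alpha> h h' \<longrightarrow> ((h, h') \<in> S \<longleftrightarrow> c \<noteq> 0) \<and>
    (\<forall>i j k l. \<not> hol i j \<longrightarrow> \<not> hol k l \<longrightarrow> i + k = h \<longrightarrow> j + l = h' \<longrightarrow> s i j k l = c * (\<alpha> * of_int j + of_int i))"
    by (rule exE[OF *])
  then have c: "hole1 \<kappa> \<alpha> h h' \<Longrightarrow> (h, h') \<in> S \<longleftrightarrow> c \<noteq> 0"
    "\<not> hol i j \<Longrightarrow> \<not> hol k l \<Longrightarrow> hole1 \<kappa> \<alpha> (i + k) (j + l) \<Longrightarrow> s i j k l = c * (\<alpha> * of_int j + of_int i)"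
    for h h' i j k l by simp_all
  have *: "\<exists>d d'. \<forall>h h'. hole2 \<kappa> \<alpha> h h' \<longrightarrow> ((h, h') \<in> S \<longleftrightarrow> d \<noteq> 0 \<or> d' \<noteq> 0) \<and>
    (\<forall>i j k l. \<not> hol i j \<longrightarrow> \<not> hol k l \<longrightarrow> i + k = h \<longrightarrow> j + l = h'
      \<longrightarrow> s i j k l = d * (\<alpha> * of_int j + of_int i) + d' * (\<alpha> + \<kappa> * of_int i))"
  proof (cases "\<exists>h h'. hole2 \<kappa> \<alpha> h h' \<and> (h, h') \<in> S")
    case True
    then obtain h h' where h: "hole2 \<kappa> \<alpha> h h'" "(h, h') \<in> S" by blast
    obtain d d' where d: "\<And>i j k l. \<not> hol i j \<Longrightarrow> \<not> hol k l \<Longrightarrow> i + k = h \<Longrightarrow> j + l = h'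
      \<Longrightarrow> s i j k l = d * (\<alpha> * of_int j + of_int i) + d' * (\<alpha> + \<kappa> * of_int i)" by (rule hole2_cocycle[OF h(1)]) blast
    have "hol h h'" using h by (simp add: hole_iff)
    then obtain i j k l where "i + k = h" "j + l = h'" "\<not> hol i j" "\<not> hol k l" "s i j k l \<noteq> 0"
      by (rule hole_produced[OF _ h(2)])
    then have "d \<noteq> 0 \<or> d' \<noteq> 0" using d[of i j k l] by auto
    then have nz: "(h, h') \<in> S \<longleftrightarrow> d \<noteq> 0 \<or> d' \<noteq> 0" using h(2) by simp
    show ?thesis
    proof (intro exI allI impI)
      fix a a'
      assume "hole2 \<kappa> \<alpha> a a'"
      then have "a = h" "a' = h'" using hole2_unique[OF h(1)] by auto
      then show "((a, a') \<in> S \<longleftrightarrow> d \<noteq> 0 \<or> d' \<noteq> 0) \<and> (\<forall>i j k l. \<not> hol i j \<longrightarrow> \<not> hol k l \<longrightarrow> i + k = a \<longrightarrow> j + l = a'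
        \<longrightarrow> s i j k l = d * (\<alpha> * of_int j + of_int i) + d' * (\<alpha> + \<kappa> * of_int i))"
        using nz d by metis
    qed
  next
    case False
    then have "s i j k l = 0" if "hole2 \<kappa> \<alpha> (i + k) (j + l)" for i j k l
      using that supp_zero(3)[of i k j l] by blast
    then show ?thesis using False by (intro exI[of _ 0]) auto
  qed
  obtain d d' where d0: "\<forall>h h'. hole2 \<kappa> \<alpha> h h' \<longrightarrow> ((h, h') \<in> S \<longleftrightarrow> d \<noteq> 0 \<or> d' \<noteq> 0) \<and>
    (\<forall>i j k l. \<not> hol i j \<longrightarrow> \<not> hol k l \<longrightarrow> i + k = h \<longrightarrow> j + l = h'
      \<longrightarrow> s i j k l = d * (\<alpha> * of_int j + of_int i) + d' * (\<alpha> + \<kappa> * of_int i))"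
    using * by (elim exE) (rule that)
  then have d: "hole2 \<kappa> \<alpha> h h' \<Longrightarrow> (h, h') \<in> S \<longleftrightarrow> d \<noteq> 0 \<or> d' \<noteq> 0"
    "\<not> hol i j \<Longrightarrow> \<not> hol k l \<Longrightarrow> hole2 \<kappa> \<alpha> (i + k) (j + l)
      \<Longrightarrow> s i j k l = d * (\<alpha> * of_int j + of_int i) + d' * (\<alpha> + \<kappa> * of_int i)"
    for h h' i j k l by simp_all
  have "block_shape s S \<alpha> \<kappa> c d d' (\<lambda>j. True)"
    by unfold_locales (use kappa not_hole_supp in \<open>simp_all add: c d bracket hole_central\<close>)
  then show ?thesis by blast
qed

lemma (in block_minus) shape:
  assumes triv: "\<And>k. (k, - 2) \<in> S \<Longrightarrow> of_int k = 2 * \<alpha>"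
  shows "\<exists>c d. block_shape s S \<alpha> (- 1) c d 0 (\<lambda>j. j \<ge> - 1)"
proof -
  obtain d0 where d0: "\<And>i k. of_int (i + k) = 2 * \<alpha> \<Longrightarrow> s i (- 1) k (- 1) = d0 * Y i"
    and low: "\<And>i j. j \<le> - 3 \<Longrightarrow> (i, j) \<notin> S" and central2: "\<And>k i j. s i j k (- 2) = 0"
    using column_2_trivial[OF triv] by blast
  \<comment> \<open>The normalisation of column - 1 fixes c: if i + k = \<alpha>, then Y k = - i. At
    the second hole only column - 1 contributes, where \<alpha> - i = - Y i, so a single parameter
    suffices and d' = 0.\<close>
  define c :: 'a where "c = (if \<exists>i. of_int i = \<alpha> \<and> (i, - 1) \<in> S then - 1 else 0)"
  define d where "d = (if \<exists>i. (i, - 2) \<in> S then d0 else 0)"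
  have e: "- x = y \<longleftrightarrow> x = - y" for x y :: 'a by auto
  have h1: "hole1 (- 1) \<alpha> i j \<longleftrightarrow> j = - 1 \<and> of_int i = \<alpha>" for i j
    by (simp add: hole1_def e) (metis of_int_1 of_int_eq_iff of_int_minus)
  have h2: "hole2 (- 1) \<alpha> i j \<longleftrightarrow> j = - 2 \<and> of_int i = 2 * \<alpha>" for i j
    by (simp add: hole2_def e) (metis of_int_numeral of_int_eq_iff of_int_minus)
  have ly1: "s n 0 j (- 1) = Y j" if "of_int (n + j) \<noteq> \<alpha>" for n j using ly that by blast
  have yl1: "s j (- 1) n 0 = - Y j" if "of_int (j + n) \<noteq> \<alpha>" for n j
    using ly1[of n j] skew[of j "- 1" n 0] that by (simp add: add.commute)
  have central1: "s i j k (- 1) = 0" if k: "of_int k = \<alpha>" for i j k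
  proof -
    consider "j \<ge> 1" | "j = 0" | "j = - 1" | "j = - 2" | "j \<le> - 3" by linarith
    then show ?thesis
    proof cases
      case 1
      then show ?thesis using y_bracket[OF 1, of k i] skew[of i j k "- 1"] k by (simp add: block_def algebra_simps)
    next
      case 2
      then show ?thesis using ly0[OF k] by simp
    next
      case 3
      show ?thesis
      proof (cases "of_int (i + k) = 2 * \<alpha>")
        case True
        then show ?thesis using d0[OF True] k 3 by simp
      next
        case False
        then show ?thesis using triv[of "i + k"] supp_zero(3)[of i k j "- 1"] 3 by auto
      qed
    next
      case 4
      then show ?thesis using central2[of k "- 1" i] skew[of i j k "- 1"] by simp
    next
      case 5
      then show ?thesis using low supp_zero(1) by blast
    qed
  qed
  have "block_shape s S \<alpha> (- 1) c d 0 (\<lambda>j. j \<ge> - 1)"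
  proof
    show "- 1 \<noteq> (1::'a) \<and> - 1 \<noteq> (- 1::'a) \<and> (\<lambda>j. - 1 \<le> j) = (\<lambda>j. True) \<or> - 1 = (- 1::'a) \<and> (\<lambda>j::int. - 1 \<le> j) = (\<le>) (- 1)"
      by simp
    show "(i, j) \<in> S \<longleftrightarrow> - 1 \<le> j" if nh: "\<not> hole (- 1) \<alpha> i j" for i j
    proof -
      consider "j \<ge> 0" | "j = - 1" | "j = - 2" | "j \<le> - 3" by linarith
      then show ?thesis
      proof cases
        case 1
        then show ?thesis using upper_supp by simp
      next
        case 2
        obtain k where "k \<notin> {}" "1 * of_int k + - \<alpha> \<noteq> 0"
          by (rule affine_nonzero[OF disjI1[OF one_neq_zero] finite.emptyI]) blast
        then have "s (i - k) 0 k (- 1) \<noteq> 0" using ly1[of "i - k" k] nh 2 by (simp add: hole_minus_one)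
        then show ?thesis using supp[of "i - k" 0 k "- 1"] 2 by simp
      next
        case 3
        then show ?thesis using nh triv[of i] by (auto simp: hole_minus_one)
      next
        case 4
        then show ?thesis using low by simp
      qed
    qed
    show "(i, j) \<in> S \<longleftrightarrow> c \<noteq> 0" if "hole1 (- 1) \<alpha> i j" for i j
      using that hole1_unique[OF that] by (auto simp: c_def h1)
    show "(i, j) \<in> S \<longleftrightarrow> d \<noteq> 0 \<or> 0 \<noteq> (0::'a)" if h: "hole2 (- 1) \<alpha> i j" for i j
    proof
      assume S: "(i, j) \<in> S"
      obtain a where "s a (- 1) (i - a) (- 1) \<noteq> 0"
        using column_generated[of i "- 1" 1] S h by (auto simp: h2)
      then have "d0 \<noteq> 0" using d0[of a "i - a"] h by (auto simp: h2)
      then show "d \<noteq> 0 \<or> 0 \<noteq> (0::'a)" using S h by (auto simp: d_def h2)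
    next
      assume "d \<noteq> 0 \<or> 0 \<noteq> (0::'a)"
      then obtain k where k: "(k, - 2) \<in> S" by (auto simp: d_def split: if_splits)
      then have "k = i" using h triv[OF k] by (metis h2 of_int_eq_iff)
      then show "(i, j) \<in> S" using k h by (simp add: h2)
    qed
    show "s i j k l = 0" if "hole (- 1) \<alpha> k l" for i j k l
      using that central1 central2 by (auto simp: hole_minus_one)
    fix i j k l
    assume jl: "- 1 \<le> j" "- 1 \<le> l" and nh: "\<not> hole (- 1) \<alpha> i j" "\<not> hole (- 1) \<alpha> k l"
    show "s i j k l = block (- 1) \<alpha> i j k l" if t: "\<not> hole (- 1) \<alpha> (i + k) (j + l)"
    proof -
      consider "j \<ge> 0" "l \<ge> 0" | "j = - 1" "l \<ge> 1" | "j = - 1" "l = 0" | "j \<ge> 1" "l = - 1"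
        | "j = 0" "l = - 1" | "j = - 1" "l = - 1" using jl by linarith
      then show ?thesis
      proof cases
        case 1
        then show ?thesis by (rule bracket)
      next
        case 2
        then show ?thesis using y_bracket by simp
      next
        case 3
        then show ?thesis using yl1[of i k] t by (simp add: hole_minus_one block_def)
      next
        case 4
        then show ?thesis using y_bracket[of j k i] skew[of i j k l] block_skew[of "- 1" \<alpha> i j k l] by simp
      next
        case 5
        then show ?thesis using ly1[of i k] t by (simp add: hole_minus_one block_def)
      next
        case 6
        then have "(i + k, - 2) \<notin> S" using triv[of "i + k"] t by (auto simp: hole_minus_one)
        then show ?thesis using 6 supp_zero(3)[of i k j l] by (simp add: block_def)
      qed
    qed
    show "s i j k l = c * (\<alpha> * of_int j + of_int i)" if t: "hole1 (- 1) \<alpha> (i + k) (j + l)"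
    proof (cases "(i + k, j + l) \<in> S")
      case True
      then have "\<exists>i. of_int i = \<alpha> \<and> (i, - 1) \<in> S" using t unfolding h1 by metis
      then have c: "c = - 1" by (simp add: c_def)
      have k: "of_int k = \<alpha> - of_int i" using t by (simp add: h1 algebra_simps)
      consider "j = 0" "l = - 1" | "j = - 1" "l = 0" using jl t h1 by fastforce
      then show ?thesis
      proof cases
        case 1
        then show ?thesis using ly[of i k] True c k by simp
      next
        case 2
        then show ?thesis using ly[of k i] skew[of i j k l] True c by (simp add: add.commute)
      qed
    next
      case False
      then have "c = 0" using t hole1_unique[OF t] h1 by (auto simp: c_def)
      then show ?thesis using False supp_zero(3) by simp
    qed
    show "s i j k l = d * (\<alpha> * of_int j + of_int i) + 0 * (\<alpha> + - 1 * of_int i)" if t: "hole2 (- 1) \<alpha> (i + k) (j + l)"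
    proof (cases "(i + k, j + l) \<in> S")
      case True
      have jl': "j = - 1" "l = - 1" using jl t by (simp_all add: h2)
      then have "d = d0" using True by (auto simp: d_def)
      then show ?thesis using d0[of i k] t jl' by (simp add: h2)
    next
      case False
      then have "(k', - 2) \<notin> S" for k'
        using t triv[of k'] hole2_unique[OF t, of k' "- 2"] by (auto simp: h2)
      then have "d = 0" by (simp add: d_def)
      then show ?thesis using False supp_zero(3) by simp
    qed
  qed
  then show ?thesis by blast
qed

definition normal_shape where
  "normal_shape s S \<alpha> \<longleftrightarrow> (\<exists>\<kappa> c d d' D. block_shape s S \<alpha> \<kappa> c d d' D)
    \<or> zz_algebra s S \<alpha> \<and> S = UNIV \<and> (\<forall>i j k l. s i j k l = C_coeff \<alpha> i j k l)"

lemma resc_resc: "resc t' (resc t s) = resc (\<lambda>i j. t i j * t' i j) s"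
  by (simp add: resc_def fun_eq_iff mult_ac)

lemma (in block_local') normal_shape:
  obtains t where "\<And>i j. t i j \<noteq> 0" "normal_shape (resc t s) S \<alpha>"
proof (cases "\<kappa> = - 1")
  case True
  obtain t where t: "\<And>i j. t i j \<noteq> 0" "block_minus (resc t s) S \<alpha>"
    by (rule block_minus_exists[OF True]) blast
  interpret M: block_minus "resc t s" S \<alpha> by (rule t(2))
  show thesis
  proof (cases "\<forall>k. (k, - 2) \<in> S \<longrightarrow> of_int k = 2 * \<alpha>")
    case True
    then have "normal_shape (resc t s) S \<alpha>" using M.shape unfolding normal_shape_def by blast
    then show thesis by (rule that[OF t(1)])
  next
    case False
    then obtain q where q: "(q, - 2) \<in> S" "of_int q \<noteq> 2 * \<alpha>" by blast
    obtain t' where t': "\<And>i j. t' i j \<noteq> 0" "block_C (resc t' (resc t s)) S \<alpha>"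
      by (rule M.block_C_exists[OF q]) blast
    interpret C: block_C "resc t' (resc t s)" S \<alpha> by (rule t'(2))
    have "normal_shape (resc t' (resc t s)) S \<alpha>"
      using C.coeff C.supp_UNIV C.zz_algebra_axioms unfolding normal_shape_def by blast
    then show thesis using that[of "\<lambda>i j. t i j * t' i j"] t(1) t'(1) by (simp add: resc_resc)
  qed
next
  case False
  obtain t where t: "\<And>i j. t i j \<noteq> 0" "block_full (resc t s) S \<alpha> \<kappa>"
    by (rule block_full_exists[OF kappa(1) False]) blast
  interpret F: block_full "resc t s" S \<alpha> \<kappa> by (rule t(2))
  have "normal_shape (resc t s) S \<alpha>" using F.shape unfolding normal_shape_def by blast
  then show thesis by (rule that[OF t(1)])
qed

lemma (in zz_algebra) normal_shape_cases:
  obtains t where "\<And>i j. t i j \<noteq> 0" "normal_shape (resc t s) S \<alpha>"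
  | t where "\<And>i j. t i j \<noteq> 0" "normal_shape (resc t (flip s)) (flip_set S) (- \<alpha>)"
proof -
  note result = that
  from local_normal_form show thesis
  proof cases
    case (1 t \<kappa>)
    obtain t' where "\<And>i j. t' i j \<noteq> 0" "normal_shape (resc t' (resc t s)) S \<alpha>"
      by (rule block_local'.normal_shape[OF 1(3)]) blast
    then show thesis using result(1)[of "\<lambda>i j. t i j * t' i j"] 1(1) by (simp add: resc_resc)
  next
    case (2 t \<kappa>)
    obtain t' where "\<And>i j. t' i j \<noteq> 0" "normal_shape (resc t' (resc t (flip s))) (flip_set S) (- \<alpha>)"
      by (rule block_local'.normal_shape[OF 2(3)]) blast
    then show thesis using result(2)[of "\<lambda>i j. t i j * t' i j"] 2(1) by (simp add: resc_resc)
  qed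
qed


section \<open>Lie algebras with a basis\<close>

lemma lookup_scale: "Poly_Mapping.lookup (Poly_Mapping.map ((*) c) x) k = c * Poly_Mapping.lookup x k"
  for c :: "'d::mult_zero"
  by (simp add: Poly_Mapping.map.rep_eq when_def)

context lie_algebra
begin

definition comb :: "('c \<Rightarrow> 'v) \<Rightarrow> ('c \<Rightarrow>\<^sub>0 'f) \<Rightarrow> 'v" where
  "comb e x = (\<Sum>k\<in>Poly_Mapping.keys x. lie_scale A (Poly_Mapping.lookup x k) (e k))"

lemma comb_superset:
  assumes "finite K" "Poly_Mapping.keys x \<subseteq> K"
  shows "comb e x = (\<Sum>k\<in>K. lie_scale A (Poly_Mapping.lookup x k) (e k))"
  unfolding comb_def using assms
  by (intro sum.mono_neutral_left) (auto simp: in_keys_iff)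

lemma comb_add: "comb e (x + y) = comb e x + comb e y"
proof -
  let ?K = "Poly_Mapping.keys x \<union> Poly_Mapping.keys y"
  have "comb e (x + y) = (\<Sum>k\<in>?K. lie_scale A (Poly_Mapping.lookup (x + y) k) (e k))"
    by (intro comb_superset) (simp_all add: keys_add)
  also have "\<dots> = comb e x + comb e y"
    by (simp add: lookup_add scale_left_distrib sum.distrib comb_superset[of ?K x] comb_superset[of ?K y])
  finally show ?thesis .
qed

lemma comb_scale: "comb e (Poly_Mapping.map ((*) c) x) = lie_scale A c (comb e x)"
proof -
  have "comb e (Poly_Mapping.map ((*) c) x)
      = (\<Sum>k\<in>Poly_Mapping.keys x. lie_scale A (Poly_Mapping.lookup (Poly_Mapping.map ((*) c) x) k) (e k))"
    by (intro comb_superset) (auto simp: in_keys_iff lookup_scale)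
  then show ?thesis by (simp add: lookup_scale comb_def scale_sum_right)
qed

lemma comb_0 [simp]: "comb e 0 = 0"
  by (simp add: comb_def)

lemma comb_single [simp]: "comb e (Poly_Mapping.single k c) = lie_scale A c (e k)"
  by (simp add: comb_def)

lemma comb_sum: "comb e (sum f I) = (\<Sum>i\<in>I. comb e (f i))"
  by (induction I rule: infinite_finite_induct) (simp_all add: comb_add)

lemma bracket_sum:
  assumes "finite K" "finite K'" "\<And>k. k \<in> K \<Longrightarrow> f k \<in> lie_carrier A" "\<And>k. k \<in> K' \<Longrightarrow> g k \<in> lie_carrier A"
  shows "lie_bracket A (\<Sum>k\<in>K. lie_scale A (a k) (f k)) (\<Sum>l\<in>K'. lie_scale A (b l) (g l))
    = (\<Sum>k\<in>K. \<Sum>l\<in>K'. lie_scale A (a k * b l) (lie_bracket A (f k) (g l)))"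
proof -
  have c: "lie_scale A (a k) (f k) \<in> lie_carrier A" if "k \<in> K" for k
    using assms(3) that subspace_scale subspace_carrier by blast
  have c': "lie_scale A (b k) (g k) \<in> lie_carrier A" if "k \<in> K'" for k
    using assms(4) that subspace_scale subspace_carrier by blast
  have z: "lie_bracket A 0 y = 0" "lie_bracket A y 0 = 0" if "y \<in> lie_carrier A" for y
    using bracket_scale_left[of y y 0] bracket_scale_right[of y y 0] that by simp_all
  have R: "lie_bracket A y (\<Sum>l\<in>L. lie_scale A (b l) (g l)) = (\<Sum>l\<in>L. lie_scale A (b l) (lie_bracket A y (g l)))"
    if "y \<in> lie_carrier A" "L \<subseteq> K'" for y L
    using finite_subset[OF that(2) assms(2)] that(2)
  proof (induction L rule: finite_induct)
    case (insert l L)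
    moreover have "(\<Sum>l\<in>L. lie_scale A (b l) (g l)) \<in> lie_carrier A"
      by (intro subspace_sum[OF subspace_carrier] c') (use insert in auto)
    ultimately show ?case using that c' assms(4) by (simp add: bracket_add_right bracket_scale_right)
  qed (use z that in simp)
  define w where "w = (\<Sum>l\<in>K'. lie_scale A (b l) (g l))"
  have w: "w \<in> lie_carrier A" unfolding w_def by (intro subspace_sum[OF subspace_carrier] c')
  have L: "lie_bracket A (\<Sum>k\<in>L. lie_scale A (a k) (f k)) w = (\<Sum>k\<in>L. lie_scale A (a k) (lie_bracket A (f k) w))"
    if "L \<subseteq> K" for L
    using finite_subset[OF that assms(1)] that
  proof (induction L rule: finite_induct)
    case (insert l L)
    moreover have "(\<Sum>l\<in>L. lie_scale A (a l) (f l)) \<in> lie_carrier A"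
      by (intro subspace_sum[OF subspace_carrier] c) (use insert in auto)
    ultimately show ?case using w c assms(3) by (simp add: bracket_add_left bracket_scale_left)
  qed (use z w in simp)
  show ?thesis
    using L[of K] R[of _ K'] assms(3) unfolding w_def by (simp add: scale_sum_right)
qed

lemma comb_bracket:
  assumes "\<And>k. k \<in> B \<Longrightarrow> e k \<in> lie_carrier A"
    and br: "\<And>k l. k \<in> B \<Longrightarrow> l \<in> B \<Longrightarrow> lie_bracket A (e k) (e l) = comb e (br k l)"
    and xy: "Poly_Mapping.keys x \<subseteq> B" "Poly_Mapping.keys y \<subseteq> B"
  shows "comb e (lie_bracket (lie_of_basis B br) x y) = lie_bracket A (comb e x) (comb e y)"
proof -
  have "lie_bracket A (comb e x) (comb e y) = (\<Sum>k\<in>Poly_Mapping.keys x. \<Sum>l\<in>Poly_Mapping.keys y.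
      lie_scale A (Poly_Mapping.lookup x k * Poly_Mapping.lookup y l) (lie_bracket A (e k) (e l)))"
    unfolding comb_def by (rule bracket_sum) (use assms(1) xy in auto)
  also have "\<dots> = (\<Sum>k\<in>Poly_Mapping.keys x. \<Sum>l\<in>Poly_Mapping.keys y.
      lie_scale A (Poly_Mapping.lookup x k * Poly_Mapping.lookup y l) (comb e (br k l)))"
    using br xy by (intro sum.cong) auto
  finally show ?thesis by (simp add: lie_of_basis_def comb_sum comb_scale)
qed

end

lemma vector_space_poly_mapping: "vector_space (\<lambda>c :: 'f::field. Poly_Mapping.map ((*) c) :: ('b \<Rightarrow>\<^sub>0 'f) \<Rightarrow> _)"
  by unfold_locales (auto intro!: poly_mapping_eqI simp: lookup_add lookup_scale algebra_simps)

text \<open>The Lie algebra axioms of the right-hand side are not verified on structure constants: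
  the injective linear map \<open>comb e\<close> respects brackets, so they carry over from
  A.\<close>

lemma (in lie_algebra) isomorphic_lie_of_basis:
  assumes e: "\<And>k. k \<in> B \<Longrightarrow> e k \<in> lie_carrier A"
    and bij: "bij_betw (comb e) {x. Poly_Mapping.keys x \<subseteq> B} (lie_carrier A)"
    and br: "\<And>k l. k \<in> B \<Longrightarrow> l \<in> B \<Longrightarrow> Poly_Mapping.keys (br k l) \<subseteq> B"
      "\<And>k l. k \<in> B \<Longrightarrow> l \<in> B \<Longrightarrow> lie_bracket A (e k) (e l) = comb e (br k l)"
  shows "A \<simeq>\<^sub>L lie_of_basis B br"
proof -
  let ?L = "lie_of_basis B br"
  let ?C = "{x :: 'a \<Rightarrow>\<^sub>0 'f. Poly_Mapping.keys x \<subseteq> B}"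
  let ?s = "\<lambda>c :: 'f. Poly_Mapping.map ((*) c) :: ('a \<Rightarrow>\<^sub>0 'f) \<Rightarrow> _"
  let ?b = "lie_bracket ?L"
  interpret V: vector_space ?s by (rule vector_space_poly_mapping)
  have car: "lie_carrier ?L = ?C" "lie_scale ?L = ?s" by (simp_all add: lie_of_basis_def)
  have inC: "x \<in> ?C \<longleftrightarrow> (\<forall>k. k \<notin> B \<longrightarrow> Poly_Mapping.lookup x k = 0)" for x
    by (auto simp: in_keys_iff)
  have C: "0 \<in> ?C" "x \<in> ?C \<Longrightarrow> y \<in> ?C \<Longrightarrow> x + y \<in> ?C" "x \<in> ?C \<Longrightarrow> ?s c x \<in> ?C" for x y c
    unfolding inC by (simp_all add: lookup_add lookup_scale)
  have sub: "V.subspace ?C" unfolding V.subspace_def using C by blast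
  have closed: "?b x y \<in> ?C" if "x \<in> ?C" "y \<in> ?C" for x y
  proof -
    have "br k l \<in> ?C" if "k \<in> B" "l \<in> B" for k l using br(1) that by simp
    then have "(\<Sum>k\<in>Poly_Mapping.keys x. \<Sum>l\<in>Poly_Mapping.keys y.
        ?s (Poly_Mapping.lookup x k * Poly_Mapping.lookup y l) (br k l)) \<in> ?C"
      using that by (intro V.subspace_sum[OF sub] C(3)) blast
    then show ?thesis by (simp only: lie_of_basis_def lie_struct.select_convs)
  qed
  have inj: "comb e x = comb e y \<Longrightarrow> x \<in> ?C \<Longrightarrow> y \<in> ?C \<Longrightarrow> x = y" for x y
    using bij by (auto simp: bij_betw_def inj_on_def)
  have img: "comb e x \<in> lie_carrier A" if "x \<in> ?C" for x using bij that by (auto simp: bij_betw_def)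
  have b: "comb e (?b x y) = lie_bracket A (comb e x) (comb e y)" if "x \<in> ?C" "y \<in> ?C" for x y
    using comb_bracket[of B e br x y] e br(2) that by blast
  have L: "lie_algebra ?L"
    unfolding lie_algebra_def lie_algebra_axioms_def car
  proof (intro conjI allI impI)
    show "vector_space ?s" by unfold_locales
    show "V.subspace ?C" by (rule sub)
  next
    fix x y z c
    show "x \<in> ?C \<Longrightarrow> y \<in> ?C \<Longrightarrow> ?b x y \<in> ?C" by (rule closed)
    show "x \<in> ?C \<Longrightarrow> y \<in> ?C \<Longrightarrow> z \<in> ?C \<Longrightarrow> ?b (x + y) z = ?b x z + ?b y z"
      by (rule inj) (use C closed img in \<open>simp_all only: b comb_add bracket_add_left\<close>)
    show "x \<in> ?C \<Longrightarrow> y \<in> ?C \<Longrightarrow> z \<in> ?C \<Longrightarrow> ?b x (y + z) = ?b x y + ?b x z"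
      by (rule inj) (use C closed img in \<open>simp_all only: b comb_add bracket_add_right\<close>)
    show "x \<in> ?C \<Longrightarrow> y \<in> ?C \<Longrightarrow> ?b (?s c x) y = ?s c (?b x y)"
      by (rule inj) (use C closed img in \<open>simp_all only: b comb_scale bracket_scale_left\<close>)
    show "x \<in> ?C \<Longrightarrow> y \<in> ?C \<Longrightarrow> ?b x (?s c y) = ?s c (?b x y)"
      by (rule inj) (use C closed img in \<open>simp_all only: b comb_scale bracket_scale_right\<close>)
    show "x \<in> ?C \<Longrightarrow> ?b x x = 0"
      by (rule inj) (use C closed img in \<open>simp_all only: b comb_0 bracket_self\<close>)
    show "x \<in> ?C \<Longrightarrow> y \<in> ?C \<Longrightarrow> z \<in> ?C \<Longrightarrow> ?b x (?b y z) + ?b y (?b z x) + ?b z (?b x y) = 0"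
      by (rule inj) (use C closed img in \<open>simp_all only: b comb_0 comb_add jacobi\<close>)
  qed
  define f where "f = inv_into ?C (comb e)"
  have f: "f (comb e x) = x" if "x \<in> ?C" for x
    using bij that unfolding f_def by (intro inv_into_f_f) (simp_all add: bij_betw_def)
  have surj: "\<exists>x\<in>?C. y = comb e x" if "y \<in> lie_carrier A" for y
    using bij that by (auto simp: bij_betw_def)
  show ?thesis
    unfolding lie_isomorphic_def car
  proof (intro conjI exI[of _ f] ballI allI)
    show "lie_algebra A" by unfold_locales
    show "lie_algebra ?L" by (rule L)
    show "bij_betw f (lie_carrier A) ?C" unfolding f_def by (rule bij_betw_inv_into[OF bij])
    fix x y c
    assume "x \<in> lie_carrier A"
    then obtain x' where x: "x' \<in> ?C" "x = comb e x'" using surj by blast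
    show "f (lie_scale A c x) = ?s c (f x)"
      unfolding x(2) comb_scale[symmetric] using x(1) C f by simp
    assume "y \<in> lie_carrier A"
    then obtain y' where y: "y' \<in> ?C" "y = comb e y'" using surj by blast
    show "f (x + y) = f x + f y"
      unfolding x(2) y(2) comb_add[symmetric] using x(1) y(1) C f by simp
    show "f (lie_bracket A x y) = ?b (f x) (f y)"
      unfolding x(2) y(2) b[OF x(1) y(1), symmetric] using x(1) y(1) closed f by simp
  qed
qed

lemma (in graded_lie_algebra) comb_bij:
  assumes inj: "inj_on \<sigma> B"
    and e: "\<And>k. k \<in> B \<Longrightarrow> e k \<noteq> 0" "\<And>k. k \<in> B \<Longrightarrow> G (fst (\<sigma> k)) (snd (\<sigma> k)) = span {e k}"
    and zero: "\<And>i j. (i, j) \<notin> \<sigma> ` B \<Longrightarrow> G i j = {0}"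
  shows "bij_betw (comb e) {x. Poly_Mapping.keys x \<subseteq> B} (lie_carrier A)"
  unfolding bij_betw_def
proof
  \<comment> \<open>The coefficients of x are spread over the degrees, so that the uniqueness in
    \<open>direct_sum\<close> yields injectivity.\<close>
  define part where "part x p = (if p \<in> \<sigma> ` B then lie_scale A (Poly_Mapping.lookup x (inv_into B \<sigma> p)) (e (inv_into B \<sigma> p)) else 0)" for x p
  have part: "part x (\<sigma> k) = lie_scale A (Poly_Mapping.lookup x k) (e k)" if "k \<in> B" for x k
    using that inj by (simp add: part_def)
  have part_G: "part x (i, j) \<in> G i j" for x i j
  proof (cases "(i, j) \<in> \<sigma> ` B")
    case True
    then obtain k where k: "k \<in> B" "\<sigma> k = (i, j)" by force
    then show ?thesis using part[of k x] e(2)[of k] span_scale[OF span_base[of "e k"]] by simp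
  next
    case False
    then show ?thesis using subspace_0[OF subspace_component] by (simp add: part_def)
  qed
  have supp: "{p. part x p \<noteq> 0} = \<sigma> ` Poly_Mapping.keys x" if "Poly_Mapping.keys x \<subseteq> B" for x
  proof (intro equalityI subsetI)
    fix p
    assume "p \<in> {p. part x p \<noteq> 0}"
    then have p: "part x p \<noteq> 0" by simp
    then obtain k where "k \<in> B" "p = \<sigma> k" by (auto simp: part_def split: if_splits)
    then show "p \<in> \<sigma> ` Poly_Mapping.keys x" using p part[of k x] by (auto simp: in_keys_iff)
  next
    fix p
    assume "p \<in> \<sigma> ` Poly_Mapping.keys x"
    then obtain k where "k \<in> Poly_Mapping.keys x" "p = \<sigma> k" by blast
    then show "p \<in> {p. part x p \<noteq> 0}" using that part[of k x] e(1)[of k] by (auto simp: in_keys_iff)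
  qed
  have sum: "comb e x = (\<Sum>p | part x p \<noteq> 0. part x p)" if "Poly_Mapping.keys x \<subseteq> B" for x
    unfolding supp[OF that] comb_def
    using that part inj by (subst sum.reindex) (auto intro: inj_on_subset intro!: sum.cong)
  have e_carrier: "e k \<in> lie_carrier A" if "k \<in> B" for k
    using e(2)[OF that] component_subset span_base[of "e k" "{e k}"] by blast
  have carrier: "comb e x \<in> lie_carrier A" if "Poly_Mapping.keys x \<subseteq> B" for x
    unfolding comb_def
    by (intro subspace_sum[OF subspace_carrier] subspace_scale[OF subspace_carrier] e_carrier) (use that in blast)
  show "inj_on (comb e) {x. Poly_Mapping.keys x \<subseteq> B}"
  proof (rule inj_onI)
    fix x y
    assume "x \<in> {x. Poly_Mapping.keys x \<subseteq> B}" "y \<in> {x. Poly_Mapping.keys x \<subseteq> B}" and eq: "comb e x = comb e y"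
    then have xy: "Poly_Mapping.keys x \<subseteq> B" "Poly_Mapping.keys y \<subseteq> B" by auto
    have p: "(\<forall>i j. part z (i, j) \<in> G i j) \<and> finite {p. part z p \<noteq> 0} \<and> comb e x = (\<Sum>p | part z p \<noteq> 0. part z p)"
      if "Poly_Mapping.keys z \<subseteq> B" "comb e z = comb e x" for z
      using part_G sum[OF that(1)] supp[OF that(1)] that(2) by simp
    have "part x = part y"
      using direct_sum[OF carrier[OF xy(1)]] p[OF xy(1) refl] p[OF xy(2) eq[symmetric]] by blast
    show "x = y"
    proof (rule poly_mapping_eqI)
      fix k
      show "Poly_Mapping.lookup x k = Poly_Mapping.lookup y k"
      proof (cases "k \<in> B")
        case True
        then show ?thesis using part[OF True, of x] part[OF True, of y] e(1)[OF True] \<open>part x = part y\<close> by simp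
      next
        case False
        then have "k \<notin> Poly_Mapping.keys x" "k \<notin> Poly_Mapping.keys y" using xy by auto
        then show ?thesis by (simp add: in_keys_iff)
      qed
    qed
  qed
  show "comb e ` {x. Poly_Mapping.keys x \<subseteq> B} = lie_carrier A"
  proof (intro equalityI subsetI)
    fix w
    assume "w \<in> lie_carrier A"
    then obtain c where c: "\<forall>i j. c (i, j) \<in> G i j" "finite {p. c p \<noteq> 0}" "w = (\<Sum>p | c p \<noteq> 0. c p)"
      using direct_sum by blast
    have "\<exists>r. c (\<sigma> k) = lie_scale A r (e k)" if "k \<in> B" for k
    proof -
      have "c (\<sigma> k) \<in> span {e k}" using c(1) e(2)[OF that] by (metis prod.collapse)
      then show ?thesis by (auto simp: span_singleton)
    qed
    then obtain r where r: "\<And>k. k \<in> B \<Longrightarrow> c (\<sigma> k) = lie_scale A (r k) (e k)" by metis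
    define K where "K = {k \<in> B. c (\<sigma> k) \<noteq> 0}"
    have injK: "inj_on \<sigma> K" using inj by (rule inj_on_subset) (auto simp: K_def)
    have img: "\<sigma> ` K = {p. c p \<noteq> 0}"
    proof (intro equalityI subsetI)
      fix p
      assume "p \<in> {p. c p \<noteq> 0}"
      then have p: "c p \<noteq> 0" by simp
      have "p \<in> \<sigma> ` B"
      proof (rule ccontr)
        assume "p \<notin> \<sigma> ` B"
        then have "G (fst p) (snd p) = {0}" using zero[of "fst p" "snd p"] by simp
        then show False using c(1) p by (metis prod.collapse singletonD)
      qed
      then show "p \<in> \<sigma> ` K" using p by (auto simp: K_def)
    qed (auto simp: K_def)
    define x where "x = (\<Sum>k\<in>K. Poly_Mapping.single k (r k))"
    have "Poly_Mapping.keys x \<subseteq> B"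
      unfolding x_def by (rule subset_trans[OF keys_sum]) (auto simp: K_def)
    moreover have "comb e x = w"
    proof -
      have "comb e x = (\<Sum>k\<in>K. c (\<sigma> k))"
        unfolding x_def comb_sum by (intro sum.cong) (use r in \<open>auto simp: K_def\<close>)
      then show ?thesis unfolding c(3) img[symmetric] by (simp add: sum.reindex[OF injK])
    qed
    ultimately show "w \<in> comb e ` {x. Poly_Mapping.keys x \<subseteq> B}" by blast
  qed (use carrier in auto)
qed

text \<open>\<open>\<tau>\<close> places the degrees of the structure constants among those of the grading \<open>G\<close>.\<close>

locale zz_realization = graded_lie_algebra A G
  for A :: "('f::field_char_0, 'v::ab_group_add) lie_struct" and G +
  fixes v :: "int \<Rightarrow> int \<Rightarrow> 'v" and s S and \<tau> :: "int \<times> int \<Rightarrow> int \<times> int"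
  assumes inj_\<tau>: "inj \<tau>"
    and component: "G (fst (\<tau> (i, j))) (snd (\<tau> (i, j))) = span {v i j}"
    and supp: "(i, j) \<in> S \<longleftrightarrow> v i j \<noteq> 0"
    and outside: "(i, j) \<notin> range \<tau> \<Longrightarrow> G i j = {0}"
    and bracket: "lie_bracket A (v i j) (v k l) = lie_scale A (s i j k l) (v (i + k) (j + l))"
begin

lemma realization_resc:
  assumes t: "\<And>i j. t i j \<noteq> 0"
  shows "zz_realization A G (\<lambda>i j. lie_scale A (t i j) (v i j)) (resc t s) S \<tau>"
proof
  have car: "v i j \<in> lie_carrier A" for i j
    using component[of i j] component_subset span_base[of "v i j" "{v i j}"] by blast
  show "inj \<tau>" by (rule inj_\<tau>)
  show "G (fst (\<tau> (i, j))) (snd (\<tau> (i, j))) = span {lie_scale A (t i j) (v i j)}" for i j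
    unfolding component
  proof (intro equalityI)
    have "v i j = lie_scale A (1 / t i j) (lie_scale A (t i j) (v i j))" using t by simp
    then have "v i j \<in> span {lie_scale A (t i j) (v i j)}" by (metis span_scale span_base singletonI)
    then show "span {v i j} \<subseteq> span {lie_scale A (t i j) (v i j)}" by (simp add: span_minimal)
    show "span {lie_scale A (t i j) (v i j)} \<subseteq> span {v i j}"
      by (simp add: span_minimal span_scale span_base)
  qed
  show "(i, j) \<in> S \<longleftrightarrow> lie_scale A (t i j) (v i j) \<noteq> 0" for i j using supp t by simp
  show "(i, j) \<notin> range \<tau> \<Longrightarrow> G i j = {0}" for i j by (rule outside)
  show "lie_bracket A (lie_scale A (t i j) (v i j)) (lie_scale A (t k l) (v k l))
      = lie_scale A (resc t s i j k l) (lie_scale A (t (i + k) (j + l)) (v (i + k) (j + l)))" for i j k l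
    using car t by (simp add: bracket_scale_left bracket_scale_right subspace_scale[OF subspace_carrier] bracket resc_def mult_ac)
qed

lemma realization_flip:
  "zz_realization A G (\<lambda>i j. v i (- j)) (flip s) (flip_set S) (\<lambda>(i, j). \<tau> (i, - j))"
proof
  have r: "(\<lambda>(i, j). \<tau> (i, - j)) = \<tau> \<circ> (\<lambda>(i, j). (i, - j))" by (auto simp: fun_eq_iff)
  show "inj (\<lambda>(i, j). \<tau> (i, - j))" unfolding r by (rule inj_compose[OF inj_\<tau>]) (auto simp: inj_def)
  have "surj (\<lambda>(i, j). (i :: int, - j :: int))" by (rule surjI[of _ "\<lambda>(i, j). (i, - j)"]) auto
  then have "range (\<lambda>(i, j). \<tau> (i, - j)) = range \<tau>" unfolding r by (metis image_comp)
  then show "(i, j) \<notin> range (\<lambda>(i, j). \<tau> (i, - j)) \<Longrightarrow> G i j = {0}" for i j by (simp add: outside)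
qed (simp_all add: component supp bracket flip_def flip_set_def)

lemma isomorphic_lie_of_basis_realization:
  assumes \<sigma>: "bij_betw \<sigma> B S"
    and br: "\<And>k l. k \<in> B \<Longrightarrow> l \<in> B \<Longrightarrow> Poly_Mapping.keys (br k l) \<subseteq> B"
      "\<And>k l. k \<in> B \<Longrightarrow> l \<in> B \<Longrightarrow> comb (\<lambda>k. v (fst (\<sigma> k)) (snd (\<sigma> k))) (br k l)
        = lie_scale A (s (fst (\<sigma> k)) (snd (\<sigma> k)) (fst (\<sigma> l)) (snd (\<sigma> l)))
            (v (fst (\<sigma> k) + fst (\<sigma> l)) (snd (\<sigma> k) + snd (\<sigma> l)))"
  shows "A \<simeq>\<^sub>L lie_of_basis B br"
proof (rule isomorphic_lie_of_basis[where e = "\<lambda>k. v (fst (\<sigma> k)) (snd (\<sigma> k))"])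
  show "v (fst (\<sigma> k)) (snd (\<sigma> k)) \<in> lie_carrier A" for k
    using component[of "fst (\<sigma> k)" "snd (\<sigma> k)"] component_subset span_base by blast
  show "bij_betw (comb (\<lambda>k. v (fst (\<sigma> k)) (snd (\<sigma> k)))) {x. Poly_Mapping.keys x \<subseteq> B} (lie_carrier A)"
  proof (rule comb_bij[where \<sigma> = "\<tau> \<circ> \<sigma>"])
    show "inj_on (\<tau> \<circ> \<sigma>) B" using \<sigma> inj_\<tau> by (auto simp: bij_betw_def intro: comp_inj_on inj_on_subset)
    show "v (fst (\<sigma> k)) (snd (\<sigma> k)) \<noteq> 0" if "k \<in> B" for k
    proof -
      have "\<sigma> k \<in> S" using \<sigma> that by (auto simp: bij_betw_def)
      then show ?thesis by (metis prod.collapse supp)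
    qed
    show "G (fst ((\<tau> \<circ> \<sigma>) k)) (snd ((\<tau> \<circ> \<sigma>) k)) = span {v (fst (\<sigma> k)) (snd (\<sigma> k))}" for k
      using component[of "fst (\<sigma> k)" "snd (\<sigma> k)"] by simp
    show "G i j = {0}" if "(i, j) \<notin> (\<tau> \<circ> \<sigma>) ` B" for i j
    proof (cases "(i, j) \<in> range \<tau>")
      case True
      then obtain k l where kl: "(i, j) = \<tau> (k, l)" by auto
      have "(\<tau> \<circ> \<sigma>) ` B = \<tau> ` S" using \<sigma> by (auto simp: bij_betw_def)
      then have "(k, l) \<notin> S" using that kl by auto
      then have "v k l = 0" using supp by simp
      then show ?thesis using component[of k l] by (simp flip: kl)
    qed (rule outside)
  qed
  show "lie_bracket A (v (fst (\<sigma> k)) (snd (\<sigma> k))) (v (fst (\<sigma> l)) (snd (\<sigma> l)))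
      = comb (\<lambda>k. v (fst (\<sigma> k)) (snd (\<sigma> k))) (br k l)" if "k \<in> B" "l \<in> B" for k l
    using br(2)[OF that] bracket by simp
qed (rule br(1))

end

section \<open>Comparison with the given families\<close>

lemma hole1_quotient:
  "\<kappa> \<noteq> 0 \<Longrightarrow> of_int i = - (\<alpha> / \<kappa>) \<and> of_int j = 1 / \<kappa> \<longleftrightarrow> hole1 \<kappa> \<alpha> i j"
  by (auto simp: hole1_def field_simps)

lemma hole2_quotient:
  "\<kappa> \<noteq> 0 \<Longrightarrow> of_int i = - 2 * (\<alpha> / \<kappa>) \<and> of_int j = 2 * (1 / \<kappa>) \<longleftrightarrow> hole2 \<kappa> \<alpha> i j"
  by (auto simp: hole2_def field_simps)

lemma B_Z_quotient: "\<kappa> \<noteq> 0 \<Longrightarrow> (i, j) \<in> B_Z (\<alpha> / \<kappa>) (1 / \<kappa>) \<longleftrightarrow> \<not> hole \<kappa> \<alpha> i j"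
  using hole1_quotient[of \<kappa> i \<alpha> j] hole2_quotient[of \<kappa> i \<alpha> j] by (auto simp: B_Z_def hole_iff)

text \<open>The vectors L correspond to the normalised ones divided by \<kappa>, while central
  vectors are not rescaled. So central brackets carry 1 / \<kappa>^2, and one factor 1 / \<kappa> of
  it is already contained in the linear forms; this explains the parameters.\<close>

lemma B_br_quotient:
  assumes "\<kappa> \<noteq> 0"
  shows "B_br (\<alpha> / \<kappa>) (1 / \<kappa>) (c / \<kappa>) (d / \<kappa>) (d' / \<kappa>) (L i j) (L k l) =
    (if \<not> hole \<kappa> \<alpha> (i + k) (j + l) then Poly_Mapping.single (L (i + k) (j + l)) (block \<kappa> \<alpha> i j k l / \<kappa>) else 0)
    + (if hole1 \<kappa> \<alpha> (i + k) (j + l) then Poly_Mapping.single C1 (c * (\<alpha> * of_int j + of_int i) / \<kappa> ^ 2) else 0)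
    + (if hole2 \<kappa> \<alpha> (i + k) (j + l)
       then Poly_Mapping.single C2 ((d * (\<alpha> * of_int j + of_int i) + d' * (\<alpha> + \<kappa> * of_int i)) / \<kappa> ^ 2) else 0)"
proof -
  have "(of_int i + \<alpha> / \<kappa>) * (of_int l - 1 / \<kappa>) - (of_int j - 1 / \<kappa>) * (of_int k + \<alpha> / \<kappa>) = block \<kappa> \<alpha> i j k l / \<kappa>"
    using assms by (simp add: block_def field_simps power2_eq_square)
  moreover have "(\<alpha> / \<kappa> * of_int j + 1 / \<kappa> * of_int i) * (c / \<kappa>) = c * (\<alpha> * of_int j + of_int i) / \<kappa> ^ 2"
    using assms by (simp add: field_simps power2_eq_square)
  moreover have "d / \<kappa> * (\<alpha> / \<kappa> * of_int j + 1 / \<kappa> * of_int i) + d' / \<kappa> * (\<alpha> / \<kappa> + of_int i)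
      = (d * (\<alpha> * of_int j + of_int i) + d' * (\<alpha> + \<kappa> * of_int i)) / \<kappa> ^ 2"
    using assms by (simp add: field_simps power2_eq_square)
  ultimately show ?thesis
    using hole1_quotient[OF assms, of "i + k" \<alpha> "j + l"] hole2_quotient[OF assms, of "i + k" \<alpha> "j + l"]
      B_Z_quotient[OF assms, of "i + k" "j + l" \<alpha>]
    by (simp only: B_br.simps)
qed

definition shape_basis :: "'f::field_char_0 \<Rightarrow> 'f \<Rightarrow> 'f \<Rightarrow> 'f \<Rightarrow> 'f \<Rightarrow> (int \<Rightarrow> bool) \<Rightarrow> B_basis set" where
  "shape_basis \<kappa> \<alpha> c d d' D = {L i j | i j. \<not> hole \<kappa> \<alpha> i j \<and> D j}
    \<union> (if (\<exists>i j. hole1 \<kappa> \<alpha> i j) \<and> c \<noteq> 0 then {C1} else {})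
    \<union> (if (\<exists>i j. hole2 \<kappa> \<alpha> i j) \<and> \<not> (d = 0 \<and> d' = 0) then {C2} else {})"

lemma B_set_quotient:
  assumes "\<kappa> \<noteq> 0"
  shows "B_set (\<alpha> / \<kappa>) (1 / \<kappa>) (c / \<kappa>) (d / \<kappa>) (d' / \<kappa>) = shape_basis \<kappa> \<alpha> c d d' (\<lambda>j. True)"
proof -
  have e1: "- (\<alpha> / \<kappa>) \<in> \<int> \<and> 1 / \<kappa> \<in> \<int> \<longleftrightarrow> (\<exists>i j. hole1 \<kappa> \<alpha> i j)"
    unfolding hole1_quotient[OF assms, symmetric] Ints_def by (auto simp: eq_commute)
  have e2: "- 2 * (\<alpha> / \<kappa>) \<in> \<int> \<and> 2 * (1 / \<kappa>) \<in> \<int> \<longleftrightarrow> (\<exists>i j. hole2 \<kappa> \<alpha> i j)"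
    unfolding hole2_quotient[OF assms, symmetric] Ints_def by (auto simp: eq_commute)
  have "- (\<alpha> / \<kappa>) \<in> \<int> \<and> 1 / \<kappa> \<in> \<int> \<and> c / \<kappa> \<noteq> 0 \<longleftrightarrow> (\<exists>i j. hole1 \<kappa> \<alpha> i j) \<and> c \<noteq> 0"
    "- 2 * (\<alpha> / \<kappa>) \<in> \<int> \<and> 2 * (1 / \<kappa>) \<in> \<int> \<and> \<not> (d / \<kappa> = 0 \<and> d' / \<kappa> = 0)
      \<longleftrightarrow> (\<exists>i j. hole2 \<kappa> \<alpha> i j) \<and> \<not> (d = 0 \<and> d' = 0)"
    using e1 e2 assms by auto
  then show ?thesis
    unfolding B_set_def shape_basis_def by (simp only: B_Z_quotient[OF assms] simp_thms)
qed

context zz_realization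
begin

lemma isomorphic_C_alg:
  assumes "S = UNIV" "\<And>i j k l. s i j k l = C_coeff \<alpha> i j k l"
  shows "A \<simeq>\<^sub>L C_alg \<alpha>"
  unfolding C_alg_def
  by (rule isomorphic_lie_of_basis_realization[where \<sigma> = id]) (use assms in \<open>auto split: prod.splits\<close>)

lemma isomorphic_Vir_alpha:
  assumes "block_shape s S \<alpha> 0 c d d' D"
  shows "A \<simeq>\<^sub>L Vir_alpha \<alpha>"
proof -
  interpret B: block_shape s S \<alpha> 0 c d d' D by fact
  have nh: "\<not> hole 0 \<alpha> i j" for i j by (simp add: hole_def)
  have D: "D = (\<lambda>j. True)" using B.columns by simp
  have "S = UNIV" using B.degrees(1)[OF nh] D by auto
  moreover have "s i j k l = of_int (k - i) + of_int (l - j) * \<alpha>" for i j k l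
    using B.bracket(1)[OF _ _ nh nh nh] D by (simp add: block_def mult.commute)
  ultimately show ?thesis
    unfolding Vir_alpha_def
    by (intro isomorphic_lie_of_basis_realization[where \<sigma> = id]) (auto split: prod.splits)
qed

lemma isomorphic_shape_basis:
  assumes "block_shape s S \<alpha> \<kappa> c d d' D" and \<kappa>: "\<kappa> \<noteq> 0"
  shows "A \<simeq>\<^sub>L lie_of_basis (shape_basis \<kappa> \<alpha> c d d' D) (B_br (\<alpha> / \<kappa>) (1 / \<kappa>) (c / \<kappa>) (d / \<kappa>) (d' / \<kappa>))"
proof -
  interpret B: block_shape s S \<alpha> \<kappa> c d d' D by fact
  define t where "t i j = (if hole \<kappa> \<alpha> i j then 1 else 1 / \<kappa>)" for i j
  have t: "t i j \<noteq> 0" for i j using \<kappa> by (simp add: t_def)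
  define w where "w i j = lie_scale A (t i j) (v i j)" for i j
  interpret R: zz_realization A G w "resc t s" S \<tau>
    unfolding w_def by (rule realization_resc[OF t])
  \<comment> \<open>The first hole, if there is one; otherwise the value is arbitrary and
    \<open>C1\<close> is not in the basis.\<close>
  define z1 where "z1 = (SOME p. hole1 \<kappa> \<alpha> (fst p) (snd p))"
  define z2 where "z2 = (SOME p. hole2 \<kappa> \<alpha> (fst p) (snd p))"
  have z1: "z1 = (h, h')" if "hole1 \<kappa> \<alpha> h h'" for h h'
  proof -
    have "hole1 \<kappa> \<alpha> (fst z1) (snd z1)"
      unfolding z1_def by (rule someI[of _ "(h, h')"]) (use that in simp)
    from hole1_unique[OF that this] show ?thesis by (simp add: prod_eq_iff)
  qed
  have z2: "z2 = (h, h')" if "hole2 \<kappa> \<alpha> h h'" for h h'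
  proof -
    have "hole2 \<kappa> \<alpha> (fst z2) (snd z2)"
      unfolding z2_def by (rule someI[of _ "(h, h')"]) (use that in simp)
    from hole2_unique[OF that this] show ?thesis by (simp add: prod_eq_iff)
  qed
  have disj: "\<not> hole1 \<kappa> \<alpha> h h'" if "hole2 \<kappa> \<alpha> h h'" for h h' using that by (simp add: hole1_def hole2_def)
  define \<sigma> where "\<sigma> b = (case b of L i j \<Rightarrow> (i, j) | C1 \<Rightarrow> z1 | C2 \<Rightarrow> z2)" for b
  let ?B = "shape_basis \<kappa> \<alpha> c d d' D"
  \<comment> \<open>A bracket can leave the columns of D only for \<kappa> = - 1 and two vectors of
    column - 1, which commute in the model.\<close>
  have D: "block \<kappa> \<alpha> i j k l = 0" if "D j" "D l" "\<not> D (j + l)" for i j k l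
  proof -
    have "\<kappa> = - 1" "j = - 1" "l = - 1" using that B.columns by auto
    then show ?thesis by (simp add: block_def)
  qed
  have C1: "hole1 \<kappa> \<alpha> (fst z1) (snd z1)" if "C1 \<in> ?B"
  proof -
    have "\<exists>i j. hole1 \<kappa> \<alpha> i j" using that by (auto simp: shape_basis_def split: if_splits)
    then obtain i j where "hole1 \<kappa> \<alpha> i j" by blast
    then show ?thesis using z1[of i j] by simp
  qed
  have C2: "hole2 \<kappa> \<alpha> (fst z2) (snd z2)" if "C2 \<in> ?B"
  proof -
    have "\<exists>i j. hole2 \<kappa> \<alpha> i j" using that by (auto simp: shape_basis_def split: if_splits)
    then obtain i j where "hole2 \<kappa> \<alpha> i j" by blast
    then show ?thesis using z2[of i j] by simp
  qed
  have c: "c \<noteq> 0" if "C1 \<in> ?B" using that by (auto simp: shape_basis_def split: if_splits)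
  have d: "d \<noteq> 0 \<or> d' \<noteq> 0" if "C2 \<in> ?B" using that by (auto simp: shape_basis_def split: if_splits)
  have L: "L i j \<in> ?B \<longleftrightarrow> \<not> hole \<kappa> \<alpha> i j \<and> D j" for i j by (auto simp: shape_basis_def)
  have inC1: "C1 \<in> ?B" if "hole1 \<kappa> \<alpha> i j" "c \<noteq> 0" for i j using that by (auto simp: shape_basis_def)
  have inC2: "C2 \<in> ?B" if "hole2 \<kappa> \<alpha> i j" "d \<noteq> 0 \<or> d' \<noteq> 0" for i j using that by (auto simp: shape_basis_def)
  have inC2': "C2 \<in> ?B" if "hole2 \<kappa> \<alpha> i j" "d * x + d' * y \<noteq> 0" for i j x y using inC2[OF that(1)] that(2) by (cases "d = 0") auto
  have \<sigma>: "\<sigma> (L i j) = (i, j)" "\<sigma> C1 = z1" "\<sigma> C2 = z2" for i j by (simp_all add: \<sigma>_def)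
  show ?thesis
  proof (rule R.isomorphic_lie_of_basis_realization[where \<sigma> = \<sigma>])
    show "bij_betw \<sigma> ?B S"
      unfolding bij_betw_def
    proof
      show "inj_on \<sigma> ?B"
      proof (rule inj_onI)
        fix b b'
        assume *: "b \<in> ?B" "b' \<in> ?B" "\<sigma> b = \<sigma> b'"
        show "b = b'"
        proof (cases b)
          case b: (L i j)
          then have "\<not> hole \<kappa> \<alpha> (fst (\<sigma> b')) (snd (\<sigma> b'))" using * L by (simp flip: *(3) add: \<sigma>)
          then have "b' \<noteq> C1" "b' \<noteq> C2" using * C1 C2 by (auto simp: hole_iff \<sigma>)
          then show ?thesis using * b by (cases b') (simp_all add: \<sigma>)
        next
          case b: C1
          then have "hole1 \<kappa> \<alpha> (fst (\<sigma> b')) (snd (\<sigma> b'))" using * C1 by (simp flip: *(3) add: \<sigma>)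
          then have "b' \<noteq> C2" "\<And>i j. b' \<noteq> L i j" using * disj C2 L by (auto simp: hole_iff \<sigma>)
          then show ?thesis using b by (cases b'; blast)
        next
          case b: C2
          then have "hole2 \<kappa> \<alpha> (fst (\<sigma> b')) (snd (\<sigma> b'))" using * C2 by (simp flip: *(3) add: \<sigma>)
          then have "b' \<noteq> C1" "\<And>i j. b' \<noteq> L i j" using * disj C1 L by (auto simp: hole_iff \<sigma>)
          then show ?thesis using b by (cases b'; blast)
        qed
      qed
      show "\<sigma> ` ?B = S"
      proof (intro equalityI subsetI)
        fix p
        assume "p \<in> \<sigma> ` ?B"
        then obtain b where b: "b \<in> ?B" "p = \<sigma> b" by blast
        show "p \<in> S"
        proof (cases b)
          case (L i j)
          then show ?thesis using b B.degrees(1)[of i j] \<open>\<And>j i. (L i j \<in> ?B) = (\<not> hole \<kappa> \<alpha> i j \<and> D j)\<close> by (simp add: \<sigma>)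
        next
          case C1': C1
          then show ?thesis using b B.degrees(2)[OF C1] c by (simp add: \<sigma>)
        next
          case C2': C2
          then show ?thesis using b B.degrees(3)[OF C2] d by (simp add: \<sigma>)
        qed
      next
        fix p
        assume p: "p \<in> S"
        obtain i j where ij: "p = (i, j)" by (cases p)
        consider "hole1 \<kappa> \<alpha> i j" | "hole2 \<kappa> \<alpha> i j" | "\<not> hole \<kappa> \<alpha> i j" by (auto simp: hole_iff)
        then show "p \<in> \<sigma> ` ?B"
        proof cases
          case 1
          then show ?thesis using p ij B.degrees(2)[OF 1] inC1[OF 1] z1[OF 1] by (intro image_eqI[of _ _ C1]) (simp_all add: \<sigma>)
        next
          case 2
          then show ?thesis using p ij B.degrees(3)[OF 2] inC2[OF 2] z2[OF 2] by (intro image_eqI[of _ _ C2]) (simp_all add: \<sigma>)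
        next
          case 3
          then show ?thesis using p ij B.degrees(1)[OF 3] L by (intro image_eqI[of _ _ "L i j"]) (simp_all add: \<sigma>)
        qed
      qed
    qed
  next
    fix b b'
    assume b: "b \<in> ?B" "b' \<in> ?B"
    let ?br = "B_br (\<alpha> / \<kappa>) (1 / \<kappa>) (c / \<kappa>) (d / \<kappa>) (d' / \<kappa>)"
    have central: "?br b b' = 0 \<and> resc t s (fst (\<sigma> b)) (snd (\<sigma> b)) (fst (\<sigma> b')) (snd (\<sigma> b')) = 0"
      if h: "hole \<kappa> \<alpha> (fst (\<sigma> b)) (snd (\<sigma> b)) \<or> hole \<kappa> \<alpha> (fst (\<sigma> b')) (snd (\<sigma> b'))"
    proof -
      have "s (fst (\<sigma> b)) (snd (\<sigma> b)) (fst (\<sigma> b')) (snd (\<sigma> b')) = 0"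
        using h B.central B.skew[of "fst (\<sigma> b)" "snd (\<sigma> b)" "fst (\<sigma> b')" "snd (\<sigma> b')"] by auto
      moreover have "?br b b' = 0"
        using h b L by (cases b; cases b') (auto simp: \<sigma>)
      ultimately show ?thesis by (simp add: resc_def)
    qed
    have reg: "\<exists>i j k l. b = L i j \<and> b' = L k l"
      if "\<not> hole \<kappa> \<alpha> (fst (\<sigma> b)) (snd (\<sigma> b))" "\<not> hole \<kappa> \<alpha> (fst (\<sigma> b')) (snd (\<sigma> b'))"
      using that b C1 C2 by (cases b; cases b') (auto simp: \<sigma> hole_iff)
    show "Poly_Mapping.keys (?br b b') \<subseteq> ?B"
    proof (cases "hole \<kappa> \<alpha> (fst (\<sigma> b)) (snd (\<sigma> b)) \<or> hole \<kappa> \<alpha> (fst (\<sigma> b')) (snd (\<sigma> b'))")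
      case False
      then obtain i j k l where e: "b = L i j" "b' = L k l" using reg by blast
      have Dj: "D j" "D l" using b L by (simp_all add: e)
      show ?thesis
        unfolding e B_br_quotient[OF \<kappa>]
        by (intro subset_trans[OF keys_add] Un_least)
          (use D[OF Dj] L inC1 inC2' in \<open>auto split: if_splits\<close>)
    qed (use central in simp)
    show "comb (\<lambda>k. w (fst (\<sigma> k)) (snd (\<sigma> k))) (?br b b')
        = lie_scale A (resc t s (fst (\<sigma> b)) (snd (\<sigma> b)) (fst (\<sigma> b')) (snd (\<sigma> b')))
            (w (fst (\<sigma> b) + fst (\<sigma> b')) (snd (\<sigma> b) + snd (\<sigma> b')))"
    proof (cases "hole \<kappa> \<alpha> (fst (\<sigma> b)) (snd (\<sigma> b)) \<or> hole \<kappa> \<alpha> (fst (\<sigma> b')) (snd (\<sigma> b'))")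
      case True
      then show ?thesis using central by simp
    next
      case False
      then obtain i j k l where e: "b = L i j" "b' = L k l" using reg by blast
      have nh: "D j" "D l" "\<not> hole \<kappa> \<alpha> i j" "\<not> hole \<kappa> \<alpha> k l" using b L by (simp_all add: e)
      consider "hole1 \<kappa> \<alpha> (i + k) (j + l)" | "hole2 \<kappa> \<alpha> (i + k) (j + l)" | "\<not> hole \<kappa> \<alpha> (i + k) (j + l)"
        by (auto simp: hole_iff)
      then show ?thesis
      proof cases
        case 1
        moreover have "hole \<kappa> \<alpha> (i + k) (j + l)" "\<not> hole2 \<kappa> \<alpha> (i + k) (j + l)" using 1 disj by (auto simp: hole_iff)
        ultimately show ?thesis
          unfolding e B_br_quotient[OF \<kappa>]
          using B.bracket(2)[OF nh 1] z1[OF 1] nh by (simp add: comb_add \<sigma> resc_def t_def power2_eq_square)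
      next
        case 2
        moreover have "hole \<kappa> \<alpha> (i + k) (j + l)" "\<not> hole1 \<kappa> \<alpha> (i + k) (j + l)" using 2 disj by (auto simp: hole_iff)
        ultimately show ?thesis
          unfolding e B_br_quotient[OF \<kappa>]
          using B.bracket(3)[OF nh 2] z2[OF 2] nh by (simp add: comb_add \<sigma> resc_def t_def power2_eq_square)
      next
        case 3
        moreover have "\<not> hole1 \<kappa> \<alpha> (i + k) (j + l)" "\<not> hole2 \<kappa> \<alpha> (i + k) (j + l)" using 3 by (auto simp: hole_iff)
        ultimately show ?thesis
          unfolding e B_br_quotient[OF \<kappa>]
          using B.bracket(1)[OF nh 3] nh \<kappa> by (simp add: comb_add \<sigma> resc_def t_def)
      qed
    qed
  qed
qed

text \<open>Isomorphism ignores the grading. A reversal of the second degree, absorbed into \<tau>,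
  therefore leads to the same list.\<close>

lemma isomorphic_normal_shape:
  assumes "normal_shape s S \<alpha>"
  shows "(\<exists>\<alpha>. \<alpha> \<noteq> 0 \<and> A \<simeq>\<^sub>L Vir_alpha \<alpha>)
    \<or> (\<exists>\<alpha> \<beta> a1 a2 a2'. \<alpha> * \<beta> \<noteq> 0 \<and> \<beta> \<noteq> 1 \<and> \<beta> \<noteq> - 1 \<and> A \<simeq>\<^sub>L B_alg \<alpha> \<beta> a1 a2 a2')
    \<or> (\<exists>\<alpha> a1 a2 a2'. \<alpha> \<noteq> 0 \<and> A \<simeq>\<^sub>L B_plus \<alpha> (- 1) a1 a2 a2')
    \<or> (\<exists>\<alpha>. \<alpha> \<noteq> 0 \<and> A \<simeq>\<^sub>L C_alg \<alpha>)"
proof -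
  consider \<kappa> c d d' D where "block_shape s S \<alpha> \<kappa> c d d' D"
    | "zz_algebra s S \<alpha>" "S = UNIV" "\<And>i j k l. s i j k l = C_coeff \<alpha> i j k l"
    using assms unfolding normal_shape_def by blast
  then show ?thesis
  proof cases
    case (1 \<kappa> c d d' D)
    interpret B: block_shape s S \<alpha> \<kappa> c d d' D by fact
    consider "\<kappa> = 0" | "\<kappa> \<noteq> 0" "\<kappa> \<noteq> 1" "\<kappa> \<noteq> - 1" "D = (\<lambda>j. True)" | "\<kappa> = - 1" "D = (\<lambda>j. j \<ge> - 1)"
      using B.columns by blast
    then show ?thesis
    proof cases
      case a: 1
      then show ?thesis using isomorphic_Vir_alpha 1 B.alpha(1) by blast
    next
      case a: 2
      have "A \<simeq>\<^sub>L B_alg (\<alpha> / \<kappa>) (1 / \<kappa>) (c / \<kappa>) (d / \<kappa>) (d' / \<kappa>)"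
        using isomorphic_shape_basis[OF 1 a(1)] unfolding B_alg_def B_set_quotient[OF a(1)] a(4) .
      moreover have "\<alpha> / \<kappa> * (1 / \<kappa>) \<noteq> 0" "1 / \<kappa> \<noteq> 1" "1 / \<kappa> \<noteq> - 1"
        using a B.alpha(1) by (auto simp: divide_eq_eq minus_equation_iff)
      ultimately show ?thesis by blast
    next
      case a: 3
      have \<kappa>: "\<kappa> \<noteq> 0" using a by simp
      have "B_plus (\<alpha> / \<kappa>) (1 / \<kappa>) (c / \<kappa>) (d / \<kappa>) (d' / \<kappa>)
        = lie_of_basis (shape_basis \<kappa> \<alpha> c d d' D) (B_br (\<alpha> / \<kappa>) (1 / \<kappa>) (c / \<kappa>) (d / \<kappa>) (d' / \<kappa>))"
      proof -
        have e: "1 / \<kappa> = - 1" using a by simp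
        have "{x :: B_basis \<Rightarrow>\<^sub>0 'f. Poly_Mapping.keys x \<subseteq> shape_basis \<kappa> \<alpha> c d d' (\<lambda>j. True)
            \<and> (\<forall>i j. L i j \<in> Poly_Mapping.keys x \<longrightarrow> j \<ge> - 1)}
          = {x. Poly_Mapping.keys x \<subseteq> shape_basis \<kappa> \<alpha> c d d' D}"
          unfolding a(2) shape_basis_def by (auto; fastforce)
        then show ?thesis
          unfolding B_plus_def B_alg_def B_set_quotient[OF \<kappa>]
          by (simp add: e lie_restrict_def lie_of_basis_def)
      qed
      then have "A \<simeq>\<^sub>L B_plus (\<alpha> / \<kappa>) (1 / \<kappa>) (c / \<kappa>) (d / \<kappa>) (d' / \<kappa>)"
        using isomorphic_shape_basis[OF 1 \<kappa>] by simp
      moreover have "1 / \<kappa> = - 1" "\<alpha> / \<kappa> \<noteq> 0" using a B.alpha(1) by simp_all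
      ultimately show ?thesis by metis
    qed
  next
    case 2
    then interpret zz: zz_algebra s S \<alpha> by simp
    show ?thesis using isomorphic_C_alg[OF 2(2,3)] zz.alpha(1) by blast
  qed
qed

end


section \<open>From the graded algebra to structure constants\<close>

context lie_algebra
begin

lemma bracket_zero [simp]: "x \<in> lie_carrier A \<Longrightarrow> lie_bracket A 0 x = 0" "x \<in> lie_carrier A \<Longrightarrow> lie_bracket A x 0 = 0"
  using bracket_scale_left[of x x 0] bracket_scale_right[of x x 0] by simp_all

lemma bracket_skew:
  assumes "x \<in> lie_carrier A" "y \<in> lie_carrier A"
  shows "lie_bracket A y x = - lie_bracket A x y"
proof -
  have "lie_bracket A (x + y) (x + y) = 0"
    using assms by (intro bracket_self subspace_add[OF subspace_carrier])
  moreover have "lie_bracket A (x + y) (x + y) = lie_bracket A x y + lie_bracket A y x"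
    using assms bracket_self[OF assms(1)] bracket_self[OF assms(2)]
    by (simp add: bracket_add_left bracket_add_right subspace_add[OF subspace_carrier])
  ultimately show ?thesis by (simp add: eq_neg_iff_add_eq_0 add.commute)
qed

lemma bracket_span:
  assumes X: "X \<subseteq> lie_carrier A" and Y: "Y \<subseteq> lie_carrier A" and N: "subspace N"
    and gen: "\<And>x y. x \<in> X \<Longrightarrow> y \<in> Y \<Longrightarrow> lie_bracket A x y \<in> N"
    and x: "x \<in> span X" and y: "y \<in> span Y"
  shows "lie_bracket A x y \<in> N"
proof -
  have Yc: "span Y \<subseteq> lie_carrier A" using Y subspace_carrier by (rule span_minimal)
  have 1: "lie_bracket A x y \<in> N" if "x \<in> X" for x
  proof -
    have "span Y \<subseteq> {y \<in> lie_carrier A. lie_bracket A x y \<in> N}"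
    proof (rule span_minimal)
      show "subspace {y \<in> lie_carrier A. lie_bracket A x y \<in> N}"
        using N subspace_carrier that X
        by (auto simp: subspace_def bracket_add_right bracket_scale_right)
    qed (use that X Y gen in auto)
    then show ?thesis using y by blast
  qed
  have "span X \<subseteq> {x \<in> lie_carrier A. lie_bracket A x y \<in> N}"
  proof (rule span_minimal)
    show "subspace {x \<in> lie_carrier A. lie_bracket A x y \<in> N}"
      using N subspace_carrier y Yc
      by (auto simp: subspace_def bracket_add_left bracket_scale_left subset_iff)
  qed (use X 1 in auto)
  then show ?thesis using x by blast
qed

end

context graded_lie_algebra
begin

definition is_decomp :: "'v \<Rightarrow> (int \<times> int \<Rightarrow> 'v) \<Rightarrow> bool" where
  "is_decomp x c \<longleftrightarrow> (\<forall>i j. c (i, j) \<in> G i j) \<and> finite {p. c p \<noteq> 0} \<and> x = (\<Sum>p | c p \<noteq> 0. c p)"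

definition decomp :: "'v \<Rightarrow> int \<times> int \<Rightarrow> 'v" where
  "decomp x = (THE c. is_decomp x c)"

lemma decomp: "x \<in> lie_carrier A \<Longrightarrow> is_decomp x (decomp x)"
  unfolding decomp_def by (rule theI'[OF direct_sum[folded is_decomp_def]])

lemma decomp_sum:
  assumes "finite K" "\<And>i j. (i, j) \<in> K \<Longrightarrow> c (i, j) \<in> G i j"
  shows "decomp (\<Sum>p\<in>K. c p) = (\<lambda>p. if p \<in> K then c p else 0)"
proof -
  define c' where "c' p = (if p \<in> K then c p else 0)" for p
  have G0: "0 \<in> G i j" for i j using subspace_0[OF subspace_component] .
  have sub: "{p. c' p \<noteq> 0} \<subseteq> K" by (auto simp: c'_def)
  have "(\<Sum>p\<in>K. c p) = (\<Sum>p\<in>K. c' p)" by (simp add: c'_def)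
  also have "\<dots> = (\<Sum>p | c' p \<noteq> 0. c' p)"
    using assms(1) sub by (intro sum.mono_neutral_right) auto
  finally have c': "is_decomp (\<Sum>p\<in>K. c p) c'"
    unfolding is_decomp_def using assms G0 finite_subset[OF sub] by (simp add: c'_def)
  have "(\<Sum>p\<in>K. c p) \<in> lie_carrier A"
    by (intro subspace_sum[OF subspace_carrier]) (use assms(2) component_subset in force)
  then have "decomp (\<Sum>p\<in>K. c p) = c'"
    using direct_sum[of "\<Sum>p\<in>K. c p"] decomp c' unfolding is_decomp_def by blast
  then show ?thesis by (simp add: c'_def fun_eq_iff)
qed

lemma decomp_component: "x \<in> lie_carrier A \<Longrightarrow> decomp x (i, j) \<in> G i j"
  using decomp unfolding is_decomp_def by blast

lemma decomp_add:
  assumes "x \<in> lie_carrier A" "y \<in> lie_carrier A"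
  shows "decomp (x + y) p = decomp x p + decomp y p"
proof -
  let ?X = "{p. decomp x p \<noteq> 0}" let ?Y = "{p. decomp y p \<noteq> 0}"
  have fin: "finite (?X \<union> ?Y)" using decomp[OF assms(1)] decomp[OF assms(2)] by (simp add: is_decomp_def)
  have "x = (\<Sum>p\<in>?X. decomp x p)" "y = (\<Sum>p\<in>?Y. decomp y p)"
    using decomp[OF assms(1)] decomp[OF assms(2)] unfolding is_decomp_def by blast+
  moreover have "(\<Sum>p\<in>?X. decomp x p) = (\<Sum>p\<in>?X \<union> ?Y. decomp x p)" "(\<Sum>p\<in>?Y. decomp y p) = (\<Sum>p\<in>?X \<union> ?Y. decomp y p)"
    using fin by (auto intro!: sum.mono_neutral_left)
  ultimately have "x + y = (\<Sum>p\<in>?X \<union> ?Y. decomp x p + decomp y p)" by (simp add: sum.distrib)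
  moreover have "decomp (\<Sum>p\<in>?X \<union> ?Y. decomp x p + decomp y p)
      = (\<lambda>p. if p \<in> ?X \<union> ?Y then decomp x p + decomp y p else 0)"
    using fin by (rule decomp_sum) (intro subspace_add[OF subspace_component] decomp_component assms)
  ultimately show ?thesis by simp
qed

lemma decomp_scale:
  assumes "x \<in> lie_carrier A"
  shows "decomp (lie_scale A r x) p = lie_scale A r (decomp x p)"
proof -
  let ?X = "{p. decomp x p \<noteq> 0}"
  have fin: "finite ?X" and x: "x = (\<Sum>p\<in>?X. decomp x p)"
    using decomp[OF assms] unfolding is_decomp_def by blast+
  have "lie_scale A r x = (\<Sum>p\<in>?X. lie_scale A r (decomp x p))" by (subst x) (rule scale_sum_right)
  moreover have "decomp (\<Sum>p\<in>?X. lie_scale A r (decomp x p)) = (\<lambda>p. if p \<in> ?X then lie_scale A r (decomp x p) else 0)"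
    using fin by (rule decomp_sum) (intro subspace_scale[OF subspace_component] decomp_component assms)
  ultimately show ?thesis by simp
qed

lemma decomp_homogeneous: "x \<in> G i j \<Longrightarrow> decomp x = (\<lambda>p. if p = (i, j) then x else 0)"
  using decomp_sum[of "{(i, j)}" "\<lambda>_. x"] by simp

lemma span_other_components:
  assumes x: "x \<in> span (\<Union>p\<in>K. G (fst p) (snd p))" "x \<in> G i j" and K: "(i, j) \<notin> K"
  shows "x = 0"
proof -
  have "span (\<Union>p\<in>K. G (fst p) (snd p)) \<subseteq> {x \<in> lie_carrier A. decomp x (i, j) = 0}"
  proof (rule span_minimal)
    show "subspace {x \<in> lie_carrier A. decomp x (i, j) = 0}"
      using subspace_carrier by (auto simp: subspace_def decomp_add decomp_scale decomp_homogeneous[OF subspace_0[OF subspace_component[of i j]]])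
    show "(\<Union>p\<in>K. G (fst p) (snd p)) \<subseteq> {x \<in> lie_carrier A. decomp x (i, j) = 0}"
      using K component_subset by (auto simp: decomp_homogeneous)
  qed
  then have "decomp x (i, j) = 0" using x(1) by blast
  then show ?thesis using decomp_homogeneous[OF x(2)] by simp
qed

lemma component_unique:
  assumes "x \<in> G i j" "x \<in> G k l" "x \<noteq> 0"
  shows "i = k" "j = l"
  using decomp_homogeneous[OF assms(1)] decomp_homogeneous[OF assms(2)] assms(3)
  by (metis prod.inject)+

end

section \<open>The subalgebra sl2 in the degrees (0, j)\<close>

lemma matrix_2_eq: "M = N \<longleftrightarrow> M $ 1 $ 1 = N $ 1 $ 1 \<and> M $ 1 $ 2 = N $ 1 $ 2 \<and> M $ 2 $ 1 = N $ 2 $ 1 \<and> M $ 2 $ 2 = N $ 2 $ 2"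
  for M N :: "'f^2^2"
  by (auto simp: vec_eq_iff forall_2)

text \<open>Every \<open>M\<close> of trace \<open>0\<close> is \<open>[M\<^sub>1\<^sub>1 E, F] + [H / 2, M\<^sub>1\<^sub>2 E - M\<^sub>2\<^sub>1 F]\<close>.\<close>

lemma sl2_bracket_sum:
  fixes M :: "'f::field^2^2"
  assumes two: "(2 :: 'f) \<noteq> 0" and "trace M = 0"
  obtains P Q R T where "trace P = 0" "trace Q = 0" "trace R = 0" "trace T = 0"
    "M = (P ** Q - Q ** P) + (R ** T - T ** R)"
proof -
  define P :: "'f^2^2" where "P = vector [vector [0, M $ 1 $ 1], vector [0, 0]]"
  define Q :: "'f^2^2" where "Q = vector [vector [0, 0], vector [1, 0]]"
  define R :: "'f^2^2" where "R = vector [vector [1 / 2, 0], vector [0, - (1 / 2)]]"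
  define T :: "'f^2^2" where "T = vector [vector [0, M $ 1 $ 2], vector [- M $ 2 $ 1, 0]]"
  note defs = P_def Q_def R_def T_def
  have M: "M $ 2 $ 2 = - M $ 1 $ 1" using assms(2) by (simp add: trace_def sum_2 eq_neg_iff_add_eq_0 add.commute)
  show thesis
  proof (rule that)
    show "trace P = 0" "trace Q = 0" "trace R = 0" "trace T = 0"
      by (simp_all add: trace_def sum_2 defs)
    show "M = (P ** Q - Q ** P) + (R ** T - T ** R)"
      unfolding matrix_2_eq by (simp add: matrix_matrix_mult_def sum_2 M defs two)
  qed
qed

context lie_algebra
begin

lemma sl2_perfect:
  assumes iso: "lie_restrict A V \<simeq>\<^sub>L (sl2 :: ('f, 'f^2^2) lie_struct)" and two: "(2 :: 'f) \<noteq> 0"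
    and N: "subspace N" "\<And>x y. x \<in> V \<Longrightarrow> y \<in> V \<Longrightarrow> lie_bracket A x y \<in> N"
  shows "V \<subseteq> N" "\<exists>x\<in>V. \<exists>y\<in>V. lie_bracket A x y \<noteq> 0"
proof -
  obtain g :: "'v \<Rightarrow> 'f^2^2" where bij: "bij_betw g V {M. trace M = 0}"
    and add: "\<And>x y. x \<in> V \<Longrightarrow> y \<in> V \<Longrightarrow> g (x + y) = g x + g y"
    and br: "\<And>x y. x \<in> V \<Longrightarrow> y \<in> V \<Longrightarrow> g (lie_bracket A x y) = g x ** g y - g y ** g x"
    using iso unfolding lie_isomorphic_def by (auto simp: lie_restrict_def sl2_def)
  have "lie_algebra (lie_restrict A V)" using iso by (simp add: lie_isomorphic_def)
  then interpret V: lie_algebra "lie_restrict A V" .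
  have subV: "subspace V" using V.subspace_carrier by (simp add: lie_restrict_def)
  have closed: "lie_bracket A x y \<in> V" if "x \<in> V" "y \<in> V" for x y
    using V.bracket_closed[of x y] that by (simp add: lie_restrict_def)
  have pre: "\<exists>x\<in>V. g x = M" if "trace M = 0" for M using bij that by (force simp: bij_betw_def)
  show "V \<subseteq> N"
  proof
    fix w
    assume w: "w \<in> V"
    then have "trace (g w) = 0" using bij by (auto simp: bij_betw_def)
    then obtain P Q R T where t: "trace P = 0" "trace Q = 0" "trace R = 0" "trace T = 0"
      "g w = (P ** Q - Q ** P) + (R ** T - T ** R)"
      by (rule sl2_bracket_sum[OF two])
    obtain p q r u where V: "p \<in> V" "g p = P" "q \<in> V" "g q = Q" "r \<in> V" "g r = R" "u \<in> V" "g u = T"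
      using pre t by metis
    have "g w = g (lie_bracket A p q + lie_bracket A r u)"
      using V t closed by (simp add: add br)
    then have "w = lie_bracket A p q + lie_bracket A r u"
      using bij w V closed subspace_add[OF subV] by (auto simp: bij_betw_def inj_on_def)
    then show "w \<in> N" using N V subspace_add by simp
  qed
  show "\<exists>x\<in>V. \<exists>y\<in>V. lie_bracket A x y \<noteq> 0"
  proof -
    define P :: "'f^2^2" where "P = vector [vector [0, 1], vector [0, 0]]"
    define Q :: "'f^2^2" where "Q = vector [vector [0, 0], vector [1, 0]]"
    have "trace P = 0" "trace Q = 0" by (simp_all add: trace_def sum_2 P_def Q_def)
    then obtain p q where pq: "p \<in> V" "g p = P" "q \<in> V" "g q = Q" using pre by metis
    have "P ** Q - Q ** P \<noteq> 0"
      unfolding matrix_2_eq by (simp add: matrix_matrix_mult_def sum_2 P_def Q_def)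
    moreover have "g 0 = 0" using add[of 0 0] subspace_0[OF subV] by simp
    ultimately have "lie_bracket A p q \<noteq> 0" using br[of p q] pq by auto
    then show ?thesis using pq by blast
  qed
qed

end

text \<open>The isomorphism with sl2 may ignore degrees, so the argument rests on perfectness. If
  [e, f] = 0, all brackets lie in the span of e and f; then so does h, directness of the grading
  gives h = 0, and no bracket is nonzero. If [h, e] = 0, the same reasoning gives e = 0 and
  contradicts the first part.\<close>

lemma (in graded_lie_algebra) sl2_brackets:
  fixes e f h
  assumes two: "(2 :: 'f) \<noteq> 0"
    and iso: "lie_restrict A (span (G 0 (- 1) \<union> G 0 0 \<union> G 0 1)) \<simeq>\<^sub>L (sl2 :: ('f, 'f^2^2) lie_struct)"
    and G: "G 0 1 = span {e}" "G 0 0 = span {h}" "G 0 (- 1) = span {f}"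
  shows "lie_bracket A h e \<noteq> 0" "lie_bracket A e f \<noteq> 0"
proof -
  let ?V = "span (G 0 (- 1) \<union> G 0 0 \<union> G 0 1)"
  have mem: "e \<in> G 0 1" "h \<in> G 0 0" "f \<in> G 0 (- 1)" unfolding G by (simp_all add: span_base)
  have car: "{e, h, f} \<subseteq> lie_carrier A" using mem component_subset by blast
  have V: "?V = span {e, h, f}"
  proof
    show "?V \<subseteq> span {e, h, f}"
      by (rule span_minimal) (auto simp: G intro: span_mono[THEN subsetD, rotated])
    show "span {e, h, f} \<subseteq> ?V" by (rule span_mono) (use mem in auto)
  qed
  have E: "\<exists>x\<in>?V. \<exists>y\<in>?V. lie_bracket A x y \<noteq> 0"
    by (rule sl2_perfect(2)[OF iso two subspace_UNIV]) simp
  have self: "lie_bracket A x x = 0" if "x \<in> {e, h, f}" for x using bracket_self car that by blast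
  have sk: "lie_bracket A y x = - lie_bracket A x y" if "x \<in> {e, h, f}" "y \<in> {e, h, f}" for x y
    using bracket_skew car that by blast
  have gen: "?V \<subseteq> N" if N: "subspace N" "lie_bracket A h e \<in> N" "lie_bracket A h f \<in> N" "lie_bracket A e f \<in> N" for N
  proof (rule sl2_perfect(1)[OF iso two N(1)])
    have "lie_bracket A e h = - lie_bracket A h e" "lie_bracket A f h = - lie_bracket A h f" "lie_bracket A f e = - lie_bracket A e f"
      by (rule sk; simp)+
    then have "lie_bracket A e h \<in> N" "lie_bracket A f h \<in> N" "lie_bracket A f e \<in> N"
      using N(2-4) by (simp_all only: subspace_neg[OF N(1)])
    moreover have "lie_bracket A e e = 0" "lie_bracket A f f = 0" "lie_bracket A h h = 0" using self by simp_all
    ultimately have "lie_bracket A x y \<in> N" if "x \<in> {e, h, f}" "y \<in> {e, h, f}" for x y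
      using that N(2-4) subspace_0[OF N(1)] by (elim insertE emptyE) simp_all
    then show "lie_bracket A x y \<in> N" if "x \<in> ?V" "y \<in> ?V" for x y
      using that unfolding V by (rule bracket_span[OF car car N(1)])
  qed
  have he: "lie_bracket A h e \<in> span {e}" using bracket_component[OF mem(2,1)] G by simp
  have hf: "lie_bracket A h f \<in> span {f}" using bracket_component[OF mem(2,3)] G by simp
  have ef: "lie_bracket A e f \<in> span {h}" using bracket_component[OF mem(1,3)] G by simp
  have mono: "x \<in> span X \<Longrightarrow> X \<subseteq> Y \<Longrightarrow> x \<in> span Y" for x X Y using span_mono by blast
  have out: "x = 0" if "x \<in> span (G 0 j \<union> G 0 k)" "x \<in> G 0 l" "l \<noteq> j" "l \<noteq> k" for x j k l
  proof (rule span_other_components[of _ "{(0, j), (0, k)}"])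
    show "x \<in> span (\<Union>p\<in>{(0, j), (0, k)}. G (fst p) (snd p))" using that(1) by simp
  qed (use that in auto)
  have inV: "h \<in> ?V" "e \<in> ?V" unfolding V by (simp_all add: span_base)
  have zero: "lie_bracket A 0 x = 0" if "x \<in> {e, h, f}" for x by (rule bracket_zero(1)) (use car that in blast)
  show ef0: "lie_bracket A e f \<noteq> 0"
  proof
    assume 0: "lie_bracket A e f = 0"
    have "?V \<subseteq> span {e, f}"
      by (rule gen[OF subspace_span]) (simp_all add: 0 span_zero mono[OF he] mono[OF hf])
    then have "h \<in> span {e, f}" using inV(1) by (rule subsetD)
    moreover have "span {e, f} \<subseteq> span (G 0 1 \<union> G 0 (- 1))" by (rule span_mono) (use mem in auto)
    ultimately have "h \<in> span (G 0 1 \<union> G 0 (- 1))" by (rule rev_subsetD)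
    then have "h = 0" by (rule out[of h 1 "- 1" 0]) (simp_all add: mem)
    then have "?V \<subseteq> {0}" by (intro gen subspace_single_0) (simp_all add: 0 zero)
    then have "e = 0" using inV(2) by blast
    have "lie_bracket A 0 0 = 0" using zero[of e] \<open>e = 0\<close> by simp
    then show False using E \<open>?V \<subseteq> {0}\<close> by (metis singletonD subsetD)
  qed
  show "lie_bracket A h e \<noteq> 0"
  proof
    assume 0: "lie_bracket A h e = 0"
    have "?V \<subseteq> span {h, f}"
      by (rule gen[OF subspace_span]) (simp_all add: 0 span_zero mono[OF ef] mono[OF hf])
    then have "e \<in> span {h, f}" using inV(2) by (rule subsetD)
    moreover have "span {h, f} \<subseteq> span (G 0 0 \<union> G 0 (- 1))" by (rule span_mono) (use mem in auto)
    ultimately have "e \<in> span (G 0 0 \<union> G 0 (- 1))" by (rule rev_subsetD)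
    then have "e = 0" by (rule out[of e 0 "- 1" 1]) (simp_all add: mem)
    then show False using ef0 zero[of f] by simp
  qed
qed

section \<open>The grading of the Witt algebra\<close>

lemma Vir_bracket_lookup:
  "Poly_Mapping.lookup (lie_bracket (Vir :: ('f::field, int \<Rightarrow>\<^sub>0 'f) lie_struct) H X) n
    = (\<Sum>k\<in>Poly_Mapping.keys H. \<Sum>l\<in>Poly_Mapping.keys X.
        if k + l = n then Poly_Mapping.lookup H k * Poly_Mapping.lookup X l * of_int (l - k) else 0)"
  unfolding Vir_def lie_of_basis_def
  by (simp add: lookup_sum lookup_scale lookup_single when_def if_distrib cong: if_cong)

text \<open>An eigenvector of \<open>ad H\<close> has the same top index as \<open>H\<close>, provided the latter is positive:
  otherwise \<open>[H, X]\<close> would have a top index exceeding that of \<open>X\<close>. For \<open>\<epsilon> = - 1\<close> this concerns the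
  bottom indices.\<close>

lemma Vir_eigenvector_top:
  fixes H X :: "int \<Rightarrow>\<^sub>0 'f::field_char_0"
  assumes \<epsilon>: "\<epsilon> = 1 \<or> \<epsilon> = - 1" and eig: "lie_bracket Vir H X = Poly_Mapping.map ((*) r) X"
    and m: "m \<in> Poly_Mapping.keys H" "\<And>k. k \<in> Poly_Mapping.keys H \<Longrightarrow> \<epsilon> * k \<le> \<epsilon> * m" "\<epsilon> * m > 0"
    and n: "n \<in> Poly_Mapping.keys X" "\<And>k. k \<in> Poly_Mapping.keys X \<Longrightarrow> \<epsilon> * k \<le> \<epsilon> * n"
  shows "n = m"
proof (rule ccontr)
  assume "n \<noteq> m"
  have "m + n \<notin> Poly_Mapping.keys X" using n(2)[of "m + n"] m(3) by (auto simp: algebra_simps)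
  then have "Poly_Mapping.lookup (lie_bracket Vir H X) (m + n) = 0"
    unfolding eig lookup_scale by (simp add: in_keys_iff)
  moreover have "Poly_Mapping.lookup (lie_bracket Vir H X) (m + n)
      = (\<Sum>k\<in>Poly_Mapping.keys H. \<Sum>l\<in>Poly_Mapping.keys X.
        if k = m \<and> l = n then Poly_Mapping.lookup H m * Poly_Mapping.lookup X n * of_int (n - m) else 0)"
    unfolding Vir_bracket_lookup
  proof (intro sum.cong refl)
    fix k l
    assume kl: "k \<in> Poly_Mapping.keys H" "l \<in> Poly_Mapping.keys X"
    have "k = m \<and> l = n" if "k + l = m + n" using m(2)[OF kl(1)] n(2)[OF kl(2)] that \<epsilon> by auto
    then show "(if k + l = m + n then Poly_Mapping.lookup H k * Poly_Mapping.lookup X l * of_int (l - k) else 0)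
      = (if k = m \<and> l = n then Poly_Mapping.lookup H m * Poly_Mapping.lookup X n * of_int (n - m) else 0)" by auto
  qed
  moreover have "\<dots> = (\<Sum>k\<in>Poly_Mapping.keys H. if k = m then \<Sum>l\<in>Poly_Mapping.keys X.
        if l = n then Poly_Mapping.lookup H m * Poly_Mapping.lookup X n * of_int (n - m) else 0 else 0)"
    by (intro sum.cong refl) auto
  moreover have "\<dots> = Poly_Mapping.lookup H m * Poly_Mapping.lookup X n * of_int (n - m)"
    using m(1) n(1) by simp
  ultimately show False using m(1) n(1) \<open>n \<noteq> m\<close> by (simp add: in_keys_iff)
qed

text \<open>A bracket of a vector with itself says nothing about degrees, hence the restriction to
  distinct arguments. The deviation D from linearity is constant for k \<ge> 2 and zero for k \<le>
  1; the sum 5 = 2 + 3 shows that the constant is zero.\<close>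

lemma additive_on_distinct:
  fixes \<delta> :: "int \<Rightarrow> int"
  assumes add: "\<And>k l. k \<noteq> l \<Longrightarrow> \<delta> (k + l) = \<delta> k + \<delta> l"
  shows "\<delta> k = k * \<delta> 1"
proof -
  define D where "D k = \<delta> k - k * \<delta> 1" for k
  have D: "D (k + l) = D k + D l" if "k \<noteq> l" for k l using add[OF that] by (simp add: D_def algebra_simps)
  have step: "D (k + 1) = D k" if "k \<noteq> 1" for k using D[OF that] by (simp add: D_def)
  have up: "D k = D 2" if "k \<ge> 2" for k
    using that
  proof (induction k rule: int_ge_induct)
    case (step i)
    then show ?case using \<open>\<And>k. k \<noteq> 1 \<Longrightarrow> D (k + 1) = D k\<close>[of i] by simp
  qed simp
  have down: "D k = 0" if "k \<le> 1" for k
    using that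
  proof (induction k rule: int_le_induct)
    case base
    show ?case by (simp add: D_def)
  next
    case (step i)
    then show ?case using \<open>\<And>k. k \<noteq> 1 \<Longrightarrow> D (k + 1) = D k\<close>[of "i - 1"] by simp
  qed
  have "D 2 = 0" using D[of 2 3] up[of 3] up[of 5] by simp
  then have "D k = 0" using up[of k] down[of k] by linarith
  then show ?thesis by (simp add: D_def)
qed

text \<open>The vector h of degree (0, 0) acts diagonally on homogeneous vectors. With
  \<open>Vir_eigenvector_top\<close> this forces its image to be a multiple of L_0, so homogeneous
  vectors go to multiples of the L_k although the isomorphism is not assumed to be graded. The
  degree of L_k is linear in k; its slope c is nonzero but otherwise arbitrary.\<close>

lemma Vir_basis:
  fixes A :: "('f::field_char_0, 'v::ab_group_add) lie_struct" and h :: 'v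
  assumes "graded_lie_algebra A G"
    and iso: "lie_restrict A (lie_span A (\<Union>i. G i 0)) \<simeq>\<^sub>L (Vir :: ('f, int \<Rightarrow>\<^sub>0 'f) lie_struct)"
    and dim: "\<And>i. \<exists>w. G i 0 = lie_span A {w}" and h: "h \<in> G 0 0" "h \<noteq> 0"
  obtains c u where "c \<noteq> 0" "\<And>k. u k \<noteq> 0" "\<And>k. G (c * k) 0 = lie_span A {u k}"
    "\<And>k l. lie_bracket A (u k) (u l) = lie_scale A (of_int (l - k)) (u (k + l))"
    "\<And>i. \<not> c dvd i \<Longrightarrow> G i 0 = {0}"
proof -
  interpret graded_lie_algebra A G by fact
  define V where "V = span (\<Union>i. G i 0)"
  obtain f :: "'v \<Rightarrow> int \<Rightarrow>\<^sub>0 'f" where bij: "bij_betw f V UNIV"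
    and add: "\<And>x y. x \<in> V \<Longrightarrow> y \<in> V \<Longrightarrow> f (x + y) = f x + f y"
    and scale: "\<And>c x. x \<in> V \<Longrightarrow> f (lie_scale A c x) = Poly_Mapping.map ((*) c) (f x)"
    and br: "\<And>x y. x \<in> V \<Longrightarrow> y \<in> V \<Longrightarrow> f (lie_bracket A x y) = lie_bracket Vir (f x) (f y)"
    using iso unfolding lie_isomorphic_def V_def[symmetric]
    by (auto simp: lie_restrict_def Vir_def lie_of_basis_def)
  have subV: "subspace V" unfolding V_def by (rule subspace_span)
  have GV: "x \<in> V" if "x \<in> G i 0" for x i unfolding V_def by (rule span_base) (use that in blast)
  have inj: "x = y" if "f x = f y" "x \<in> V" "y \<in> V" for x y using bij that by (auto simp: bij_betw_def inj_on_def)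
  have f0: "f 0 = 0" using add[of 0 0] subspace_0[OF subV] by simp
  have fne: "Poly_Mapping.keys (f x) \<noteq> {}" if "x \<in> V" "x \<noteq> 0" for x
    using inj[of x 0] that f0 subspace_0[OF subV] by auto
  have Gspan: "G i 0 = span {x}" if x: "x \<in> G i 0" "x \<noteq> 0" for x i
  proof -
    obtain w where w: "G i 0 = span {w}" using dim by blast
    obtain r where r: "x = lie_scale A r w" using x(1) unfolding w span_singleton by blast
    then have "w = lie_scale A (1 / r) x" using x(2) by auto
    then have "w \<in> span {x}" by (metis span_scale span_base singletonI)
    then show ?thesis unfolding w using x(1) w by (intro equalityI span_minimal) auto
  qed
  have into: "f x \<in> U" if U: "\<And>i x. x \<in> G i 0 \<Longrightarrow> f x \<in> U" "0 \<in> U" "\<And>x y. x \<in> U \<Longrightarrow> y \<in> U \<Longrightarrow> x + y \<in> U"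
    "\<And>c x. x \<in> U \<Longrightarrow> Poly_Mapping.map ((*) c) x \<in> U" and x: "x \<in> V" for U x
  proof -
    have "V \<subseteq> {x \<in> V. f x \<in> U}"
    proof (subst V_def, rule span_minimal)
      show "subspace {x \<in> V. f x \<in> U}"
        using subV U f0 by (auto simp: subspace_def add scale)
    qed (use GV U in auto)
    then show ?thesis using x by blast
  qed
  \<comment> \<open>A proper subspace cannot contain the images of all homogeneous vectors, since
    these span.\<close>
  have full: "\<exists>i x. x \<in> G i 0 \<and> f x \<notin> U" if U: "0 \<in> U" "\<And>x y. x \<in> U \<Longrightarrow> y \<in> U \<Longrightarrow> x + y \<in> U"
    "\<And>c x. x \<in> U \<Longrightarrow> Poly_Mapping.map ((*) c) x \<in> U" and z: "z \<notin> U" for U z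
  proof (rule ccontr)
    assume *: "\<not> ?thesis"
    obtain x where x: "x \<in> V" "f x = z" using bij by (metis UNIV_I bij_betw_def imageE)
    have "f x \<in> U" by (rule into) (use * U x in auto)
    then show False using x z by simp
  qed
  have eig: "\<exists>r. lie_bracket Vir (f h) (f x) = Poly_Mapping.map ((*) r) (f x)" if x: "x \<in> G i 0" for x i
  proof (cases "x = 0")
    case True
    have "lie_bracket Vir (f h) 0 = (0 :: int \<Rightarrow>\<^sub>0 'f)" by (simp add: Vir_def lie_of_basis_def)
    then show ?thesis using True f0 by (auto intro!: exI[of _ 0] poly_mapping_eqI simp: lookup_scale)
  next
    case False
    have "lie_bracket A h x \<in> span {x}" using bracket_component[OF h(1) x] Gspan[OF x False] by simp
    then obtain r where "lie_bracket A h x = lie_scale A r x" by (auto simp: span_singleton)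
    then show ?thesis using br[OF GV[OF h(1)] GV[OF x]] scale[OF GV[OF x], of r] by (intro exI[of _ r]) simp
  qed
  have keys_h: "Poly_Mapping.keys (f h) \<subseteq> {0}"
  proof
    fix k
    assume k: "k \<in> Poly_Mapping.keys (f h)"
    have "k = 0"
    proof (rule ccontr)
      assume "k \<noteq> 0"
      define \<epsilon> :: int where "\<epsilon> = (if k > 0 then 1 else - 1)"
      have \<epsilon>: "\<epsilon> = 1 \<or> \<epsilon> = - 1" "\<epsilon> * k > 0" using \<open>k \<noteq> 0\<close> by (auto simp: \<epsilon>_def)
      have top: "\<exists>n\<in>Poly_Mapping.keys X. \<forall>k\<in>Poly_Mapping.keys X. \<epsilon> * k \<le> \<epsilon> * n"
        if "Poly_Mapping.keys X \<noteq> {}" for X :: "int \<Rightarrow>\<^sub>0 'f"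
      proof -
        let ?M = "Max ((*) \<epsilon> ` Poly_Mapping.keys X)"
        have "?M \<in> (*) \<epsilon> ` Poly_Mapping.keys X" using that by (intro Max_in) auto
        then obtain n where n: "n \<in> Poly_Mapping.keys X" "\<epsilon> * n = ?M" by force
        have "\<epsilon> * k \<le> \<epsilon> * n" if "k \<in> Poly_Mapping.keys X" for k unfolding n(2) by (rule Max_ge) (use that in auto)
        then show ?thesis using n(1) by blast
      qed
      obtain m where m: "m \<in> Poly_Mapping.keys (f h)" "\<And>k. k \<in> Poly_Mapping.keys (f h) \<Longrightarrow> \<epsilon> * k \<le> \<epsilon> * m"
        using top[of "f h"] k by blast
      have m0: "\<epsilon> * m > 0" using m(2)[OF k] \<epsilon>(2) by simp
      \<comment> \<open>Some homogeneous vector has an image with nonzero coefficient at m +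
        \<epsilon>, just beyond the extreme index m of the image of h; its own extreme index is then
        different from m.\<close>
      define U :: "(int \<Rightarrow>\<^sub>0 'f) set" where "U = {x. Poly_Mapping.lookup x (m + \<epsilon>) = 0}"
      have "\<exists>i x. x \<in> G i 0 \<and> f x \<notin> U"
        by (rule full[of _ "Poly_Mapping.single (m + \<epsilon>) 1"]) (auto simp: U_def lookup_add lookup_scale)
      then obtain i x where x: "x \<in> G i 0" "m + \<epsilon> \<in> Poly_Mapping.keys (f x)" by (auto simp: U_def in_keys_iff)
      obtain r where r: "lie_bracket Vir (f h) (f x) = Poly_Mapping.map ((*) r) (f x)" using eig[OF x(1)] by blast
      obtain n where n: "n \<in> Poly_Mapping.keys (f x)" "\<And>k. k \<in> Poly_Mapping.keys (f x) \<Longrightarrow> \<epsilon> * k \<le> \<epsilon> * n"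
        using top[of "f x"] x(2) by blast
      have "n = m" by (rule Vir_eigenvector_top[OF \<epsilon>(1) r m m0 n])
      then show False using n(2)[OF x(2)] \<epsilon>(1) by auto
    qed
    then show "k \<in> {0}" by simp
  qed
  define r0 where "r0 = Poly_Mapping.lookup (f h) 0"
  have fh: "f h = Poly_Mapping.single 0 r0"
    using keys_h by (intro poly_mapping_eqI) (auto simp: r0_def lookup_single when_def in_keys_iff)
  have r0: "r0 \<noteq> 0" using fne[OF GV[OF h(1)] h(2)] fh by auto
  have mono: "\<exists>k r. f x = Poly_Mapping.single k r" if x: "x \<in> G i 0" for x i
  proof (cases "Poly_Mapping.keys (f x) = {}")
    case True
    then show ?thesis by (intro exI[of _ 0] exI[of _ 0]) simp
  next
    case False
    obtain r where r: "lie_bracket Vir (f h) (f x) = Poly_Mapping.map ((*) r) (f x)" using eig[OF x] by blast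
    have ev: "r0 * of_int k = r" if k: "k \<in> Poly_Mapping.keys (f x)" for k
    proof -
      have "Poly_Mapping.lookup (lie_bracket Vir (f h) (f x)) k = r0 * Poly_Mapping.lookup (f x) k * of_int k"
        unfolding Vir_bracket_lookup fh using r0 k by simp
      then show ?thesis unfolding r lookup_scale using k by (simp add: in_keys_iff)
    qed
    obtain k where k: "k \<in> Poly_Mapping.keys (f x)" using False by blast
    have "k' = k" if "k' \<in> Poly_Mapping.keys (f x)" for k'
      using ev[OF k] ev[OF that] r0 by (metis mult_cancel_left of_int_eq_iff)
    then have "f x = Poly_Mapping.single k (Poly_Mapping.lookup (f x) k)"
      by (intro poly_mapping_eqI) (auto simp: lookup_single when_def in_keys_iff)
    then show ?thesis by blast
  qed
  have "\<exists>i x. x \<in> G i 0 \<and> f x = Poly_Mapping.single k 1" for k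
  proof -
    have "\<exists>i x. x \<in> G i 0 \<and> f x \<notin> {x. Poly_Mapping.lookup x k = 0}"
      by (rule full[of _ "Poly_Mapping.single k 1"]) (auto simp: lookup_add lookup_scale)
    then obtain i x where x: "x \<in> G i 0" "Poly_Mapping.lookup (f x) k \<noteq> 0" by blast
    obtain k' r where k': "f x = Poly_Mapping.single k' r" using mono[OF x(1)] by blast
    have "k' = k" "r \<noteq> 0" using x(2) k' by (auto simp: lookup_single when_def split: if_splits)
    then have "f (lie_scale A (1 / r) x) = Poly_Mapping.single k 1"
      unfolding scale[OF GV[OF x(1)]] k' by (intro poly_mapping_eqI) (simp add: lookup_scale lookup_single when_def)
    then show ?thesis using subspace_scale[OF subspace_component x(1)] by blast
  qed
  then obtain \<delta> u where u: "\<And>k. u k \<in> G (\<delta> k) 0" "\<And>k. f (u k) = Poly_Mapping.single k 1" by metis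
  have uV: "u k \<in> V" for k using GV u(1) .
  have u0: "u k \<noteq> 0" for k
  proof -
    have "Poly_Mapping.lookup (f (u k)) k = 1" by (simp add: u(2))
    then show ?thesis using f0 by auto
  qed
  have bru: "lie_bracket A (u k) (u l) = lie_scale A (of_int (l - k)) (u (k + l))" for k l
  proof (rule inj)
    show "f (lie_bracket A (u k) (u l)) = f (lie_scale A (of_int (l - k)) (u (k + l)))"
      unfolding br[OF uV uV] scale[OF uV] u(2)
      by (intro poly_mapping_eqI) (simp add: Vir_bracket_lookup lookup_scale lookup_single when_def)
    show "lie_bracket A (u k) (u l) \<in> V" using bracket_component[OF u(1) u(1), of k l] GV by simp
    show "lie_scale A (of_int (l - k)) (u (k + l)) \<in> V" using subspace_scale[OF subV uV] .
  qed
  have "\<delta> (k + l) = \<delta> k + \<delta> l" if "k \<noteq> l" for k l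
  proof -
    have "lie_bracket A (u k) (u l) \<noteq> 0" using u0 that unfolding bru by simp
    moreover have "lie_bracket A (u k) (u l) \<in> G (\<delta> (k + l)) 0"
      unfolding bru by (intro subspace_scale[OF subspace_component] u(1))
    ultimately show ?thesis using component_unique(1) bracket_component[OF u(1) u(1), of k l] by metis
  qed
  then have \<delta>: "\<delta> k = \<delta> 1 * k" for k using additive_on_distinct[of \<delta> k] by (simp add: mult.commute)
  show thesis
  proof (rule that)
    show "u k \<noteq> 0" for k by (rule u0)
    show "G (\<delta> 1 * k) 0 = span {u k}" for k using Gspan[OF u(1) u0, of k] \<delta>[of k] by simp
    show "lie_bracket A (u k) (u l) = lie_scale A (of_int (l - k)) (u (k + l))" for k l by (rule bru)
    show "\<delta> 1 \<noteq> 0"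
    proof
      assume "\<delta> 1 = 0"
      then have "u 1 \<in> span {u 0}" using u(1)[of 1] Gspan[OF u(1) u0, of 0] \<delta>[of 0] by simp
      then obtain r where "u 1 = lie_scale A r (u 0)" by (auto simp: span_singleton)
      then have "f (u 1) = Poly_Mapping.map ((*) r) (f (u 0))" using scale[OF uV] by simp
      then have "Poly_Mapping.lookup (f (u 1)) 1 = r * Poly_Mapping.lookup (f (u 0)) 1" by (simp add: lookup_scale)
      then show False by (simp add: u(2) lookup_single del: single_one)
    qed
    show "G i 0 = {0}" if i: "\<not> \<delta> 1 dvd i" for i
    proof -
      have "x = 0" if x: "x \<in> G i 0" for x
      proof (rule ccontr)
        assume "x \<noteq> 0"
        obtain k r where k: "f x = Poly_Mapping.single k r" using mono[OF x] by blast
        have "x = lie_scale A r (u k)"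
          by (rule inj) (use GV[OF x] subspace_scale[OF subV uV] in \<open>auto simp: k scale[OF uV] u(2) intro!: poly_mapping_eqI simp: lookup_scale lookup_single when_def\<close>)
        then have "x \<in> G (\<delta> k) 0" using subspace_scale[OF subspace_component u(1)] by simp
        then have "i = \<delta> k" using component_unique(1)[OF x _ \<open>x \<noteq> 0\<close>] by blast
        then show False using i \<delta>[of k] by simp
      qed
      then show ?thesis using subspace_0[OF subspace_component] by blast
    qed
  qed
qed

lemma structure_constants:
  fixes A :: "('f::field_char_0, 'v::ab_group_add) lie_struct"
  assumes graded: "graded_lie_algebra A G"
    and dim: "\<And>i j. lie_dim_le A (G i j) 1"
    and vir: "lie_restrict A (lie_span A (\<Union>i. G i 0)) \<simeq>\<^sub>L (Vir :: ('f, int \<Rightarrow>\<^sub>0 'f) lie_struct)"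
    and sl2: "lie_restrict A (lie_span A (G 0 (- 1) \<union> G 0 0 \<union> G 0 1))
                \<simeq>\<^sub>L (sl2 :: ('f, 'f^2^2) lie_struct)"
    and generated: "lie_generated A (G 0 1 \<union> G 0 (- 1) \<union> lie_span A (\<Union>i. G i 0)) = lie_carrier A"
  obtains v s S \<tau> \<alpha> where "zz_realization A G v s S \<tau>" "zz_algebra s S \<alpha>"
proof -
  interpret graded_lie_algebra A G by fact
  have dim: "\<exists>w. G i j = span {w}" for i j
  proof -
    obtain B where B: "finite B" "card B \<le> 1" "span B = G i j" using dim[of i j] unfolding lie_dim_le_def by blast
    show ?thesis
    proof (cases "B = {}")
      case True
      then have "G i j = span {0}" unfolding B(3)[symmetric] by (simp only: span_insert_0)
      then show ?thesis by (rule exI)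
    next
      case False
      then have "card B = 1" using B(1,2) by (simp add: Suc_leI card_gt_0_iff le_antisym)
      then show ?thesis using B(3) by (metis card_1_singletonE)
    qed
  qed
  obtain e where e: "G 0 1 = span {e}" using dim by blast
  obtain f where f: "G 0 (- 1) = span {f}" using dim by blast
  obtain h where h: "G 0 0 = span {h}" using dim by blast
  have mem: "e \<in> G 0 1" "f \<in> G 0 (- 1)" "h \<in> G 0 0" unfolding e f h by (simp_all add: span_base)
  have car: "e \<in> lie_carrier A" "f \<in> lie_carrier A" "h \<in> lie_carrier A" using mem component_subset by blast+
  have "h \<noteq> 0" using sl2_brackets(1)[OF _ sl2 e h f] car by auto
  then obtain c u where c: "c \<noteq> 0" and u: "\<And>k. u k \<noteq> 0" "\<And>k. G (c * k) 0 = span {u k}"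
    "\<And>k l. lie_bracket A (u k) (u l) = lie_scale A (of_int (l - k)) (u (k + l))"
    and out0: "\<And>i. \<not> c dvd i \<Longrightarrow> G i 0 = {0}"
    using Vir_basis[OF graded vir dim mem(3)] by blast
  \<comment> \<open>First degrees are divided by c, and column 0 consists of the vectors of the Witt
    basis. For a missing degree the chosen generator is 0.\<close>
  define v where "v i j = (if j = 0 then u i else SOME w. G (c * i) j = span {w})" for i j
  have v: "G (c * i) j = span {v i j}" for i j
    using u(2)[of i] someI_ex[OF dim[of "c * i" j]] by (simp add: v_def)
  have v_mem: "v i j \<in> G (c * i) j" for i j unfolding v by (simp add: span_base)
  have v_car: "v i j \<in> lie_carrier A" for i j using v_mem component_subset by blast
  define S where "S = {(i, j). v i j \<noteq> 0}"
  define s where "s i j k l = (if v i j = 0 \<or> v k l = 0 \<or> v (i + k) (j + l) = 0 then 0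
      else SOME r. lie_bracket A (v i j) (v k l) = lie_scale A r (v (i + k) (j + l)))" for i j k l
  have bracket_mem: "lie_bracket A (v i j) (v k l) \<in> span {v (i + k) (j + l)}" for i j k l
    using bracket_component[OF v_mem[of i j] v_mem[of k l]] v[of "i + k" "j + l"] by (simp add: distrib_left)
  have br: "lie_bracket A (v i j) (v k l) = lie_scale A (s i j k l) (v (i + k) (j + l))" for i j k l
  proof -
    have ex: "\<exists>r. lie_bracket A (v i j) (v k l) = lie_scale A r (v (i + k) (j + l))"
      using bracket_mem[of i j k l] by (auto simp: span_singleton)
    show ?thesis
      using someI_ex[OF ex] ex v_car[of i j] v_car[of k l] by (auto simp: s_def)
  qed
  have s_supp: "v i j \<noteq> 0 \<and> v k l \<noteq> 0 \<and> v (i + k) (j + l) \<noteq> 0" if "s i j k l \<noteq> 0" for i j k l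
    using that by (auto simp: s_def split: if_splits)
  define \<tau> where "\<tau> p = (c * fst p, snd p)" for p :: "int \<times> int"
  have inj\<tau>: "inj \<tau>" using \<open>c \<noteq> 0\<close> by (auto simp: inj_def \<tau>_def)
  have generate: "lie_carrier A \<subseteq> span (\<Union>p\<in>K. G (fst p) (snd p))"
    if K: "(0, 1) \<in> K" "(0, - 1) \<in> K" "\<And>i. G i 0 \<noteq> {0} \<Longrightarrow> (i, 0) \<in> K"
      and closed: "\<And>i j k l x y. (i, j) \<in> K \<Longrightarrow> (k, l) \<in> K \<Longrightarrow> x \<in> G i j \<Longrightarrow> y \<in> G k l
        \<Longrightarrow> lie_bracket A x y \<noteq> 0 \<Longrightarrow> (i + k, j + l) \<in> K" for K
  proof -
    let ?H = "span (\<Union>p\<in>K. G (fst p) (snd p))"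
    have sub: "(\<Union>p\<in>K. G (fst p) (snd p)) \<subseteq> lie_carrier A" using component_subset by blast
    have GH: "G i j \<subseteq> ?H" if "(i, j) \<in> K" for i j using that by (force intro: span_base)
    have "lie_subalgebra A ?H"
      unfolding lie_subalgebra_def
    proof (intro conjI ballI)
      show "?H \<subseteq> lie_carrier A" using sub subspace_carrier by (rule span_minimal)
      fix x y
      assume "x \<in> ?H" "y \<in> ?H"
      then show "lie_bracket A x y \<in> ?H"
      proof (rule bracket_span[OF sub sub subspace_span, rotated])
        fix x y
        assume "x \<in> (\<Union>p\<in>K. G (fst p) (snd p))" "y \<in> (\<Union>p\<in>K. G (fst p) (snd p))"
        then obtain i j k l where *: "(i, j) \<in> K" "(k, l) \<in> K" "x \<in> G i j" "y \<in> G k l" by force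
        show "lie_bracket A x y \<in> ?H"
          using closed[OF *] bracket_component[OF *(3,4)] GH span_zero by (cases "lie_bracket A x y = 0") auto
      qed
    qed simp
    moreover have "G 0 1 \<union> G 0 (- 1) \<union> span (\<Union>i. G i 0) \<subseteq> ?H"
    proof -
      have "G i 0 \<subseteq> ?H" for i using K(3)[of i] GH[of i 0] span_zero by (cases "G i 0 = {0}") auto
      then have "span (\<Union>i. G i 0) \<subseteq> ?H" by (intro span_minimal) auto
      then show ?thesis using GH K(1,2) by blast
    qed
    ultimately have "lie_generated A (G 0 1 \<union> G 0 (- 1) \<union> span (\<Union>i. G i 0)) \<subseteq> ?H"
      unfolding lie_generated_def by (intro hull_minimal)
    then show ?thesis using generated by simp
  qed
  have vanish: "G i j = {0}" if K: "lie_carrier A \<subseteq> span (\<Union>p\<in>K. G (fst p) (snd p))" "(i, j) \<notin> K" for i j K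
  proof -
    have "x = 0" if "x \<in> G i j" for x
      by (rule span_other_components[OF _ that K(2)]) (use that component_subset K(1) in blast)
    then show ?thesis using subspace_0[OF subspace_component] by blast
  qed
  \<comment> \<open>The components whose first degree is a multiple of c contain the generators and
    are closed under brackets, so no other component is nonzero.\<close>
  have outside: "G i j = {0}" if "\<not> c dvd i" for i j
  proof (rule vanish[of "{(i, j). c dvd i}"])
    show "lie_carrier A \<subseteq> span (\<Union>p\<in>{(i, j). c dvd i}. G (fst p) (snd p))"
      by (rule generate) (use out0 in \<open>auto intro: dvd_add\<close>)
  qed (use that in simp)
  have R: "zz_realization A G v s S \<tau>"
  proof
    show "inj \<tau>" by (rule inj\<tau>)
    show "G (fst (\<tau> (i, j))) (snd (\<tau> (i, j))) = span {v i j}" for i j by (simp add: \<tau>_def v)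
    show "(i, j) \<in> S \<longleftrightarrow> v i j \<noteq> 0" for i j by (simp add: S_def)
    show "G i j = {0}" if "(i, j) \<notin> range \<tau>" for i j
    proof (rule outside)
      show "\<not> c dvd i"
      proof
        assume "c dvd i"
        then obtain k where "i = c * k" by (elim dvdE)
        then have "(i, j) = \<tau> (k, j)" by (simp add: \<tau>_def)
        then show False using that by blast
      qed
    qed
  qed (rule br)
  have v0: "v i 0 = u i" for i by (simp add: v_def)
  have span_e: "span {v 0 1} = span {e}" "span {v 0 0} = span {h}" "span {v 0 (- 1)} = span {f}"
    using v[of 0 1] v[of 0 0] v[of 0 "- 1"] e f h by simp_all
  have nz: "lie_bracket A (v 0 0) (v 0 1) \<noteq> 0" "lie_bracket A (v 0 1) (v 0 (- 1)) \<noteq> 0"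
    using sl2_brackets[OF _ sl2, of "v 0 1" "v 0 0" "v 0 (- 1)"] e f h by (simp_all add: span_e)
  have Z: "zz_algebra s S (s 0 0 0 1)"
  proof
    show "s k l i j = - s i j k l" for i j k l
    proof (cases "v (i + k) (j + l) = 0")
      case True
      then have "s i j k l = 0" "s k l i j = 0" by (simp_all add: s_def add.commute)
      then show ?thesis by simp
    next
      case False
      have "lie_scale A (s k l i j) (v (i + k) (j + l)) = lie_scale A (- s i j k l) (v (i + k) (j + l))"
        using bracket_skew[OF v_car[of i j] v_car[of k l]] br[of k l i j] br[of i j k l] by (simp add: add.commute)
      then show ?thesis using False by (simp only: scale_cancel_right simp_thms)
    qed
  next
    fix i j k l m n
    have out: "x * s i' j' k' l' = 0" if "v (i + k + m) (j + l + n) = 0" "i' + k' = i + k + m" "j' + l' = j + l + n"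
      for x i' j' k' l' using that by (simp add: s_def)
    show "s k l m n * s i j (k + m) (l + n)
      = s i j k l * s (i + k) (j + l) m n + s i j m n * s k l (i + m) (j + n)"
    proof (cases "v (i + k + m) (j + l + n) = 0")
      case True
      then show ?thesis by (simp add: out)
    next
      case False
      let ?w = "v (i + k + m) (j + l + n)"
      let ?x = "v i j" let ?y = "v k l" let ?z = "v m n"
      have cars: "lie_bracket A ?y ?z \<in> lie_carrier A" "lie_bracket A ?z ?x \<in> lie_carrier A"
        "lie_bracket A ?x ?y \<in> lie_carrier A" by (intro bracket_closed v_car)+
      have 1: "lie_bracket A ?x (lie_bracket A ?y ?z) = lie_scale A (s k l m n * s i j (k + m) (l + n)) ?w"
        unfolding br[of k l] by (simp add: bracket_scale_right v_car br add_ac)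
      have 2: "lie_bracket A ?y (lie_bracket A ?x ?z) = lie_scale A (s i j m n * s k l (i + m) (j + n)) ?w"
        unfolding br[of i j m] by (simp add: bracket_scale_right v_car br add_ac)
      have 3: "lie_bracket A (lie_bracket A ?x ?y) ?z = lie_scale A (s i j k l * s (i + k) (j + l) m n) ?w"
        unfolding br[of i j k] by (simp add: bracket_scale_left v_car br)
      have "lie_bracket A ?x (lie_bracket A ?y ?z) = lie_bracket A (lie_bracket A ?x ?y) ?z + lie_bracket A ?y (lie_bracket A ?x ?z)"
      proof -
        have "lie_bracket A ?z ?x = - lie_bracket A ?x ?z" by (rule bracket_skew[OF v_car v_car])
        then have "lie_bracket A ?y (lie_bracket A ?z ?x) = - lie_bracket A ?y (lie_bracket A ?x ?z)"
          using bracket_scale_right[OF v_car[of k l] bracket_closed[OF v_car[of i j] v_car[of m n]], of "- 1"] by simp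
        moreover have "lie_bracket A ?z (lie_bracket A ?x ?y) = - lie_bracket A (lie_bracket A ?x ?y) ?z"
          by (rule bracket_skew[OF cars(3) v_car])
        ultimately show ?thesis using jacobi[OF v_car v_car v_car, of i j k l m n] by (simp add: algebra_simps)
      qed
      then have "lie_scale A (s k l m n * s i j (k + m) (l + n)) ?w
        = lie_scale A (s i j k l * s (i + k) (j + l) m n + s i j m n * s k l (i + m) (j + n)) ?w"
        unfolding 1 2 3 by (simp add: scale_left_distrib)
      then show ?thesis using False by simp
    qed
    show "s i j k l \<noteq> 0 \<Longrightarrow> (i, j) \<in> S \<and> (k, l) \<in> S \<and> (i + k, j + l) \<in> S"
      using s_supp[of i j k l] by (simp add: S_def)
    show "s i 0 k 0 = of_int (k - i)"
      using br[of i 0 k 0] u(1)[of "i + k"] unfolding v0 u(3) by (simp add: v0)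
    show "s 0 0 0 1 \<noteq> 0" "s 0 1 0 (- 1) \<noteq> 0" using nz unfolding br by auto
  next
    fix T :: "(int \<times> int) set"
    assume T: "\<And>i. (i, 0) \<in> T" "(0, 1) \<in> T" "(0, - 1) \<in> T"
      "\<And>i j k l. \<lbrakk>(i, j) \<in> T; (k, l) \<in> T; s i j k l \<noteq> 0\<rbrakk> \<Longrightarrow> (i + k, j + l) \<in> T"
    have K: "lie_carrier A \<subseteq> span (\<Union>p\<in>\<tau> ` T. G (fst p) (snd p))"
    proof (rule generate)
      show "(0, 1) \<in> \<tau> ` T" "(0, - 1) \<in> \<tau> ` T"
        using imageI[OF T(2), of \<tau>] imageI[OF T(3), of \<tau>] by (simp_all add: \<tau>_def)
      show "(i, 0) \<in> \<tau> ` T" if "G i 0 \<noteq> {0}" for i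
      proof -
        obtain k where "i = c * k" using outside[of i 0] \<open>G i 0 \<noteq> {0}\<close> by (metis dvdE)
        then show ?thesis using T(1)[of k] by (auto simp: \<tau>_def image_iff intro!: bexI[of _ "(k, 0)"])
      qed
      fix i' j' k' l' x y
      assume *: "(i', j') \<in> \<tau> ` T" "(k', l') \<in> \<tau> ` T" "x \<in> G i' j'" "y \<in> G k' l'" "lie_bracket A x y \<noteq> 0"
      obtain i j where ij: "(i, j) \<in> T" "i' = c * i" "j' = j" using *(1) by (auto simp: \<tau>_def)
      obtain k l where kl: "(k, l) \<in> T" "k' = c * k" "l' = l" using *(2) by (auto simp: \<tau>_def)
      obtain r where r: "x = lie_scale A r (v i j)" using *(3) unfolding ij v by (auto simp: span_singleton)
      obtain r' where r': "y = lie_scale A r' (v k l)" using *(4) unfolding kl v by (auto simp: span_singleton)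
      have "s i j k l \<noteq> 0"
      proof
        assume "s i j k l = 0"
        then have "lie_bracket A (v i j) (v k l) = 0" using br[of i j k l] by simp
        then have "lie_bracket A x y = 0"
          unfolding r r' by (simp add: bracket_scale_left bracket_scale_right v_car subspace_scale[OF subspace_carrier])
        then show False using *(5) by simp
      qed
      then have "(i + k, j + l) \<in> T" by (rule T(4)[OF ij(1) kl(1)])
      then have "\<tau> (i + k, j + l) \<in> \<tau> ` T" by (rule imageI)
      then show "(i' + k', j' + l') \<in> \<tau> ` T" by (simp add: ij kl \<tau>_def distrib_left)
    qed
    show "S \<subseteq> T"
    proof
      fix p
      assume "p \<in> S"
      obtain i j where p: "p = (i, j)" by (cases p)
      show "p \<in> T"
      proof (rule ccontr)
        assume "p \<notin> T"
        then have "\<tau> p \<notin> \<tau> ` T" using inj\<tau> by (simp add: inj_image_mem_iff)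
        then have "G (c * i) j = {0}" using vanish[OF K] by (simp add: \<tau>_def p)
        then show False using \<open>p \<in> S\<close> v_mem[of i j] by (simp add: S_def p)
      qed
    qed
  qed simp
  show thesis by (rule that[OF R Z])
qed

theorem theorem1p1:
  fixes A :: "('f::field_char_0, 'v::ab_group_add) lie_struct"
    and G :: "int \<Rightarrow> int \<Rightarrow> 'v set"
  assumes graded: "graded_lie_algebra A G"
    and dim: "\<And>i j. lie_dim_le A (G i j) 1"
    and vir: "lie_restrict A (lie_span A (\<Union>i. G i 0)) \<simeq>\<^sub>L (Vir :: ('f, int \<Rightarrow>\<^sub>0 'f) lie_struct)"
    and sl2: "lie_restrict A (lie_span A (G 0 (- 1) \<union> G 0 0 \<union> G 0 1))
                \<simeq>\<^sub>L (sl2 :: ('f, 'f^2^2) lie_struct)"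
    and generated: "lie_generated A (G 0 1 \<union> G 0 (- 1) \<union> lie_span A (\<Union>i. G i 0)) = lie_carrier A"
  shows "(\<exists>\<alpha>. \<alpha> \<noteq> 0 \<and> A \<simeq>\<^sub>L Vir_alpha \<alpha>)
    \<or> (\<exists>\<alpha> \<beta> a1 a2 a2'. \<alpha> * \<beta> \<noteq> 0 \<and> \<beta> \<noteq> 1 \<and> \<beta> \<noteq> - 1 \<and> A \<simeq>\<^sub>L B_alg \<alpha> \<beta> a1 a2 a2')
    \<or> (\<exists>\<alpha> a1 a2 a2'. \<alpha> \<noteq> 0 \<and>
          (A \<simeq>\<^sub>L B_plus \<alpha> 1 a1 a2 a2' \<or> A \<simeq>\<^sub>L B_plus \<alpha> (- 1) a1 a2 a2'))
    \<or> (\<exists>\<alpha>. \<alpha> \<noteq> 0 \<and> (A \<simeq>\<^sub>L C_alg \<alpha> \<or> A \<simeq>\<^sub>L C_bar \<alpha>))"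
proof -
  obtain v s S \<tau> \<alpha> where R: "zz_realization A G v s S \<tau>" and Z: "zz_algebra s S \<alpha>"
    by (rule structure_constants[OF graded dim vir sl2 generated])
  from zz_algebra.normal_shape_cases[OF Z] show ?thesis
  proof cases
    case (1 t)
    show ?thesis
      using zz_realization.isomorphic_normal_shape[OF zz_realization.realization_resc[OF R 1(1)] 1(2)] by blast
  next
    case (2 t)
    show ?thesis
      using zz_realization.isomorphic_normal_shape[OF zz_realization.realization_resc[OF
          zz_realization.realization_flip[OF R] 2(1)] 2(2)] by blast
  qed
qed

end
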